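(* For irrational $\theta\in(0,1)$ let $\mathcal{A}_\theta$ be the Effros--Shen algebra of $\theta$ with its faithful tracial state $\tau^\theta$, let $\beta^\theta=(\beta^\theta_n)_{n\in\mathbb{N}}$ be the summable sequence $\beta^\theta_n=1/\dim(\mathcal{A}_{\theta,n})$, and let $L^{\tau^\theta}_{\beta^\theta}$ be the associated Christensen--Ivan $L$-seminorm on $\mathcal{A}_\theta$ (all defined in the context). Then the map $$\theta\in(0,1)\setminus\mathbb{Q}\longmapsto(\mathcal{A}_\theta,L^{\tau^\theta}_{\beta^\theta})$$ is continuous from $(0,1)\setminus\mathbb{Q}$ with the usual topology to the class of Leibniz compact quantum metric spaces with the quantum Gromov--Hausdorff propinquity $\mathsf{\Lambda}$; that is, if $(\theta_n)_{n\in\mathbb{N}}$ is a sequence in $(0,1)\setminus\mathbb{Q}$ converging to $\theta\in(0,1)\setminus\mathbb{Q}$, then $$\lim_{n\to\infty}\mathsf{\Lambda}\big((\mathcal{A}_{\theta_n},L^{\tau^{\theta_n}}_{\beta^{\theta_n}}),(\mathcal{A}_\theta,L^{\tau^\theta}_{\beta^\theta})\big)=0.$$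
   Context: $\mathbb{N}=\{0,1,2,\dots\}$; $M_d(\mathbb{C})$ is the algebra of complex $d\times d$ matrices; $\mathrm{Tr}$ is the unnormalized trace. **Leibniz compact quantum metric space.** A pair $(\mathcal{A},L)$, with $\mathcal{A}$ a unital C*-algebra and $L:\mathcal{A}\to[0,\infty]$ a seminorm (possibly taking the value $\infty$) such that $\mathrm{dom}(L)=\{a:L(a)<\infty\}$ is a dense *-subalgebra, $L(a)=L(a^* )$, $\{a:L(a)=0\}=\mathbb{C}1_\mathcal{A}$, $L(ab)\le\|a\|L(b)+\|b\|L(a)$, and such that the metric $mk_L(\phi,\psi)=\sup\{|\phi(a)-\psi(a)|:a\in\mathcal{A},L(a)\le1\}$ on the state space $S(\mathcal{A})$ metrizes the weak* topology. Then $L$ is called an $L$-seminorm. **Quantum Gromov--Hausdorff propinquity (Latrémolière).** It is defined on the class of pairs $(\mathcal{A},L)$ where $L$ is a lower semicontinuous seminorm on the self-adjoint part $\mathfrak{sa}(\mathcal{A})$ with values in $[0,\infty]$, finite on a dense subspace, with $L(a)=0$ iff $a\in\mathbb{R}1_\mathcal{A}$, with $mk_L$ (computed with self-adjoint elements) metrizing the weak* topology of $S(\mathcal{A})$, and with $L(\frac{ab+ba}{2})$ and $L(\frac{ab-ba}{2i})$ both at most $\|a\|L(b)+\|b\|L(a)$; an $L$-seminorm on $\mathcal{A}$ is regarded as such by restriction to $\mathfrak{sa}(\mathcal{A})$. A bridge from $\mathcal{A}$ to $\mathcal{B}$ is $\gamma=(\mathcal{D},\omega,\pi_\mathcal{A},\pi_\mathcal{B})$,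 where $\mathcal{D}$ is a unital C*-algebra, $\pi_\mathcal{A}:\mathcal{A}\to\mathcal{D}$ and $\pi_\mathcal{B}:\mathcal{B}\to\mathcal{D}$ are unital *-monomorphisms, and $\omega\in\mathcal{D}$ is such that $S_1(\omega)=\{\phi\in S(\mathcal{D}):\phi((1-\omega)^*(1-\omega))=\phi((1-\omega)(1-\omega)^* )=0\}$ is nonempty. Given $(\mathcal{A},L_\mathcal{A})$ and $(\mathcal{B},L_\mathcal{B})$ in the class: - the reach of $\gamma$ is the Hausdorff distance in $(\mathcal{D},\|\cdot\|_\mathcal{D})$ between $\{\pi_\mathcal{A}(a)\omega:a\in\mathfrak{sa}(\mathcal{A}),L_\mathcal{A}(a)\le1\}$ and $\{\omega\pi_\mathcal{B}(b):b\in\mathfrak{sa}(\mathcal{B}),L_\mathcal{B}(b)\le1\}$; - the height of $\gamma$ is the maximum of the Hausdorff distance for $mk_{L_\mathcal{A}}$ between $S(\mathcal{A})$ and $\{\phi\circ\pi_\mathcal{A}:\phi\in S_1(\omega)\}$ and of the Hausdorff distance for $mk_{L_\mathcal{B}}$ between $S(\mathcal{B})$ and $\{\phi\circ\pi_\mathcal{B}:\phi\in S_1(\omega)\}$; - the length of $\gamma$ is the maximum of its reach and height. A trek from $(\mathcal{A},L_\mathcal{A})$ to $(\mathcal{B},L_\mathcal{B})$ is a finite chain of pairs in the class starting at $(\mathcal{A},L_\mathcal{A})$ and ending at $(\mathcal{B},L_\mathcal{B})$, with a bridge between each pair of consecutive terms; its length is the sum of the lengths of its bridges. $\mathsf{\Lambda}((\mathcal{A},L_\mathcal{A}),(\mathcal{B},L_\mathcal{B}))$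 is the infimum of the lengths of all treks from $(\mathcal{A},L_\mathcal{A})$ to $(\mathcal{B},L_\mathcal{B})$. **Christensen--Ivan $L$-seminorms.** Let $\mathcal{A}=\overline{\bigcup_{n\in\mathbb{N}}\mathcal{A}_n}$ be a unital AF algebra, with $(\mathcal{A}_n)$ an increasing sequence of finite-dimensional C*-subalgebras containing $1_\mathcal{A}$ and $\mathcal{A}_0=\mathbb{C}1_\mathcal{A}$, and let $\tau$ be a faithful tracial state on $\mathcal{A}$. Let $H_\tau$ be the GNS Hilbert space (completion of $\mathcal{A}$ for $\langle a,b\rangle_\tau=\tau(b^*a)$, norm $\|a\|_\tau=\sqrt{\tau(a^*a)}$), with $\mathcal{A}\subseteq H_\tau$, and let $\pi_\tau:\mathcal{A}\to B(H_\tau)$ be the GNS representation, $\pi_\tau(a)b=ab$. Let $P^\tau_n$ be the orthogonal projection of $H_\tau$ onto $\mathcal{A}_n$ and $Q^\tau_n=P^\tau_n-P^\tau_{n-1}$ for $n\ge1$. Let $c^\tau_n$ be the smallest constant with $\|a\|_\mathcal{A}\le c^\tau_n\|a\|_\tau$ for all $a\in\mathcal{A}_n$. For a summable sequence $\beta=(\beta_n)_{n\in\mathbb{N}}$ of positive reals, put $a^\tau_{\beta,n}=c^\tau_n/\beta_n$ for $n\geq 1$, and let $D^\tau_\beta=\sum_{n\ge1}a^\tau_{\beta,n}Q^\tau_n$, an unbounded self-adjoint operator on $H_\tau$ with domain $\{h:\sum_n(a^\tau_{\beta,n})^2\|Q^\tau_nh\|_\tau^2<\infty\}$. For $a\in\mathcal{A}$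 set $L^\tau_\beta(a)=\|[D^\tau_\beta,\pi_\tau(a)]\|_{B(H_\tau)}$ if $[D^\tau_\beta,\pi_\tau(a)]$ extends to a bounded operator on $H_\tau$ (i.e. $\pi_\tau(a)$ maps $\mathrm{dom}(D^\tau_\beta)$ into itself and the commutator is bounded there), and $L^\tau_\beta(a)=\infty$ otherwise. By a theorem of Christensen and Ivan, $(\mathcal{A},L^\tau_\beta)$ is a Leibniz compact quantum metric space. **Effros--Shen algebras.** Let $\theta\in(0,1)$ be irrational with continued fraction expansion $\theta=[r^\theta_0;r^\theta_1,r^\theta_2,\dots]$, so $r_0^\theta=0$ and $r^\theta_n\in\mathbb{N}\setminus\{0\}$ for $n\ge1$. Put $p^\theta_0=r^\theta_0$, $p^\theta_1=1$, $q^\theta_0=1$, $q^\theta_1=r^\theta_1$, and for $n\ge1$, $p^\theta_{n+1}=r^\theta_{n+1}p^\theta_n+p^\theta_{n-1}$ and $q^\theta_{n+1}=r^\theta_{n+1}q^\theta_n+q^\theta_{n-1}$. Let $\mathcal{B}_{\theta,0}=\mathbb{C}$ and $\mathcal{B}_{\theta,n}=M_{q^\theta_n}(\mathbb{C})\oplus M_{q^\theta_{n-1}}(\mathbb{C})$ for $n\ge1$. For $n\ge1$ let $\alpha_{\theta,n}:\mathcal{B}_{\theta,n}\to\mathcal{B}_{\theta,n+1}$, $a\oplus b\mapsto\mathrm{diag}(a,\dots,a,b)\oplus a$, with $r^\theta_{n+1}$ copies of $a$ on the diagonal of the first summand, and let $\alpha_{\theta,0}(\lambda)=\mathrm{diag}(\lambda,\dots,\lambda)\oplus\lambda\in\mathcal{B}_{\theta,1}$.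 Then $\mathcal{A}_\theta=\varinjlim(\mathcal{B}_{\theta,n},\alpha_{\theta,n})$ is the C*-algebraic inductive limit, with canonical unital *-monomorphisms $\alpha^{(n)}:\mathcal{B}_{\theta,n}\to\mathcal{A}_\theta$, and $\mathcal{A}_{\theta,n}=\alpha^{(n)}(\mathcal{B}_{\theta,n})$. There is a unique faithful tracial state $\tau^\theta$ on $\mathcal{A}_\theta$ such that for every $n\ge1$ and $(a,b)\in\mathcal{B}_{\theta,n}$, $$\tau^\theta(\alpha^{(n)}(a,b))=\frac{t(\theta,n)}{q^\theta_n}\mathrm{Tr}(a)+\frac{1-t(\theta,n)}{q^\theta_{n-1}}\mathrm{Tr}(b),\qquad t(\theta,n)=(-1)^{n-1}q^\theta_n(\theta q^\theta_{n-1}-p^\theta_{n-1})\in(0,1).$$ Put $\beta^\theta_0=1$ and $\beta^\theta_n=\frac{1}{\dim(\mathcal{A}_{\theta,n})}=\frac{1}{(q^\theta_n)^2+(q^\theta_{n-1})^2}$ for $n\ge1$; this sequence is summable. $L^{\tau^\theta}_{\beta^\theta}$ is the Christensen--Ivan $L$-seminorm for $\mathcal{A}=\mathcal{A}_\theta$, $\mathcal{A}_n=\mathcal{A}_{\theta,n}$, $\tau=\tau^\theta$, $\beta=\beta^\theta$. *)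

theory Defs
  imports
    "HOL-Analysis.Abstract_Metric_Spaces"
    "HOL-Analysis.Function_Topology"
    "HOL-Library.Extended_Nonnegative_Real"
    "HOL-Library.Nonpos_Ints"
    "Jordan_Normal_Form.Schur_Decomposition"
begin

hide_const (open) Multiset.mult Polynomial.smult

section \<open>Unital C*-algebras with explicit carrier\<close>

record 'a cstar = "(complex, 'a) module" +
  star :: "'a \<Rightarrow> 'a"
  nrm :: "'a \<Rightarrow> real"

definition cstar_algebra :: "'a cstar \<Rightarrow> bool" where
  "cstar_algebra A \<longleftrightarrow>
     Ring.ring A \<and> Module.module class_ring A \<and>
     (\<forall>c. \<forall>x\<in>carrier A. \<forall>y\<in>carrier A.
        (c \<odot>\<^bsub>A\<^esub> x) \<otimes>\<^bsub>A\<^esub> y = c \<odot>\<^bsub>A\<^esub> (x \<otimes>\<^bsub>A\<^esub> y) \<and>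
        x \<otimes>\<^bsub>A\<^esub> (c \<odot>\<^bsub>A\<^esub> y) = c \<odot>\<^bsub>A\<^esub> (x \<otimes>\<^bsub>A\<^esub> y)) \<and>
     (\<forall>x\<in>carrier A. star A x \<in> carrier A \<and> star A (star A x) = x) \<and>
     (\<forall>x\<in>carrier A. \<forall>y\<in>carrier A.
        star A (x \<oplus>\<^bsub>A\<^esub> y) = star A x \<oplus>\<^bsub>A\<^esub> star A y \<and>
        star A (x \<otimes>\<^bsub>A\<^esub> y) = star A y \<otimes>\<^bsub>A\<^esub> star A x) \<and>
     (\<forall>c. \<forall>x\<in>carrier A. star A (c \<odot>\<^bsub>A\<^esub> x) = cnj c \<odot>\<^bsub>A\<^esub> star A x) \<and>
     (\<forall>x\<in>carrier A. 0 \<le> nrm A x \<and> (nrm A x = 0 \<longleftrightarrow> x = \<zero>\<^bsub>A\<^esub>)) \<and>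
     (\<forall>x\<in>carrier A. \<forall>y\<in>carrier A.
        nrm A (x \<oplus>\<^bsub>A\<^esub> y) \<le> nrm A x + nrm A y \<and>
        nrm A (x \<otimes>\<^bsub>A\<^esub> y) \<le> nrm A x * nrm A y) \<and>
     (\<forall>c. \<forall>x\<in>carrier A. nrm A (c \<odot>\<^bsub>A\<^esub> x) = cmod c * nrm A x) \<and>
     (\<forall>x\<in>carrier A. nrm A (star A x \<otimes>\<^bsub>A\<^esub> x) = (nrm A x)\<^sup>2) \<and>
     (\<forall>s :: nat \<Rightarrow> 'a. (\<forall>n. s n \<in> carrier A) \<longrightarrow>
        (\<forall>\<epsilon>>0. \<exists>N. \<forall>m\<ge>N. \<forall>n\<ge>N. nrm A (s m \<ominus>\<^bsub>A\<^esub> s n) < \<epsilon>) \<longrightarrow>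
        (\<exists>x\<in>carrier A. (\<lambda>n. nrm A (s n \<ominus>\<^bsub>A\<^esub> x)) \<longlonglongrightarrow> 0))"

definition sa :: "'a cstar \<Rightarrow> 'a set" where
  "sa A = {a \<in> carrier A. star A a = a}"

definition dense_in :: "'a cstar \<Rightarrow> 'a set \<Rightarrow> 'a set \<Rightarrow> bool" where
  "dense_in A X S \<longleftrightarrow> S \<subseteq> X \<and> (\<forall>x\<in>X. \<forall>\<epsilon>>0. \<exists>y\<in>S. nrm A (x \<ominus>\<^bsub>A\<^esub> y) < \<epsilon>)"

definition star_subalgebra :: "'a cstar \<Rightarrow> 'a set \<Rightarrow> bool" where
  "star_subalgebra A S \<longleftrightarrow> S \<subseteq> carrier A \<and> \<zero>\<^bsub>A\<^esub> \<in> S \<and>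
     (\<forall>x\<in>S. \<forall>y\<in>S. x \<oplus>\<^bsub>A\<^esub> y \<in> S \<and> x \<otimes>\<^bsub>A\<^esub> y \<in> S) \<and>
     (\<forall>c. \<forall>x\<in>S. c \<odot>\<^bsub>A\<^esub> x \<in> S) \<and> (\<forall>x\<in>S. star A x \<in> S)"

definition unital_star_mono :: "'a cstar \<Rightarrow> 'b cstar \<Rightarrow> ('a \<Rightarrow> 'b) \<Rightarrow> bool" where
  "unital_star_mono A D f \<longleftrightarrow>
     f \<in> carrier A \<rightarrow> carrier D \<and> inj_on f (carrier A) \<and> f \<one>\<^bsub>A\<^esub> = \<one>\<^bsub>D\<^esub> \<and>
     (\<forall>x\<in>carrier A. \<forall>y\<in>carrier A.
        f (x \<oplus>\<^bsub>A\<^esub> y) = f x \<oplus>\<^bsub>D\<^esub> f y \<and> f (x \<otimes>\<^bsub>A\<^esub> y) = f x \<otimes>\<^bsub>D\<^esub> f y) \<and>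
     (\<forall>c. \<forall>x\<in>carrier A. f (c \<odot>\<^bsub>A\<^esub> x) = c \<odot>\<^bsub>D\<^esub> f x) \<and>
     (\<forall>x\<in>carrier A. f (star A x) = star D (f x))"

text \<open>States are extensional on the carrier, so that they are determined by their values there.\<close>

definition states :: "'a cstar \<Rightarrow> ('a \<Rightarrow> complex) set" where
  "states A = {\<phi> \<in> extensional (carrier A).
     (\<forall>x\<in>carrier A. \<forall>y\<in>carrier A. \<phi> (x \<oplus>\<^bsub>A\<^esub> y) = \<phi> x + \<phi> y) \<and>
     (\<forall>c. \<forall>x\<in>carrier A. \<phi> (c \<odot>\<^bsub>A\<^esub> x) = c * \<phi> x) \<and>
     (\<forall>x\<in>carrier A. \<phi> (star A x \<otimes>\<^bsub>A\<^esub> x) \<in> \<real>\<^sub>\<ge>\<^sub>0) \<and>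
     \<phi> \<one>\<^bsub>A\<^esub> = 1}"

definition weak_star :: "'a cstar \<Rightarrow> ('a \<Rightarrow> complex) topology" where
  "weak_star A = subtopology (product_topology (\<lambda>_. euclidean) (carrier A)) (states A)"

definition faithful_tracial_state :: "'a cstar \<Rightarrow> ('a \<Rightarrow> complex) \<Rightarrow> bool" where
  "faithful_tracial_state A \<tau> \<longleftrightarrow> \<tau> \<in> states A \<and>
     (\<forall>x\<in>carrier A. \<forall>y\<in>carrier A. \<tau> (x \<otimes>\<^bsub>A\<^esub> y) = \<tau> (y \<otimes>\<^bsub>A\<^esub> x)) \<and>
     (\<forall>x\<in>carrier A. \<tau> (star A x \<otimes>\<^bsub>A\<^esub> x) = 0 \<longrightarrow> x = \<zero>\<^bsub>A\<^esub>)"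


section \<open>Compact quantum metric spaces\<close>

definition mk_dist :: "'a set \<Rightarrow> ('a \<Rightarrow> complex) \<Rightarrow> ('a \<Rightarrow> complex) \<Rightarrow> ennreal" where
  "mk_dist S \<phi> \<psi> = (SUP a\<in>S. ennreal (cmod (\<phi> a - \<psi> a)))"

definition metrizes_weak_star ::
  "'a cstar \<Rightarrow> (('a \<Rightarrow> complex) \<Rightarrow> ('a \<Rightarrow> complex) \<Rightarrow> ennreal) \<Rightarrow> bool" where
  "metrizes_weak_star A d \<longleftrightarrow>
     (\<forall>\<phi>\<in>states A. \<forall>\<psi>\<in>states A. d \<phi> \<psi> < \<infinity>) \<and>
     Metric_space (states A) (\<lambda>\<phi> \<psi>. enn2real (d \<phi> \<psi>)) \<and>
     Metric_space.mtopology (states A) (\<lambda>\<phi> \<psi>. enn2real (d \<phi> \<psi>)) = weak_star A"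

definition lip_ball :: "'a cstar \<Rightarrow> ('a \<Rightarrow> ennreal) \<Rightarrow> 'a set" where
  "lip_ball A L = {a \<in> carrier A. L a \<le> 1}"

definition sa_lip_ball :: "'a cstar \<Rightarrow> ('a \<Rightarrow> ennreal) \<Rightarrow> 'a set" where
  "sa_lip_ball A L = {a \<in> sa A. L a \<le> 1}"

text \<open>In \<open>ennreal\<close> one has \<open>0 * \<infinity> = 0\<close>, which is the convention wanted in the
  homogeneity and Leibniz conditions.\<close>

definition leibniz_cqms :: "'a cstar \<times> ('a \<Rightarrow> ennreal) \<Rightarrow> bool" where
  "leibniz_cqms = (\<lambda>(A, L).
     cstar_algebra A \<and>
     (\<forall>a\<in>carrier A. \<forall>b\<in>carrier A. L (a \<oplus>\<^bsub>A\<^esub> b) \<le> L a + L b) \<and>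
     (\<forall>c. \<forall>a\<in>carrier A. L (c \<odot>\<^bsub>A\<^esub> a) = ennreal (cmod c) * L a) \<and>
     star_subalgebra A {a \<in> carrier A. L a < \<infinity>} \<and>
     dense_in A (carrier A) {a \<in> carrier A. L a < \<infinity>} \<and>
     (\<forall>a\<in>carrier A. L (star A a) = L a) \<and>
     {a \<in> carrier A. L a = 0} = {c \<odot>\<^bsub>A\<^esub> \<one>\<^bsub>A\<^esub> | c. True} \<and>
     (\<forall>a\<in>carrier A. \<forall>b\<in>carrier A.
        L (a \<otimes>\<^bsub>A\<^esub> b) \<le> ennreal (nrm A a) * L b + ennreal (nrm A b) * L a) \<and>
     metrizes_weak_star A (mk_dist (lip_ball A L)))"

text \<open>The class on which the propinquity is defined.  Only the values of \<open>L\<close> on the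
  self-adjoint part matter, here and in the bridge data below, so an L-seminorm on the whole
  algebra can be used without restricting it explicitly.\<close>

definition propinquity_class :: "'a cstar \<times> ('a \<Rightarrow> ennreal) \<Rightarrow> bool" where
  "propinquity_class = (\<lambda>(A, L).
     cstar_algebra A \<and>
     (\<forall>a\<in>sa A. \<forall>b\<in>sa A. L (a \<oplus>\<^bsub>A\<^esub> b) \<le> L a + L b) \<and>
     (\<forall>r::real. \<forall>a\<in>sa A. L (complex_of_real r \<odot>\<^bsub>A\<^esub> a) = ennreal \<bar>r\<bar> * L a) \<and>
     (\<forall>s a. (\<forall>n::nat. s n \<in> sa A) \<longrightarrow> a \<in> sa A \<longrightarrow>
        (\<lambda>n. nrm A (s n \<ominus>\<^bsub>A\<^esub> a)) \<longlonglongrightarrow> 0 \<longrightarrow> L a \<le> liminf (\<lambda>n. L (s n))) \<and>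
     dense_in A (sa A) {a \<in> sa A. L a < \<infinity>} \<and>
     {a \<in> sa A. L a = 0} = {complex_of_real r \<odot>\<^bsub>A\<^esub> \<one>\<^bsub>A\<^esub> | r. True} \<and>
     (\<forall>a\<in>sa A. \<forall>b\<in>sa A.
        L ((1/2) \<odot>\<^bsub>A\<^esub> (a \<otimes>\<^bsub>A\<^esub> b \<oplus>\<^bsub>A\<^esub> b \<otimes>\<^bsub>A\<^esub> a))
          \<le> ennreal (nrm A a) * L b + ennreal (nrm A b) * L a \<and>
        L ((1/(2*\<i>)) \<odot>\<^bsub>A\<^esub> (a \<otimes>\<^bsub>A\<^esub> b \<ominus>\<^bsub>A\<^esub> b \<otimes>\<^bsub>A\<^esub> a))
          \<le> ennreal (nrm A a) * L b + ennreal (nrm A b) * L a) \<and>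
     metrizes_weak_star A (mk_dist (sa_lip_ball A L)))"


section \<open>The quantum Gromov--Hausdorff propinquity\<close>

definition hausdorff_edist :: "('x \<Rightarrow> 'x \<Rightarrow> ennreal) \<Rightarrow> 'x set \<Rightarrow> 'x set \<Rightarrow> ennreal" where
  "hausdorff_edist d S T = max (SUP s\<in>S. INF t\<in>T. d s t) (SUP t\<in>T. INF s\<in>S. d s t)"

record ('a, 'b, 'd) bridge =
  bridge_algebra :: "'d cstar"
  pivot :: 'd
  left_map :: "'a \<Rightarrow> 'd"
  right_map :: "'b \<Rightarrow> 'd"

definition one_level :: "'d cstar \<Rightarrow> 'd \<Rightarrow> ('d \<Rightarrow> complex) set" where
  "one_level D w = {\<phi> \<in> states D.
     \<phi> (star D (\<one>\<^bsub>D\<^esub> \<ominus>\<^bsub>D\<^esub> w) \<otimes>\<^bsub>D\<^esub> (\<one>\<^bsub>D\<^esub> \<ominus>\<^bsub>D\<^esub> w)) = 0 \<and>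
     \<phi> ((\<one>\<^bsub>D\<^esub> \<ominus>\<^bsub>D\<^esub> w) \<otimes>\<^bsub>D\<^esub> star D (\<one>\<^bsub>D\<^esub> \<ominus>\<^bsub>D\<^esub> w)) = 0}"

definition is_bridge :: "'a cstar \<Rightarrow> 'b cstar \<Rightarrow> ('a, 'b, 'd) bridge \<Rightarrow> bool" where
  "is_bridge A B g \<longleftrightarrow>
     cstar_algebra (bridge_algebra g) \<and>
     unital_star_mono A (bridge_algebra g) (left_map g) \<and>
     unital_star_mono B (bridge_algebra g) (right_map g) \<and>
     pivot g \<in> carrier (bridge_algebra g) \<and>
     one_level (bridge_algebra g) (pivot g) \<noteq> {}"

definition bridge_reach ::
  "('a, 'b, 'd) bridge \<Rightarrow> 'a cstar \<times> ('a \<Rightarrow> ennreal) \<Rightarrow> 'b cstar \<times> ('b \<Rightarrow> ennreal) \<Rightarrow> ennreal" where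
  "bridge_reach g = (\<lambda>(A, LA) (B, LB). let D = bridge_algebra g in
     hausdorff_edist (\<lambda>x y. ennreal (nrm D (x \<ominus>\<^bsub>D\<^esub> y)))
       ((\<lambda>a. left_map g a \<otimes>\<^bsub>D\<^esub> pivot g) ` sa_lip_ball A LA)
       ((\<lambda>b. pivot g \<otimes>\<^bsub>D\<^esub> right_map g b) ` sa_lip_ball B LB))"

definition bridge_height ::
  "('a, 'b, 'd) bridge \<Rightarrow> 'a cstar \<times> ('a \<Rightarrow> ennreal) \<Rightarrow> 'b cstar \<times> ('b \<Rightarrow> ennreal) \<Rightarrow> ennreal" where
  "bridge_height g = (\<lambda>(A, LA) (B, LB).
     let S1 = one_level (bridge_algebra g) (pivot g) in
     max (hausdorff_edist (mk_dist (sa_lip_ball A LA)) (states A)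
            ((\<lambda>\<phi>. compose (carrier A) \<phi> (left_map g)) ` S1))
         (hausdorff_edist (mk_dist (sa_lip_ball B LB)) (states B)
            ((\<lambda>\<phi>. compose (carrier B) \<phi> (right_map g)) ` S1)))"

definition bridge_length ::
  "('a, 'b, 'd) bridge \<Rightarrow> 'a cstar \<times> ('a \<Rightarrow> ennreal) \<Rightarrow> 'b cstar \<times> ('b \<Rightarrow> ennreal) \<Rightarrow> ennreal" where
  "bridge_length g X Y = max (bridge_reach g X Y) (bridge_height g X Y)"

definition is_trek ::
  "'u cstar \<times> ('u \<Rightarrow> ennreal) \<Rightarrow> 'u cstar \<times> ('u \<Rightarrow> ennreal) \<Rightarrow>
   ('u cstar \<times> ('u \<Rightarrow> ennreal)) list \<Rightarrow> ('u, 'u, 'u) bridge list \<Rightarrow> bool" where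
  "is_trek X Y Xs gs \<longleftrightarrow>
     length Xs = Suc (length gs) \<and> hd Xs = X \<and> last Xs = Y \<and>
     (\<forall>Z\<in>set Xs. propinquity_class Z) \<and>
     (\<forall>i<length gs. is_bridge (fst (Xs ! i)) (fst (Xs ! Suc i)) (gs ! i))"

definition trek_length ::
  "('u cstar \<times> ('u \<Rightarrow> ennreal)) list \<Rightarrow> ('u, 'u, 'u) bridge list \<Rightarrow> ennreal" where
  "trek_length Xs gs = (\<Sum>i<length gs. bridge_length (gs ! i) (Xs ! i) (Xs ! Suc i))"

text \<open>HOL cannot quantify over the carrier types of the intermediate algebras of a trek and of the
  algebras of its bridges, so all of them live on one type \<open>'u\<close>.  If \<open>'u\<close> has at least
  continuum many elements this does not change the infimum.  Every algebra in the class is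
  separable, because its state space is metrizable in the weak* topology.  Moreover \<open>D\<close> in
  a bridge may be replaced by its (separable) C*-subalgebra generated by the images of the two
  algebras and the pivot: the reach is the same, and so is the height, because states extend from a
  unital C*-subalgebra.  A separable C*-algebra has at most continuum many elements.\<close>

definition propinquity ::
  "'u cstar \<times> ('u \<Rightarrow> ennreal) \<Rightarrow> 'u cstar \<times> ('u \<Rightarrow> ennreal) \<Rightarrow> ennreal" where
  "propinquity X Y = (INF (Xs, gs)\<in>{(Xs, gs). is_trek X Y Xs gs}. trek_length Xs gs)"


section \<open>Completions by classes of sequences\<close>

definition null_rel ::
  "(nat \<Rightarrow> 'a \<Rightarrow> 'a \<Rightarrow> real) \<Rightarrow> (nat \<Rightarrow> 'a) set \<Rightarrow> ((nat \<Rightarrow> 'a) \<times> (nat \<Rightarrow> 'a)) set" where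
  "null_rel d S = {(x, y). x \<in> S \<and> y \<in> S \<and> (\<lambda>n. d n (x n) (y n)) \<longlonglongrightarrow> 0}"

definition rep :: "(nat \<Rightarrow> 'a) set \<Rightarrow> nat \<Rightarrow> 'a" where
  "rep X = (SOME x. x \<in> X)"

definition lift1 ::
  "((nat \<Rightarrow> 'a) \<times> (nat \<Rightarrow> 'a)) set \<Rightarrow> (nat \<Rightarrow> 'a \<Rightarrow> 'a) \<Rightarrow> (nat \<Rightarrow> 'a) set \<Rightarrow> (nat \<Rightarrow> 'a) set" where
  "lift1 r f X = r `` {\<lambda>n. f n (rep X n)}"

definition lift2 ::
  "((nat \<Rightarrow> 'a) \<times> (nat \<Rightarrow> 'a)) set \<Rightarrow> (nat \<Rightarrow> 'a \<Rightarrow> 'a \<Rightarrow> 'a) \<Rightarrow>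
   (nat \<Rightarrow> 'a) set \<Rightarrow> (nat \<Rightarrow> 'a) set \<Rightarrow> (nat \<Rightarrow> 'a) set" where
  "lift2 r f X Y = r `` {\<lambda>n. f n (rep X n) (rep Y n)}"


section \<open>C*-algebraic inductive limits of sequences\<close>

text \<open>\<open>connect \<alpha> n k\<close> is the composite connecting map from stage \<open>n\<close> to stage
  \<open>n + k\<close>.\<close>

primrec connect :: "(nat \<Rightarrow> 'b \<Rightarrow> 'b) \<Rightarrow> nat \<Rightarrow> nat \<Rightarrow> 'b \<Rightarrow> 'b" where
  "connect \<alpha> n 0 = (\<lambda>x. x)"
| "connect \<alpha> n (Suc k) = \<alpha> (n + k) \<circ> connect \<alpha> n k"

text \<open>A sequence \<open>x\<close> in the product of the \<open>B n\<close> is identified with the sequence of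
  the images of the \<open>x n\<close> in the algebraic direct limit; the sequences below are those for which
  the latter is Cauchy.  Modulo null sequences they form the completion of the algebraic limit
  (equivalently, the closure of its image in the product of the \<open>B n\<close> modulo
  \<open>c\<^sub>0\<close>-sequences).\<close>

definition lim_seqs :: "(nat \<Rightarrow> 'b cstar) \<Rightarrow> (nat \<Rightarrow> 'b \<Rightarrow> 'b) \<Rightarrow> (nat \<Rightarrow> 'b) set" where
  "lim_seqs B \<alpha> = {x. (\<forall>n. x n \<in> carrier (B n)) \<and>
     (\<forall>\<epsilon>>0. \<exists>N. \<forall>n\<ge>N. \<forall>k. nrm (B (n + k)) (x (n + k) \<ominus>\<^bsub>B (n + k)\<^esub> connect \<alpha> n k (x n)) < \<epsilon>)}"

definition lim_rel ::
  "(nat \<Rightarrow> 'b cstar) \<Rightarrow> (nat \<Rightarrow> 'b \<Rightarrow> 'b) \<Rightarrow> ((nat \<Rightarrow> 'b) \<times> (nat \<Rightarrow> 'b)) set" where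
  "lim_rel B \<alpha> = null_rel (\<lambda>n x y. nrm (B n) (x \<ominus>\<^bsub>B n\<^esub> y)) (lim_seqs B \<alpha>)"

definition inductive_limit ::
  "(nat \<Rightarrow> 'b cstar) \<Rightarrow> (nat \<Rightarrow> 'b \<Rightarrow> 'b) \<Rightarrow> (nat \<Rightarrow> 'b) set cstar" where
  "inductive_limit B \<alpha> = (let r = lim_rel B \<alpha> in
     \<lparr> carrier = lim_seqs B \<alpha> // r,
       mult = lift2 r (\<lambda>n. (\<otimes>\<^bsub>B n\<^esub>)),
       one = r `` {\<lambda>n. \<one>\<^bsub>B n\<^esub>},
       zero = r `` {\<lambda>n. \<zero>\<^bsub>B n\<^esub>},
       add = lift2 r (\<lambda>n. (\<oplus>\<^bsub>B n\<^esub>)),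
       smult = (\<lambda>c. lift1 r (\<lambda>n x. c \<odot>\<^bsub>B n\<^esub> x)),
       star = lift1 r (\<lambda>n. star (B n)),
       nrm = (\<lambda>X. lim (\<lambda>n. nrm (B n) (rep X n))) \<rparr>)"

definition limit_map ::
  "(nat \<Rightarrow> 'b cstar) \<Rightarrow> (nat \<Rightarrow> 'b \<Rightarrow> 'b) \<Rightarrow> nat \<Rightarrow> 'b \<Rightarrow> (nat \<Rightarrow> 'b) set" where
  "limit_map B \<alpha> n b =
     lim_rel B \<alpha> `` {\<lambda>m. if m < n then \<zero>\<^bsub>B m\<^esub> else connect \<alpha> n (m - n) b}"


section \<open>The GNS space of a faithful tracial state\<close>

record 'h inner_space = "(complex, 'h) module" +
  ip :: "'h \<Rightarrow> 'h \<Rightarrow> complex"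

definition ip_norm :: "'h inner_space \<Rightarrow> 'h \<Rightarrow> real" where
  "ip_norm H h = sqrt (Re (ip H h h))"

definition tau_norm :: "'a cstar \<Rightarrow> ('a \<Rightarrow> complex) \<Rightarrow> 'a \<Rightarrow> real" where
  "tau_norm A \<tau> a = sqrt (Re (\<tau> (star A a \<otimes>\<^bsub>A\<^esub> a)))"

definition gns_seqs :: "'a cstar \<Rightarrow> ('a \<Rightarrow> complex) \<Rightarrow> (nat \<Rightarrow> 'a) set" where
  "gns_seqs A \<tau> = {x. (\<forall>n. x n \<in> carrier A) \<and>
     (\<forall>\<epsilon>>0. \<exists>N. \<forall>m\<ge>N. \<forall>n\<ge>N. tau_norm A \<tau> (x m \<ominus>\<^bsub>A\<^esub> x n) < \<epsilon>)}"

definition gns_rel :: "'a cstar \<Rightarrow> ('a \<Rightarrow> complex) \<Rightarrow> ((nat \<Rightarrow> 'a) \<times> (nat \<Rightarrow> 'a)) set" where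
  "gns_rel A \<tau> = null_rel (\<lambda>_ x y. tau_norm A \<tau> (x \<ominus>\<^bsub>A\<^esub> y)) (gns_seqs A \<tau>)"

text \<open>The ring multiplication and unit inherited from the module record carry no meaning here.\<close>

definition gns :: "'a cstar \<Rightarrow> ('a \<Rightarrow> complex) \<Rightarrow> (nat \<Rightarrow> 'a) set inner_space" where
  "gns A \<tau> = (let r = gns_rel A \<tau> in
     \<lparr> carrier = gns_seqs A \<tau> // r,
       mult = undefined,
       one = undefined,
       zero = r `` {\<lambda>_. \<zero>\<^bsub>A\<^esub>},
       add = lift2 r (\<lambda>_. (\<oplus>\<^bsub>A\<^esub>)),
       smult = (\<lambda>c. lift1 r (\<lambda>_ x. c \<odot>\<^bsub>A\<^esub> x)),
       ip = (\<lambda>X Y. lim (\<lambda>n. \<tau> (star A (rep Y n) \<otimes>\<^bsub>A\<^esub> rep X n))) \<rparr>)"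

definition gns_vec :: "'a cstar \<Rightarrow> ('a \<Rightarrow> complex) \<Rightarrow> 'a \<Rightarrow> (nat \<Rightarrow> 'a) set" where
  "gns_vec A \<tau> a = gns_rel A \<tau> `` {\<lambda>_. a}"

definition gns_rep ::
  "'a cstar \<Rightarrow> ('a \<Rightarrow> complex) \<Rightarrow> 'a \<Rightarrow> (nat \<Rightarrow> 'a) set \<Rightarrow> (nat \<Rightarrow> 'a) set" where
  "gns_rep A \<tau> a = lift1 (gns_rel A \<tau>) (\<lambda>_ x. a \<otimes>\<^bsub>A\<^esub> x)"

definition ortho_proj :: "'h inner_space \<Rightarrow> 'h set \<Rightarrow> 'h \<Rightarrow> 'h" where
  "ortho_proj H K h = (THE v. v \<in> K \<and> (\<forall>w\<in>K. ip H (h \<ominus>\<^bsub>H\<^esub> v) w = 0))"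


section \<open>Christensen--Ivan seminorms\<close>

text \<open>Throughout, \<open>F n\<close> is the finite-dimensional subalgebra of index \<open>n\<close>.\<close>

definition ci_P ::
  "'a cstar \<Rightarrow> (nat \<Rightarrow> 'a set) \<Rightarrow> ('a \<Rightarrow> complex) \<Rightarrow> nat \<Rightarrow> (nat \<Rightarrow> 'a) set \<Rightarrow> (nat \<Rightarrow> 'a) set" where
  "ci_P A F \<tau> n = ortho_proj (gns A \<tau>) (gns_vec A \<tau> ` F n)"

definition ci_Q ::
  "'a cstar \<Rightarrow> (nat \<Rightarrow> 'a set) \<Rightarrow> ('a \<Rightarrow> complex) \<Rightarrow> nat \<Rightarrow> (nat \<Rightarrow> 'a) set \<Rightarrow> (nat \<Rightarrow> 'a) set" where
  "ci_Q A F \<tau> n h = ci_P A F \<tau> n h \<ominus>\<^bsub>gns A \<tau>\<^esub> ci_P A F \<tau> (n - 1) h"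

definition ci_const :: "'a cstar \<Rightarrow> (nat \<Rightarrow> 'a set) \<Rightarrow> ('a \<Rightarrow> complex) \<Rightarrow> nat \<Rightarrow> real" where
  "ci_const A F \<tau> n = (LEAST c. \<forall>a\<in>F n. nrm A a \<le> c * tau_norm A \<tau> a)"

definition ci_coeff ::
  "'a cstar \<Rightarrow> (nat \<Rightarrow> 'a set) \<Rightarrow> ('a \<Rightarrow> complex) \<Rightarrow> (nat \<Rightarrow> real) \<Rightarrow> nat \<Rightarrow> real" where
  "ci_coeff A F \<tau> \<beta> n = ci_const A F \<tau> n / \<beta> n"

definition ci_dom ::
  "'a cstar \<Rightarrow> (nat \<Rightarrow> 'a set) \<Rightarrow> ('a \<Rightarrow> complex) \<Rightarrow> (nat \<Rightarrow> real) \<Rightarrow> (nat \<Rightarrow> 'a) set set" where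
  "ci_dom A F \<tau> \<beta> = {h \<in> carrier (gns A \<tau>).
     summable (\<lambda>n. (ci_coeff A F \<tau> \<beta> (Suc n))\<^sup>2 * (ip_norm (gns A \<tau>) (ci_Q A F \<tau> (Suc n) h))\<^sup>2)}"

definition ci_D ::
  "'a cstar \<Rightarrow> (nat \<Rightarrow> 'a set) \<Rightarrow> ('a \<Rightarrow> complex) \<Rightarrow> (nat \<Rightarrow> real) \<Rightarrow>
   (nat \<Rightarrow> 'a) set \<Rightarrow> (nat \<Rightarrow> 'a) set" where
  "ci_D A F \<tau> \<beta> h = (let H = gns A \<tau> in
     THE v. v \<in> carrier H \<and>
       (\<lambda>N. ip_norm H ((\<Oplus>\<^bsub>H\<^esub>n\<in>{1..N}.
               complex_of_real (ci_coeff A F \<tau> \<beta> n) \<odot>\<^bsub>H\<^esub> ci_Q A F \<tau> n h) \<ominus>\<^bsub>H\<^esub> v))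
         \<longlonglongrightarrow> 0)"

text \<open>The supremum is \<open>\<infinity>\<close> exactly when the commutator is unbounded on the (dense) domain
  of \<open>D\<close>; otherwise it is the norm of its bounded extension.\<close>

definition ci_seminorm ::
  "'a cstar \<Rightarrow> (nat \<Rightarrow> 'a set) \<Rightarrow> ('a \<Rightarrow> complex) \<Rightarrow> (nat \<Rightarrow> real) \<Rightarrow> 'a \<Rightarrow> ennreal" where
  "ci_seminorm A F \<tau> \<beta> a = (let H = gns A \<tau>; D = ci_D A F \<tau> \<beta>; dom = ci_dom A F \<tau> \<beta> in
     if \<forall>h\<in>dom. gns_rep A \<tau> a h \<in> dom
     then SUP h\<in>{h \<in> dom. ip_norm H h \<le> 1}.
            ennreal (ip_norm H (D (gns_rep A \<tau> a h) \<ominus>\<^bsub>H\<^esub> gns_rep A \<tau> a (D h)))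
     else \<infinity>)"


section \<open>Effros--Shen algebras\<close>

definition mat_opnorm :: "complex mat \<Rightarrow> real" where
  "mat_opnorm a = (SUP v\<in>{v \<in> carrier_vec (dim_col a). Re (v \<bullet>c v) \<le> 1}.
     sqrt (Re ((a *\<^sub>v v) \<bullet>c (a *\<^sub>v v))))"

definition two_block :: "nat \<Rightarrow> nat \<Rightarrow> (complex mat \<times> complex mat) cstar" where
  "two_block k l =
     \<lparr> carrier = carrier_mat k k \<times> carrier_mat l l,
       mult = (\<lambda>(a, b) (a', b'). (a * a', b * b')),
       one = (1\<^sub>m k, 1\<^sub>m l),
       zero = (0\<^sub>m k k, 0\<^sub>m l l),
       add = (\<lambda>(a, b) (a', b'). (a + a', b + b')),
       smult = (\<lambda>c (a, b). (c \<cdot>\<^sub>m a, c \<cdot>\<^sub>m b)),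
       star = (\<lambda>(a, b). (mat_adjoint a, mat_adjoint b)),
       nrm = (\<lambda>(a, b). max (mat_opnorm a) (mat_opnorm b)) \<rparr>"

primrec cf_rem :: "real \<Rightarrow> nat \<Rightarrow> real" where
  "cf_rem \<theta> 0 = \<theta>"
| "cf_rem \<theta> (Suc n) = 1 / frac (cf_rem \<theta> n)"

definition cf_digit :: "real \<Rightarrow> nat \<Rightarrow> nat" where
  "cf_digit \<theta> n = nat \<lfloor>cf_rem \<theta> n\<rfloor>"

fun cf_p :: "real \<Rightarrow> nat \<Rightarrow> nat" where
  "cf_p \<theta> 0 = cf_digit \<theta> 0"
| "cf_p \<theta> (Suc 0) = 1"
| "cf_p \<theta> (Suc (Suc n)) = cf_digit \<theta> (Suc (Suc n)) * cf_p \<theta> (Suc n) + cf_p \<theta> n"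

fun cf_q :: "real \<Rightarrow> nat \<Rightarrow> nat" where
  "cf_q \<theta> 0 = 1"
| "cf_q \<theta> (Suc 0) = cf_digit \<theta> 1"
| "cf_q \<theta> (Suc (Suc n)) = cf_digit \<theta> (Suc (Suc n)) * cf_q \<theta> (Suc n) + cf_q \<theta> n"

text \<open>The usual convention that the denominator of index \<open>-1\<close> is \<open>0\<close> turns stage
  \<open>0\<close> into \<open>M\<^sub>1 \<oplus> M\<^sub>0\<close>, a copy of the complex numbers (there is exactly one
  \<open>0 \<times> 0\<close> matrix), and makes the first connecting map and \<open>\<beta>\<^sub>0 = 1\<close> instances
  of the general formulas.\<close>

definition cf_q_prev :: "real \<Rightarrow> nat \<Rightarrow> nat" where
  "cf_q_prev \<theta> n = (case n of 0 \<Rightarrow> 0 | Suc m \<Rightarrow> cf_q \<theta> m)"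

definition es_stage :: "real \<Rightarrow> nat \<Rightarrow> (complex mat \<times> complex mat) cstar" where
  "es_stage \<theta> n = two_block (cf_q \<theta> n) (cf_q_prev \<theta> n)"

definition es_connect ::
  "real \<Rightarrow> nat \<Rightarrow> complex mat \<times> complex mat \<Rightarrow> complex mat \<times> complex mat" where
  "es_connect \<theta> n = (\<lambda>(a, b). (diag_block_mat (replicate (cf_digit \<theta> (Suc n)) a @ [b]), a))"

type_synonym es_elem = "(nat \<Rightarrow> complex mat \<times> complex mat) set"

definition effros_shen :: "real \<Rightarrow> es_elem cstar" where
  "effros_shen \<theta> = inductive_limit (es_stage \<theta>) (es_connect \<theta>)"

definition es_map :: "real \<Rightarrow> nat \<Rightarrow> complex mat \<times> complex mat \<Rightarrow> es_elem" where
  "es_map \<theta> = limit_map (es_stage \<theta>) (es_connect \<theta>)"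

definition es_filtration :: "real \<Rightarrow> nat \<Rightarrow> es_elem set" where
  "es_filtration \<theta> n = es_map \<theta> n ` carrier (es_stage \<theta> n)"

definition es_t :: "real \<Rightarrow> nat \<Rightarrow> real" where
  "es_t \<theta> n = (-1) ^ (n - 1) * real (cf_q \<theta> n) * (\<theta> * real (cf_q \<theta> (n - 1)) - real (cf_p \<theta> (n - 1)))"

definition mat_tr :: "complex mat \<Rightarrow> complex" where
  "mat_tr a = (\<Sum>i<dim_row a. a $$ (i, i))"

definition es_trace :: "real \<Rightarrow> es_elem \<Rightarrow> complex" where
  "es_trace \<theta> = (THE \<tau>. faithful_tracial_state (effros_shen \<theta>) \<tau> \<and>
     (\<forall>n\<ge>1. \<forall>(a, b)\<in>carrier (es_stage \<theta> n).
        \<tau> (es_map \<theta> n (a, b)) =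
          complex_of_real (es_t \<theta> n / real (cf_q \<theta> n)) * mat_tr a +
          complex_of_real ((1 - es_t \<theta> n) / real (cf_q \<theta> (n - 1))) * mat_tr b))"

text \<open>The denominator is the dimension of the \<open>n\<close>-th stage.\<close>

definition es_beta :: "real \<Rightarrow> nat \<Rightarrow> real" where
  "es_beta \<theta> n = 1 / ((real (cf_q \<theta> n))\<^sup>2 + (real (cf_q_prev \<theta> n))\<^sup>2)"

definition es_seminorm :: "real \<Rightarrow> es_elem \<Rightarrow> ennreal" where
  "es_seminorm \<theta> = ci_seminorm (effros_shen \<theta>) (es_filtration \<theta>) (es_trace \<theta>) (es_beta \<theta>)"

definition es_qms :: "real \<Rightarrow> es_elem cstar \<times> (es_elem \<Rightarrow> ennreal)" where
  "es_qms \<theta> = (effros_shen \<theta>, es_seminorm \<theta>)"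

end

theory Submission
  imports Defs "HOL-Analysis.Analysis"
begin

text \<open>A commutator bound \<open>L a \<le> C\<close> is equivalent to a bound on a sesquilinear form on the union of
  the stages, which makes it stable under the trace-preserving conditional expectations \<open>E n\<close>.
  Since moreover \<open>a\<close> is within \<open>C * (\<Sum>j>n. \<beta> j)\<close> of \<open>E n a\<close>, the Lipschitz balls of the stages
  approximate that of the whole algebra, and because \<open>\<beta> j \<le> 1 / j\<^sup>2\<close> they do so uniformly in
  \<open>\<theta>\<close>; the same estimate gives total boundedness and hence the weak* metrization.
  With pivot \<open>1\<close> a bridge has height \<open>0\<close>, because states of a stage extend by
  composition with \<open>E n\<close>, so only the reach matters.

  If \<open>\<theta>'\<close> is close to \<open>\<theta>\<close>, the partial quotients up to a given \<open>n\<close> agree.  The \<open>n\<close>-th stages are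
  then canonically isomorphic, and their traces differ only in two weights that depend
  continuously on \<open>\<theta>\<close>; so the seminorms of corresponding elements of these stages agree up to a
  factor close to \<open>1\<close>.  The trek from \<open>\<theta>'\<close> to \<open>\<theta>\<close> passes through the \<open>n\<close>-th stage of \<open>\<theta>'\<close>.\<close>

section \<open>Seminormed complex vector spaces with carrier\<close>

text \<open>A bridge needs one C*-algebra that contains both sides, and for two angles none is at
  hand. What the algebras share is a stage. The stage of \<theta>' embeds into the algebra of
  \<theta> although the traces disagree, because the maps of a bridge need not respect traces. The
  weak form makes the seminorms comparable. On a stage it involves a finite sum of projections and
  no operator domain, and for an element of stage n it is decided on stage n, hence by finitely many
  matrices and two weights. The price is the way back to the seminorm as defined: a bound on the
  form has to force the element to preserve the domain of the operator. The comparison costs about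
  \<delta> times \<open>K n\<close>, and \<open>K n\<close> grows without bound in n. So n is fixed
  first, from a tail bound uniform in the angle, and only then does \<delta> tend to 0; every
  estimate is arranged so that \<open>K n\<close> belongs to the limit angle and not to the moving
  one. Spectral theory is replaced by two elementary tools: a square root of 1 - h for h of norm
  below 1, and the description of the C*-norm on a stage as an operator norm for the trace.\<close>

locale cvec =
  fixes V :: "(complex, 'v, 'm) module_scheme" (structure)
  assumes is_module: "Module.module class_ring V"
begin

sublocale abelian_group V using is_module by (rule Module.module.axioms)

lemma smult_closed [simp, intro]: "x \<in> carrier V \<Longrightarrow> c \<odot> x \<in> carrier V"
  using Module.module.smult_closed[OF is_module] by (simp add: class_ring_simps)

lemma smult_add_left: "x \<in> carrier V \<Longrightarrow> (c + d) \<odot> x = c \<odot> x \<oplus> d \<odot> x"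
  using Module.module.smult_l_distr[OF is_module, of c d x] by (simp add: class_ring_simps)

lemma smult_add_right: "x \<in> carrier V \<Longrightarrow> y \<in> carrier V \<Longrightarrow> c \<odot> (x \<oplus> y) = c \<odot> x \<oplus> c \<odot> y"
  using Module.module.smult_r_distr[OF is_module, of c x y] by (simp add: class_ring_simps)

lemma smult_smult: "x \<in> carrier V \<Longrightarrow> c \<odot> (d \<odot> x) = (c * d) \<odot> x"
  using Module.module.smult_assoc1[OF is_module, of c d x] by (simp add: class_ring_simps)

lemma smult_one_left [simp]: "x \<in> carrier V \<Longrightarrow> 1 \<odot> x = x"
  using Module.module.smult_one[OF is_module, of x] by (simp add: class_ring_simps)

lemma smult_zero_left [simp]: "x \<in> carrier V \<Longrightarrow> 0 \<odot> x = \<zero>"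
  using Module.module.smult_l_null[OF is_module, of x] by (simp add: class_ring_simps)

lemma smult_zero_right [simp]: "c \<odot> \<zero> = \<zero>"
  using Module.module.smult_r_null[OF is_module, of c] by (simp add: class_ring_simps)

lemma uminus_eq_smult: "x \<in> carrier V \<Longrightarrow> \<ominus> x = (-1) \<odot> x"
  using smult_add_left[of x "-1" 1] by (intro minus_equality) auto

lemma minus_eq_smult: "x \<in> carrier V \<Longrightarrow> y \<in> carrier V \<Longrightarrow> x \<ominus> y = x \<oplus> (-1) \<odot> y"
  by (simp add: a_minus_def uminus_eq_smult)

lemma smult_minus: "x \<in> carrier V \<Longrightarrow> y \<in> carrier V \<Longrightarrow> c \<odot> (x \<ominus> y) = c \<odot> x \<ominus> c \<odot> y"
  by (simp add: minus_eq_smult smult_add_right smult_smult mult.commute)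

lemma minus_minus_minus:
  assumes "x \<in> carrier V" "y \<in> carrier V" "z \<in> carrier V"
  shows "x \<ominus> z = (x \<ominus> y) \<oplus> (y \<ominus> z)"
  using assms by (simp add: a_minus_def a_assoc r_neg1)

lemma add_minus_add:
  assumes "x \<in> carrier V" "y \<in> carrier V" "x' \<in> carrier V" "y' \<in> carrier V"
  shows "(x \<oplus> y) \<ominus> (x' \<oplus> y') = (x \<ominus> x') \<oplus> (y \<ominus> y')"
  using assms by (simp add: a_minus_def minus_add a_ac)

lemma minus_add_minus:
  assumes "x \<in> carrier V" "y \<in> carrier V" "x' \<in> carrier V" "y' \<in> carrier V"
  shows "(x \<ominus> x') \<ominus> (y \<ominus> y') = (x \<ominus> y) \<ominus> (x' \<ominus> y')"
  using assms by (simp add: a_minus_def minus_add a_ac)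

lemma minus_self [simp]: "x \<in> carrier V \<Longrightarrow> x \<ominus> x = \<zero>"
  by (simp add: a_minus_def r_neg)

lemma minus_eq_zero: "x \<in> carrier V \<Longrightarrow> y \<in> carrier V \<Longrightarrow> x \<ominus> y = \<zero> \<Longrightarrow> x = y"
  by simp

lemma minus_zero_right [simp]: "x \<in> carrier V \<Longrightarrow> x \<ominus> \<zero> = x"
  by (simp add: a_minus_def)

lemma add_minus_cancel: "x \<in> carrier V \<Longrightarrow> y \<in> carrier V \<Longrightarrow> y \<oplus> (x \<ominus> y) = x"
  by (simp add: a_minus_def a_lcomm[of y x] r_neg)

end

text \<open>Definiteness is left out so that the C*-norm and the trace seminorm
  \<open>tau_norm\<close> of an arbitrary state are both instances; limits are then unique only up
  to elements of norm zero.\<close>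

locale snorm = cvec +
  fixes N :: "'a \<Rightarrow> real"
  assumes N_add: "x \<in> carrier V \<Longrightarrow> y \<in> carrier V \<Longrightarrow> N (x \<oplus> y) \<le> N x + N y"
    and N_smult: "x \<in> carrier V \<Longrightarrow> N (c \<odot> x) = cmod c * N x"
begin

lemma N_zero [simp]: "N \<zero> = 0"
  using N_smult[of \<zero> 0] by simp

lemma N_uminus: "x \<in> carrier V \<Longrightarrow> N (\<ominus> x) = N x"
  by (simp add: uminus_eq_smult N_smult)

lemma N_nonneg: "x \<in> carrier V \<Longrightarrow> 0 \<le> N x"
  using N_add[of x "\<ominus> x"] by (simp add: r_neg N_uminus)

lemma N_minus_commute: "x \<in> carrier V \<Longrightarrow> y \<in> carrier V \<Longrightarrow> N (x \<ominus> y) = N (y \<ominus> x)"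
  using N_uminus[of "x \<ominus> y"] by (simp add: a_minus_def minus_add a_comm)

lemma N_minus: "x \<in> carrier V \<Longrightarrow> y \<in> carrier V \<Longrightarrow> N (x \<ominus> y) \<le> N x + N y"
  using N_add[of x "\<ominus> y"] by (simp add: a_minus_def N_uminus)

lemma N_triangle:
  assumes "x \<in> carrier V" "y \<in> carrier V" "z \<in> carrier V"
  shows "N (x \<ominus> z) \<le> N (x \<ominus> y) + N (y \<ominus> z)"
  using assms N_add[of "x \<ominus> y" "y \<ominus> z"] by (simp add: minus_minus_minus[of x y z])

lemma N_le_minus: "x \<in> carrier V \<Longrightarrow> y \<in> carrier V \<Longrightarrow> N x \<le> N y + N (x \<ominus> y)"
  using N_triangle[of x y \<zero>] by simp

lemma N_diff: "x \<in> carrier V \<Longrightarrow> y \<in> carrier V \<Longrightarrow> \<bar>N x - N y\<bar> \<le> N (x \<ominus> y)"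
  using N_le_minus[of x y] N_le_minus[of y x] N_minus_commute[of x y] by linarith

lemma N_minus_telescope:
  assumes s: "\<And>n. s n \<in> carrier V" and f: "\<And>n. N (s (Suc n) \<ominus> s n) \<le> f n"
  shows "N (s (n + k) \<ominus> s n) \<le> (\<Sum>i=n..<n+k. f i)"
proof (induction k)
  case (Suc k)
  have "N (s (n + Suc k) \<ominus> s n) \<le> N (s (Suc (n + k)) \<ominus> s (n + k)) + N (s (n + k) \<ominus> s n)"
    using N_triangle[of "s (Suc (n + k))" "s (n + k)" "s n"] s by simp
  also have "\<dots> \<le> (\<Sum>i=n..<n+Suc k. f i)"
    using f[of "n + k"] Suc by simp
  finally show ?case .
qed (use s in simp)

lemma Cauchy_if_summable:
  assumes s: "\<And>n. s n \<in> carrier V" and f: "\<And>n. N (s (Suc n) \<ominus> s n) \<le> f n"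
    and summ: "summable f" and e: "\<epsilon> > 0"
  shows "\<exists>M. \<forall>m\<ge>M. \<forall>n\<ge>M. N (s m \<ominus> s n) < \<epsilon>"
proof -
  obtain M where M: "\<And>m n. m \<ge> M \<Longrightarrow> norm (sum f {m..<n}) < \<epsilon>"
    using summ e unfolding summable_Cauchy by metis
  have *: "N (s m \<ominus> s n) < \<epsilon>" if "m \<ge> n" "n \<ge> M" for m n
    using N_minus_telescope[of s f n "m - n", OF s f] M[OF that(2), of m] that by auto
  have "N (s m \<ominus> s n) < \<epsilon>" if "m \<ge> M" "n \<ge> M" for m n
    using *[of n m] *[of m n] that N_minus_commute[of "s m" "s n"] s by (cases "n \<le> m") auto
  thus ?thesis by blast
qed

lemma lim_unique:
  assumes "\<And>n. s n \<in> carrier V" "x \<in> carrier V" "y \<in> carrier V"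
    "(\<lambda>n. N (s n \<ominus> x)) \<longlonglongrightarrow> 0" "(\<lambda>n. N (s n \<ominus> y)) \<longlonglongrightarrow> 0"
  shows "N (x \<ominus> y) = 0"
proof -
  have "(\<lambda>n. N (s n \<ominus> x) + N (s n \<ominus> y)) \<longlonglongrightarrow> 0 + 0"
    by (intro tendsto_add assms)
  moreover have "N (x \<ominus> y) \<le> N (s n \<ominus> x) + N (s n \<ominus> y)" for n
    using N_triangle[of x "s n" y] N_minus_commute[of x "s n"] assms by simp
  ultimately have "N (x \<ominus> y) \<le> 0"
    by (intro LIMSEQ_le_const) auto
  thus ?thesis using N_nonneg[of "x \<ominus> y"] assms by simp
qed

end

section \<open>Positive sesquilinear forms\<close>

text \<open>In the Cauchy-Schwarz inequality C is the squared modulus of the inner product, which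
  explains the factor C in both terms. For Y > 0 the choice t = 1/Y gives the claim. For Y = 0 the
  expression is affine in t and negative at t = (X + 1)/C unless C = 0.\<close>

lemma quadratic_discriminant:
  fixes X C Y :: real
  assumes q: "\<And>t. 0 \<le> X - 2 * t * C + t\<^sup>2 * C * Y" and "0 \<le> C" "0 \<le> Y" "0 \<le> X"
  shows "C \<le> X * Y"
proof (cases "C = 0")
  case False
  hence C: "C > 0" using assms by simp
  show ?thesis
  proof (cases "Y = 0")
    case True
    thus ?thesis using q[of "(X + 1) / C"] C assms(4) by simp
  next
    case False
    hence Y: "Y > 0" using assms by simp
    have "(1 / Y)\<^sup>2 * C * Y = C / Y" using Y by (simp add: power2_eq_square)
    thus ?thesis using q[of "1 / Y"] Y by (simp add: pos_divide_le_eq)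
  qed
qed (use assms in simp)

text \<open>The norm \<open>tn\<close> is a parameter tied to \<open>s\<close> on the carrier only;
  thus \<open>tau_norm\<close>, \<open>ip_norm\<close> and the Euclidean norm \<open>vn\<close>
  become instances under their own names.\<close>

locale sesq = cvec V for V :: "(complex, 'v, 'm) module_scheme" (structure) +
  fixes s :: "'v \<Rightarrow> 'v \<Rightarrow> complex" and tn :: "'v \<Rightarrow> real"
  assumes s_add: "\<lbrakk>x \<in> carrier V; y \<in> carrier V; z \<in> carrier V\<rbrakk> \<Longrightarrow> s (x \<oplus> y) z = s x z + s y z"
    and s_smult: "\<lbrakk>x \<in> carrier V; z \<in> carrier V\<rbrakk> \<Longrightarrow> s (c \<odot> x) z = c * s x z"
    and s_cnj: "\<lbrakk>x \<in> carrier V; y \<in> carrier V\<rbrakk> \<Longrightarrow> s x y = cnj (s y x)"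
    and s_pos: "x \<in> carrier V \<Longrightarrow> 0 \<le> Re (s x x)"
    and tn_def: "x \<in> carrier V \<Longrightarrow> tn x = sqrt (Re (s x x))"
begin

lemma s_add_right: "\<lbrakk>x \<in> carrier V; y \<in> carrier V; z \<in> carrier V\<rbrakk> \<Longrightarrow> s z (x \<oplus> y) = s z x + s z y"
  by (subst (1 2 3) s_cnj) (auto simp: s_add)

lemma s_smult_right: "\<lbrakk>x \<in> carrier V; z \<in> carrier V\<rbrakk> \<Longrightarrow> s z (c \<odot> x) = cnj c * s z x"
  by (subst (1 2) s_cnj) (auto simp: s_smult)

lemma s_minus: "\<lbrakk>x \<in> carrier V; y \<in> carrier V; z \<in> carrier V\<rbrakk> \<Longrightarrow> s (x \<ominus> y) z = s x z - s y z"
  by (simp add: minus_eq_smult s_add s_smult)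

lemma s_minus_right: "\<lbrakk>x \<in> carrier V; y \<in> carrier V; z \<in> carrier V\<rbrakk> \<Longrightarrow> s z (x \<ominus> y) = s z x - s z y"
  by (simp add: minus_eq_smult s_add_right s_smult_right)

lemma s_zero [simp]: "x \<in> carrier V \<Longrightarrow> s \<zero> x = 0" "x \<in> carrier V \<Longrightarrow> s x \<zero> = 0"
  using s_smult[of \<zero> x 0] s_smult_right[of \<zero> x 0] by auto

lemma tn_sq: "x \<in> carrier V \<Longrightarrow> (tn x)\<^sup>2 = Re (s x x)"
  by (simp add: tn_def s_pos)

lemma s_self: "x \<in> carrier V \<Longrightarrow> s x x = complex_of_real ((tn x)\<^sup>2)"
  using s_cnj[of x x] by (simp add: tn_sq complex_eq_iff)

lemma tn_nonneg [simp]: "x \<in> carrier V \<Longrightarrow> 0 \<le> tn x"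
  by (simp add: tn_def s_pos)

lemma Cauchy_Schwarz:
  assumes x: "x \<in> carrier V" and y: "y \<in> carrier V"
  shows "cmod (s x y) \<le> tn x * tn y"
proof -
  define c where "c = s x y"
  have cc: "c * cnj c = complex_of_real ((cmod c)\<^sup>2)" using complex_norm_square[of c] by simp
  have quad: "0 \<le> (tn x)\<^sup>2 - 2 * t * (cmod c)\<^sup>2 + t\<^sup>2 * (cmod c)\<^sup>2 * (tn y)\<^sup>2" for t :: real
  proof -
    \<comment> \<open>The multiple of y points along c = s x y, so that the cross terms are real
      whatever the phase of c.\<close>
    let ?l = "complex_of_real t * c"
    have "0 \<le> Re (s (x \<ominus> ?l \<odot> y) (x \<ominus> ?l \<odot> y))"
      using x y by (intro s_pos) auto
    also have "s (x \<ominus> ?l \<odot> y) (x \<ominus> ?l \<odot> y)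
        = s x x - 2 * complex_of_real t * (c * cnj c) + complex_of_real t * complex_of_real t * (c * cnj c) * s y y"
      using x y by (simp add: s_minus s_minus_right s_smult s_smult_right c_def s_cnj[of y x] algebra_simps)
    also have "\<dots> = complex_of_real ((tn x)\<^sup>2 - 2 * t * (cmod c)\<^sup>2 + t\<^sup>2 * (cmod c)\<^sup>2 * (tn y)\<^sup>2)"
      unfolding cc using x y by (simp add: s_self power2_eq_square)
    finally show ?thesis by simp
  qed
  have "(cmod c)\<^sup>2 \<le> (tn x)\<^sup>2 * (tn y)\<^sup>2"
    by (rule quadratic_discriminant) (use quad in auto)
  thus ?thesis using x y unfolding c_def
    by (intro power2_le_imp_le[of "cmod (s x y)" "tn x * tn y"]) (auto simp: power_mult_distrib)
qed

lemma tn_add: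
  assumes x: "x \<in> carrier V" and y: "y \<in> carrier V"
  shows "tn (x \<oplus> y) \<le> tn x + tn y"
proof (rule power2_le_imp_le)
  have "(tn (x \<oplus> y))\<^sup>2 = (tn x)\<^sup>2 + (tn y)\<^sup>2 + 2 * Re (s x y)"
    using x y s_cnj[of y x] by (simp add: tn_sq s_add s_add_right)
  also have "Re (s x y) \<le> tn x * tn y"
    using Cauchy_Schwarz[OF x y] complex_Re_le_cmod order_trans by blast
  finally show "(tn (x \<oplus> y))\<^sup>2 \<le> (tn x + tn y)\<^sup>2"
    by (simp add: power2_sum)
qed (use x y in auto)

lemma tn_smult: "x \<in> carrier V \<Longrightarrow> tn (c \<odot> x) = cmod c * tn x"
proof -
  assume x: "x \<in> carrier V"
  have "s (c \<odot> x) (c \<odot> x) = (c * cnj c) * s x x"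
    using x by (simp add: s_smult s_smult_right)
  also have "\<dots> = complex_of_real ((cmod c)\<^sup>2 * (tn x)\<^sup>2)"
    using x by (simp add: s_self complex_norm_square[symmetric])
  finally have "(tn (c \<odot> x))\<^sup>2 = (cmod c * tn x)\<^sup>2"
    using x by (simp add: tn_sq power_mult_distrib)
  thus ?thesis by (rule power2_eq_imp_eq) (use x in auto)
qed

sublocale T: snorm V tn
  by unfold_locales (auto intro: tn_add tn_smult)

text \<open>Pair the element with itself and divide by its norm. Norms of projections and adjoints
  are estimated in this way throughout.\<close>

lemma tn_le_if_s_le:
  assumes "x \<in> carrier V" "cmod (s x x) \<le> C * tn x" "0 \<le> C"
  shows "tn x \<le> C"
proof (cases "tn x = 0")
  case False
  have "tn x * tn x \<le> C * tn x" using assms by (simp add: s_self power2_eq_square del: of_real_power of_real_mult)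
  thus ?thesis using False tn_nonneg[OF assms(1)] by (simp add: mult_le_cancel_right)
qed (use assms in simp)

end

section \<open>C*-algebras\<close>

text \<open>The constant c disappears when roots of growing order are taken. Exponents
  \<open>2 ^ k\<close> suffice, and they are the ones reached by repeated squaring.\<close>

lemma le_if_pow2_le:
  fixes a b c :: real
  assumes "\<And>k. a ^ (2 ^ k) \<le> c * b ^ (2 ^ k)" "0 \<le> b"
  shows "a \<le> b"
proof (rule ccontr)
  assume n: "\<not> a \<le> b"
  show False
  proof (cases "b = 0")
    case True
    thus ?thesis using assms(1)[of 0] n by simp
  next
    case False
    hence b: "b > 0" using assms by simp
    have r: "a / b > 1" using n b by simp
    obtain k where k: "c < (a / b) ^ k" using real_arch_pow[OF r] by blast
    have "(a / b) ^ k \<le> (a / b) ^ (2 ^ k)"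
      using r by (intro power_increasing) (auto simp: less_imp_le)
    moreover have "(a / b) ^ (2 ^ k) \<le> c"
      using assms(1)[of k] b by (simp add: power_divide divide_simps)
    ultimately show False using k by linarith
  qed
qed

locale cstar =
  fixes A :: "'a cstar" (structure)
  assumes cstar_alg: "cstar_algebra A"
begin

lemmas axs = cstar_alg[unfolded cstar_algebra_def]
lemmas axs3 = axs[THEN conjunct2, THEN conjunct2]
lemmas axs6 = axs3[THEN conjunct2, THEN conjunct2, THEN conjunct2]
lemmas axs9 = axs6[THEN conjunct2, THEN conjunct2, THEN conjunct2]
lemmas ax3 = axs3[THEN conjunct1]
  and ax4 = axs3[THEN conjunct2, THEN conjunct1]
  and ax5 = axs3[THEN conjunct2, THEN conjunct2, THEN conjunct1]
  and ax6 = axs6[THEN conjunct1]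
  and ax7 = axs6[THEN conjunct2, THEN conjunct1]
  and ax8 = axs6[THEN conjunct2, THEN conjunct2, THEN conjunct1]
  and ax9 = axs9[THEN conjunct1]
  and ax10 = axs9[THEN conjunct2, THEN conjunct1]
  and ax11 = axs9[THEN conjunct2, THEN conjunct2]

sublocale cvec A by (rule cvec.intro) (use axs in blast)
sublocale ring A using cstar_alg by (simp add: cstar_algebra_def)

lemma smult_mult_left: "x \<in> carrier A \<Longrightarrow> y \<in> carrier A \<Longrightarrow> (c \<odot> x) \<otimes> y = c \<odot> (x \<otimes> y)"
  using ax3 by blast
lemma smult_mult_right: "x \<in> carrier A \<Longrightarrow> y \<in> carrier A \<Longrightarrow> x \<otimes> (c \<odot> y) = c \<odot> (x \<otimes> y)"
  using ax3 by blast
lemma star_closed [simp, intro]: "x \<in> carrier A \<Longrightarrow> star A x \<in> carrier A"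
  using ax4 by blast
lemma star_star [simp]: "x \<in> carrier A \<Longrightarrow> star A (star A x) = x"
  using ax4 by blast
lemma star_add: "x \<in> carrier A \<Longrightarrow> y \<in> carrier A \<Longrightarrow> star A (x \<oplus> y) = star A x \<oplus> star A y"
  using ax5 by blast
lemma star_mult: "x \<in> carrier A \<Longrightarrow> y \<in> carrier A \<Longrightarrow> star A (x \<otimes> y) = star A y \<otimes> star A x"
  using ax5 by blast
lemma star_smult: "x \<in> carrier A \<Longrightarrow> star A (c \<odot> x) = cnj c \<odot> star A x"
  using ax6 by blast
lemma nrm_eq_0: "x \<in> carrier A \<Longrightarrow> nrm A x = 0 \<longleftrightarrow> x = \<zero>"
  using ax7 by blast
lemma nrm_mult: "x \<in> carrier A \<Longrightarrow> y \<in> carrier A \<Longrightarrow> nrm A (x \<otimes> y) \<le> nrm A x * nrm A y"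
  using ax8 by blast
lemma nrm_cstar: "x \<in> carrier A \<Longrightarrow> nrm A (star A x \<otimes> x) = (nrm A x)\<^sup>2"
  using ax10 by blast
lemma complete:
  assumes "\<And>n. s n \<in> carrier A"
    "\<And>\<epsilon>. \<epsilon> > 0 \<Longrightarrow> \<exists>N. \<forall>m\<ge>N. \<forall>n\<ge>N. nrm A (s m \<ominus> s n) < \<epsilon>"
  shows "\<exists>x\<in>carrier A. (\<lambda>n. nrm A (s n \<ominus> x)) \<longlonglongrightarrow> 0"
  using ax11 assms by blast

sublocale snorm A "nrm A"
  by unfold_locales (use ax8 ax9 in blast)+

lemma nrm_star [simp]:
  assumes x: "x \<in> carrier A" shows "nrm A (star A x) = nrm A x"
proof -
  have *: "nrm A y \<le> nrm A (star A y)" if y: "y \<in> carrier A" for y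
  proof (cases "nrm A y = 0")
    case False
    have "(nrm A y)\<^sup>2 \<le> nrm A (star A y) * nrm A y"
      using nrm_mult[of "star A y" y] nrm_cstar[of y] y by simp
    thus ?thesis using False N_nonneg[OF y] by (simp add: power2_eq_square mult_le_cancel_right)
  qed (use N_nonneg y in auto)
  show ?thesis using *[of x] *[of "star A x"] x by simp
qed

lemma star_zero [simp]: "star A \<zero> = \<zero>"
  using nrm_star[of \<zero>] nrm_eq_0[of "star A \<zero>"] by simp

lemma star_one [simp]: "star A \<one> = \<one>"
  using star_mult[of "\<one>" "star A \<one>"] by simp

lemma star_minus: "x \<in> carrier A \<Longrightarrow> y \<in> carrier A \<Longrightarrow> star A (x \<ominus> y) = star A x \<ominus> star A y"
  by (simp add: minus_eq_smult star_add star_smult)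

text \<open>The zero algebra satisfies the axioms, so the norm of the unit is 0 or 1 and only an
  inequality holds.\<close>

lemma nrm_one_le: "nrm A \<one> \<le> 1"
proof -
  have "nrm A \<one> * (nrm A \<one> - 1) = 0" using nrm_cstar[of \<one>] by (simp add: power2_eq_square algebra_simps)
  thus ?thesis by auto
qed

lemma saD: "h \<in> sa A \<Longrightarrow> h \<in> carrier A" "h \<in> sa A \<Longrightarrow> star A h = h"
  by (auto simp: sa_def)

lemma mult_minus_mult:
  assumes "x \<in> carrier A" "y \<in> carrier A" "x' \<in> carrier A" "y' \<in> carrier A"
  shows "x \<otimes> y \<ominus> x' \<otimes> y' = x \<otimes> (y \<ominus> y') \<oplus> (x \<ominus> x') \<otimes> y'"
  using assms by (simp add: a_minus_def r_distr l_distr r_minus l_minus a_assoc r_neg1)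

lemma nrm_mult_minus_mult:
  assumes "x \<in> carrier A" "y \<in> carrier A" "x' \<in> carrier A" "y' \<in> carrier A"
  shows "nrm A (x \<otimes> y \<ominus> x' \<otimes> y') \<le> nrm A x * nrm A (y \<ominus> y') + nrm A (x \<ominus> x') * nrm A y'"
proof -
  have "nrm A (x \<otimes> y \<ominus> x' \<otimes> y') \<le> nrm A (x \<otimes> (y \<ominus> y')) + nrm A ((x \<ominus> x') \<otimes> y')"
    using assms by (simp add: mult_minus_mult N_add)
  also have "\<dots> \<le> nrm A x * nrm A (y \<ominus> y') + nrm A (x \<ominus> x') * nrm A y'"
    using assms by (intro add_mono nrm_mult) auto
  finally show ?thesis .
qed

text \<open>The square root of \<open>1 - h\<close> is \<open>1 - s\<close> for the fixed point \<open>s\<close> of the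
  contraction \<open>s \<mapsto> (h + s\<^sup>2) / 2\<close>.\<close>

lemma sqrt_one_minus:
  assumes h: "h \<in> sa A" and n: "nrm A h < 1"
  shows "\<exists>z\<in>sa A. z \<otimes> z = \<one> \<ominus> h"
proof -
  define r where "r = nrm A h"
  \<comment> \<open>The scalar fixed point t = (r + t * t) / 2 < 1: the ball of radius t is
    invariant under the iteration, and t is also the Lipschitz constant of the iteration on that
    ball.\<close>
  define t where "t = 1 - sqrt (1 - r)"
  have hc: "h \<in> carrier A" "star A h = h" using saD[OF h] by auto
  have r: "0 \<le> r" "r < 1" using N_nonneg[OF hc(1)] n by (auto simp: r_def)
  have t: "0 \<le> t" "t < 1" using r by (auto simp: t_def)
  have tr: "(r + t * t) / 2 = t" using r by (simp add: t_def field_simps)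
  define s where "s = rec_nat \<zero> (\<lambda>_ x. (1/2) \<odot> (h \<oplus> x \<otimes> x))"
  have s0: "s 0 = \<zero>" and sS: "s (Suc n) = (1/2) \<odot> (h \<oplus> s n \<otimes> s n)" for n
    by (simp_all add: s_def)
  have sc [simp]: "s n \<in> carrier A" for n by (induction n) (simp_all add: s0 sS hc)
  have ss: "star A (s n) = s n" for n
    by (induction n) (simp_all add: s0 sS hc star_smult star_add star_mult)
  have sn: "nrm A (s n) \<le> t" for n
  proof (induction n)
    case (Suc n)
    have "nrm A (s (Suc n)) \<le> (1/2) * (r + nrm A (s n \<otimes> s n))"
      using N_add[of h "s n \<otimes> s n"] hc by (simp add: sS N_smult r_def)
    also have "nrm A (s n \<otimes> s n) \<le> t * t"
      using nrm_mult[of "s n" "s n"] mult_mono[OF Suc Suc] t N_nonneg[of "s n"] by simp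
    finally show ?case using tr by simp
  qed (simp add: s0 t)
  have lip: "nrm A (((1/2) \<odot> (h \<oplus> x \<otimes> x)) \<ominus> ((1/2) \<odot> (h \<oplus> y \<otimes> y))) \<le> t * nrm A (x \<ominus> y)"
    if x: "x \<in> carrier A" "nrm A x \<le> t" and y: "y \<in> carrier A" "nrm A y \<le> t" for x y
  proof -
    have "nrm A (((1/2) \<odot> (h \<oplus> x \<otimes> x)) \<ominus> ((1/2) \<odot> (h \<oplus> y \<otimes> y)))
        = (1/2) * nrm A (x \<otimes> x \<ominus> y \<otimes> y)"
      using x y hc by (simp add: smult_minus[symmetric] N_smult add_minus_add)
    also have "nrm A (x \<otimes> x \<ominus> y \<otimes> y) \<le> nrm A x * nrm A (x \<ominus> y) + nrm A (x \<ominus> y) * nrm A y"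
      using x y by (intro nrm_mult_minus_mult)
    also have "\<dots> \<le> t * nrm A (x \<ominus> y) + nrm A (x \<ominus> y) * t"
      using x y by (intro add_mono mult_right_mono mult_left_mono N_nonneg) auto
    finally show ?thesis by simp
  qed
  have d: "nrm A (s (Suc n) \<ominus> s n) \<le> t ^ n" for n
  proof (induction n)
    case 0 show ?case using sn[of "Suc 0"] t by (simp add: s0)
  next
    case (Suc n)
    have "nrm A (s (Suc (Suc n)) \<ominus> s (Suc n)) \<le> t * nrm A (s (Suc n) \<ominus> s n)"
      using lip[of "s (Suc n)" "s n"] sn by (simp add: sS[symmetric])
    thus ?case using Suc t mult_left_mono[OF Suc, of t] by simp
  qed
  have summ: "summable (\<lambda>n. t ^ n)" using t by (intro summable_geometric) auto
  obtain x where x: "x \<in> carrier A" and lim: "(\<lambda>n. nrm A (s n \<ominus> x)) \<longlonglongrightarrow> 0"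
    using complete[of s] Cauchy_if_summable[of s "\<lambda>n. t ^ n", OF sc d summ] sc by blast
  have xn: "nrm A x \<le> t"
  proof -
    have "(\<lambda>n. t + nrm A (s n \<ominus> x)) \<longlonglongrightarrow> t + 0" by (intro tendsto_intros lim)
    moreover have "nrm A x \<le> t + nrm A (s n \<ominus> x)" for n
      using N_le_minus[of x "s n"] x sn[of n] N_minus_commute[of x "s n"] by simp
    ultimately show ?thesis by (intro LIMSEQ_le_const) auto
  qed
  have "x = (1/2) \<odot> (h \<oplus> x \<otimes> x)"
  proof -
    let ?y = "(1/2) \<odot> (h \<oplus> x \<otimes> x)"
    have y: "?y \<in> carrier A" using x hc by simp
    have "(\<lambda>n. t * nrm A (s n \<ominus> x)) \<longlonglongrightarrow> t * 0" by (intro tendsto_intros lim)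
    moreover have "nrm A (s (Suc n) \<ominus> ?y) \<le> t * nrm A (s n \<ominus> x)" for n
      unfolding sS using sn x xn by (intro lip) auto
    ultimately have "(\<lambda>n. nrm A (s (Suc n) \<ominus> ?y)) \<longlonglongrightarrow> 0"
      using y by (intro tendsto_sandwich[of "\<lambda>_. 0" "\<lambda>n. nrm A (s (Suc n) \<ominus> ?y)" _ "\<lambda>n. t * nrm A (s n \<ominus> x)"])
        (auto intro!: N_nonneg always_eventually)
    hence "nrm A (x \<ominus> ?y) = 0"
      using LIMSEQ_Suc[OF lim] x y by (intro lim_unique[of "\<lambda>n. s (Suc n)"]) auto
    thus ?thesis using nrm_eq_0[of "x \<ominus> ?y"] x y by simp
  qed
  hence "2 \<odot> x = 2 \<odot> ((1/2) \<odot> (h \<oplus> x \<otimes> x))" by (rule arg_cong)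
  hence xx: "x \<oplus> x = h \<oplus> x \<otimes> x"
    using x hc smult_add_left[of x 1 1] by (simp add: smult_smult)
  have xs: "star A x = x"
  proof -
    have "nrm A (s n \<ominus> star A x) = nrm A (s n \<ominus> x)" for n
      using nrm_star[of "s n \<ominus> x"] x by (simp add: star_minus ss)
    hence "nrm A (star A x \<ominus> x) = 0"
      using lim x by (intro lim_unique[of s]) auto
    thus ?thesis using nrm_eq_0[of "star A x \<ominus> x"] x by simp
  qed
  show ?thesis
  proof (rule bexI[of _ "\<one> \<ominus> x"])
    have "(\<one> \<ominus> x) \<otimes> (\<one> \<ominus> x) = \<one> \<ominus> (x \<oplus> x) \<oplus> x \<otimes> x"
      using x by (simp add: a_minus_def r_distr l_distr r_minus l_minus minus_add a_ac)
    also have "\<dots> = \<one> \<ominus> h"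
      unfolding xx using x hc by (simp add: a_minus_def minus_add a_assoc l_neg)
    finally show "(\<one> \<ominus> x) \<otimes> (\<one> \<ominus> x) = \<one> \<ominus> h" .
    show "\<one> \<ominus> x \<in> sa A" using x xs by (simp add: sa_def star_minus)
  qed
qed

end

section \<open>States\<close>

locale cstate = cstar +
  fixes \<phi> :: "'a \<Rightarrow> complex"
  assumes state: "\<phi> \<in> states A"
begin

lemma st_add: "x \<in> carrier A \<Longrightarrow> y \<in> carrier A \<Longrightarrow> \<phi> (x \<oplus> y) = \<phi> x + \<phi> y"
  and st_smult: "x \<in> carrier A \<Longrightarrow> \<phi> (c \<odot> x) = c * \<phi> x"
  and st_one [simp]: "\<phi> \<one> = 1"
  and st_pos: "x \<in> carrier A \<Longrightarrow> Im (\<phi> (star A x \<otimes> x)) = 0" "x \<in> carrier A \<Longrightarrow> 0 \<le> Re (\<phi> (star A x \<otimes> x))"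
  using state by (auto simp: states_def complex_nonneg_Reals_iff)

text \<open>Positivity at x + c 1 makes the mixed terms real for every c; c = 1 compares the
  imaginary parts and c = \<open>\<i>\<close> the real parts.\<close>

lemma st_star:
  assumes x: "x \<in> carrier A" shows "\<phi> (star A x) = cnj (\<phi> x)"
proof -
  have "Im (cnj c * \<phi> x + c * \<phi> (star A x)) = 0" for c
  proof -
    let ?y = "x \<oplus> c \<odot> \<one>"
    have "star A ?y \<otimes> ?y = star A x \<otimes> x \<oplus> (cnj c \<odot> x \<oplus> (c \<odot> star A x \<oplus> (cnj c * c) \<odot> \<one>))"
      using x by (simp add: star_add star_smult l_distr r_distr smult_mult_left smult_mult_right smult_smult smult_add_right a_ac mult.commute)
    hence "\<phi> (star A ?y \<otimes> ?y) = \<phi> (star A x \<otimes> x) + (cnj c * \<phi> x + c * \<phi> (star A x)) + cnj c * c"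
      using x by (simp add: st_add st_smult)
    thus ?thesis using st_pos(1)[of ?y] st_pos(1)[OF x] x by simp
  qed
  from this[of 1] this[of \<i>] show ?thesis by (simp add: complex_eq_iff)
qed

sublocale sesq A "\<lambda>x y. \<phi> (star A y \<otimes> x)" "tau_norm A \<phi>"
proof unfold_locales
  fix x y assume "x \<in> carrier A" "y \<in> carrier A"
  thus "\<phi> (star A y \<otimes> x) = cnj (\<phi> (star A x \<otimes> y))"
    using st_star[of "star A x \<otimes> y"] by (simp add: star_mult)
qed (auto simp: st_add st_smult r_distr smult_mult_right st_pos tau_norm_def)

text \<open>For every M above the norm of k, the element 1 - k/M is the square of a self-adjoint
  element by \<open>sqrt_one_minus\<close>, so the state is nonnegative on it. Applying this to h
  and to -h gives the bound.\<close>

lemma st_bound_sa: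
  assumes h: "h \<in> sa A" shows "\<bar>Re (\<phi> h)\<bar> \<le> nrm A h" "Im (\<phi> h) = 0"
proof -
  show "Im (\<phi> h) = 0" using st_star[of h] saD[OF h] by (simp add: complex_eq_iff)
  have *: "Re (\<phi> k) \<le> nrm A k" if k: "k \<in> sa A" for k
  proof (rule dense_ge)
    fix M assume M: "nrm A k < M"
    have kc: "k \<in> carrier A" "star A k = k" using saD[OF k] by auto
    have M0: "M > 0" using M N_nonneg[OF kc(1)] by linarith
    let ?h = "complex_of_real (1/M) \<odot> k"
    have "?h \<in> sa A" "nrm A ?h < 1" using kc M M0 by (auto simp: sa_def star_smult N_smult norm_divide)
    then obtain z where z: "z \<in> sa A" "z \<otimes> z = \<one> \<ominus> ?h" using sqrt_one_minus by blast
    have "0 \<le> Re (\<phi> (\<one> \<ominus> ?h))" using st_pos(2)[of z] z saD[OF z(1)] by simp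
    thus "Re (\<phi> k) \<le> M" using kc M0 by (simp add: minus_eq_smult st_add st_smult field_simps)
  qed
  have "\<ominus> h \<in> sa A" using saD[OF h] by (simp add: sa_def uminus_eq_smult star_smult)
  from *[OF this] *[OF h] show "\<bar>Re (\<phi> h)\<bar> \<le> nrm A h"
    using saD[OF h] N_uminus[of h] by (simp add: uminus_eq_smult st_smult)
qed

text \<open>A phase u makes the value at u x real and nonnegative, so it is also the value at the
  self-adjoint part of u x, where the previous bound applies.\<close>

lemma st_bound:
  assumes x: "x \<in> carrier A" shows "cmod (\<phi> x) \<le> nrm A x"
proof -
  obtain u where u: "cmod u = 1" "u * \<phi> x = complex_of_real (cmod (\<phi> x))"
  proof (cases "\<phi> x = 0")
    case True thus ?thesis using that[of 1] by simp
  next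
    case False
    have "cnj (\<phi> x) / complex_of_real (cmod (\<phi> x)) * \<phi> x = complex_of_real (cmod (\<phi> x))"
      using False by (simp add: field_simps complex_norm_square[symmetric] power2_eq_square)
    thus ?thesis using that[of "cnj (\<phi> x) / complex_of_real (cmod (\<phi> x))"] False by (simp add: norm_divide)
  qed
  let ?h = "(1/2) \<odot> (u \<odot> x \<oplus> star A (u \<odot> x))"
  have h: "?h \<in> sa A" using x by (simp add: sa_def star_smult star_add a_comm)
  have "\<phi> ?h = complex_of_real (cmod (\<phi> x))"
    using x u by (simp add: st_smult st_add st_star[of "u \<odot> x"])
  hence "cmod (\<phi> x) \<le> nrm A ?h" using st_bound_sa(1)[OF h] by simp
  also have "\<dots> \<le> nrm A x"
    using x u N_add[of "u \<odot> x" "star A (u \<odot> x)"] nrm_star[of "u \<odot> x"] by (simp add: N_smult)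
  finally show ?thesis .
qed

lemma st_minus: "x \<in> carrier A \<Longrightarrow> y \<in> carrier A \<Longrightarrow> \<phi> (x \<ominus> y) = \<phi> x - \<phi> y"
  by (simp add: minus_eq_smult st_add st_smult)

text \<open>For M above the norm of a, the element 1 - r a* a with r = 1/M^2 is a square z z.
  Nonnegativity of the state on the square of z x then reads r |a x|^2 \<le> |x|^2 in the trace
  norm.\<close>

lemma tn_mult:
  assumes a: "a \<in> carrier A" and x: "x \<in> carrier A"
  shows "tau_norm A \<phi> (a \<otimes> x) \<le> nrm A a * tau_norm A \<phi> x"
proof -
  have *: "tau_norm A \<phi> (a \<otimes> x) \<le> M * tau_norm A \<phi> x" if M: "nrm A a < M" for M
  proof -
    have M0: "M > 0" using M N_nonneg[OF a] by linarith
    define r where "r = 1 / M\<^sup>2"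
    have r: "r > 0" using M0 by (simp add: r_def)
    let ?h = "complex_of_real r \<odot> (star A a \<otimes> a)"
    have "(nrm A a)\<^sup>2 < M\<^sup>2" using M N_nonneg[OF a] by (intro power_strict_mono) auto
    hence "?h \<in> sa A" "nrm A ?h < 1"
      using a M0 r by (auto simp: sa_def star_smult star_mult N_smult nrm_cstar r_def norm_power norm_divide)
    then obtain z where z: "z \<in> sa A" "z \<otimes> z = \<one> \<ominus> ?h" using sqrt_one_minus by blast
    have zc: "z \<in> carrier A" "star A z = z" using saD[OF z(1)] by auto
    have "star A (z \<otimes> x) \<otimes> (z \<otimes> x) = star A x \<otimes> ((z \<otimes> z) \<otimes> x)"
      using zc x by (simp add: star_mult m_assoc)
    also have "\<dots> = star A x \<otimes> x \<ominus> complex_of_real r \<odot> (star A (a \<otimes> x) \<otimes> (a \<otimes> x))"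
      unfolding z(2) using a x
      by (simp add: minus_eq_smult l_distr r_distr smult_mult_left smult_mult_right smult_smult star_mult m_assoc)
    finally have "0 \<le> Re (\<phi> (star A x \<otimes> x) - complex_of_real r * \<phi> (star A (a \<otimes> x) \<otimes> (a \<otimes> x)))"
      using st_pos(2)[of "z \<otimes> x"] zc x a by (simp add: st_minus st_smult)
    hence "r * (tau_norm A \<phi> (a \<otimes> x))\<^sup>2 \<le> (tau_norm A \<phi> x)\<^sup>2"
      using a x by (simp add: tn_sq)
    hence "(tau_norm A \<phi> (a \<otimes> x))\<^sup>2 \<le> (M * tau_norm A \<phi> x)\<^sup>2"
      using M0 by (simp add: power_mult_distrib r_def field_simps)
    thus ?thesis by (rule power2_le_imp_le) (use M0 x in auto)
  qed
  show ?thesis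
  proof (cases "tau_norm A \<phi> x = 0")
    case True thus ?thesis using *[of "nrm A a + 1"] by simp
  next
    case False
    hence p: "tau_norm A \<phi> x > 0" using tn_nonneg[OF x] by simp
    have "tau_norm A \<phi> (a \<otimes> x) / tau_norm A \<phi> x \<le> nrm A a"
    proof (rule dense_ge)
      fix M assume "nrm A a < M"
      thus "tau_norm A \<phi> (a \<otimes> x) / tau_norm A \<phi> x \<le> M"
        using *[of M] p by (simp add: pos_divide_le_eq)
    qed
    thus ?thesis using p by (simp add: pos_divide_le_eq)
  qed
qed

lemma tn_one [simp]: "tau_norm A \<phi> \<one> = 1"
  by (simp add: tau_norm_def)

lemma tn_le_nrm: "x \<in> carrier A \<Longrightarrow> tau_norm A \<phi> x \<le> nrm A x"
  using tn_mult[of x \<one>] by simp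

lemma s_mult_left:
  "\<lbrakk>a \<in> carrier A; x \<in> carrier A; y \<in> carrier A\<rbrakk> \<Longrightarrow>
    \<phi> (star A y \<otimes> (a \<otimes> x)) = \<phi> (star A (star A a \<otimes> y) \<otimes> x)"
  by (simp add: star_mult m_assoc)

text \<open>The left regular representation is isometric: compare \<open>(b\<^sup>*b)\<^sup>2\<^sup>^\<^sup>k\<close> in both norms.\<close>

lemma nrm_le_if_tn_le:
  assumes F: "F \<subseteq> carrier A" "\<one> \<in> F" "\<And>x y. x \<in> F \<Longrightarrow> y \<in> F \<Longrightarrow> x \<otimes> y \<in> F"
      "\<And>x. x \<in> F \<Longrightarrow> star A x \<in> F"
    and c: "\<And>x. x \<in> F \<Longrightarrow> nrm A x \<le> c * tau_norm A \<phi> x"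
    and b: "b \<in> F" and C: "0 \<le> C" and le: "\<And>x. x \<in> F \<Longrightarrow> tau_norm A \<phi> (b \<otimes> x) \<le> C * tau_norm A \<phi> x"
  shows "nrm A b \<le> C"
proof -
  have Fc [simp]: "x \<in> F \<Longrightarrow> x \<in> carrier A" for x using F by blast
  have bs: "star A b \<in> F" using F b by blast
  \<comment> \<open>By duality the adjoint obeys the same bound on F, so that the product of the
    adjoint with b is bounded by C^2.\<close>
  have le': "tau_norm A \<phi> (star A b \<otimes> x) \<le> C * tau_norm A \<phi> x" if x: "x \<in> F" for x
  proof (rule tn_le_if_s_le)
    let ?y = "star A b \<otimes> x"
    have y: "?y \<in> F" using F bs x by blast
    have "cmod (\<phi> (star A ?y \<otimes> ?y)) = cmod (\<phi> (star A (b \<otimes> ?y) \<otimes> x))"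
      using s_mult_left[of "star A b" x ?y] b x y by simp
    also have "\<dots> \<le> tau_norm A \<phi> x * tau_norm A \<phi> (b \<otimes> ?y)"
      using b x y by (intro Cauchy_Schwarz) auto
    also have "\<dots> \<le> tau_norm A \<phi> x * (C * tau_norm A \<phi> ?y)"
      using x y by (intro mult_left_mono le) auto
    finally show "cmod (\<phi> (star A ?y \<otimes> ?y)) \<le> C * tau_norm A \<phi> x * tau_norm A \<phi> ?y"
      by (simp add: ac_simps)
  qed (use b x C in auto)
  define p where "p = rec_nat (star A b \<otimes> b) (\<lambda>_ x. x \<otimes> x)"
  have p0: "p 0 = star A b \<otimes> b" and pS: "p (Suc k) = p k \<otimes> p k" for k by (simp_all add: p_def)
  have pF: "p k \<in> F" for k by (induction k) (use F b bs in \<open>simp_all add: p0 pS\<close>)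
  have ps: "star A (p k) = p k" for k
    by (induction k) (use b pF in \<open>simp_all add: p0 pS star_mult\<close>)
  have pn: "nrm A (p k) = ((nrm A b)\<^sup>2) ^ (2 ^ k)" for k
  proof (induction k)
    case (Suc k)
    have "nrm A (p (Suc k)) = (nrm A (p k))\<^sup>2"
      using nrm_cstar[of "p k"] pF[of k] by (simp add: ps pS)
    thus ?case using Suc by (simp add: power_mult[symmetric] mult.commute)
  qed (use b in \<open>simp add: p0 nrm_cstar\<close>)
  have pt: "tau_norm A \<phi> (p k \<otimes> x) \<le> (C\<^sup>2) ^ (2 ^ k) * tau_norm A \<phi> x" if "x \<in> F" for k x
    using that
  proof (induction k arbitrary: x)
    case 0
    have "tau_norm A \<phi> (p 0 \<otimes> x) \<le> C * tau_norm A \<phi> (b \<otimes> x)"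
      using le'[of "b \<otimes> x"] F b bs 0 by (simp add: p0 m_assoc)
    also have "\<dots> \<le> C * (C * tau_norm A \<phi> x)" using C 0 by (intro mult_left_mono le)
    finally show ?case by (simp add: power2_eq_square ac_simps)
  next
    case (Suc k)
    have "tau_norm A \<phi> (p (Suc k) \<otimes> x) \<le> (C\<^sup>2) ^ (2 ^ k) * tau_norm A \<phi> (p k \<otimes> x)"
      using Suc.IH[of "p k \<otimes> x"] pF[of k] F Suc.prems by (simp add: pS m_assoc)
    also have "\<dots> \<le> (C\<^sup>2) ^ (2 ^ k) * ((C\<^sup>2) ^ (2 ^ k) * tau_norm A \<phi> x)"
      using Suc C by (intro mult_left_mono Suc.IH) auto
    also have "\<dots> = (C\<^sup>2) ^ (2 ^ Suc k) * tau_norm A \<phi> x"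
      by (simp add: power_add[symmetric] mult_2 algebra_simps)
    finally show ?case .
  qed
  have c0: "0 \<le> c"
  proof (rule ccontr)
    assume "\<not> 0 \<le> c"
    thus False using c[OF F(2)] N_nonneg[of \<one>] by simp
  qed
  \<comment> \<open>The powers are tested on the unit only. The comparison constant c enters as a
    fixed factor, which disappears when roots are taken.\<close>
  have "((nrm A b)\<^sup>2) ^ (2 ^ k) \<le> c * (C\<^sup>2) ^ (2 ^ k)" for k
  proof -
    have "((nrm A b)\<^sup>2) ^ (2 ^ k) \<le> c * tau_norm A \<phi> (p k)" using c[OF pF[of k]] by (simp add: pn)
    also have "\<dots> \<le> c * ((C\<^sup>2) ^ (2 ^ k))"
      using pt[OF F(2), of k] pF[of k] c0 by (intro mult_left_mono) auto
    finally show ?thesis .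
  qed
  hence "(nrm A b)\<^sup>2 \<le> C\<^sup>2" by (rule le_if_pow2_le) auto
  thus ?thesis using C by (rule power2_le_imp_le)
qed

end

text \<open>On both sides the C*-norm is the norm of left multiplication for the trace inner product
  (\<open>nrm_le_if_tn_le\<close>). A trace-preserving morphism is isometric for the trace norms,
  hence intertwines these operator norms; in B the test vectors are taken in the image of f.\<close>

lemma trace_preserving_isometric:
  assumes A: "cstate A \<phi>" and B: "cstate B \<psi>" and f: "f \<in> carrier A \<rightarrow> carrier B"
    and mult: "\<And>x y. x \<in> carrier A \<Longrightarrow> y \<in> carrier A \<Longrightarrow> f (x \<otimes>\<^bsub>A\<^esub> y) = f x \<otimes>\<^bsub>B\<^esub> f y"
    and star: "\<And>x. x \<in> carrier A \<Longrightarrow> f (star A x) = star B (f x)"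
    and one: "f \<one>\<^bsub>A\<^esub> = \<one>\<^bsub>B\<^esub>"
    and tr: "\<And>x. x \<in> carrier A \<Longrightarrow> \<psi> (f x) = \<phi> x"
    and cA: "\<And>x. x \<in> carrier A \<Longrightarrow> nrm A x \<le> c * tau_norm A \<phi> x"
    and cB: "\<And>x. x \<in> carrier B \<Longrightarrow> nrm B x \<le> d * tau_norm B \<psi> x"
    and x: "x \<in> carrier A"
  shows "nrm B (f x) = nrm A x"
proof (rule antisym)
  interpret A: cstate A \<phi> by fact
  interpret B: cstate B \<psi> by fact
  have fc [simp]: "y \<in> carrier A \<Longrightarrow> f y \<in> carrier B" for y using f by blast
  have t: "tau_norm B \<psi> (f y) = tau_norm A \<phi> y" if "y \<in> carrier A" for y
    using that by (simp add: tau_norm_def star[symmetric] mult[symmetric] tr)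
  show "nrm B (f x) \<le> nrm A x"
  proof (rule B.nrm_le_if_tn_le[where F = "f ` carrier A" and c = d])
    fix y assume "y \<in> f ` carrier A"
    thus "tau_norm B \<psi> (f x \<otimes>\<^bsub>B\<^esub> y) \<le> nrm A x * tau_norm B \<psi> y"
      using x A.tn_mult[OF x] by (auto simp: mult[symmetric] t)
  next
    show "\<one>\<^bsub>B\<^esub> \<in> f ` carrier A" using one[symmetric] by auto
  qed (use x cB A.N_nonneg in \<open>auto simp: mult[symmetric] star[symmetric]\<close>)
  show "nrm A x \<le> nrm B (f x)"
  proof (rule A.nrm_le_if_tn_le[where F = "carrier A" and c = c])
    fix y assume y: "y \<in> carrier A"
    show "tau_norm A \<phi> (x \<otimes>\<^bsub>A\<^esub> y) \<le> nrm B (f x) * tau_norm A \<phi> y"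
      using B.tn_mult[of "f x" "f y"] x y by (simp add: t[symmetric] mult)
  qed (use x cA B.N_nonneg in auto)
qed

section \<open>Completions by classes of sequences\<close>

lemma null_le:
  fixes f g :: "nat \<Rightarrow> real"
  assumes "\<And>n. 0 \<le> f n" "\<And>n. f n \<le> g n" "g \<longlonglongrightarrow> 0"
  shows "f \<longlonglongrightarrow> 0"
  by (rule tendsto_sandwich[OF _ _ tendsto_const assms(3)]) (use assms in auto)

lemma null_if_small:
  fixes f :: "nat \<Rightarrow> real"
  assumes "\<And>n. 0 \<le> f n" "\<And>\<epsilon>. \<epsilon> > 0 \<Longrightarrow> \<exists>M. \<forall>n\<ge>M. f n \<le> \<epsilon>"
  shows "f \<longlonglongrightarrow> 0"
proof (rule LIMSEQ_I)
  fix e :: real assume "e > 0"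
  then obtain M where "\<forall>n\<ge>M. f n \<le> e / 2" using assms(2)[of "e / 2"] by auto
  hence "norm (f n - 0) < e" if "n \<ge> M" for n
    using assms(1)[of n] \<open>e > 0\<close> that by fastforce
  thus "\<exists>no. \<forall>n\<ge>no. norm (f n - 0) < e" by blast
qed

lemma connect_connect: "connect \<alpha> (n + k) l (connect \<alpha> n k x) = connect \<alpha> n (k + l) x"
  by (induction l) (simp_all add: add.assoc)

text \<open>One construction serves both completions: for the inductive limit the spaces are the
  stages with their connecting maps, for the GNS space they are all equal to A with the identity as
  connecting map.\<close>

locale vsys =
  fixes V :: "nat \<Rightarrow> (complex, 'a, 'm) module_scheme" and N :: "nat \<Rightarrow> 'a \<Rightarrow> real"
    and \<alpha> :: "nat \<Rightarrow> 'a \<Rightarrow> 'a"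
  assumes snorms: "snorm (V n) (N n)"
    and \<alpha>_closed [simp]: "x \<in> carrier (V n) \<Longrightarrow> \<alpha> n x \<in> carrier (V (Suc n))"
    and \<alpha>_add: "\<lbrakk>x \<in> carrier (V n); y \<in> carrier (V n)\<rbrakk> \<Longrightarrow> \<alpha> n (x \<oplus>\<^bsub>V n\<^esub> y) = \<alpha> n x \<oplus>\<^bsub>V (Suc n)\<^esub> \<alpha> n y"
    and \<alpha>_smult: "x \<in> carrier (V n) \<Longrightarrow> \<alpha> n (c \<odot>\<^bsub>V n\<^esub> x) = c \<odot>\<^bsub>V (Suc n)\<^esub> \<alpha> n x"
    and \<alpha>_N: "x \<in> carrier (V n) \<Longrightarrow> N (Suc n) (\<alpha> n x) = N n x"
begin

sublocale V: snorm "V n" "N n" for n by (rule snorms)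

lemma con_closed [simp]: "x \<in> carrier (V n) \<Longrightarrow> connect \<alpha> n k x \<in> carrier (V (n + k))"
  by (induction k) auto

lemma con_add: "\<lbrakk>x \<in> carrier (V n); y \<in> carrier (V n)\<rbrakk> \<Longrightarrow>
    connect \<alpha> n k (x \<oplus>\<^bsub>V n\<^esub> y) = connect \<alpha> n k x \<oplus>\<^bsub>V (n + k)\<^esub> connect \<alpha> n k y"
  by (induction k) (auto simp: \<alpha>_add)

lemma con_smult: "x \<in> carrier (V n) \<Longrightarrow>
    connect \<alpha> n k (c \<odot>\<^bsub>V n\<^esub> x) = c \<odot>\<^bsub>V (n + k)\<^esub> connect \<alpha> n k x"
  by (induction k) (auto simp: \<alpha>_smult)

lemma con_N: "x \<in> carrier (V n) \<Longrightarrow> N (n + k) (connect \<alpha> n k x) = N n x"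
  by (induction k) (auto simp: \<alpha>_N)

lemma con_zero [simp]: "connect \<alpha> n k \<zero>\<^bsub>V n\<^esub> = \<zero>\<^bsub>V (n + k)\<^esub>"
  using con_smult[of "\<zero>\<^bsub>V n\<^esub>" n k 0] by simp

text \<open>The distance, in the algebraic direct limit, between the entries of x at n and n +
  k.\<close>

definition dev :: "(nat \<Rightarrow> 'a) \<Rightarrow> nat \<Rightarrow> nat \<Rightarrow> real" where
  "dev x n k = N (n + k) (x (n + k) \<ominus>\<^bsub>V (n + k)\<^esub> connect \<alpha> n k (x n))"

definition S :: "(nat \<Rightarrow> 'a) set" where
  "S = {x. (\<forall>n. x n \<in> carrier (V n)) \<and> (\<forall>\<epsilon>>0. \<exists>M. \<forall>n\<ge>M. \<forall>k. dev x n k < \<epsilon>)}"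

definition r :: "((nat \<Rightarrow> 'a) \<times> (nat \<Rightarrow> 'a)) set" where
  "r = null_rel (\<lambda>n x y. N n (x \<ominus>\<^bsub>V n\<^esub> y)) S"

definition cls :: "(nat \<Rightarrow> 'a) \<Rightarrow> (nat \<Rightarrow> 'a) set" where
  "cls x = r `` {x}"

lemma S_carrier [simp]: "x \<in> S \<Longrightarrow> x n \<in> carrier (V n)"
  by (simp add: S_def)

lemma S_small: "x \<in> S \<Longrightarrow> \<epsilon> > 0 \<Longrightarrow> \<exists>M. \<forall>n\<ge>M. \<forall>k. dev x n k < \<epsilon>"
  unfolding S_def by blast

text \<open>All closure properties of the set of Cauchy sequences reduce to a linear bound on
  \<open>dev\<close>.\<close>

lemma S_le:
  assumes z: "\<And>n. z n \<in> carrier (V n)" and x: "x \<in> S" and y: "y \<in> S" and C: "0 \<le> C" "0 \<le> D"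
    and le: "\<And>n k. dev z n k \<le> C * dev x n k + D * dev y n k"
  shows "z \<in> S"
  unfolding S_def
proof (intro CollectI conjI allI impI z)
  fix e :: real assume e: "e > 0"
  obtain M where M: "\<And>n k. n \<ge> M \<Longrightarrow> dev x n k < e / (2 * (C + 1))"
    using S_small[OF x, of "e / (2 * (C + 1))"] e C by auto
  obtain M' where M': "\<And>n k. n \<ge> M' \<Longrightarrow> dev y n k < e / (2 * (D + 1))"
    using S_small[OF y, of "e / (2 * (D + 1))"] e C by auto
  have "dev z n k < e" if n: "n \<ge> max M M'" for n k
  proof -
    have "C * dev x n k + D * dev y n k \<le> C * (e / (2 * (C + 1))) + D * (e / (2 * (D + 1)))"
      using M[of n k] M'[of n k] n C by (intro add_mono mult_left_mono) auto
    also have "\<dots> < e / 2 + e / 2"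
      using C e by (intro add_strict_mono) (simp_all add: divide_simps)
    finally show ?thesis using le[of n k] by simp
  qed
  thus "\<exists>M. \<forall>n\<ge>M. \<forall>k. dev z n k < e" by blast
qed

lemma S_add [simp]: "x \<in> S \<Longrightarrow> y \<in> S \<Longrightarrow> (\<lambda>n. x n \<oplus>\<^bsub>V n\<^esub> y n) \<in> S"
  by (rule S_le[of _ x y 1 1])
    (auto simp: dev_def con_add V.add_minus_add intro!: V.N_add)

lemma S_smult [simp]: "x \<in> S \<Longrightarrow> (\<lambda>n. c \<odot>\<^bsub>V n\<^esub> x n) \<in> S"
  by (rule S_le[of _ x x "cmod c" 0])
    (auto simp: dev_def con_smult V.smult_minus[symmetric] V.N_smult)

lemma S_zero [simp]: "(\<lambda>n. \<zero>\<^bsub>V n\<^esub>) \<in> S"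
proof -
  have "dev (\<lambda>n. \<zero>\<^bsub>V n\<^esub>) n k = 0" for n k by (simp add: dev_def)
  thus ?thesis unfolding S_def by simp
qed

lemma S_minus [simp]: "x \<in> S \<Longrightarrow> y \<in> S \<Longrightarrow> (\<lambda>n. x n \<ominus>\<^bsub>V n\<^esub> y n) \<in> S"
  using S_add[OF _ S_smult[of y "-1"], of x] by (simp add: V.minus_eq_smult)

lemma N_diff_le_dev: "x \<in> S \<Longrightarrow> \<bar>N (n + k) (x (n + k)) - N n (x n)\<bar> \<le> dev x n k"
  using V.N_diff[of "x (n + k)" "n + k" "connect \<alpha> n k (x n)"] by (simp add: dev_def con_N)

lemma N_convergent: "x \<in> S \<Longrightarrow> convergent (\<lambda>n. N n (x n))"
  unfolding Cauchy_convergent_iff[symmetric]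
proof (rule CauchyI)
  fix e :: real assume x: "x \<in> S" and e: "e > 0"
  obtain M where M: "\<And>k. dev x M k < e / 2" using S_small[OF x, of "e / 2"] e by auto
  have *: "\<bar>N m (x m) - N M (x M)\<bar> < e / 2" if "m \<ge> M" for m
    using N_diff_le_dev[OF x, of M "m - M"] M[of "m - M"] that by simp
  have "norm (N m (x m) - N n (x n)) < e" if "m \<ge> M" "n \<ge> M" for m n
    using *[OF that(1)] *[OF that(2)] by (simp add: abs_if split: if_splits)
  thus "\<exists>M. \<forall>m\<ge>M. \<forall>n\<ge>M. norm (N m (x m) - N n (x n)) < e" by blast
qed

definition nn :: "(nat \<Rightarrow> 'a) \<Rightarrow> real" where "nn x = lim (\<lambda>n. N n (x n))"

lemma nn_lim: "x \<in> S \<Longrightarrow> (\<lambda>n. N n (x n)) \<longlonglongrightarrow> nn x"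
  unfolding nn_def using N_convergent convergent_LIMSEQ_iff by blast

lemma nn_le: "x \<in> S \<Longrightarrow> (\<And>n. n \<ge> M \<Longrightarrow> N n (x n) \<le> C) \<Longrightarrow> nn x \<le> C"
  by (rule LIMSEQ_le_const2[OF nn_lim]) auto

lemma nn_ge: "x \<in> S \<Longrightarrow> (\<And>n. n \<ge> M \<Longrightarrow> C \<le> N n (x n)) \<Longrightarrow> C \<le> nn x"
  by (rule LIMSEQ_le_const[OF nn_lim]) auto

lemma nn_nonneg: "x \<in> S \<Longrightarrow> 0 \<le> nn x"
  by (rule nn_ge[of _ 0]) (auto intro: V.N_nonneg)

lemma S_bounded:
  assumes "x \<in> S" obtains B where "B \<ge> 0" "\<And>n. N n (x n) \<le> B"
proof -
  have "Bseq (\<lambda>n. N n (x n))" using assms N_convergent convergent_imp_Bseq by blast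
  then obtain K where "K > 0" "\<And>n. norm (N n (x n)) \<le> K" by (auto simp: Bseq_def)
  thus ?thesis using that[of K] by (auto simp: abs_le_iff)
qed

lemma equiv_r: "equiv S r"
proof (rule equivI)
  show "r \<subseteq> S \<times> S" by (auto simp: r_def null_rel_def)
  show "refl_on S r" by (auto simp: refl_on_def r_def null_rel_def)
  show "sym r"
  proof (rule symI)
    fix x y assume "(x, y) \<in> r"
    thus "(y, x) \<in> r" using V.N_minus_commute[of "x _" _ "y _"] by (auto simp: r_def null_rel_def)
  qed
  show "trans r"
  proof (rule transI)
    fix x y z assume xy: "(x, y) \<in> r" and yz: "(y, z) \<in> r"
    hence S: "x \<in> S" "y \<in> S" "z \<in> S" by (auto simp: r_def null_rel_def)
    have "(\<lambda>n. N n (x n \<ominus>\<^bsub>V n\<^esub> y n) + N n (y n \<ominus>\<^bsub>V n\<^esub> z n)) \<longlonglongrightarrow> 0 + 0"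
      using xy yz by (intro tendsto_add) (auto simp: r_def null_rel_def)
    hence "(\<lambda>n. N n (x n \<ominus>\<^bsub>V n\<^esub> z n)) \<longlonglongrightarrow> 0"
      using S by (intro null_le[of "\<lambda>n. N n (x n \<ominus>\<^bsub>V n\<^esub> z n)"]) (auto intro: V.N_nonneg V.N_triangle)
    thus "(x, z) \<in> r" using S by (simp add: r_def null_rel_def)
  qed
qed

lemma cls_eq: "\<lbrakk>x \<in> S; y \<in> S\<rbrakk> \<Longrightarrow> cls x = cls y \<longleftrightarrow> (\<lambda>n. N n (x n \<ominus>\<^bsub>V n\<^esub> y n)) \<longlonglongrightarrow> 0"
  using eq_equiv_class_iff[OF equiv_r, of x y] by (simp add: cls_def r_def null_rel_def)

lemma cls_eq_nn: "\<lbrakk>x \<in> S; y \<in> S\<rbrakk> \<Longrightarrow> cls x = cls y \<longleftrightarrow> nn (\<lambda>n. x n \<ominus>\<^bsub>V n\<^esub> y n) = 0"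
  using nn_lim[of "\<lambda>n. x n \<ominus>\<^bsub>V n\<^esub> y n"] by (auto simp: cls_eq intro: LIMSEQ_unique)

lemma cls_in [simp]: "x \<in> S \<Longrightarrow> cls x \<in> S // r"
  by (simp add: cls_def quotientI)

lemma rep_S: assumes "X \<in> S // r" shows "rep X \<in> S" "cls (rep X) = X"
proof -
  obtain x where x: "x \<in> S" "X = r `` {x}" using assms by (rule quotientE)
  hence "x \<in> X" using equiv_class_self[OF equiv_r] by blast
  hence *: "rep X \<in> X" unfolding rep_def by (rule someI[where P = "\<lambda>x. x \<in> X"])
  thus "rep X \<in> S" using x by (auto simp: r_def null_rel_def)
  show "cls (rep X) = X" using * x equiv_class_eq[OF equiv_r, of x "rep X"] by (simp add: cls_def)
qed

lemma clsE: assumes "X \<in> S // r" obtains x where "x \<in> S" "X = cls x"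
  using rep_S[OF assms] that[of "rep X"] by simp

lemma rep_cls: "x \<in> S \<Longrightarrow> rep (cls x) \<in> S \<and> (\<lambda>n. N n (rep (cls x) n \<ominus>\<^bsub>V n\<^esub> x n)) \<longlonglongrightarrow> 0"
  using rep_S[OF cls_in, of x] cls_eq[of "rep (cls x)" x] by simp

lemma nn_cls_cong:
  assumes "x \<in> S" "y \<in> S" "cls x = cls y" shows "nn x = nn y"
proof -
  have "(\<lambda>n. N n (x n) - N n (y n)) \<longlonglongrightarrow> 0"
  proof (rule tendsto_rabs_zero_cancel, rule null_le)
    show "(\<lambda>n. N n (x n \<ominus>\<^bsub>V n\<^esub> y n)) \<longlonglongrightarrow> 0" using assms cls_eq by blast
  qed (use assms in \<open>auto intro: V.N_diff\<close>)
  moreover have "(\<lambda>n. N n (x n) - N n (y n)) \<longlonglongrightarrow> nn x - nn y"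
    by (intro tendsto_diff nn_lim assms)
  ultimately show ?thesis using LIMSEQ_unique by fastforce
qed

lemma nn_rep: "x \<in> S \<Longrightarrow> lim (\<lambda>n. N n (rep (cls x) n)) = nn x"
  using rep_S[OF cls_in, of x] nn_cls_cong[of "rep (cls x)" x] by (simp add: nn_def[symmetric])

text \<open>\<open>lift1\<close> works on a chosen representative; the Lipschitz bound makes the
  resulting class independent of the choice.\<close>

lemma lift1_cls:
  assumes x: "x \<in> S" and cl: "\<And>x. x \<in> S \<Longrightarrow> (\<lambda>n. f n (x n)) \<in> S"
    and le: "\<And>n x y. x \<in> carrier (V n) \<Longrightarrow> y \<in> carrier (V n) \<Longrightarrow>
      N n (f n x \<ominus>\<^bsub>V n\<^esub> f n y) \<le> C * N n (x \<ominus>\<^bsub>V n\<^esub> y)"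
  shows "lift1 r f (cls x) = cls (\<lambda>n. f n (x n))"
proof -
  have "(\<lambda>n. C * N n (rep (cls x) n \<ominus>\<^bsub>V n\<^esub> x n)) \<longlonglongrightarrow> C * 0"
    using rep_cls[OF x] by (intro tendsto_mult_left) simp
  hence "cls (\<lambda>n. f n (rep (cls x) n)) = cls (\<lambda>n. f n (x n))"
    using x rep_cls[OF x] S_carrier[OF cl]
    by (subst cls_eq) (auto intro!: cl null_le[of _ "\<lambda>n. C * N n (rep (cls x) n \<ominus>\<^bsub>V n\<^esub> x n)"] V.N_nonneg le)
  thus ?thesis by (simp add: lift1_def cls_def)
qed

text \<open>The constants may depend on the four sequences, since multiplication is Lipschitz only
  on bounded sets and Cauchy sequences are bounded.\<close>

lemma lift2_cls:
  assumes x: "x \<in> S" and y: "y \<in> S"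
    and cl: "\<And>x y. x \<in> S \<Longrightarrow> y \<in> S \<Longrightarrow> (\<lambda>n. f n (x n) (y n)) \<in> S"
    and le: "\<And>x x' y y'. \<lbrakk>x \<in> S; x' \<in> S; y \<in> S; y' \<in> S\<rbrakk> \<Longrightarrow> \<exists>C D. \<forall>n.
      N n (f n (x n) (y n) \<ominus>\<^bsub>V n\<^esub> f n (x' n) (y' n)) \<le> C * N n (x n \<ominus>\<^bsub>V n\<^esub> x' n) + D * N n (y n \<ominus>\<^bsub>V n\<^esub> y' n)"
  shows "lift2 r f (cls x) (cls y) = cls (\<lambda>n. f n (x n) (y n))"
proof -
  let ?x = "rep (cls x)" and ?y = "rep (cls y)"
  have S: "?x \<in> S" "?y \<in> S" using rep_cls x y by auto
  obtain C D where CD: "\<And>n. N n (f n (?x n) (?y n) \<ominus>\<^bsub>V n\<^esub> f n (x n) (y n))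
      \<le> C * N n (?x n \<ominus>\<^bsub>V n\<^esub> x n) + D * N n (?y n \<ominus>\<^bsub>V n\<^esub> y n)"
    using le[OF S(1) x S(2) y] by blast
  have "(\<lambda>n. C * N n (?x n \<ominus>\<^bsub>V n\<^esub> x n) + D * N n (?y n \<ominus>\<^bsub>V n\<^esub> y n)) \<longlonglongrightarrow> C * 0 + D * 0"
    using rep_cls[OF x] rep_cls[OF y] by (intro tendsto_add tendsto_mult_left) simp_all
  hence "(\<lambda>n. N n (f n (?x n) (?y n) \<ominus>\<^bsub>V n\<^esub> f n (x n) (y n))) \<longlonglongrightarrow> 0"
    using S_carrier[OF cl[OF S]] S_carrier[OF cl[OF x y]]
    by (intro null_le[OF _ CD]) (auto intro: V.N_nonneg)
  hence "cls (\<lambda>n. f n (?x n) (?y n)) = cls (\<lambda>n. f n (x n) (y n))"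
    using x y S by (subst cls_eq) (auto intro: cl)
  thus ?thesis by (simp add: lift2_def cls_def)
qed

definition emb :: "nat \<Rightarrow> 'a \<Rightarrow> nat \<Rightarrow> 'a" where
  "emb n b = (\<lambda>m. if m < n then \<zero>\<^bsub>V m\<^esub> else connect \<alpha> n (m - n) b)"

lemma emb_closed [simp]: "b \<in> carrier (V n) \<Longrightarrow> emb n b m \<in> carrier (V m)"
  using con_closed[of b n "m - n"] by (cases "m < n") (simp_all add: emb_def)

lemma dev_emb: "b \<in> carrier (V n) \<Longrightarrow> m \<ge> n \<Longrightarrow> dev (emb n b) m k = 0"
  using connect_connect[of \<alpha> n "m - n" k b] emb_closed[of b n "m + k"]
  by (simp add: dev_def emb_def)

lemma emb_S [simp]: "b \<in> carrier (V n) \<Longrightarrow> emb n b \<in> S"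
  unfolding S_def using dev_emb by fastforce

lemma nn_emb: "b \<in> carrier (V n) \<Longrightarrow> nn (emb n b) = N n b"
proof -
  assume b: "b \<in> carrier (V n)"
  have *: "N m (emb n b m) = N n b" if "m \<ge> n" for m
    using con_N[OF b, of "m - n"] that by (simp add: emb_def)
  show ?thesis using b * by (intro antisym nn_le[of _ n] nn_ge[of _ n]) auto
qed

lemma emb_dense:
  assumes x: "x \<in> S" and e: "\<epsilon> > 0"
  shows "\<exists>n\<ge>M. nn (\<lambda>m. x m \<ominus>\<^bsub>V m\<^esub> emb n (x n) m) < \<epsilon>"
proof -
  obtain K where K: "\<And>n k. n \<ge> K \<Longrightarrow> dev x n k < \<epsilon> / 2" using S_small[OF x, of "\<epsilon> / 2"] e by auto
  let ?n = "max K M"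
  have "nn (\<lambda>m. x m \<ominus>\<^bsub>V m\<^esub> emb ?n (x ?n) m) \<le> \<epsilon> / 2"
  proof (rule nn_le[of _ ?n])
    fix m assume "m \<ge> ?n"
    moreover from this have "\<not> m < ?n" by linarith
    ultimately show "N m (x m \<ominus>\<^bsub>V m\<^esub> emb ?n (x ?n) m) \<le> \<epsilon> / 2"
      using K[of ?n "m - ?n"] by (simp add: dev_def emb_def)
  qed (use x in simp)
  thus ?thesis using e by (intro exI[of _ ?n]) auto
qed

text \<open>A diagonal argument: the limit is \<open>s (\<mu> n) n\<close>, where the index \<mu> n
  grows so slowly that at place n the sequence \<open>s (\<mu> n)\<close> has already settled, both
  in itself and relative to all earlier sequences.\<close>

lemma seq_complete:
  assumes s: "\<And>i. s i \<in> S"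
    and cauchy: "\<And>\<epsilon>. \<epsilon> > 0 \<Longrightarrow> \<exists>M. \<forall>i\<ge>M. \<forall>j\<ge>M. nn (\<lambda>n. s i n \<ominus>\<^bsub>V n\<^esub> s j n) < \<epsilon>"
  shows "\<exists>y\<in>S. (\<lambda>i. nn (\<lambda>n. s i n \<ominus>\<^bsub>V n\<^esub> y n)) \<longlonglongrightarrow> 0"
proof -
  define D where "D i j = nn (\<lambda>n. s i n \<ominus>\<^bsub>V n\<^esub> s j n)" for i j
  have sc [simp]: "s i n \<in> carrier (V n)" for i n using s by simp
  \<comment> \<open>Beyond the threshold K i, sequence i is Cauchy up to 1/(i + 1), and its
    distances to the sequences j \<le> i exceed their limits by less than 1/(i + 1).\<close>
  have "\<exists>K. \<forall>n\<ge>K. (\<forall>k. dev (s i) n k < 1 / (real i + 1)) \<and>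
      (\<forall>j\<le>i. N n (s i n \<ominus>\<^bsub>V n\<^esub> s j n) < D i j + 1 / (real i + 1))" for i
  proof -
    have "\<forall>\<^sub>F n in sequentially. N n (s i n \<ominus>\<^bsub>V n\<^esub> s j n) < D i j + 1 / (real i + 1)" for j
      using order_tendstoD(2)[OF nn_lim[OF S_minus[OF s s]], of i j] unfolding D_def by force
    hence "\<forall>\<^sub>F n in sequentially. \<forall>j\<in>{..i}. N n (s i n \<ominus>\<^bsub>V n\<^esub> s j n) < D i j + 1 / (real i + 1)"
      by (intro eventually_ball_finite) auto
    then obtain K1 where "\<forall>n\<ge>K1. \<forall>j\<le>i. N n (s i n \<ominus>\<^bsub>V n\<^esub> s j n) < D i j + 1 / (real i + 1)"
      by (auto simp: eventually_sequentially)
    moreover obtain K2 where "\<forall>n\<ge>K2. \<forall>k. dev (s i) n k < 1 / (real i + 1)"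
      using S_small[OF s[of i], of "1 / (real i + 1)"] by auto
    ultimately show ?thesis by (intro exI[of _ "max K1 K2"]) auto
  qed
  then obtain K where K1: "\<And>i n k. n \<ge> K i \<Longrightarrow> dev (s i) n k < 1 / (real i + 1)"
    and K2: "\<And>i j n. n \<ge> K i \<Longrightarrow> j \<le> i \<Longrightarrow> N n (s i n \<ominus>\<^bsub>V n\<^esub> s j n) < D i j + 1 / (real i + 1)"
    by metis
  \<comment> \<open>The largest admissible index whose threshold has been passed. The inserted 0
    keeps the set nonempty and is itself admissible once n reaches K 0.\<close>
  define \<mu> where "\<mu> n = Max (insert 0 {i. i \<le> n \<and> K i \<le> n})" for n
  have fin: "finite (insert 0 {i. i \<le> n \<and> K i \<le> n})" for n by simp
  have \<mu>_ge: "i \<le> \<mu> n" if "i \<le> n" "K i \<le> n" for i n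
    unfolding \<mu>_def using that fin by (intro Max_ge) auto
  have \<mu>_K: "K (\<mu> n) \<le> n" if "K 0 \<le> n" for n
    using Max_in[OF fin[of n]] that unfolding \<mu>_def[symmetric] by auto
  have \<mu>_mono: "\<mu> n \<le> \<mu> (n + k)" for n k
    unfolding \<mu>_def by (intro Max_mono) auto
  define y where "y n = s (\<mu> n) n" for n
  have small: "\<exists>I. \<forall>i\<ge>I. \<forall>j\<ge>I. D i j + 1 / (real i + 1) < \<epsilon>" if e: "\<epsilon> > 0" for \<epsilon>
  proof -
    obtain M where M: "\<And>i j. i \<ge> M \<Longrightarrow> j \<ge> M \<Longrightarrow> D i j < \<epsilon> / 2"
      using cauchy[of "\<epsilon> / 2"] e unfolding D_def by auto
    obtain L :: nat where L: "L > 0" "1 / real L < \<epsilon> / 2"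
      using reals_Archimedean[of "\<epsilon> / 2"] e by (metis inverse_eq_divide half_gt_zero zero_less_Suc)
    have "D i j + 1 / (real i + 1) < \<epsilon>" if "i \<ge> max M L" "j \<ge> max M L" for i j
    proof -
      have "1 / (real i + 1) \<le> 1 / real L" using that L by (intro divide_left_mono) auto
      thus ?thesis using M[of i j] that L by simp
    qed
    thus ?thesis by blast
  qed
  have y: "y \<in> S"
    unfolding S_def
  proof (intro CollectI conjI allI impI)
    show "y n \<in> carrier (V n)" for n by (simp add: y_def)
    fix e :: real assume e: "e > 0"
    obtain I where I: "\<And>i j. i \<ge> I \<Longrightarrow> j \<ge> I \<Longrightarrow> D i j + 1 / (real i + 1) < e / 2"
      using small[of "e / 2"] e by auto
    have Dnn: "0 \<le> D i j" for i j unfolding D_def using s by (intro nn_nonneg) simp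
    show "\<exists>M. \<forall>n\<ge>M. \<forall>k. dev y n k < e"
    proof (intro exI allI impI)
      fix n k assume n: "max (max I (K I)) (K 0) \<le> n"
      have i: "I \<le> \<mu> n" "\<mu> n \<le> \<mu> (n + k)" using n by (auto intro: \<mu>_ge \<mu>_mono)
      have "dev y n k \<le> N (n + k) (s (\<mu> (n + k)) (n + k) \<ominus>\<^bsub>V (n + k)\<^esub> s (\<mu> n) (n + k)) + dev (s (\<mu> n)) n k"
        unfolding dev_def y_def by (rule V.N_triangle) auto
      also have "\<dots> < (D (\<mu> (n + k)) (\<mu> n) + 1 / (real (\<mu> (n + k)) + 1)) + 1 / (real (\<mu> n) + 1)"
        using n i \<mu>_K[of n] \<mu>_K[of "n + k"] by (intro add_strict_mono K1 K2) auto
      also have "\<dots> < e / 2 + e / 2"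
        using I[of "\<mu> (n + k)" "\<mu> n"] I[of "\<mu> n" "\<mu> n"] i Dnn[of "\<mu> n" "\<mu> n"]
        by (intro add_strict_mono) auto
      finally show "dev y n k < e" by simp
    qed
  qed
  have "(\<lambda>i. nn (\<lambda>n. s i n \<ominus>\<^bsub>V n\<^esub> y n)) \<longlonglongrightarrow> 0"
  proof (rule null_if_small)
    fix e :: real assume e: "e > 0"
    obtain I where I: "\<And>i j. i \<ge> I \<Longrightarrow> j \<ge> I \<Longrightarrow> D i j + 1 / (real i + 1) < e"
      using small[OF e] by auto
    show "\<exists>M. \<forall>i\<ge>M. nn (\<lambda>n. s i n \<ominus>\<^bsub>V n\<^esub> y n) \<le> e"
    proof (intro exI allI impI)
      fix i assume i: "I \<le> i"
      show "nn (\<lambda>n. s i n \<ominus>\<^bsub>V n\<^esub> y n) \<le> e"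
      proof (rule nn_le)
        fix n assume n: "max (max i (K i)) (K 0) \<le> n"
        have m: "i \<le> \<mu> n" using n by (auto intro: \<mu>_ge)
        have "N n (s i n \<ominus>\<^bsub>V n\<^esub> y n) = N n (s (\<mu> n) n \<ominus>\<^bsub>V n\<^esub> s i n)"
          unfolding y_def by (rule V.N_minus_commute) auto
        also have "\<dots> < D (\<mu> n) i + 1 / (real (\<mu> n) + 1)"
          using n m \<mu>_K[of n] by (intro K2) auto
        also have "\<dots> < e" using I i m by auto
        finally show "N n (s i n \<ominus>\<^bsub>V n\<^esub> y n) \<le> e" by simp
      qed (use s y in simp)
    qed
  qed (use s y in \<open>auto intro: nn_nonneg\<close>)
  thus ?thesis using y by blast
qed

end

text \<open>The completion W is a parameter described by its operations on classes, because its two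
  instances are records of different types, a C*-algebra and an inner product space.\<close>

locale vsys_lim = vsys V N \<alpha>
  for V :: "nat \<Rightarrow> (complex, 'a, 'm) module_scheme" and N :: "nat \<Rightarrow> 'a \<Rightarrow> real" and \<alpha> +
  fixes W :: "(complex, (nat \<Rightarrow> 'a) set, 'w) module_scheme" and NN :: "(nat \<Rightarrow> 'a) set \<Rightarrow> real"
  assumes carrier_W: "carrier W = S // r"
    and zero_W: "\<zero>\<^bsub>W\<^esub> = cls (\<lambda>n. \<zero>\<^bsub>V n\<^esub>)"
    and add_W: "x \<in> S \<Longrightarrow> y \<in> S \<Longrightarrow> cls x \<oplus>\<^bsub>W\<^esub> cls y = lift2 r (\<lambda>n. (\<oplus>\<^bsub>V n\<^esub>)) (cls x) (cls y)"
    and smult_W: "x \<in> S \<Longrightarrow> c \<odot>\<^bsub>W\<^esub> cls x = lift1 r (\<lambda>n. (\<odot>\<^bsub>V n\<^esub>) c) (cls x)"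
    and NN_cls: "x \<in> S \<Longrightarrow> NN (cls x) = nn x"
begin

lemma W_add: "x \<in> S \<Longrightarrow> y \<in> S \<Longrightarrow> cls x \<oplus>\<^bsub>W\<^esub> cls y = cls (\<lambda>n. x n \<oplus>\<^bsub>V n\<^esub> y n)"
proof (subst add_W, assumption, assumption, rule lift2_cls)
  fix x y x' y' assume S: "x \<in> S" "x' \<in> S" "y \<in> S" "y' \<in> S"
  have "N n (x n \<oplus>\<^bsub>V n\<^esub> y n \<ominus>\<^bsub>V n\<^esub> (x' n \<oplus>\<^bsub>V n\<^esub> y' n))
        \<le> 1 * N n (x n \<ominus>\<^bsub>V n\<^esub> x' n) + 1 * N n (y n \<ominus>\<^bsub>V n\<^esub> y' n)" for n
    using S by (simp add: V.add_minus_add V.N_add)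
  thus "\<exists>C D. \<forall>n. N n (x n \<oplus>\<^bsub>V n\<^esub> y n \<ominus>\<^bsub>V n\<^esub> (x' n \<oplus>\<^bsub>V n\<^esub> y' n))
        \<le> C * N n (x n \<ominus>\<^bsub>V n\<^esub> x' n) + D * N n (y n \<ominus>\<^bsub>V n\<^esub> y' n)" by blast
qed auto

lemma W_smult: "x \<in> S \<Longrightarrow> c \<odot>\<^bsub>W\<^esub> cls x = cls (\<lambda>n. c \<odot>\<^bsub>V n\<^esub> x n)"
  by (subst smult_W, assumption, rule lift1_cls[where C = "cmod c"])
    (auto simp: V.smult_minus[symmetric] V.N_smult)

lemma cls_carrier [simp]: "x \<in> S \<Longrightarrow> cls x \<in> carrier W"
  by (simp add: carrier_W)

lemma carrierE: assumes "X \<in> carrier W" obtains x where "x \<in> S" "X = cls x"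
  using assms clsE by (auto simp: carrier_W)

lemma module_W: "Module.module class_ring W"
proof (rule moduleI)
  show "cring (class_ring :: complex ring)"
    by (rule class_field[THEN field.axioms(1), THEN domain.axioms(1)])
  show "abelian_group W"
  proof (rule abelian_groupI)
    fix X assume "X \<in> carrier W"
    then obtain x where x: "x \<in> S" "X = cls x" by (rule carrierE)
    have "cls (\<lambda>n. (-1) \<odot>\<^bsub>V n\<^esub> x n) \<oplus>\<^bsub>W\<^esub> X = \<zero>\<^bsub>W\<^esub>"
    proof -
      have "(-1) \<odot>\<^bsub>V n\<^esub> x n \<oplus>\<^bsub>V n\<^esub> x n = \<zero>\<^bsub>V n\<^esub>" for n
        using x V.l_neg[of "x n" n] by (simp add: V.uminus_eq_smult)
      thus ?thesis using x by (simp add: W_add zero_W)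
    qed
    thus "\<exists>Y\<in>carrier W. Y \<oplus>\<^bsub>W\<^esub> X = \<zero>\<^bsub>W\<^esub>" using x by (intro bexI[of _ "cls (\<lambda>n. (-1) \<odot>\<^bsub>V n\<^esub> x n)"]) auto
  qed (auto elim!: carrierE simp: W_add zero_W V.a_ac simp del: set_eq_iff intro!: arg_cong[of _ _ cls])
qed (auto elim!: carrierE simp: W_add W_smult V.smult_add_left V.smult_add_right V.smult_smult class_ring_simps)

sublocale W: cvec W by (rule cvec.intro, rule module_W)

lemma W_minus: "x \<in> S \<Longrightarrow> y \<in> S \<Longrightarrow> cls x \<ominus>\<^bsub>W\<^esub> cls y = cls (\<lambda>n. x n \<ominus>\<^bsub>V n\<^esub> y n)"
  by (simp add: W.minus_eq_smult W_add W_smult V.minus_eq_smult)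

sublocale W: snorm W NN
proof unfold_locales
  fix X Y assume "X \<in> carrier W" "Y \<in> carrier W"
  then obtain x y where xy: "x \<in> S" "X = cls x" "y \<in> S" "Y = cls y" by (metis carrierE)
  have "nn (\<lambda>n. x n \<oplus>\<^bsub>V n\<^esub> y n) \<le> nn x + nn y"
    by (rule LIMSEQ_le[OF nn_lim tendsto_add[OF nn_lim nn_lim]])
      (use xy in \<open>auto intro!: V.N_add exI[of _ 0]\<close>)
  thus "NN (X \<oplus>\<^bsub>W\<^esub> Y) \<le> NN X + NN Y" using xy by (simp add: W_add NN_cls)
next
  fix X c assume "X \<in> carrier W"
  then obtain x where x: "x \<in> S" "X = cls x" by (rule carrierE)
  have "nn (\<lambda>n. c \<odot>\<^bsub>V n\<^esub> x n) = cmod c * nn x"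
    by (rule LIMSEQ_unique[OF nn_lim]) (use x in \<open>auto simp: V.N_smult intro: tendsto_mult_left nn_lim\<close>)
  thus "NN (c \<odot>\<^bsub>W\<^esub> X) = cmod c * NN X" using x by (simp add: W_smult NN_cls)
qed

lemma NN_eq_0: "X \<in> carrier W \<Longrightarrow> NN X = 0 \<longleftrightarrow> X = \<zero>\<^bsub>W\<^esub>"
proof -
  assume "X \<in> carrier W"
  then obtain x where x: "x \<in> S" "X = cls x" by (rule carrierE)
  show ?thesis using cls_eq_nn[OF x(1) S_zero] x by (simp add: NN_cls zero_W)
qed

lemma complete_W:
  assumes X: "\<And>n. X n \<in> carrier W"
    and c: "\<And>\<epsilon>. \<epsilon> > 0 \<Longrightarrow> \<exists>M. \<forall>m\<ge>M. \<forall>n\<ge>M. NN (X m \<ominus>\<^bsub>W\<^esub> X n) < \<epsilon>"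
  shows "\<exists>Y\<in>carrier W. (\<lambda>n. NN (X n \<ominus>\<^bsub>W\<^esub> Y)) \<longlonglongrightarrow> 0"
proof -
  have "\<forall>n. \<exists>x. x \<in> S \<and> X n = cls x" using X carrierE by metis
  then obtain s where s: "\<And>n. s n \<in> S" "\<And>n. X n = cls (s n)" by metis
  obtain y where "y \<in> S" "(\<lambda>i. nn (\<lambda>n. s i n \<ominus>\<^bsub>V n\<^esub> y n)) \<longlonglongrightarrow> 0"
    using seq_complete[of s] s c by (auto simp: W_minus NN_cls)
  thus ?thesis using s by (intro bexI[of _ "cls y"]) (auto simp: W_minus NN_cls)
qed

definition incl :: "nat \<Rightarrow> 'a \<Rightarrow> (nat \<Rightarrow> 'a) set" where
  "incl n b = cls (emb n b)"

lemma incl_closed [simp]: "b \<in> carrier (V n) \<Longrightarrow> incl n b \<in> carrier W"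
  by (simp add: incl_def)

lemma incl_N: "b \<in> carrier (V n) \<Longrightarrow> NN (incl n b) = N n b"
  by (simp add: incl_def NN_cls nn_emb)

lemma cls_eqI: "\<lbrakk>x \<in> S; y \<in> S; \<And>m. m \<ge> M \<Longrightarrow> x m = y m\<rbrakk> \<Longrightarrow> cls x = cls y"
  unfolding cls_eq by (rule tendsto_eventually) (auto simp: eventually_sequentially intro!: exI[of _ M])

lemma emb_eq: "m \<ge> n \<Longrightarrow> emb n b m = connect \<alpha> n (m - n) b"
  by (simp add: emb_def)

lemma incl_add:
  assumes "b \<in> carrier (V n)" "b' \<in> carrier (V n)"
  shows "incl n (b \<oplus>\<^bsub>V n\<^esub> b') = incl n b \<oplus>\<^bsub>W\<^esub> incl n b'"
proof -
  have "emb n (b \<oplus>\<^bsub>V n\<^esub> b') m = emb n b m \<oplus>\<^bsub>V m\<^esub> emb n b' m" if "m \<ge> n" for m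
    using con_add[of b n b' "m - n"] assms that by (simp add: emb_eq)
  thus ?thesis using assms unfolding incl_def by (simp add: W_add, intro cls_eqI[of _ _ n]) auto
qed

lemma incl_smult:
  assumes "b \<in> carrier (V n)"
  shows "incl n (c \<odot>\<^bsub>V n\<^esub> b) = c \<odot>\<^bsub>W\<^esub> incl n b"
proof -
  have "emb n (c \<odot>\<^bsub>V n\<^esub> b) m = c \<odot>\<^bsub>V m\<^esub> emb n b m" if "m \<ge> n" for m
    using con_smult[of b n "m - n"] assms that by (simp add: emb_eq)
  thus ?thesis using assms unfolding incl_def by (simp add: W_smult, intro cls_eqI[of _ _ n]) auto
qed

lemma incl_minus: "b \<in> carrier (V n) \<Longrightarrow> b' \<in> carrier (V n) \<Longrightarrow> incl n (b \<ominus>\<^bsub>V n\<^esub> b') = incl n b \<ominus>\<^bsub>W\<^esub> incl n b'"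
  by (simp add: V.minus_eq_smult W.minus_eq_smult incl_add incl_smult)

lemma incl_connect:
  assumes "b \<in> carrier (V n)"
  shows "incl (n + k) (connect \<alpha> n k b) = incl n b"
proof -
  have "emb (n + k) (connect \<alpha> n k b) m = emb n b m" if "m \<ge> n + k" for m
    using connect_connect[of \<alpha> n k "m - (n + k)" b] that by (simp add: emb_eq)
  thus ?thesis using assms unfolding incl_def by (intro cls_eqI[of _ _ "n + k"]) auto
qed

lemma incl_dense:
  assumes "X \<in> carrier W" "\<epsilon> > 0"
  shows "\<exists>n\<ge>M. \<exists>b\<in>carrier (V n). NN (X \<ominus>\<^bsub>W\<^esub> incl n b) < \<epsilon>"
proof -
  obtain x where x: "x \<in> S" "X = cls x" using assms carrierE by metis
  obtain n where "n \<ge> M" "nn (\<lambda>m. x m \<ominus>\<^bsub>V m\<^esub> emb n (x n) m) < \<epsilon>"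
    using emb_dense[OF x(1) assms(2)] by blast
  thus ?thesis using x by (intro exI[of _ n] conjI bexI[of _ "x n"]) (auto simp: incl_def W_minus NN_cls)
qed

end

section \<open>Inductive limits of C*-algebras\<close>

text \<open>States are contractive, so agreement on a dense set gives agreement on the carrier; off
  the carrier both are extensional.\<close>

lemma cstate_eqI:
  assumes "cstate A \<phi>" "cstate A \<psi>"
    and d: "\<And>x \<epsilon>. x \<in> carrier A \<Longrightarrow> \<epsilon> > 0 \<Longrightarrow> \<exists>y\<in>carrier A. \<phi> y = \<psi> y \<and> nrm A (x \<ominus>\<^bsub>A\<^esub> y) < \<epsilon>"
  shows "\<phi> = \<psi>"
proof -
  interpret P: cstate A \<phi> by fact
  interpret Q: cstate A \<psi> by fact
  have "\<phi> x = \<psi> x" if x: "x \<in> carrier A" for x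
  proof -
    have "cmod (\<phi> x - \<psi> x) \<le> 0"
    proof (rule field_le_epsilon)
      fix e :: real assume e: "e > 0"
      obtain y where y: "y \<in> carrier A" "\<phi> y = \<psi> y" "nrm A (x \<ominus>\<^bsub>A\<^esub> y) < e / 2"
        using d[OF x, of "e / 2"] e by auto
      have "\<phi> x - \<psi> x = \<phi> (x \<ominus>\<^bsub>A\<^esub> y) - \<psi> (x \<ominus>\<^bsub>A\<^esub> y)"
        using x y by (simp add: P.st_minus Q.st_minus)
      also have "cmod \<dots> \<le> nrm A (x \<ominus>\<^bsub>A\<^esub> y) + nrm A (x \<ominus>\<^bsub>A\<^esub> y)"
        using x y by (intro norm_triangle_ineq4[THEN order_trans] add_mono P.st_bound Q.st_bound) auto
      finally show "cmod (\<phi> x - \<psi> x) \<le> 0 + e" using y by simp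
    qed
    thus ?thesis by simp
  qed
  moreover have "\<phi> \<in> extensional (carrier A)" "\<psi> \<in> extensional (carrier A)"
    using P.state Q.state by (auto simp: states_def)
  ultimately show ?thesis by (rule extensionalityI[rotated 2])
qed

locale cstar_sys =
  fixes B :: "nat \<Rightarrow> 'b cstar" and \<alpha> :: "nat \<Rightarrow> 'b \<Rightarrow> 'b"
  assumes cstars: "cstar (B n)"
    and con1_closed: "x \<in> carrier (B n) \<Longrightarrow> \<alpha> n x \<in> carrier (B (Suc n))"
    and con1_add: "\<lbrakk>x \<in> carrier (B n); y \<in> carrier (B n)\<rbrakk> \<Longrightarrow> \<alpha> n (x \<oplus>\<^bsub>B n\<^esub> y) = \<alpha> n x \<oplus>\<^bsub>B (Suc n)\<^esub> \<alpha> n y"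
    and con1_smult: "x \<in> carrier (B n) \<Longrightarrow> \<alpha> n (c \<odot>\<^bsub>B n\<^esub> x) = c \<odot>\<^bsub>B (Suc n)\<^esub> \<alpha> n x"
    and con1_mult: "\<lbrakk>x \<in> carrier (B n); y \<in> carrier (B n)\<rbrakk> \<Longrightarrow> \<alpha> n (x \<otimes>\<^bsub>B n\<^esub> y) = \<alpha> n x \<otimes>\<^bsub>B (Suc n)\<^esub> \<alpha> n y"
    and con1_star: "x \<in> carrier (B n) \<Longrightarrow> \<alpha> n (star (B n) x) = star (B (Suc n)) (\<alpha> n x)"
    and con1_one: "\<alpha> n \<one>\<^bsub>B n\<^esub> = \<one>\<^bsub>B (Suc n)\<^esub>"
    and con1_nrm: "x \<in> carrier (B n) \<Longrightarrow> nrm (B (Suc n)) (\<alpha> n x) = nrm (B n) x"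
begin

sublocale B: cstar "B n" for n by (rule cstars)

sublocale vsys B "\<lambda>n. nrm (B n)" \<alpha>
  by unfold_locales (auto simp: con1_closed con1_add con1_smult con1_nrm)

abbreviation "W \<equiv> inductive_limit B \<alpha>"

lemma lim_seqs_eq: "lim_seqs B \<alpha> = S"
  unfolding lim_seqs_def S_def dev_def by (rule refl)

lemma lim_rel_eq: "lim_rel B \<alpha> = r"
  by (simp add: lim_rel_def r_def lim_seqs_eq)

sublocale vsys_lim B "\<lambda>n. nrm (B n)" \<alpha> W "nrm W"
proof (rule vsys_lim.intro, rule vsys_axioms, rule vsys_lim_axioms.intro)
  show "carrier W = S // r"
    by (simp add: inductive_limit_def Let_def lim_seqs_eq lim_rel_eq)
  show "\<zero>\<^bsub>W\<^esub> = cls (\<lambda>n. \<zero>\<^bsub>B n\<^esub>)"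
    by (simp add: inductive_limit_def Let_def lim_rel_eq cls_def)
  show "cls x \<oplus>\<^bsub>W\<^esub> cls y = lift2 r (\<lambda>n. (\<oplus>\<^bsub>B n\<^esub>)) (cls x) (cls y)" for x y
    by (simp add: inductive_limit_def Let_def lim_rel_eq)
  show "c \<odot>\<^bsub>W\<^esub> cls x = lift1 r (\<lambda>n. (\<odot>\<^bsub>B n\<^esub>) c) (cls x)" for x c
    by (simp add: inductive_limit_def Let_def lim_rel_eq)
  show "nrm W (cls x) = nn x" if "x \<in> S" for x
    using nn_rep[OF that] by (simp add: inductive_limit_def Let_def)
qed

lemma limit_map_eq: "limit_map B \<alpha> = incl"
  by (intro ext) (simp add: limit_map_def lim_rel_eq incl_def cls_def emb_def)

lemma W_one: "\<one>\<^bsub>W\<^esub> = cls (\<lambda>n. \<one>\<^bsub>B n\<^esub>)"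
  by (simp add: inductive_limit_def Let_def lim_rel_eq cls_def)

lemma con_mult: "\<lbrakk>x \<in> carrier (B n); y \<in> carrier (B n)\<rbrakk> \<Longrightarrow>
    connect \<alpha> n k (x \<otimes>\<^bsub>B n\<^esub> y) = connect \<alpha> n k x \<otimes>\<^bsub>B (n + k)\<^esub> connect \<alpha> n k y"
  by (induction k) (auto simp: con1_mult)

lemma con_star: "x \<in> carrier (B n) \<Longrightarrow> connect \<alpha> n k (star (B n) x) = star (B (n + k)) (connect \<alpha> n k x)"
  by (induction k) (auto simp: con1_star)

lemma con_one: "connect \<alpha> n k \<one>\<^bsub>B n\<^esub> = \<one>\<^bsub>B (n + k)\<^esub>"
  by (induction k) (auto simp: con1_one)

lemma S_mult [simp]:
  assumes x: "x \<in> S" and y: "y \<in> S" shows "(\<lambda>n. x n \<otimes>\<^bsub>B n\<^esub> y n) \<in> S"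
proof -
  obtain C where C: "C \<ge> 0" "\<And>n. nrm (B n) (x n) \<le> C" using S_bounded[OF x] by blast
  obtain D where D: "D \<ge> 0" "\<And>n. nrm (B n) (y n) \<le> D" using S_bounded[OF y] by blast
  show ?thesis
  proof (rule S_le[OF _ x y D(1) C(1)])
    fix n k
    have "dev (\<lambda>n. x n \<otimes>\<^bsub>B n\<^esub> y n) n k \<le> nrm (B (n + k)) (x (n + k)) * dev y n k
        + dev x n k * nrm (B (n + k)) (connect \<alpha> n k (y n))"
      unfolding dev_def using x y by (subst con_mult) (auto intro!: B.nrm_mult_minus_mult)
    also have "\<dots> \<le> C * dev y n k + dev x n k * D"
      using x y C(2)[of "n + k"] D(2)[of n]
      by (intro add_mono mult_left_mono mult_right_mono) (auto simp: con_N dev_def intro!: B.N_nonneg)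
    finally show "dev (\<lambda>n. x n \<otimes>\<^bsub>B n\<^esub> y n) n k \<le> D * dev x n k + C * dev y n k"
      by (simp add: ac_simps)
  qed (use x y in auto)
qed

lemma S_star [simp]:
  assumes x: "x \<in> S" shows "(\<lambda>n. star (B n) (x n)) \<in> S"
  by (rule S_le[OF _ x x, of _ 1 0])
    (use x in \<open>auto simp: dev_def con_star B.star_minus[symmetric]\<close>)

lemma S_one [simp]: "(\<lambda>n. \<one>\<^bsub>B n\<^esub>) \<in> S"
proof -
  have "dev (\<lambda>n. \<one>\<^bsub>B n\<^esub>) n k = 0" for n k by (simp add: dev_def con_one)
  thus ?thesis unfolding S_def by simp
qed

lemma W_mult: "x \<in> S \<Longrightarrow> y \<in> S \<Longrightarrow> cls x \<otimes>\<^bsub>W\<^esub> cls y = cls (\<lambda>n. x n \<otimes>\<^bsub>B n\<^esub> y n)"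
proof -
  assume xy: "x \<in> S" "y \<in> S"
  have "lift2 r (\<lambda>n. (\<otimes>\<^bsub>B n\<^esub>)) (cls x) (cls y) = cls (\<lambda>n. x n \<otimes>\<^bsub>B n\<^esub> y n)"
  proof (rule lift2_cls[OF xy S_mult])
    fix x x' y y' assume S: "x \<in> S" "x' \<in> S" "y \<in> S" "y' \<in> S"
    obtain C where C: "C \<ge> 0" "\<And>n. nrm (B n) (x n) \<le> C" using S_bounded[OF S(1)] by blast
    obtain D where D: "D \<ge> 0" "\<And>n. nrm (B n) (y' n) \<le> D" using S_bounded[OF S(4)] by blast
    have "nrm (B n) (x n \<otimes>\<^bsub>B n\<^esub> y n \<ominus>\<^bsub>B n\<^esub> x' n \<otimes>\<^bsub>B n\<^esub> y' n)
        \<le> D * nrm (B n) (x n \<ominus>\<^bsub>B n\<^esub> x' n) + C * nrm (B n) (y n \<ominus>\<^bsub>B n\<^esub> y' n)" for n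
    proof -
      have "nrm (B n) (x n \<otimes>\<^bsub>B n\<^esub> y n \<ominus>\<^bsub>B n\<^esub> x' n \<otimes>\<^bsub>B n\<^esub> y' n)
         \<le> nrm (B n) (x n) * nrm (B n) (y n \<ominus>\<^bsub>B n\<^esub> y' n) + nrm (B n) (x n \<ominus>\<^bsub>B n\<^esub> x' n) * nrm (B n) (y' n)"
        using S by (intro B.nrm_mult_minus_mult) auto
      also have "\<dots> \<le> C * nrm (B n) (y n \<ominus>\<^bsub>B n\<^esub> y' n) + nrm (B n) (x n \<ominus>\<^bsub>B n\<^esub> x' n) * D"
        using S C D by (intro add_mono mult_left_mono mult_right_mono B.N_nonneg) auto
      finally show ?thesis by (simp add: ac_simps)
    qed
    thus "\<exists>C D. \<forall>n. nrm (B n) (x n \<otimes>\<^bsub>B n\<^esub> y n \<ominus>\<^bsub>B n\<^esub> x' n \<otimes>\<^bsub>B n\<^esub> y' n)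
        \<le> C * nrm (B n) (x n \<ominus>\<^bsub>B n\<^esub> x' n) + D * nrm (B n) (y n \<ominus>\<^bsub>B n\<^esub> y' n)" by blast
  qed auto
  thus ?thesis by (simp add: inductive_limit_def Let_def lim_rel_eq)
qed

lemma W_star: "x \<in> S \<Longrightarrow> star W (cls x) = cls (\<lambda>n. star (B n) (x n))"
proof -
  assume x: "x \<in> S"
  have "lift1 r (\<lambda>n. star (B n)) (cls x) = cls (\<lambda>n. star (B n) (x n))"
    by (rule lift1_cls[OF x, where C = 1]) (auto simp: B.star_minus[symmetric])
  thus ?thesis by (simp add: inductive_limit_def Let_def lim_rel_eq)
qed

lemma ring_W: "Ring.ring W"
proof (rule ringI)
  show "abelian_group W" by unfold_locales
  show "Group.monoid W"
    by (rule monoidI) (auto elim!: carrierE simp: W_mult W_one B.m_assoc)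
qed (auto elim!: carrierE simp: W_mult W_add B.l_distr B.r_distr)

lemma nrm_W: "x \<in> S \<Longrightarrow> nrm W (cls x) = nn x"
  by (rule NN_cls)

lemma cstar_W: "cstar_algebra W"
  unfolding cstar_algebra_def
proof (intro conjI ballI allI impI)
  fix X Y assume "X \<in> carrier W" "Y \<in> carrier W"
  then obtain x y where xy: "x \<in> S" "X = cls x" "y \<in> S" "Y = cls y" by (metis carrierE)
  have "nn (\<lambda>n. x n \<otimes>\<^bsub>B n\<^esub> y n) \<le> nn x * nn y"
    by (rule LIMSEQ_le[OF nn_lim tendsto_mult[OF nn_lim nn_lim]])
      (use xy in \<open>auto intro!: B.nrm_mult exI[of _ 0]\<close>)
  thus "nrm W (X \<otimes>\<^bsub>W\<^esub> Y) \<le> nrm W X * nrm W Y" using xy by (simp add: W_mult nrm_W)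
next
  fix X assume "X \<in> carrier W"
  then obtain x where x: "x \<in> S" "X = cls x" by (metis carrierE)
  have "nn (\<lambda>n. star (B n) (x n) \<otimes>\<^bsub>B n\<^esub> x n) = (nn x)\<^sup>2"
    by (rule LIMSEQ_unique[OF nn_lim]) (use x tendsto_power[OF nn_lim] in \<open>auto simp: B.nrm_cstar\<close>)
  thus "nrm W (star W X \<otimes>\<^bsub>W\<^esub> X) = (nrm W X)\<^sup>2" using x by (simp add: W_mult W_star nrm_W)
qed (auto simp: ring_W module_W W.N_add W.N_smult W.N_nonneg NN_eq_0 complete_W elim!: carrierE
      simp: W_mult W_smult W_star W_add B.smult_mult_left B.smult_mult_right B.star_add B.star_mult B.star_smult)

sublocale C: cstar W by (rule cstar.intro, rule cstar_W)

lemma incl_one: "incl n \<one>\<^bsub>B n\<^esub> = \<one>\<^bsub>W\<^esub>"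
proof -
  have "emb n \<one>\<^bsub>B n\<^esub> m = \<one>\<^bsub>B m\<^esub>" if "m \<ge> n" for m
    using con_one[of n "m - n"] that by (simp add: emb_eq)
  thus ?thesis unfolding incl_def W_one by (intro cls_eqI[of _ _ n]) auto
qed

lemma incl_mult:
  assumes "b \<in> carrier (B n)" "b' \<in> carrier (B n)"
  shows "incl n (b \<otimes>\<^bsub>B n\<^esub> b') = incl n b \<otimes>\<^bsub>W\<^esub> incl n b'"
proof -
  have "emb n (b \<otimes>\<^bsub>B n\<^esub> b') m = emb n b m \<otimes>\<^bsub>B m\<^esub> emb n b' m" if "m \<ge> n" for m
    using con_mult[of b n b' "m - n"] assms that by (simp add: emb_eq)
  thus ?thesis using assms unfolding incl_def by (simp add: W_mult, intro cls_eqI[of _ _ n]) auto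
qed

lemma incl_star:
  assumes "b \<in> carrier (B n)"
  shows "incl n (star (B n) b) = star W (incl n b)"
proof -
  have "emb n (star (B n) b) m = star (B m) (emb n b m)" if "m \<ge> n" for m
    using con_star[of b n "m - n"] assms that by (simp add: emb_eq)
  thus ?thesis using assms unfolding incl_def by (simp add: W_star, intro cls_eqI[of _ _ n]) auto
qed

lemma incl_inj: "\<lbrakk>b \<in> carrier (B n); b' \<in> carrier (B n); incl n b = incl n b'\<rbrakk> \<Longrightarrow> b = b'"
  using incl_N[of "b \<ominus>\<^bsub>B n\<^esub> b'" n] B.nrm_eq_0[of "b \<ominus>\<^bsub>B n\<^esub> b'" n] by (simp add: incl_minus)

end

locale cstar_sys_state = cstar_sys +
  fixes \<tau> :: "nat \<Rightarrow> 'a \<Rightarrow> complex"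
  assumes csts: "cstate (B n) (\<tau> n)"
    and \<tau>_con1: "x \<in> carrier (B n) \<Longrightarrow> \<tau> (Suc n) (\<alpha> n x) = \<tau> n x"
    and \<tau>_trace: "\<lbrakk>x \<in> carrier (B n); y \<in> carrier (B n)\<rbrakk> \<Longrightarrow> \<tau> n (x \<otimes>\<^bsub>B n\<^esub> y) = \<tau> n (y \<otimes>\<^bsub>B n\<^esub> x)"
begin

sublocale T: cstate "B n" "\<tau> n" for n by (rule csts)

lemma \<tau>_con: "x \<in> carrier (B n) \<Longrightarrow> \<tau> (n + k) (connect \<alpha> n k x) = \<tau> n x"
  by (induction k) (auto simp: \<tau>_con1)

definition lim_state :: "(nat \<Rightarrow> 'a) set \<Rightarrow> complex" where
  "lim_state = (\<lambda>X\<in>carrier W. lim (\<lambda>n. \<tau> n (rep X n)))"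

lemma \<tau>_convergent:
  assumes x: "x \<in> S" shows "convergent (\<lambda>n. \<tau> n (x n))"
  unfolding Cauchy_convergent_iff[symmetric]
proof (rule CauchyI)
  fix e :: real assume e: "e > 0"
  obtain M where M: "\<And>k. dev x M k < e / 2" using S_small[OF x, of "e / 2"] e by auto
  have *: "cmod (\<tau> m (x m) - \<tau> M (x M)) < e / 2" if "m \<ge> M" for m
  proof -
    obtain k where k: "m = M + k" using \<open>m \<ge> M\<close> le_Suc_ex by blast
    have "\<tau> m (x m) - \<tau> M (x M) = \<tau> (M + k) (x (M + k) \<ominus>\<^bsub>B (M + k)\<^esub> connect \<alpha> M k (x M))"
      using x unfolding k by (subst T.st_minus) (auto simp: \<tau>_con)
    also have "cmod \<dots> \<le> dev x M k" unfolding dev_def using x by (intro T.st_bound) auto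
    finally show ?thesis using M[of k] by simp
  qed
  have "norm (\<tau> m (x m) - \<tau> n (x n)) < e" if "m \<ge> M" "n \<ge> M" for m n
    using norm_triangle_lt[of "\<tau> m (x m) - \<tau> M (x M)" "\<tau> M (x M) - \<tau> n (x n)" e]
      *[OF that(1)] *[OF that(2)] norm_minus_commute[of "\<tau> n (x n)" "\<tau> M (x M)"] by simp
  thus "\<exists>M. \<forall>m\<ge>M. \<forall>n\<ge>M. norm (\<tau> m (x m) - \<tau> n (x n)) < e" by blast
qed

lemma lim_state_lim:
  assumes x: "x \<in> S" shows "(\<lambda>n. \<tau> n (x n)) \<longlonglongrightarrow> lim_state (cls x)"
proof -
  let ?y = "rep (cls x)"
  have y: "?y \<in> S" "(\<lambda>n. nrm (B n) (?y n \<ominus>\<^bsub>B n\<^esub> x n)) \<longlonglongrightarrow> 0" using rep_cls[OF x] by auto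
  have "(\<lambda>n. \<tau> n (?y n)) \<longlonglongrightarrow> lim_state (cls x)"
    using \<tau>_convergent[OF y(1)] x by (simp add: lim_state_def convergent_LIMSEQ_iff)
  moreover have "(\<lambda>n. \<tau> n (?y n) - \<tau> n (x n)) \<longlonglongrightarrow> 0"
  proof (rule tendsto_norm_zero_cancel, rule null_le[OF _ _ y(2)])
    show "norm (\<tau> n (?y n) - \<tau> n (x n)) \<le> nrm (B n) (?y n \<ominus>\<^bsub>B n\<^esub> x n)" for n
      using T.st_bound[of "?y n \<ominus>\<^bsub>B n\<^esub> x n" n] x y by (simp add: T.st_minus)
  qed auto
  ultimately show ?thesis using tendsto_diff by fastforce
qed

lemma lim_state_incl: "b \<in> carrier (B n) \<Longrightarrow> lim_state (incl n b) = \<tau> n b"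
proof -
  assume b: "b \<in> carrier (B n)"
  have "\<tau> m (emb n b m) = \<tau> n b" if "m \<ge> n" for m
    using \<tau>_con[OF b, of "m - n"] that by (simp add: emb_eq)
  hence "(\<lambda>m. \<tau> m (emb n b m)) \<longlonglongrightarrow> \<tau> n b"
    by (intro tendsto_eventually) (auto simp: eventually_sequentially)
  thus ?thesis using lim_state_lim[OF emb_S[OF b]] LIMSEQ_unique by (auto simp: incl_def)
qed

lemma lim_state_state: "lim_state \<in> states W"
proof -
  have "lim_state (X \<oplus>\<^bsub>W\<^esub> Y) = lim_state X + lim_state Y" if "X \<in> carrier W" "Y \<in> carrier W" for X Y
  proof -
    obtain x y where xy: "x \<in> S" "X = cls x" "y \<in> S" "Y = cls y" using \<open>X \<in> carrier W\<close> \<open>Y \<in> carrier W\<close> by (metis carrierE)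
    show ?thesis unfolding xy using xy lim_state_lim[of "\<lambda>n. x n \<oplus>\<^bsub>B n\<^esub> y n"]
        tendsto_add[OF lim_state_lim[OF xy(1)] lim_state_lim[OF xy(3)]]
      by (auto simp: W_add T.st_add intro: LIMSEQ_unique)
  qed
  moreover have "lim_state (c \<odot>\<^bsub>W\<^esub> X) = c * lim_state X" if "X \<in> carrier W" for X c
  proof -
    obtain x where x: "x \<in> S" "X = cls x" using \<open>X \<in> carrier W\<close> by (metis carrierE)
    show ?thesis unfolding x using x lim_state_lim[of "\<lambda>n. c \<odot>\<^bsub>B n\<^esub> x n"]
        tendsto_mult_left[OF lim_state_lim[OF x(1)], of c]
      by (auto simp: W_smult T.st_smult intro: LIMSEQ_unique)
  qed
  moreover have "lim_state (star W X \<otimes>\<^bsub>W\<^esub> X) \<in> \<real>\<^sub>\<ge>\<^sub>0" if "X \<in> carrier W" for X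
  proof -
    obtain x where x: "x \<in> S" "X = cls x" using \<open>X \<in> carrier W\<close> by (metis carrierE)
    have l: "(\<lambda>n. \<tau> n (star (B n) (x n) \<otimes>\<^bsub>B n\<^esub> x n)) \<longlonglongrightarrow> lim_state (star W X \<otimes>\<^bsub>W\<^esub> X)"
      unfolding x using x lim_state_lim[of "\<lambda>n. star (B n) (x n) \<otimes>\<^bsub>B n\<^esub> x n"] by (simp add: W_mult W_star)
    show ?thesis
      by (rule Lim_in_closed_set[OF closed_nonneg_Reals_complex _ _ l])
        (use x T.st_pos in \<open>auto simp: complex_nonneg_Reals_iff\<close>)
  qed
  moreover have "lim_state \<one>\<^bsub>W\<^esub> = 1"
    using lim_state_incl[of "\<one>\<^bsub>B 0\<^esub>" 0] by (simp add: incl_one)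
  ultimately show ?thesis by (simp add: states_def) (simp add: lim_state_def)
qed

sublocale L: cstate W lim_state by unfold_locales (rule lim_state_state)

lemma lim_state_trace:
  assumes "X \<in> carrier W" "Y \<in> carrier W" shows "lim_state (X \<otimes>\<^bsub>W\<^esub> Y) = lim_state (Y \<otimes>\<^bsub>W\<^esub> X)"
proof -
  obtain x y where xy: "x \<in> S" "X = cls x" "y \<in> S" "Y = cls y" using assms by (metis carrierE)
  show ?thesis unfolding xy using xy lim_state_lim[of "\<lambda>n. x n \<otimes>\<^bsub>B n\<^esub> y n"]
        lim_state_lim[of "\<lambda>n. y n \<otimes>\<^bsub>B n\<^esub> x n"]
      by (auto simp: W_mult \<tau>_trace intro: LIMSEQ_unique)
qed

text \<open>The cutoff M is there because the formula that characterizes the Effros-Shen trace is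
  prescribed only from stage 1 on; later stages are still dense.\<close>

lemma lim_state_unique:
  assumes "cstate W \<phi>" "\<And>n b. n \<ge> M \<Longrightarrow> b \<in> carrier (B n) \<Longrightarrow> \<phi> (incl n b) = \<tau> n b"
  shows "\<phi> = lim_state"
proof (rule cstate_eqI[OF assms(1)])
  show "cstate W lim_state" by unfold_locales
  fix X and e :: real assume "X \<in> carrier W" "e > 0"
  then obtain n b where "n \<ge> M" "b \<in> carrier (B n)" "nrm W (X \<ominus>\<^bsub>W\<^esub> incl n b) < e"
    using incl_dense[of X e M] by blast
  thus "\<exists>Y\<in>carrier W. \<phi> Y = lim_state Y \<and> nrm W (X \<ominus>\<^bsub>W\<^esub> Y) < e"
    using assms(2) by (intro bexI[of _ "incl n b"]) (auto simp: lim_state_incl)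
qed

end

section \<open>Filtered algebras with a tracial state\<close>

text \<open>Recursion on the number of terms turns every rule about linear combinations into a plain
  induction.\<close>

primrec lcomb :: "(complex, 'v, 'm) module_scheme \<Rightarrow> (nat \<Rightarrow> complex) \<Rightarrow> (nat \<Rightarrow> 'v) \<Rightarrow> nat \<Rightarrow> 'v" where
  "lcomb V c e 0 = \<zero>\<^bsub>V\<^esub>"
| "lcomb V c e (Suc n) = lcomb V c e n \<oplus>\<^bsub>V\<^esub> c n \<odot>\<^bsub>V\<^esub> e n"

context cvec
begin

lemma lcomb_closed [simp]: "(\<And>i. i < n \<Longrightarrow> e i \<in> carrier V) \<Longrightarrow> lcomb V c e n \<in> carrier V"
  by (induction n) auto

lemma lcomb_cong: "(\<And>i. i < n \<Longrightarrow> c i = c' i) \<Longrightarrow> (\<And>i. i < n \<Longrightarrow> e i = e' i) \<Longrightarrow> lcomb V c e n = lcomb V c' e' n"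
  by (induction n) auto

lemma lcomb_smult:
  assumes "\<And>i. i < n \<Longrightarrow> e i \<in> carrier V"
  shows "lcomb V c (\<lambda>i. d \<odot> e i) n = d \<odot> lcomb V c e n"
  using assms by (induction n) (auto simp: smult_add_right smult_smult mult.commute)

end

lemma (in snorm) N_lcomb_le:
  assumes "\<And>i. i < n \<Longrightarrow> e i \<in> carrier V"
  shows "N (lcomb V c e n) \<le> (\<Sum>i<n. cmod (c i) * N (e i))"
  using assms
proof (induction n)
  case (Suc n)
  have "N (lcomb V c e (Suc n)) \<le> N (lcomb V c e n) + N (c n \<odot> e n)"
    using Suc.prems by (simp add: N_add)
  thus ?case using Suc by (simp add: N_smult)
qed simp

context sesq
begin

lemma s_lcomb:
  "(\<And>i. i < n \<Longrightarrow> e i \<in> carrier V) \<Longrightarrow> y \<in> carrier V \<Longrightarrow> s (lcomb V c e n) y = (\<Sum>i<n. c i * s (e i) y)"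
  by (induction n) (auto simp: s_add s_smult)

lemma s_lcomb_right:
  "(\<And>i. i < n \<Longrightarrow> e i \<in> carrier V) \<Longrightarrow> y \<in> carrier V \<Longrightarrow> s y (lcomb V c e n) = (\<Sum>i<n. cnj (c i) * s y (e i))"
  by (induction n) (auto simp: s_add_right s_smult_right)

end

text \<open>By Cauchy-Schwarz each coefficient with respect to normalized vectors is at most the
  trace norm of x. This is the equivalence of the two norms on a finite-dimensional
  subspace.\<close>

lemma (in cstate) norm_le_basis:
  assumes e: "\<And>i. i < d \<Longrightarrow> e i \<in> carrier A" "\<And>i. i < d \<Longrightarrow> \<phi> (star A (e i) \<otimes> e i) = 1"
    and x: "x \<in> carrier A" "lcomb A (\<lambda>i. \<phi> (star A (e i) \<otimes> x)) e d = x"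
  shows "nrm A x \<le> (\<Sum>i<d. nrm A (e i)) * tau_norm A \<phi> x"
proof -
  have "nrm A x \<le> (\<Sum>i<d. cmod (\<phi> (star A (e i) \<otimes> x)) * nrm A (e i))"
    using N_lcomb_le[of d e "\<lambda>i. \<phi> (star A (e i) \<otimes> x)"] x e by simp
  also have "\<dots> \<le> (\<Sum>i<d. tau_norm A \<phi> x * nrm A (e i))"
  proof (intro sum_mono mult_right_mono)
    fix i assume i: "i \<in> {..<d}"
    hence "tau_norm A \<phi> (e i) = 1" using e(2)[of i] by (simp add: tau_norm_def)
    thus "cmod (\<phi> (star A (e i) \<otimes> x)) \<le> tau_norm A \<phi> x" "0 \<le> nrm A (e i)"
      using Cauchy_Schwarz[of x "e i"] x(1) e(1)[of i] N_nonneg i by auto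
  qed
  finally show ?thesis by (simp add: sum_distrib_left mult.commute)
qed

text \<open>\<open>F_basis\<close> encodes both the finite dimension of each stage and the
  definiteness of the trace on it, by an orthonormal basis. Faithfulness on the whole algebra is a
  consequence (\<open>faithful\<close>).\<close>

locale filt = cstate A \<tau> for A :: "'a cstar" (structure) and \<tau> +
  fixes F :: "nat \<Rightarrow> 'a set"
  assumes trace: "\<lbrakk>x \<in> carrier A; y \<in> carrier A\<rbrakk> \<Longrightarrow> \<tau> (x \<otimes> y) = \<tau> (y \<otimes> x)"
    and F_carrier: "x \<in> F n \<Longrightarrow> x \<in> carrier A"
    and F_add: "\<lbrakk>x \<in> F n; y \<in> F n\<rbrakk> \<Longrightarrow> x \<oplus> y \<in> F n"
    and F_smult: "x \<in> F n \<Longrightarrow> c \<odot> x \<in> F n"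
    and F_mult: "\<lbrakk>x \<in> F n; y \<in> F n\<rbrakk> \<Longrightarrow> x \<otimes> y \<in> F n"
    and F_star: "x \<in> F n \<Longrightarrow> star A x \<in> F n"
    and F_one: "\<one> \<in> F n"
    and F_Suc: "x \<in> F n \<Longrightarrow> x \<in> F (Suc n)"
    and F_0: "x \<in> F 0 \<Longrightarrow> \<exists>c. x = c \<odot> \<one>"
    and F_dense: "\<lbrakk>x \<in> carrier A; \<epsilon> > 0\<rbrakk> \<Longrightarrow> \<exists>n. \<exists>y\<in>F n. nrm A (x \<ominus> y) < \<epsilon>"
    and F_basis: "\<exists>d e. (\<forall>i<d. e i \<in> F n) \<and> (\<forall>i<d. \<forall>j<d. \<tau> (star A (e j) \<otimes> e i) = of_bool (i = j)) \<and>
      (\<forall>x\<in>F n. x = lcomb A (\<lambda>i. \<tau> (star A (e i) \<otimes> x)) e d)"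
begin

abbreviation s :: "'a \<Rightarrow> 'a \<Rightarrow> complex" where "s x y \<equiv> \<tau> (star A y \<otimes> x)"
abbreviation tn :: "'a \<Rightarrow> real" where "tn \<equiv> tau_norm A \<tau>"

declare F_carrier [simp] F_add [simp] F_smult [simp] F_mult [simp] F_star [simp] F_one [simp]

lemma F_zero [simp]: "\<zero> \<in> F n"
  using F_smult[OF F_one, of 0] by simp

lemma F_minus [simp]: "x \<in> F n \<Longrightarrow> y \<in> F n \<Longrightarrow> x \<ominus> y \<in> F n"
  by (simp add: minus_eq_smult)

lemma F_mono: "m \<le> n \<Longrightarrow> x \<in> F m \<Longrightarrow> x \<in> F n"
  by (induction n rule: dec_induct) (auto intro: F_Suc)

lemma F_lcomb: "(\<And>i. i < d \<Longrightarrow> e i \<in> F n) \<Longrightarrow> lcomb A c e d \<in> F n"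
  by (induction d) auto

lemma st_zero [simp]: "\<tau> \<zero> = 0"
  using st_smult[of \<zero> 0] by simp

lemma basisE:
  obtains d e where "\<And>i. i < d \<Longrightarrow> e i \<in> F n" "\<And>i. i < d \<Longrightarrow> e i \<in> carrier A"
    "\<And>i j. i < d \<Longrightarrow> j < d \<Longrightarrow> s (e i) (e j) = of_bool (i = j)"
    "\<And>x. x \<in> F n \<Longrightarrow> lcomb A (\<lambda>i. s x (e i)) e d = x"
proof -
  obtain d e where *: "\<forall>i<d. e i \<in> F n" "\<forall>i<d. \<forall>j<d. s (e i) (e j) = of_bool (i = j)"
    "\<forall>x\<in>F n. x = lcomb A (\<lambda>i. s x (e i)) e d" using F_basis[of n] by blast
  show ?thesis by (rule that[of d e]) (use * F_carrier in \<open>blast | metis\<close>)+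
qed

lemma norm_equiv: "\<exists>c. \<forall>x\<in>F n. nrm A x \<le> c * tn x"
proof -
  obtain d e where e: "\<And>i. i < d \<Longrightarrow> e i \<in> F n" "\<And>i. i < d \<Longrightarrow> e i \<in> carrier A"
      "\<And>i j. i < d \<Longrightarrow> j < d \<Longrightarrow> s (e i) (e j) = of_bool (i = j)"
      and ex: "\<And>x. x \<in> F n \<Longrightarrow> lcomb A (\<lambda>i. s x (e i)) e d = x"
    using basisE[of n] by metis
  have "nrm A x \<le> (\<Sum>i<d. nrm A (e i)) * tn x" if x: "x \<in> F n" for x
    by (rule norm_le_basis) (use e(2) e(3) ex[OF x] F_carrier[OF x] in auto)
  thus ?thesis by blast
qed

lemma F_definite: "x \<in> F n \<Longrightarrow> tn x = 0 \<Longrightarrow> x = \<zero>"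
  using norm_equiv[of n] nrm_eq_0[of x] N_nonneg[of x] by fastforce

lemma nrm_le_F:
  assumes "b \<in> F n" "0 \<le> C" "\<And>x. x \<in> F n \<Longrightarrow> tn (b \<otimes> x) \<le> C * tn x"
  shows "nrm A b \<le> C"
proof -
  obtain c where "\<And>x. x \<in> F n \<Longrightarrow> nrm A x \<le> c * tn x" using norm_equiv by blast
  thus ?thesis using assms by (intro nrm_le_if_tn_le[of "F n" c b C]) auto
qed

lemma tn_star: "x \<in> carrier A \<Longrightarrow> tn (star A x) = tn x"
  using trace[of x "star A x"] by (simp add: tau_norm_def)

lemma tn_mult_right: "x \<in> carrier A \<Longrightarrow> z \<in> carrier A \<Longrightarrow> tn (x \<otimes> z) \<le> nrm A z * tn x"
  using tn_mult[of "star A z" "star A x"] tn_star[of "x \<otimes> z"] tn_star[of x] by (simp add: star_mult)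

text \<open>If x has trace norm 0, then so has x z for every z, by the trace property. An element y
  of a stage close to x therefore acts on that stage with small norm, and \<open>nrm_le_F\<close>
  makes y, hence x, small in the C*-norm.\<close>

lemma faithful:
  assumes x: "x \<in> carrier A" and x0: "tn x = 0" shows "x = \<zero>"
proof -
  have "nrm A x \<le> 0"
  proof (rule field_le_epsilon)
    fix e :: real assume e: "e > 0"
    obtain n y where y: "y \<in> F n" "nrm A (x \<ominus> y) < e / 2" using F_dense[OF x, of "e / 2"] e by auto
    have "nrm A y \<le> e / 2"
    proof (rule nrm_le_F[OF y(1)])
      fix z assume z: "z \<in> F n"
      have "y \<otimes> z = (y \<ominus> x) \<otimes> z \<oplus> x \<otimes> z"
        using x y z by (simp add: l_distr[symmetric] a_minus_def a_assoc l_neg)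
      hence "tn (y \<otimes> z) \<le> tn ((y \<ominus> x) \<otimes> z) + tn (x \<otimes> z)"
        using x y z by (simp add: tn_add)
      also have "tn ((y \<ominus> x) \<otimes> z) \<le> nrm A (y \<ominus> x) * tn z" using x y z by (intro tn_mult) auto
      also have "\<dots> \<le> (e / 2) * tn z"
        using x y z N_minus_commute[of x y] by (intro mult_right_mono) auto
      also have "tn (x \<otimes> z) \<le> 0" using tn_mult_right[of x z] x z x0 by simp
      finally show "tn (y \<otimes> z) \<le> e / 2 * tn z" by simp
    qed (use e in simp)
    thus "nrm A x \<le> 0 + e" using y x N_le_minus[of x y] by simp
  qed
  thus ?thesis using nrm_eq_0[OF x] N_nonneg[OF x] by simp
qed

lemma faithful_tracial: "faithful_tracial_state A \<tau>"
  using state trace faithful by (auto simp: faithful_tracial_state_def tau_norm_def)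

lemma s_eqI:
  assumes "x \<in> F n" "x' \<in> F n" "\<And>y. y \<in> F n \<Longrightarrow> s x y = s x' y"
  shows "x = x'"
proof -
  have "s (x \<ominus> x') (x \<ominus> x') = 0" using assms by (simp add: s_minus)
  hence "tn (x \<ominus> x') = 0" by (simp add: tau_norm_def)
  hence "x \<ominus> x' = \<zero>" by (rule F_definite[OF F_minus[OF assms(1,2)]])
  thus ?thesis by (rule minus_eq_zero[OF F_carrier[OF assms(1)] F_carrier[OF assms(2)]])
qed

section \<open>Conditional expectations onto the stages and their differences\<close>

lemma riesz:
  assumes g: "\<And>x y. x \<in> F n \<Longrightarrow> y \<in> F n \<Longrightarrow> g (x \<oplus> y) = g x + g y"
    "\<And>c x. x \<in> F n \<Longrightarrow> g (c \<odot> x) = cnj c * g x"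
  shows "\<exists>x\<in>F n. \<forall>y\<in>F n. s x y = g y"
proof -
  obtain d e where e: "\<And>i. i < d \<Longrightarrow> e i \<in> F n" "\<And>i. i < d \<Longrightarrow> e i \<in> carrier A"
      and ex: "\<And>x. x \<in> F n \<Longrightarrow> lcomb A (\<lambda>i. s x (e i)) e d = x"
    using basisE[of n] by metis
  have g0: "g \<zero> = 0" using g(2)[of \<zero> 0] by simp
  have gl: "g (lcomb A c e k) = (\<Sum>i<k. cnj (c i) * g (e i))" if "k \<le> d" for c k
    using that by (induction k) (use e F_lcomb in \<open>auto simp: g g0\<close>)
  show ?thesis
  proof (intro bexI ballI)
    let ?x = "lcomb A (\<lambda>i. g (e i)) e d"
    show "?x \<in> F n" using e(1) by (rule F_lcomb)
    fix y assume y: "y \<in> F n"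
    have "s ?x y = (\<Sum>i<d. g (e i) * s (e i) y)"
      using e y by (intro s_lcomb) auto
    also have "\<dots> = (\<Sum>i<d. cnj (s y (e i)) * g (e i))"
      using e y by (intro sum.cong refl) (subst s_cnj, auto)
    also have "\<dots> = g (lcomb A (\<lambda>i. s y (e i)) e d)" by (simp add: gl)
    finally show "s ?x y = g y" using ex[OF y] by simp
  qed
qed

text \<open>The trace-preserving conditional expectation, obtained as the orthogonal projection for
  the trace inner product but with values in A itself. Its existence on all of A comes from
  \<open>riesz\<close> on the finite-dimensional stage.\<close>

definition E :: "nat \<Rightarrow> 'a \<Rightarrow> 'a" where
  "E n a = (THE x. x \<in> F n \<and> (\<forall>y\<in>F n. s x y = s a y))"

lemma E_unique: "x \<in> F n \<Longrightarrow> (\<And>y. y \<in> F n \<Longrightarrow> s x y = s a y) \<Longrightarrow> E n a = x"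
  unfolding E_def by (rule the_equality) (auto intro: s_eqI)

lemma E_ex: assumes "a \<in> carrier A" shows "E n a \<in> F n \<and> (\<forall>y\<in>F n. s (E n a) y = s a y)"
proof -
  obtain x where "x \<in> F n" "\<forall>y\<in>F n. s x y = s a y"
    using riesz[of n "\<lambda>y. s a y"] assms by (auto simp: s_add_right s_smult_right)
  thus ?thesis using E_unique[of x n a] by auto
qed

lemma E_F [simp]: "a \<in> carrier A \<Longrightarrow> E n a \<in> F n"
  and E_s: "a \<in> carrier A \<Longrightarrow> y \<in> F n \<Longrightarrow> s (E n a) y = s a y"
  using E_ex by auto

lemma E_closed [simp]: "a \<in> carrier A \<Longrightarrow> E n a \<in> carrier A"
  using E_F F_carrier by blast

lemma E_s_right: "a \<in> carrier A \<Longrightarrow> y \<in> F n \<Longrightarrow> s y (E n a) = s y a"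
  by (subst (1 2) s_cnj) (auto simp: E_s)

lemma E_sym: "\<lbrakk>x \<in> carrier A; y \<in> carrier A\<rbrakk> \<Longrightarrow> s (E n x) y = s x (E n y)"
  using E_s[of x "E n y" n] E_s_right[of y "E n x" n] by simp

lemma E_add: "\<lbrakk>x \<in> carrier A; y \<in> carrier A\<rbrakk> \<Longrightarrow> E n (x \<oplus> y) = E n x \<oplus> E n y"
  by (rule E_unique) (auto simp: s_add E_s)

lemma E_smult: "x \<in> carrier A \<Longrightarrow> E n (c \<odot> x) = c \<odot> E n x"
  by (rule E_unique) (auto simp: s_smult E_s)

lemma E_minus: "\<lbrakk>x \<in> carrier A; y \<in> carrier A\<rbrakk> \<Longrightarrow> E n (x \<ominus> y) = E n x \<ominus> E n y"
  by (rule E_unique) (auto simp: s_minus E_s)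

lemma E_id: "x \<in> F n \<Longrightarrow> E n x = x"
  by (rule E_unique) auto

lemma E_E: "m \<le> n \<Longrightarrow> x \<in> carrier A \<Longrightarrow> E m (E n x) = E m x"
  by (rule E_unique) (auto simp: E_s dest: F_mono)

lemma E_E': "m \<le> n \<Longrightarrow> x \<in> carrier A \<Longrightarrow> E n (E m x) = E m x"
  using F_mono[of m n "E m x"] by (simp add: E_id)

text \<open>Moving a right factor across the inner product needs the trace property, while
  \<open>s_mult_left\<close> needs only the involution. Together they give the bimodule property of
  \<open>E\<close>.\<close>

lemma s_mult_right:
  "\<lbrakk>a \<in> carrier A; x \<in> carrier A; y \<in> carrier A\<rbrakk> \<Longrightarrow> s (a \<otimes> x) y = s a (y \<otimes> star A x)"
  using trace[of "star A y \<otimes> a" x] by (simp add: star_mult m_assoc)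

lemma E_mult_left: "b \<in> F n \<Longrightarrow> x \<in> carrier A \<Longrightarrow> E n (b \<otimes> x) = b \<otimes> E n x"
  by (rule E_unique) (auto simp: s_mult_left E_s)

lemma E_mult_right: "b \<in> F n \<Longrightarrow> x \<in> carrier A \<Longrightarrow> E n (x \<otimes> b) = E n x \<otimes> b"
  by (rule E_unique) (auto simp: s_mult_right E_s)

lemma E_star:
  assumes x: "x \<in> carrier A" shows "E n (star A x) = star A (E n x)"
proof (rule E_unique)
  fix y assume y: "y \<in> F n"
  have *: "s (star A z) y = cnj (s z (star A y))" if "z \<in> carrier A" for z
    using st_star[of "y \<otimes> z"] trace[of "star A y" "star A z"] that y by (simp add: star_mult)
  show "s (star A (E n x)) y = s (star A x) y" using x y by (simp add: * E_s del: star_star)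
qed (use x in simp)

lemma tn_E: "x \<in> carrier A \<Longrightarrow> tn (E n x) \<le> tn x"
  by (rule tn_le_if_s_le) (auto simp: E_s intro: Cauchy_Schwarz)

text \<open>Contractivity in the C*-norm comes from contractivity in the trace norm: on the stage,
  left multiplication by E n x is multiplication by x followed by E n, and the stage detects the
  C*-norm of its elements.\<close>

lemma nrm_E: "x \<in> carrier A \<Longrightarrow> nrm A (E n x) \<le> nrm A x"
proof (rule nrm_le_F[of _ n])
  fix y assume x: "x \<in> carrier A" and y: "y \<in> F n"
  have "tn (E n x \<otimes> y) \<le> tn (x \<otimes> y)" using tn_E[of "x \<otimes> y" n] x y by (simp add: E_mult_right)
  also have "\<dots> \<le> nrm A x * tn y" using x y by (intro tn_mult) auto
  finally show "tn (E n x \<otimes> y) \<le> nrm A x * tn y" .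
qed (auto intro: N_nonneg)

lemma E_lim:
  assumes x: "x \<in> carrier A" shows "(\<lambda>n. nrm A (E n x \<ominus> x)) \<longlonglongrightarrow> 0"
proof (rule null_if_small)
  fix e :: real assume e: "e > 0"
  obtain n y where y: "y \<in> F n" "nrm A (x \<ominus> y) < e / 2" using F_dense[OF x, of "e / 2"] e by auto
  have "nrm A (E m x \<ominus> x) \<le> e" if "m \<ge> n" for m
  proof -
    have "E m y = y" using F_mono[OF that y(1)] by (rule E_id)
    hence "nrm A (E m x \<ominus> x) \<le> nrm A (E m (x \<ominus> y)) + nrm A (y \<ominus> x)"
      using N_triangle[of "E m x" y x] x y by (simp add: E_minus)
    also have "\<dots> \<le> e" using nrm_E[of "x \<ominus> y" m] x y N_minus_commute[of x y] by simp
    finally show ?thesis .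
  qed
  thus "\<exists>M. \<forall>n\<ge>M. nrm A (E n x \<ominus> x) \<le> e" by blast
qed (use x in \<open>auto intro: N_nonneg\<close>)

lemma E_0: "x \<in> carrier A \<Longrightarrow> E 0 x = \<tau> x \<odot> \<one>"
proof (rule E_unique)
  fix y assume x: "x \<in> carrier A" and "y \<in> F 0"
  then obtain c where "y = c \<odot> \<one>" using F_0 by blast
  thus "s (\<tau> x \<odot> \<one>) y = s x y" using x by (simp add: star_smult smult_mult_left smult_smult st_smult)
qed auto

text \<open>The projection Q_j of the GNS space, realized on A. At j = 0 the truncated index j - 1
  makes it zero; the operator uses only j \<ge> 1.\<close>

definition q :: "nat \<Rightarrow> 'a \<Rightarrow> 'a" where "q j x = E j x \<ominus> E (j - 1) x"

lemma q_F [simp]: "x \<in> carrier A \<Longrightarrow> q j x \<in> F j"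
  using F_mono[of "j - 1" j "E (j - 1) x"] by (simp add: q_def)

lemma q_closed [simp]: "x \<in> carrier A \<Longrightarrow> q j x \<in> carrier A"
  using q_F F_carrier by blast

lemma q_smult: "x \<in> carrier A \<Longrightarrow> q j (c \<odot> x) = c \<odot> q j x"
  by (simp add: q_def E_smult smult_minus)

lemma q_sym: "\<lbrakk>x \<in> carrier A; y \<in> carrier A\<rbrakk> \<Longrightarrow> s (q j x) y = s x (q j y)"
  by (simp add: q_def s_minus s_minus_right E_sym)

lemma q_zero: "x \<in> F n \<Longrightarrow> n < j \<Longrightarrow> q j x = \<zero>"
  using F_mono[of n j x] F_mono[of n "j - 1" x] by (simp add: q_def E_id)

lemma q_E: "j \<le> n \<Longrightarrow> x \<in> carrier A \<Longrightarrow> q j (E n x) = q j x"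
  by (simp add: q_def E_E)

text \<open>Beyond stage n both expectations in q j are linear over F n. This commutation is the
  reason why an element of stage n sees only the first n summands of the operator.\<close>

lemma q_mult_left: "b \<in> F n \<Longrightarrow> n < j \<Longrightarrow> x \<in> carrier A \<Longrightarrow> q j (b \<otimes> x) = b \<otimes> q j x"
  using F_mono[of n j b] F_mono[of n "j - 1" b]
  by (simp add: q_def E_mult_left a_minus_def r_distr r_minus)

lemma q_q: "x \<in> carrier A \<Longrightarrow> i \<noteq> j \<Longrightarrow> q i (q j x) = \<zero>"
  and q_idem: "x \<in> carrier A \<Longrightarrow> q j (q j x) = q j x"
proof -
  have *: "q i (q j x) = (if i = j then q j x else \<zero>)" if x: "x \<in> carrier A" for i j
  proof (cases "i < j")
    case True
    hence "E i (q j x) = \<zero>" "E (i - 1) (q j x) = \<zero>" using x by (auto simp: q_def E_minus E_E)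
    thus ?thesis using True by (simp add: q_def[of i])
  next
    case False
    show ?thesis
    proof (cases "i = j")
      case True
      have "E j (q j x) = q j x" using x by (intro E_id) simp
      moreover have "E (j - 1) (q j x) = \<zero>" using x by (auto simp: q_def E_minus E_E E_E' E_id)
      ultimately show ?thesis using True x by (simp add: q_def[of j "q j x"])
    next
      case False
      thus ?thesis using \<open>\<not> i < j\<close> x q_zero[of "q j x" j i] by simp
    qed
  qed
  show "x \<in> carrier A \<Longrightarrow> i \<noteq> j \<Longrightarrow> q i (q j x) = \<zero>" "x \<in> carrier A \<Longrightarrow> q j (q j x) = q j x"
    using * by auto
qed

lemma q_orth: "\<lbrakk>x \<in> carrier A; y \<in> carrier A; i \<noteq> j\<rbrakk> \<Longrightarrow> s (q i x) (q j y) = 0"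
  using q_sym[of "q i x" y j] by (simp add: q_q)

lemma q_one: "q j \<one> = \<zero>"
  by (simp add: q_def E_id)

lemma tn_q: "x \<in> carrier A \<Longrightarrow> tn (q j x) \<le> tn x"
proof (rule tn_le_if_s_le)
  assume x: "x \<in> carrier A"
  have "s (q j x) (q j x) = s x (q j x)" using x q_sym[of x "q j x" j] by (simp add: q_idem)
  thus "cmod (s (q j x) (q j x)) \<le> tn x * tn (q j x)" using x by (simp add: Cauchy_Schwarz)
qed auto

end

section \<open>The GNS space\<close>

lemma connect_id: "connect (\<lambda>_ x. x) n k x = x"
  by (induction k) simp_all

context filt
begin

sublocale G: vsys "\<lambda>_. A" "\<lambda>_. tn" "\<lambda>_ x. x"
  by (rule vsys.intro) (auto intro: T.snorm_axioms)

lemma gns_seqs_eq: "gns_seqs A \<tau> = G.S"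
proof (rule Set.set_eqI, rule iffI)
  fix x assume "x \<in> gns_seqs A \<tau>"
  hence c: "\<And>n. x n \<in> carrier A" and s: "\<And>\<epsilon>. \<epsilon> > 0 \<Longrightarrow> \<exists>N. \<forall>m\<ge>N. \<forall>n\<ge>N. tn (x m \<ominus> x n) < \<epsilon>"
    unfolding gns_seqs_def by auto
  have "\<exists>N. \<forall>n\<ge>N. \<forall>k. G.dev x n k < \<epsilon>" if e: "\<epsilon> > 0" for \<epsilon>
  proof -
    obtain N where "\<And>m n. m \<ge> N \<Longrightarrow> n \<ge> N \<Longrightarrow> tn (x m \<ominus> x n) < \<epsilon>" using s[OF e] by blast
    thus ?thesis by (intro exI[of _ N]) (simp add: G.dev_def connect_id)
  qed
  thus "x \<in> G.S" using c unfolding G.S_def by blast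
next
  fix x assume x: "x \<in> G.S"
  have c: "x n \<in> carrier A" for n using x by (rule G.S_carrier)
  have "\<exists>N. \<forall>m\<ge>N. \<forall>n\<ge>N. tn (x m \<ominus> x n) < \<epsilon>" if e: "\<epsilon> > 0" for \<epsilon>
  proof -
    obtain M where M: "\<And>k. G.dev x M k < \<epsilon> / 2" using G.S_small[OF x, of "\<epsilon> / 2"] e by auto
    have *: "tn (x m \<ominus> x M) < \<epsilon> / 2" if "m \<ge> M" for m
      using M[of "m - M"] that by (simp add: G.dev_def connect_id)
    have "tn (x m \<ominus> x n) < \<epsilon>" if "m \<ge> M" "n \<ge> M" for m n
      using T.N_triangle[of "x m" "x M" "x n"] T.N_minus_commute[of "x M" "x n"]
        *[OF that(1)] *[OF that(2)] c by simp
    thus ?thesis by blast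
  qed
  thus "x \<in> gns_seqs A \<tau>" using c unfolding gns_seqs_def by blast
qed

lemma gns_rel_eq: "gns_rel A \<tau> = G.r"
  by (simp add: gns_rel_def G.r_def gns_seqs_eq)

abbreviation "H \<equiv> gns A \<tau>"
abbreviation "hn \<equiv> ip_norm (gns A \<tau>)"

lemma ip_rep: "ip H X Y = lim (\<lambda>n. s (rep X n) (rep Y n))"
  by (simp add: gns_def Let_def)

sublocale G: vsys_lim "\<lambda>_. A" "\<lambda>_. tn" "\<lambda>_ x. x" H hn
proof (rule vsys_lim.intro, rule G.vsys_axioms, rule vsys_lim_axioms.intro)
  show "carrier H = G.S // G.r"
    by (simp add: gns_def Let_def gns_seqs_eq gns_rel_eq)
  show "\<zero>\<^bsub>H\<^esub> = G.cls (\<lambda>n. \<zero>)"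
    by (simp add: gns_def Let_def gns_rel_eq G.cls_def)
  show "G.cls x \<oplus>\<^bsub>H\<^esub> G.cls y = lift2 G.r (\<lambda>n. (\<oplus>)) (G.cls x) (G.cls y)" for x y
    by (simp add: gns_def Let_def gns_rel_eq)
  show "c \<odot>\<^bsub>H\<^esub> G.cls x = lift1 G.r (\<lambda>n. (\<odot>) c) (G.cls x)" for x c
    by (simp add: gns_def Let_def gns_rel_eq)
  fix x assume x: "x \<in> G.S"
  let ?y = "rep (G.cls x)"
  have y: "?y \<in> G.S" "G.cls ?y = G.cls x" using G.rep_S[OF G.cls_in[OF x]] by auto
  have "(\<lambda>n. complex_of_real ((tn (?y n))\<^sup>2)) \<longlonglongrightarrow> complex_of_real ((G.nn ?y)\<^sup>2)"
    by (intro tendsto_of_real tendsto_power G.nn_lim y)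
  moreover have "s (?y n) (?y n) = complex_of_real ((tn (?y n))\<^sup>2)" for n
    using G.S_carrier[OF y(1)] by (rule s_self)
  ultimately have "ip H (G.cls x) (G.cls x) = complex_of_real ((G.nn ?y)\<^sup>2)"
    unfolding ip_rep by (simp add: limI)
  thus "hn (G.cls x) = G.nn x"
    using G.nn_nonneg[OF x] G.nn_cls_cong[OF y(1) x y(2)] by (simp add: ip_norm_def)
qed

text \<open>\<open>ip\<close> is defined as a limit along chosen representatives, and
  \<open>lim\<close> carries no convergence. Polarization expresses the inner product through norms,
  which are already known to converge and to depend on the class alone.\<close>

definition pol :: "(nat \<Rightarrow> 'a) set \<Rightarrow> (nat \<Rightarrow> 'a) set \<Rightarrow> complex" where
  "pol X Y = (1/4) * (\<Sum>c\<in>{1, -1, \<i>, -\<i>}. c * complex_of_real ((hn (X \<oplus>\<^bsub>H\<^esub> c \<odot>\<^bsub>H\<^esub> Y))\<^sup>2))"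

lemma polarization:
  assumes "x \<in> carrier A" "y \<in> carrier A"
  shows "s x y = (1/4) * (\<Sum>c\<in>{1, -1, \<i>, -\<i>}. c * complex_of_real ((tn (x \<oplus> c \<odot> y))\<^sup>2))"
proof -
  have "c * complex_of_real ((tn (x \<oplus> c \<odot> y))\<^sup>2) =
      c * s x x + (c * cnj c) * s x y + c\<^sup>2 * s y x + c * c * cnj c * s y y" for c
    using assms unfolding s_self[of "x \<oplus> c \<odot> y", OF a_closed[OF assms(1) smult_closed[OF assms(2)]], symmetric]
    by (simp add: s_add s_add_right s_smult s_smult_right power2_eq_square algebra_simps)
  note * = this
  \<comment> \<open>The instances of \<open>complex_eq_iff\<close> show that the four units are
    distinct, so that the sum over the set really has four terms.\<close>
  show ?thesis unfolding * by (simp add: complex_eq_iff[of \<i> "- \<i>"] complex_eq_iff[of 1 \<i>] complex_eq_iff[of 1 "-\<i>"]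
     complex_eq_iff[of "-1" \<i>] complex_eq_iff[of "-1" "-\<i>"] field_simps)
qed

lemma pol_lim:
  assumes x: "x \<in> G.S" and y: "y \<in> G.S"
  shows "(\<lambda>n. s (x n) (y n)) \<longlonglongrightarrow> pol (G.cls x) (G.cls y)"
proof -
  have "(\<lambda>n. tn (x n \<oplus> c \<odot> y n)) \<longlonglongrightarrow> hn (G.cls x \<oplus>\<^bsub>H\<^esub> c \<odot>\<^bsub>H\<^esub> G.cls y)" for c
  proof -
    have *: "(\<lambda>n. x n \<oplus> c \<odot> y n) \<in> G.S" using G.S_add[OF x G.S_smult[OF y, of c]] .
    have "hn (G.cls x \<oplus>\<^bsub>H\<^esub> c \<odot>\<^bsub>H\<^esub> G.cls y) = G.nn (\<lambda>n. x n \<oplus> c \<odot> y n)"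
      using x y * G.S_smult[OF y, of c] by (simp add: G.W_add G.W_smult G.NN_cls)
    thus ?thesis using G.nn_lim[OF *] by simp
  qed
  thus ?thesis unfolding pol_def polarization[OF G.S_carrier[OF x] G.S_carrier[OF y]]
    by (intro tendsto_mult tendsto_const tendsto_sum tendsto_of_real tendsto_power)
qed

lemma ip_pol: "X \<in> carrier H \<Longrightarrow> Y \<in> carrier H \<Longrightarrow> ip H X Y = pol X Y"
  using pol_lim[of "rep X" "rep Y"] G.rep_S[of X] G.rep_S[of Y]
  by (simp add: ip_rep limI G.carrier_W)

lemma ip_lim: "x \<in> G.S \<Longrightarrow> y \<in> G.S \<Longrightarrow> (\<lambda>n. s (x n) (y n)) \<longlonglongrightarrow> ip H (G.cls x) (G.cls y)"
  using pol_lim by (simp add: ip_pol)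

lemma ip_eqI:
  "\<lbrakk>x \<in> G.S; y \<in> G.S; \<And>n. s (x n) (y n) = f n; f \<longlonglongrightarrow> l\<rbrakk> \<Longrightarrow> ip H (G.cls x) (G.cls y) = l"
  using ip_lim[of x y] LIMSEQ_unique by auto

sublocale I: sesq H "ip H" hn
proof (rule sesq.intro, rule G.W.cvec_axioms, rule sesq_axioms.intro)
  fix X Y Z assume "X \<in> carrier H" "Y \<in> carrier H" "Z \<in> carrier H"
  then obtain x y z where x: "x \<in> G.S" "X = G.cls x" "y \<in> G.S" "Y = G.cls y" "z \<in> G.S" "Z = G.cls z"
    by (metis G.carrierE)
  have "ip H (G.cls (\<lambda>n. x n \<oplus> y n)) (G.cls z) = ip H (G.cls x) (G.cls z) + ip H (G.cls y) (G.cls z)"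
    by (rule ip_eqI[OF _ _ _ tendsto_add[OF ip_lim ip_lim]])
      (use x G.S_add G.S_carrier in \<open>auto simp: s_add\<close>)
  thus "ip H (X \<oplus>\<^bsub>H\<^esub> Y) Z = ip H X Z + ip H Y Z" using x by (simp add: G.W_add)
next
  fix X Y c assume "X \<in> carrier H" "Y \<in> carrier H"
  then obtain x y where x: "x \<in> G.S" "X = G.cls x" "y \<in> G.S" "Y = G.cls y"
    by (metis G.carrierE)
  have "ip H (G.cls (\<lambda>n. c \<odot> x n)) (G.cls y) = c * ip H (G.cls x) (G.cls y)"
    by (rule ip_eqI[OF _ _ _ tendsto_mult_left[OF ip_lim]])
      (use x G.S_smult G.S_carrier in \<open>auto simp: s_smult\<close>)
  thus "ip H (c \<odot>\<^bsub>H\<^esub> X) Y = c * ip H X Y" using x by (simp add: G.W_smult)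
  have "ip H (G.cls x) (G.cls y) = cnj (ip H (G.cls y) (G.cls x))"
    by (rule ip_eqI[OF _ _ s_cnj tendsto_cnj[OF ip_lim]]) (use x G.S_carrier in auto)
  thus "ip H X Y = cnj (ip H Y X)" using x by simp
next
  fix X assume "X \<in> carrier H"
  then obtain x where x: "x \<in> G.S" "X = G.cls x" by (metis G.carrierE)
  have "0 \<le> Re (s (x n) (x n))" for n using G.S_carrier[OF x(1)] by (rule s_pos)
  thus "0 \<le> Re (ip H X X)"
    unfolding x(2) by (intro LIMSEQ_le_const[OF tendsto_Re[OF ip_lim[OF x(1) x(1)]]]) auto
qed (simp add: ip_norm_def)

section \<open>Vectors from the algebra, the GNS representation and the projections onto the
  stages\<close>

abbreviation "gv \<equiv> gns_vec A \<tau>"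
abbreviation "R \<equiv> gns_rep A \<tau>"

lemma const_S [simp]: "a \<in> carrier A \<Longrightarrow> (\<lambda>_. a) \<in> G.S"
  using gns_seqs_eq by (auto simp: gns_seqs_def)

lemma vec_cls: "gv a = G.cls (\<lambda>_. a)"
  by (simp add: gns_vec_def gns_rel_eq G.cls_def)

lemma vec_closed [simp]: "a \<in> carrier A \<Longrightarrow> gv a \<in> carrier H"
  by (simp add: vec_cls)

lemma vec_add: "\<lbrakk>a \<in> carrier A; b \<in> carrier A\<rbrakk> \<Longrightarrow> gv (a \<oplus> b) = gv a \<oplus>\<^bsub>H\<^esub> gv b"
  by (simp add: vec_cls G.W_add)

lemma vec_smult: "a \<in> carrier A \<Longrightarrow> gv (c \<odot> a) = c \<odot>\<^bsub>H\<^esub> gv a"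
  by (simp add: vec_cls G.W_smult)

lemma vec_minus: "\<lbrakk>a \<in> carrier A; b \<in> carrier A\<rbrakk> \<Longrightarrow> gv (a \<ominus> b) = gv a \<ominus>\<^bsub>H\<^esub> gv b"
  by (simp add: vec_cls G.W_minus)

lemma vec_zero: "gv \<zero> = \<zero>\<^bsub>H\<^esub>"
  by (simp add: vec_cls G.zero_W)

lemma ip_vec [simp]: "\<lbrakk>a \<in> carrier A; b \<in> carrier A\<rbrakk> \<Longrightarrow> ip H (gv a) (gv b) = s a b"
  unfolding vec_cls by (rule ip_eqI[where f = "\<lambda>_. s a b"]) auto

lemma hn_vec [simp]: "a \<in> carrier A \<Longrightarrow> hn (gv a) = tn a"
  by (simp add: ip_norm_def tau_norm_def)

lemma vec_dense: "\<lbrakk>h \<in> carrier H; \<epsilon> > 0\<rbrakk> \<Longrightarrow> \<exists>a\<in>carrier A. hn (h \<ominus>\<^bsub>H\<^esub> gv a) < \<epsilon>"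
proof -
  assume "h \<in> carrier H" "\<epsilon> > 0"
  then obtain n b where b: "b \<in> carrier A" "hn (h \<ominus>\<^bsub>H\<^esub> G.incl n b) < \<epsilon>" using G.incl_dense by blast
  have "G.incl n b = gv b"
    unfolding G.incl_def vec_cls using b
    by (intro G.cls_eqI[of _ _ n] G.emb_S const_S) (auto simp: G.emb_def connect_id)
  thus ?thesis using b by auto
qed

lemma R_cls: "a \<in> carrier A \<Longrightarrow> x \<in> G.S \<Longrightarrow> (\<lambda>n. a \<otimes> x n) \<in> G.S \<and> R a (G.cls x) = G.cls (\<lambda>n. a \<otimes> x n)"
proof -
  assume a: "a \<in> carrier A" and x: "x \<in> G.S"
  have l: "a \<otimes> u \<ominus> a \<otimes> v = a \<otimes> (u \<ominus> v)" if "u \<in> carrier A" "v \<in> carrier A" for u v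
    using that a by (simp add: a_minus_def r_distr r_minus)
  have S: "(\<lambda>n. a \<otimes> y n) \<in> G.S" if y: "y \<in> G.S" for y
    by (rule G.S_le[OF _ y y, of _ "nrm A a" 0])
      (use a G.S_carrier[OF y] in \<open>auto simp: G.dev_def connect_id l intro: tn_mult N_nonneg\<close>)
  show ?thesis unfolding gns_rep_def gns_rel_eq
    by (intro conjI S x G.lift1_cls[where C = "nrm A a"]) (use a in \<open>auto simp: l intro: tn_mult\<close>)
qed

lemma R_closed [simp]: "a \<in> carrier A \<Longrightarrow> h \<in> carrier H \<Longrightarrow> R a h \<in> carrier H"
  by (auto elim!: G.carrierE simp: R_cls)

lemma R_vec: "a \<in> carrier A \<Longrightarrow> b \<in> carrier A \<Longrightarrow> R a (gv b) = gv (a \<otimes> b)"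
  by (simp add: vec_cls R_cls)

lemma hn_R: "a \<in> carrier A \<Longrightarrow> h \<in> carrier H \<Longrightarrow> hn (R a h) \<le> nrm A a * hn h"
proof -
  assume a: "a \<in> carrier A" and "h \<in> carrier H"
  then obtain x where x: "x \<in> G.S" "h = G.cls x" by (metis G.carrierE)
  have "G.nn (\<lambda>n. a \<otimes> x n) \<le> nrm A a * G.nn x"
    by (rule LIMSEQ_le[OF G.nn_lim tendsto_mult_left[OF G.nn_lim]])
      (use a x R_cls G.S_carrier[OF x(1)] in \<open>auto intro!: tn_mult exI[of _ 0]\<close>)
  thus ?thesis using a x R_cls[OF a x(1)] by (simp add: G.NN_cls)
qed

lemma R_adj:
  assumes a: "a \<in> carrier A" and h: "h \<in> carrier H" and y: "y \<in> carrier A"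
  shows "ip H (R a h) (gv y) = ip H h (gv (star A a \<otimes> y))"
proof -
  obtain x where x: "x \<in> G.S" "h = G.cls x" using h by (metis G.carrierE)
  have "ip H (G.cls (\<lambda>n. a \<otimes> x n)) (G.cls (\<lambda>_. y)) = ip H (G.cls x) (G.cls (\<lambda>_. star A a \<otimes> y))"
    by (rule ip_eqI[OF _ _ _ ip_lim]) (use a x y R_cls G.S_carrier s_mult_left in auto)
  thus ?thesis using a x R_cls[OF a x(1)] by (simp add: vec_cls)
qed

text \<open>The projection of a GNS vector onto stage n, as an element of A rather than as a class
  of sequences; computations with the operator can then be carried out inside A.\<close>

definition p :: "nat \<Rightarrow> (nat \<Rightarrow> 'a) set \<Rightarrow> 'a" where
  "p n h = (SOME x. x \<in> F n \<and> (\<forall>y\<in>F n. s x y = ip H h (gv y)))"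

lemma p_ex: assumes "h \<in> carrier H" shows "p n h \<in> F n \<and> (\<forall>y\<in>F n. s (p n h) y = ip H h (gv y))"
proof -
  obtain x where x: "x \<in> F n \<and> (\<forall>y\<in>F n. s x y = ip H h (gv y))"
    using riesz[of n "\<lambda>y. ip H h (gv y)"] assms
    by (auto simp: vec_add vec_smult I.s_add_right I.s_smult_right)
  show ?thesis unfolding p_def using x by (rule someI)
qed

lemma p_F [simp]: "h \<in> carrier H \<Longrightarrow> p n h \<in> F n"
  and p_s: "h \<in> carrier H \<Longrightarrow> y \<in> F n \<Longrightarrow> s (p n h) y = ip H h (gv y)"
  using p_ex by auto

lemma p_closed [simp]: "h \<in> carrier H \<Longrightarrow> p n h \<in> carrier A"
  using p_F F_carrier by blast

lemma p_vec: "a \<in> carrier A \<Longrightarrow> p n (gv a) = E n a"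
  by (rule s_eqI[of _ n]) (auto simp: p_s E_s)

lemma p_minus: "h \<in> carrier H \<Longrightarrow> k \<in> carrier H \<Longrightarrow> p n (h \<ominus>\<^bsub>H\<^esub> k) = p n h \<ominus> p n k"
  by (rule s_eqI[of _ n]) (auto simp: p_s I.s_minus s_minus)

lemma E_p: "m \<le> n \<Longrightarrow> h \<in> carrier H \<Longrightarrow> E m (p n h) = p m h"
  by (rule E_unique) (auto simp: p_s dest: F_mono)

lemma tn_p: "h \<in> carrier H \<Longrightarrow> tn (p n h) \<le> hn h"
proof (rule tn_le_if_s_le)
  assume h: "h \<in> carrier H"
  show "cmod (s (p n h) (p n h)) \<le> hn h * tn (p n h)"
    using h I.Cauchy_Schwarz[of h "gv (p n h)"] by (simp add: p_s)
qed auto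

text \<open>Strong convergence of the projections to the identity: h is close to a vector of A, on
  which \<open>E_lim\<close> gives even norm convergence, and projections are contractive.\<close>

lemma p_lim: assumes h: "h \<in> carrier H" shows "(\<lambda>n. hn (gv (p n h) \<ominus>\<^bsub>H\<^esub> h)) \<longlonglongrightarrow> 0"
proof (rule null_if_small)
  fix e :: real assume e: "e > 0"
  obtain a where a: "a \<in> carrier A" "hn (h \<ominus>\<^bsub>H\<^esub> gv a) < e / 3" using vec_dense[OF h, of "e / 3"] e by auto
  have "\<forall>\<^sub>F n in sequentially. nrm A (E n a \<ominus> a) < e / 3"
    using order_tendstoD(2)[OF E_lim[OF a(1)], of "e / 3"] e by simp
  then obtain M where M: "\<And>n. n \<ge> M \<Longrightarrow> nrm A (E n a \<ominus> a) < e / 3" by (auto simp: eventually_sequentially)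
  have "hn (gv (p n h) \<ominus>\<^bsub>H\<^esub> h) \<le> e" if n: "n \<ge> M" for n
  proof -
    have "hn (gv (p n h) \<ominus>\<^bsub>H\<^esub> h) \<le> hn (gv (p n h) \<ominus>\<^bsub>H\<^esub> gv (E n a)) + (hn (gv (E n a) \<ominus>\<^bsub>H\<^esub> gv a) + hn (gv a \<ominus>\<^bsub>H\<^esub> h))"
      using G.W.N_triangle[of "gv (p n h)" "gv (E n a)" h] G.W.N_triangle[of "gv (E n a)" "gv a" h] a h by simp
    also have "hn (gv (p n h) \<ominus>\<^bsub>H\<^esub> gv (E n a)) \<le> hn (h \<ominus>\<^bsub>H\<^esub> gv a)"
      using tn_p[of "h \<ominus>\<^bsub>H\<^esub> gv a" n] a h by (simp add: p_minus p_vec vec_minus[symmetric])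
    also have "hn (gv (E n a) \<ominus>\<^bsub>H\<^esub> gv a) \<le> nrm A (E n a \<ominus> a)"
      using a tn_le_nrm[of "E n a \<ominus> a"] by (simp add: vec_minus[symmetric])
    finally show ?thesis using a h M[OF n] G.W.N_minus_commute[of h "gv a"] by simp
  qed
  thus "\<exists>M. \<forall>n\<ge>M. hn (gv (p n h) \<ominus>\<^bsub>H\<^esub> h) \<le> e" by blast
qed (use h in \<open>auto intro!: G.W.N_nonneg\<close>)

lemma ip_tendsto:
  assumes h: "\<And>n. f n \<in> carrier H" "h \<in> carrier H" "(\<lambda>n. hn (f n \<ominus>\<^bsub>H\<^esub> h)) \<longlonglongrightarrow> 0" and k: "k \<in> carrier H"
  shows "(\<lambda>n. ip H (f n) k) \<longlonglongrightarrow> ip H h k"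
proof (rule LIM_zero_cancel, rule tendsto_norm_zero_cancel, rule null_le)
  show "(\<lambda>n. hn (f n \<ominus>\<^bsub>H\<^esub> h) * hn k) \<longlonglongrightarrow> 0" using tendsto_mult_left_zero[OF h(3)] .
  show "norm (ip H (f n) k - ip H h k) \<le> hn (f n \<ominus>\<^bsub>H\<^esub> h) * hn k" for n
    using I.Cauchy_Schwarz[of "f n \<ominus>\<^bsub>H\<^esub> h" k] h k by (simp add: I.s_minus)
qed auto

lemma ci_P_eq:
  assumes h: "h \<in> carrier H" shows "ci_P A F \<tau> n h = gv (p n h)"
  unfolding ci_P_def ortho_proj_def
proof (rule the_equality)
  show "gv (p n h) \<in> gv ` F n \<and> (\<forall>w\<in>gv ` F n. ip H (h \<ominus>\<^bsub>H\<^esub> gv (p n h)) w = 0)"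
    using h by (auto simp: I.s_minus p_s)
  fix v assume v: "v \<in> gv ` F n \<and> (\<forall>w\<in>gv ` F n. ip H (h \<ominus>\<^bsub>H\<^esub> v) w = 0)"
  then obtain x where x: "x \<in> F n" "v = gv x" by auto
  have "x = p n h"
    by (rule s_eqI[OF x(1)]) (use v x h in \<open>auto simp: I.s_minus p_s\<close>)
  thus "v = gv (p n h)" using x by simp
qed

lemma ci_Q_eq: "h \<in> carrier H \<Longrightarrow> ci_Q A F \<tau> n h = gv (q n (p n h))"
  by (simp add: ci_Q_def ci_P_eq vec_minus q_def E_id E_p)

end

section \<open>The commutator with the Christensen--Ivan operator\<close>

locale ci = filt A \<tau> F for A :: "'a cstar" (structure) and \<tau> F +
  fixes \<beta> :: "nat \<Rightarrow> real"
  assumes \<beta>_pos: "j \<ge> 1 \<Longrightarrow> \<beta> j > 0" and \<beta>_summable: "summable \<beta>"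
begin

definition \<kappa> :: "nat \<Rightarrow> real" where "\<kappa> = ci_coeff A F \<tau> \<beta>"

text \<open>The operator D cut off after m summands. It stays inside A and agrees with D on stage m
  (\<open>dsum_stable\<close>, \<open>vec_dom\<close>).\<close>

definition dsum :: "nat \<Rightarrow> 'a \<Rightarrow> 'a" where
  "dsum m x = lcomb A (\<lambda>j. complex_of_real (\<kappa> (Suc j))) (\<lambda>j. q (Suc j) x) m"

lemma dsum_0 [simp]: "dsum 0 x = \<zero>"
  by (simp add: dsum_def)

lemma dsum_Suc: "dsum (Suc m) x = dsum m x \<oplus> complex_of_real (\<kappa> (Suc m)) \<odot> q (Suc m) x"
  by (simp add: dsum_def)

lemma dsum_F [simp]: "x \<in> carrier A \<Longrightarrow> dsum m x \<in> F m"
proof -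
  assume x: "x \<in> carrier A"
  have "q (Suc j) x \<in> F m" if "j < m" for j using F_mono[of "Suc j" m "q (Suc j) x"] x that by simp
  thus ?thesis unfolding dsum_def by (intro F_lcomb)
qed

lemma dsum_closed [simp]: "x \<in> carrier A \<Longrightarrow> dsum m x \<in> carrier A"
  using dsum_F F_carrier by blast

lemma dsum_smult: "x \<in> carrier A \<Longrightarrow> dsum m (c \<odot> x) = c \<odot> dsum m x"
  by (simp add: dsum_def q_smult lcomb_smult)

lemma dsum_one: "dsum m \<one> = \<zero>"
  by (induction m) (auto simp: dsum_Suc q_one)

lemma dsum_sym: "\<lbrakk>x \<in> carrier A; y \<in> carrier A\<rbrakk> \<Longrightarrow> s (dsum m x) y = s x (dsum m y)"
  by (simp add: dsum_def s_lcomb s_lcomb_right q_sym)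

lemma dsum_stable: assumes x: "x \<in> F m" and mn: "m \<le> n" shows "dsum n x = dsum m x"
  using mn by (induction n rule: dec_induct) (use x q_zero[OF x] in \<open>auto simp: dsum_Suc\<close>)

lemma dsum_E: "m \<le> n \<Longrightarrow> x \<in> carrier A \<Longrightarrow> dsum m (E n x) = dsum m x"
  unfolding dsum_def by (rule lcomb_cong) (auto simp: q_E)

lemma dsum_p: "m \<le> n \<Longrightarrow> h \<in> carrier H \<Longrightarrow> dsum m (p n h) = dsum m (p m h)"
  using dsum_E[of m m "p n h"] by (simp add: E_p)

lemma s_dsum_q: "x \<in> carrier A \<Longrightarrow> m < j \<Longrightarrow> s (dsum m x) (q j x) = 0"
  by (simp add: dsum_def s_lcomb q_orth)

lemma tn_dsum_diff:
  assumes x: "x \<in> carrier A" and "m \<le> n"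
  shows "(tn (dsum n x \<ominus> dsum m x))\<^sup>2 = (\<Sum>j=m..<n. (\<kappa> (Suc j))\<^sup>2 * (tn (q (Suc j) x))\<^sup>2)"
  using \<open>m \<le> n\<close>
proof (induction n rule: dec_induct)
  case base show ?case using x by (simp add: tau_norm_def)
next
  case (step n)
  let ?u = "dsum n x \<ominus> dsum m x" and ?v = "complex_of_real (\<kappa> (Suc n)) \<odot> q (Suc n) x"
  have e: "dsum (Suc n) x \<ominus> dsum m x = ?u \<oplus> ?v"
    using x by (simp add: dsum_Suc a_minus_def a_ac)
  have o: "s ?u ?v = 0" "s ?v ?u = 0"
    using x step(1) s_dsum_q[of x n "Suc n"] s_dsum_q[of x m "Suc n"] s_cnj[of ?v ?u]
    by (simp_all add: s_smult_right s_minus)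
  have "(tn (dsum (Suc n) x \<ominus> dsum m x))\<^sup>2 = (tn ?u)\<^sup>2 + (tn ?v)\<^sup>2"
    unfolding e using x o by (simp add: tn_sq s_add s_add_right)
  thus ?case using step x by (simp add: tn_smult power_mult_distrib)
qed

lemma tn_dsum: "x \<in> carrier A \<Longrightarrow> (tn (dsum n x))\<^sup>2 = (\<Sum>j<n. (\<kappa> (Suc j))\<^sup>2 * (tn (q (Suc j) x))\<^sup>2)"
  using tn_dsum_diff[of x 0 n] by (simp add: lessThan_atLeast0)

text \<open>The matrix coefficient of the commutator of D with a, where in the first term D has been
  moved to y by symmetry. It makes sense whether or not a x lies in the domain of D.\<close>

definition Wf :: "nat \<Rightarrow> 'a \<Rightarrow> 'a \<Rightarrow> 'a \<Rightarrow> complex" where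
  "Wf m a x y = s (a \<otimes> x) (dsum m y) - s (a \<otimes> dsum m x) y"

text \<open>The weak form of \<open>\<parallel>[Dop, a]\<parallel> \<le> C\<close> on the union of the finite-dimensional stages.\<close>

definition lipb :: "real \<Rightarrow> 'a \<Rightarrow> bool" where
  "lipb C a \<longleftrightarrow> (\<forall>m. \<forall>x\<in>F m. \<forall>y\<in>F m. cmod (Wf m a x y) \<le> C * tn x * tn y)"

section \<open>The domain of the operator and the weak form of the commutator bound\<close>

abbreviation "cdom \<equiv> ci_dom A F \<tau> \<beta>"
abbreviation "Dop \<equiv> ci_D A F \<tau> \<beta>"

lemma q_p: "j \<le> n \<Longrightarrow> h \<in> carrier H \<Longrightarrow> q j (p n h) = q j (p j h)"
  using q_E[of j j "p n h"] by (simp add: E_p)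

lemma dom_iff: "h \<in> cdom \<longleftrightarrow> h \<in> carrier H \<and> summable (\<lambda>j. (\<kappa> (Suc j))\<^sup>2 * (tn (q (Suc j) (p (Suc j) h)))\<^sup>2)"
  by (auto simp: ci_dom_def ci_Q_eq \<kappa>_def)

lemma finsum_Q: "h \<in> carrier H \<Longrightarrow>
    (\<Oplus>\<^bsub>H\<^esub>n\<in>{1..N}. complex_of_real (ci_coeff A F \<tau> \<beta> n) \<odot>\<^bsub>H\<^esub> ci_Q A F \<tau> n h) = gv (dsum N (p N h))"
proof (induction N)
  case (Suc N)
  have "{1..Suc N} = insert (Suc N) {1..N}" by auto
  hence "(\<Oplus>\<^bsub>H\<^esub>n\<in>{1..Suc N}. complex_of_real (ci_coeff A F \<tau> \<beta> n) \<odot>\<^bsub>H\<^esub> ci_Q A F \<tau> n h)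
      = complex_of_real (\<kappa> (Suc N)) \<odot>\<^bsub>H\<^esub> gv (q (Suc N) (p (Suc N) h)) \<oplus>\<^bsub>H\<^esub> gv (dsum N (p N h))"
    using Suc by (simp add: G.W.finsum_insert Pi_def ci_Q_eq \<kappa>_def)
  also have "\<dots> = gv (dsum (Suc N) (p (Suc N) h))"
    using Suc.prems dsum_p[of N "Suc N" h] by (simp add: dsum_Suc vec_add vec_smult G.W.a_comm)
  finally show ?case .
qed (simp add: vec_zero)

text \<open>By orthogonality of the q j (\<open>tn_dsum_diff\<close>) the squared distances of the
  partial sums are sections of the series that defines the domain. Completeness of the GNS space
  yields the limit, so the description in \<open>ci_D\<close> denotes it.\<close>

lemma D_lim:
  assumes h: "h \<in> cdom"
  shows "Dop h \<in> carrier H \<and> (\<lambda>N. hn (gv (dsum N (p N h)) \<ominus>\<^bsub>H\<^esub> Dop h)) \<longlonglongrightarrow> 0"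
proof -
  have hc: "h \<in> carrier H" using h by (simp add: dom_iff)
  define f where "f j = (\<kappa> (Suc j))\<^sup>2 * (tn (q (Suc j) (p (Suc j) h)))\<^sup>2" for j
  have f: "summable f" using h unfolding dom_iff f_def by simp
  have d: "(hn (gv (dsum n (p n h)) \<ominus>\<^bsub>H\<^esub> gv (dsum m (p m h))))\<^sup>2 = sum f {m..<n}" if "m \<le> n" for m n
  proof -
    have "(hn (gv (dsum n (p n h)) \<ominus>\<^bsub>H\<^esub> gv (dsum m (p m h))))\<^sup>2 = (tn (dsum n (p n h) \<ominus> dsum m (p n h)))\<^sup>2"
      using hc dsum_p[OF that hc] by (simp add: vec_minus[symmetric])
    also have "\<dots> = (\<Sum>j=m..<n. (\<kappa> (Suc j))\<^sup>2 * (tn (q (Suc j) (p n h)))\<^sup>2)"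
      using hc that by (intro tn_dsum_diff) auto
    also have "\<dots> = sum f {m..<n}"
      unfolding f_def using hc by (intro sum.cong refl) (simp add: q_p[of "Suc _" n])
    finally show ?thesis .
  qed
  have "\<exists>v\<in>carrier H. (\<lambda>n. hn (gv (dsum n (p n h)) \<ominus>\<^bsub>H\<^esub> v)) \<longlonglongrightarrow> 0"
  proof (rule G.complete_W)
    fix e :: real assume e: "e > 0"
    obtain M where M: "\<And>m n. m \<ge> M \<Longrightarrow> norm (sum f {m..<n}) < e\<^sup>2"
      using f e unfolding summable_Cauchy by (metis zero_less_power)
    have *: "hn (gv (dsum n (p n h)) \<ominus>\<^bsub>H\<^esub> gv (dsum m (p m h))) < e" if "M \<le> m" "m \<le> n" for m n
      using d[OF that(2)] M[OF that(1), of n] e by (intro power2_less_imp_less[of _ e]) auto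
    have "hn (gv (dsum m (p m h)) \<ominus>\<^bsub>H\<^esub> gv (dsum n (p n h))) < e" if "m \<ge> M" "n \<ge> M" for m n
      using *[of m n] *[of n m] that hc G.W.N_minus_commute[of "gv (dsum m (p m h))" "gv (dsum n (p n h))"]
      by (cases "m \<le> n") auto
    thus "\<exists>M. \<forall>m\<ge>M. \<forall>n\<ge>M. hn (gv (dsum m (p m h)) \<ominus>\<^bsub>H\<^esub> gv (dsum n (p n h))) < e" by blast
  qed (use hc in simp)
  then obtain v where v: "v \<in> carrier H" "(\<lambda>n. hn (gv (dsum n (p n h)) \<ominus>\<^bsub>H\<^esub> v)) \<longlonglongrightarrow> 0" by blast
  have "Dop h = v"
    unfolding ci_D_def Let_def finsum_Q[OF hc]
  proof (rule the_equality)
    fix w assume w: "w \<in> carrier H \<and> (\<lambda>N. hn (gv (dsum N (p N h)) \<ominus>\<^bsub>H\<^esub> w)) \<longlonglongrightarrow> 0"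
    have "hn (w \<ominus>\<^bsub>H\<^esub> v) = 0"
      by (rule G.W.lim_unique[OF _ _ v(1) conjunct2[OF w] v(2)]) (use w hc in simp_all)
    hence "w \<ominus>\<^bsub>H\<^esub> v = \<zero>\<^bsub>H\<^esub>" using G.NN_eq_0[of "w \<ominus>\<^bsub>H\<^esub> v"] w v(1) by blast
    thus "w = v" using w v(1) G.W.minus_eq_zero by blast
  qed (use v in auto)
  thus ?thesis using v by simp
qed

lemma D_closed [simp]: "h \<in> cdom \<Longrightarrow> Dop h \<in> carrier H"
  by (rule conjunct1[OF D_lim])

lemma dom_carrier: "h \<in> cdom \<Longrightarrow> h \<in> carrier H"
  by (simp add: dom_iff)

text \<open>Symmetry of D against vectors of a stage: there the partial sums are eventually
  constant, and \<open>dsum_sym\<close> moves them across before the limit is taken.\<close>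

lemma D_ip:
  assumes h: "h \<in> cdom" and y: "y \<in> F m"
  shows "ip H (Dop h) (gv y) = ip H h (gv (dsum m y))"
proof (rule LIMSEQ_unique)
  have hc: "h \<in> carrier H" using h by (rule dom_carrier)
  show "(\<lambda>N. ip H (gv (dsum N (p N h))) (gv y)) \<longlonglongrightarrow> ip H (Dop h) (gv y)"
    by (rule ip_tendsto[OF _ conjunct1[OF D_lim[OF h]] conjunct2[OF D_lim[OF h]]]) (use hc y in simp_all)
  have *: "ip H (gv (dsum N (p N h))) (gv y) = ip H h (gv (dsum m y))" if N: "N \<ge> m" for N
  proof -
    have "dsum m y \<in> F N" using F_mono[OF N, of "dsum m y"] y by simp
    thus ?thesis
      using hc y dsum_sym[of "p N h" y N] p_s[OF hc, of "dsum m y" N] dsum_stable[OF y N] by simp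
  qed
  show "(\<lambda>N. ip H (gv (dsum N (p N h))) (gv y)) \<longlonglongrightarrow> ip H h (gv (dsum m y))"
    by (rule tendsto_eventually, rule eventually_sequentiallyI, rule *)
qed

lemma vec_dom: assumes x: "x \<in> F m" shows "gv x \<in> cdom" "Dop (gv x) = gv (dsum m x)"
proof -
  have xc: "x \<in> carrier A" using x by simp
  have "q (Suc j) (p (Suc j) (gv x)) = \<zero>" if "j \<ge> m" for j
    using x xc that q_E[of "Suc j" "Suc j" x] q_zero[of x m "Suc j"] by (simp add: p_vec)
  hence z: "(\<kappa> (Suc j))\<^sup>2 * (tn (q (Suc j) (p (Suc j) (gv x))))\<^sup>2 = 0" if "j \<notin> {..<m}" for j using that by simp
  show d: "gv x \<in> cdom" unfolding dom_iff
    by (intro conjI summable_finite[of "{..<m}"] z) (use xc in auto)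
  have "gv (dsum N (p N (gv x))) = gv (dsum m x)" if "N \<ge> m" for N
    using xc dsum_E[of N N x] dsum_stable[OF x that] by (simp add: p_vec)
  hence l: "(\<lambda>N. hn (gv (dsum N (p N (gv x))) \<ominus>\<^bsub>H\<^esub> gv (dsum m x))) \<longlonglongrightarrow> 0"
    using xc by (intro tendsto_eventually) (auto simp: eventually_sequentially intro!: exI[of _ m])
  have "hn (Dop (gv x) \<ominus>\<^bsub>H\<^esub> gv (dsum m x)) = 0"
    by (rule G.W.lim_unique[OF _ _ _ conjunct2[OF D_lim[OF d]] l]) (use D_closed[OF d] xc in simp_all)
  hence "Dop (gv x) \<ominus>\<^bsub>H\<^esub> gv (dsum m x) = \<zero>\<^bsub>H\<^esub>"
    using G.NN_eq_0[of "Dop (gv x) \<ominus>\<^bsub>H\<^esub> gv (dsum m x)"] D_closed[OF d] xc by simp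
  thus "Dop (gv x) = gv (dsum m x)"
    by (rule G.W.minus_eq_zero[OF D_closed[OF d] vec_closed[OF dsum_closed[OF xc]]])
qed

lemma Wf_smult: "\<lbrakk>a \<in> carrier A; x \<in> carrier A; y \<in> carrier A\<rbrakk> \<Longrightarrow> Wf m a (c \<odot> x) y = c * Wf m a x y"
  by (simp add: Wf_def dsum_smult smult_mult_right st_smult algebra_simps)

lemma lipb_if_ci_seminorm_le:
  assumes a: "a \<in> carrier A" and C: "0 \<le> C" and le: "ci_seminorm A F \<tau> \<beta> a \<le> ennreal C"
  shows "lipb C a"
proof -
  \<comment> \<open>A finite value excludes the second branch of the definition, so the
    representation of a preserves the domain.\<close>
  have dm: "\<forall>h\<in>cdom. R a h \<in> cdom"
    using le by (auto simp: ci_seminorm_def Let_def top_unique split: if_splits)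
  have le': "hn (Dop (R a h) \<ominus>\<^bsub>H\<^esub> R a (Dop h)) \<le> C" if h: "h \<in> cdom" "hn h \<le> 1" for h
  proof -
    have "ennreal (hn (Dop (R a h) \<ominus>\<^bsub>H\<^esub> R a (Dop h))) \<le> ennreal C"
      using le dm h by (auto simp: ci_seminorm_def Let_def SUP_le_iff)
    thus ?thesis using C by simp
  qed
  have *: "cmod (Wf m a x y) \<le> C * tn y" if x: "x \<in> F m" "tn x \<le> 1" and y: "y \<in> F m" for m x y
  proof -
    have d: "gv x \<in> cdom" "R a (gv x) \<in> cdom" using vec_dom[OF x(1)] dm by auto
    have "ip H (Dop (R a (gv x))) (gv y) = s (a \<otimes> x) (dsum m y)"
      using D_ip[OF d(2) y] a x y by (simp add: R_vec)
    moreover have "ip H (R a (Dop (gv x))) (gv y) = s (a \<otimes> dsum m x) y"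
      using a x y by (simp add: R_vec vec_dom(2)[OF x(1)])
    ultimately have e: "Wf m a x y = ip H (Dop (R a (gv x)) \<ominus>\<^bsub>H\<^esub> R a (Dop (gv x))) (gv y)"
      using a y d by (simp add: I.s_minus Wf_def)
    have "cmod (Wf m a x y) \<le> hn (Dop (R a (gv x)) \<ominus>\<^bsub>H\<^esub> R a (Dop (gv x))) * hn (gv y)"
      unfolding e using a d y by (intro I.Cauchy_Schwarz) auto
    also have "\<dots> \<le> C * tn y" using le'[OF d(1)] x y by (simp add: mult_right_mono)
    finally show ?thesis .
  qed
  show ?thesis unfolding lipb_def
  proof (intro allI ballI)
    fix m x y assume x: "x \<in> F m" and y: "y \<in> F m"
    show "cmod (Wf m a x y) \<le> C * tn x * tn y"
    proof (cases "tn x = 0")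
      case True
      hence "x = \<zero>" using F_definite[OF x] by blast
      hence "Wf m a x y = 0" using a y Wf_smult[of a \<zero> y m 0] by simp
      thus ?thesis using True by simp
    next
      case False
      hence t: "tn x > 0" using tn_nonneg[OF F_carrier[OF x]] by linarith
      have "cmod (Wf m a (complex_of_real (1 / tn x) \<odot> x) y) \<le> C * tn y"
        using x y t by (intro *) (auto simp: tn_smult norm_divide)
      hence "cmod (Wf m a x y) / tn x \<le> C * tn y"
        using a x y t by (simp add: Wf_smult norm_mult norm_divide)
      thus ?thesis using t by (simp add: divide_simps ac_simps)
    qed
  qed
qed

text \<open>The substance is that a bound on the form alone forces a to preserve the domain: it
  bounds the truncations of D at a h uniformly, and membership in the domain is exactly boundedness
  of the truncations.\<close>

lemma ci_seminorm_le_if_lipb: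
  assumes a: "a \<in> carrier A" and C: "0 \<le> C" and l: "lipb C a"
  shows "ci_seminorm A F \<tau> \<beta> a \<le> ennreal C"
proof -
  \<comment> \<open>The form bound extends from stage vectors to every h of the domain by inserting
    the projections p n h and letting n grow, while y stays in a fixed stage.\<close>
  have key: "cmod (ip H (R a h) (gv (dsum m y)) - ip H (R a (Dop h)) (gv y)) \<le> C * hn h * tn y"
    if h: "h \<in> cdom" and y: "y \<in> F m" for h y m
  proof -
    have hc: "h \<in> carrier H" using h by (rule dom_carrier)
    have yc: "y \<in> carrier A" using y by simp
    have l1: "(\<lambda>n. s (a \<otimes> p n h) (dsum m y)) \<longlonglongrightarrow> ip H (R a h) (gv (dsum m y))"
    proof -
      have "(\<lambda>n. ip H (gv (p n h)) (gv (star A a \<otimes> dsum m y))) \<longlonglongrightarrow> ip H h (gv (star A a \<otimes> dsum m y))"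
        using a hc yc by (intro ip_tendsto p_lim) auto
      thus ?thesis using a hc yc by (simp add: R_adj s_mult_left del: ip_vec) (simp add: s_mult_left)
    qed
    have l2: "(\<lambda>n. s (a \<otimes> dsum n (p n h)) y) \<longlonglongrightarrow> ip H (R a (Dop h)) (gv y)"
    proof -
      have "(\<lambda>n. ip H (gv (dsum n (p n h))) (gv (star A a \<otimes> y))) \<longlonglongrightarrow> ip H (Dop h) (gv (star A a \<otimes> y))"
        by (rule ip_tendsto[OF _ conjunct1[OF D_lim[OF h]] conjunct2[OF D_lim[OF h]]]) (use a hc yc in simp_all)
      thus ?thesis using a hc yc h by (simp add: R_adj s_mult_left del: ip_vec) (simp add: s_mult_left)
    qed
    show ?thesis
    proof (rule LIMSEQ_le_const2[OF tendsto_norm[OF tendsto_diff[OF l1 l2]]], intro exI allI impI)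
      fix n assume n: "m \<le> n"
      have "cmod (Wf n a (p n h) y) \<le> C * tn (p n h) * tn y"
        using l hc F_mono[OF n y] unfolding lipb_def by auto
      also have "\<dots> \<le> C * hn h * tn y"
        using tn_p[OF hc, of n] C yc by (intro mult_right_mono mult_left_mono) auto
      finally show "cmod (s (a \<otimes> p n h) (dsum m y) - s (a \<otimes> dsum n (p n h)) y) \<le> C * hn h * tn y"
        using dsum_stable[OF y n] by (simp add: Wf_def)
    qed
  qed
  have dm: "R a h \<in> cdom" if h: "h \<in> cdom" for h
  proof -
    have hc: "h \<in> carrier H" "R a h \<in> carrier H" using h dom_carrier a by auto
    let ?M = "nrm A a * hn (Dop h) + C * hn h"
    have M0: "0 \<le> ?M" using a C h hc by (intro add_nonneg_nonneg mult_nonneg_nonneg N_nonneg) auto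
    have "tn (dsum m (p m (R a h))) \<le> ?M" for m
    proof (rule tn_le_if_s_le[OF _ _ M0])
      \<comment> \<open>The truncated image is tested against itself: its squared norm is the
        pairing of a h with D y, to which \<open>key\<close> applies, and dividing by the norm of y
        leaves a bound independent of m.\<close>
      let ?y = "dsum m (p m (R a h))"
      have y: "?y \<in> F m" using hc by simp
      have e: "s ?y ?y = ip H (R a h) (gv (dsum m ?y))"
        using hc y dsum_sym[of "p m (R a h)" ?y m] by (simp add: p_s)
      have "cmod (s ?y ?y) \<le> cmod (ip H (R a (Dop h)) (gv ?y)) + C * hn h * tn ?y"
        unfolding e using key[OF h y] norm_triangle_sub[of "ip H (R a h) (gv (dsum m ?y))" "ip H (R a (Dop h)) (gv ?y)"] by simp
      also have "cmod (ip H (R a (Dop h)) (gv ?y)) \<le> hn (R a (Dop h)) * tn ?y"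
        using I.Cauchy_Schwarz[of "R a (Dop h)" "gv ?y"] a h hc by simp
      also have "\<dots> \<le> nrm A a * hn (Dop h) * tn ?y"
        using a h hc by (intro mult_right_mono hn_R) auto
      finally show "cmod (s ?y ?y) \<le> ?M * tn ?y" by (simp add: algebra_simps)
    qed (use hc in simp)
    hence b: "(tn (dsum m (p m (R a h))))\<^sup>2 \<le> ?M\<^sup>2" for m
      using hc by (intro power_mono) auto
    have "summable (\<lambda>j. (\<kappa> (Suc j))\<^sup>2 * (tn (q (Suc j) (p (Suc j) (R a h))))\<^sup>2)"
    proof (rule summableI_nonneg_bounded[where x = "?M\<^sup>2"])
      fix n
      have e: "(\<Sum>j<n. (\<kappa> (Suc j))\<^sup>2 * (tn (q (Suc j) (p (Suc j) (R a h))))\<^sup>2) = (tn (dsum n (p n (R a h))))\<^sup>2"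
        unfolding tn_dsum[OF p_closed[OF hc(2)]] using hc(2)
        by (intro sum.cong refl) (simp add: q_p[of "Suc _" n])
      show "(\<Sum>j<n. (\<kappa> (Suc j))\<^sup>2 * (tn (q (Suc j) (p (Suc j) (R a h))))\<^sup>2) \<le> ?M\<^sup>2"
        unfolding e by (rule b)
    qed (intro mult_nonneg_nonneg zero_le_power2)
    thus ?thesis using hc by (simp add: dom_iff)
  qed
  have "hn (Dop (R a h) \<ominus>\<^bsub>H\<^esub> R a (Dop h)) \<le> C" if h: "h \<in> cdom" and h1: "hn h \<le> 1" for h
  proof -
    have hc: "h \<in> carrier H" using h by (rule dom_carrier)
    let ?k = "Dop (R a h) \<ominus>\<^bsub>H\<^esub> R a (Dop h)"
    have k: "?k \<in> carrier H" using h dm a by simp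
    \<comment> \<open>The norm of the commutator at h is recovered as the limit of the norms of its
      projections, which the weak form bounds uniformly.\<close>
    have *: "tn (p n ?k) \<le> C * hn h" for n
    proof (rule tn_le_if_s_le)
      have y: "p n ?k \<in> F n" using k by simp
      have "s (p n ?k) (p n ?k) = ip H ?k (gv (p n ?k))" using k by (simp add: p_s)
      also have "\<dots> = ip H (R a h) (gv (dsum n (p n ?k))) - ip H (R a (Dop h)) (gv (p n ?k))"
        using k h dm a hc by (simp add: I.s_minus D_ip[OF dm[OF h] y])
      finally show "cmod (s (p n ?k) (p n ?k)) \<le> C * hn h * tn (p n ?k)" using key[OF h y] by simp
    qed (use k C hc in auto)
    have le: "hn ?k \<le> C * hn h + hn (gv (p n ?k) \<ominus>\<^bsub>H\<^esub> ?k)" for n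
      using G.W.N_le_minus[of ?k "gv (p n ?k)"] G.W.N_minus_commute[of ?k "gv (p n ?k)"] k *[of n] by simp
    have "(\<lambda>n. C * hn h + hn (gv (p n ?k) \<ominus>\<^bsub>H\<^esub> ?k)) \<longlonglongrightarrow> C * hn h + 0"
      by (intro tendsto_intros p_lim k)
    from LIMSEQ_le_const[OF this] le have "hn ?k \<le> C * hn h" by simp
    also have "\<dots> \<le> C" using C h1 mult_left_mono[of "hn h" 1 C] by simp
    finally show ?thesis .
  qed
  hence "(SUP h\<in>{h \<in> cdom. hn h \<le> 1}. ennreal (hn (Dop (R a h) \<ominus>\<^bsub>H\<^esub> R a (Dop h)))) \<le> ennreal C"
    by (intro SUP_least) (auto intro: ennreal_leI)
  thus ?thesis using dm by (simp add: ci_seminorm_def Let_def)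
qed

theorem ci_seminorm_le_iff:
  "\<lbrakk>a \<in> carrier A; 0 \<le> C\<rbrakk> \<Longrightarrow> ci_seminorm A F \<tau> \<beta> a \<le> ennreal C \<longleftrightarrow> lipb C a"
  using lipb_if_ci_seminorm_le ci_seminorm_le_if_lipb by blast

end

section \<open>Properties of the Christensen--Ivan seminorm\<close>

context ci
begin

lemma lipbD: "lipb C a \<Longrightarrow> x \<in> F m \<Longrightarrow> y \<in> F m \<Longrightarrow> cmod (Wf m a x y) \<le> C * tn x * tn y"
  by (simp add: lipb_def)

lemma lipb_mono: "lipb C a \<Longrightarrow> C \<le> C' \<Longrightarrow> lipb C' a"
  unfolding lipb_def using tn_nonneg[OF F_carrier]
  by (meson mult_right_mono order_trans)

lemma Wf_add: "\<lbrakk>a \<in> carrier A; b \<in> carrier A; x \<in> carrier A; y \<in> carrier A\<rbrakk> \<Longrightarrow>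
    Wf m (a \<oplus> b) x y = Wf m a x y + Wf m b x y"
  by (simp add: Wf_def l_distr s_add)

lemma Wf_smult_left: "\<lbrakk>a \<in> carrier A; x \<in> carrier A; y \<in> carrier A\<rbrakk> \<Longrightarrow> Wf m (c \<odot> a) x y = c * Wf m a x y"
  by (simp add: Wf_def smult_mult_left s_smult algebra_simps)

lemma Wf_minus: "\<lbrakk>a \<in> carrier A; b \<in> carrier A; x \<in> carrier A; y \<in> carrier A\<rbrakk> \<Longrightarrow>
    Wf m (a \<ominus> b) x y = Wf m a x y - Wf m b x y"
  by (simp add: minus_eq_smult Wf_add Wf_smult_left)

lemma lipb_add:
  assumes a: "a \<in> carrier A" "lipb C a" and b: "b \<in> carrier A" "lipb C' b"
  shows "lipb (C + C') (a \<oplus> b)"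
  unfolding lipb_def
proof (intro allI ballI)
  fix m x y assume xy: "x \<in> F m" "y \<in> F m"
  have "cmod (Wf m (a \<oplus> b) x y) \<le> cmod (Wf m a x y) + cmod (Wf m b x y)"
    using a b xy by (simp add: Wf_add norm_triangle_ineq)
  also have "\<dots> \<le> C * tn x * tn y + C' * tn x * tn y"
    using lipbD[OF a(2) xy] lipbD[OF b(2) xy] by linarith
  finally show "cmod (Wf m (a \<oplus> b) x y) \<le> (C + C') * tn x * tn y" by (simp add: algebra_simps)
qed

lemma lipb_smult:
  assumes a: "a \<in> carrier A" "lipb C a" shows "lipb (cmod c * C) (c \<odot> a)"
  unfolding lipb_def
proof (intro allI ballI)
  fix m x y assume xy: "x \<in> F m" "y \<in> F m"
  show "cmod (Wf m (c \<odot> a) x y) \<le> cmod c * C * tn x * tn y"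
    using mult_left_mono[OF lipbD[OF a(2) xy], of "cmod c"] a xy
    by (simp add: Wf_smult_left norm_mult mult.assoc)
qed

text \<open>The adjoint exchanges the two test vectors and changes the sign, since D is
  symmetric.\<close>

lemma lipb_star:
  assumes a: "a \<in> carrier A" "lipb C a" shows "lipb C (star A a)"
  unfolding lipb_def
proof (intro allI ballI)
  fix m x y assume xy: "x \<in> F m" "y \<in> F m"
  have c: "x \<in> carrier A" "y \<in> carrier A" "dsum m x \<in> carrier A" "dsum m y \<in> carrier A"
    using xy by auto
  have *: "s (star A a \<otimes> u) v = cnj (s (a \<otimes> v) u)" if "u \<in> carrier A" "v \<in> carrier A" for u v
    using s_mult_left[of "star A a" u v] s_cnj[of u "a \<otimes> v"] a(1) that by simp
  have "Wf m (star A a) x y = - cnj (Wf m a y x)"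
    unfolding Wf_def using c by (simp only: * complex_cnj_diff minus_diff_eq)
  thus "cmod (Wf m (star A a) x y) \<le> C * tn x * tn y"
    using lipbD[OF a(2) xy(2,1)] by (simp add: ac_simps)
qed

lemma Wf_bound:
  assumes "a \<in> carrier A" "x \<in> carrier A" "y \<in> carrier A"
  shows "cmod (Wf m a x y) \<le> nrm A a * (tn x * tn (dsum m y) + tn (dsum m x) * tn y)"
proof -
  have 1: "cmod (s (a \<otimes> u) v) \<le> nrm A a * (tn u * tn v)" if "u \<in> carrier A" "v \<in> carrier A" for u v
  proof -
    have "cmod (s (a \<otimes> u) v) \<le> tn (a \<otimes> u) * tn v" using assms that by (intro Cauchy_Schwarz) auto
    also have "\<dots> \<le> (nrm A a * tn u) * tn v" using assms that by (intro mult_right_mono tn_mult) auto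
    finally show ?thesis by (simp add: mult.assoc)
  qed
  have "cmod (Wf m a x y) \<le> cmod (s (a \<otimes> x) (dsum m y)) + cmod (s (a \<otimes> dsum m x) y)"
    unfolding Wf_def by (rule norm_triangle_ineq4)
  also have "\<dots> \<le> nrm A a * (tn x * tn (dsum m y)) + nrm A a * (tn (dsum m x) * tn y)"
    using assms by (intro add_mono 1) auto
  finally show ?thesis by (simp add: algebra_simps)
qed

lemma Wf_lim:
  assumes f: "\<And>k. f k \<in> carrier A" "a \<in> carrier A" "(\<lambda>k. nrm A (f k \<ominus> a)) \<longlonglongrightarrow> 0"
    and "x \<in> carrier A" "y \<in> carrier A"
  shows "(\<lambda>k. Wf m (f k) x y) \<longlonglongrightarrow> Wf m a x y"
proof (rule LIM_zero_cancel, rule tendsto_norm_zero_cancel, rule null_le)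
  let ?K = "tn x * tn (dsum m y) + tn (dsum m x) * tn y"
  show "(\<lambda>k. nrm A (f k \<ominus> a) * ?K) \<longlonglongrightarrow> 0" using tendsto_mult_left_zero[OF f(3)] .
  show "norm (Wf m (f k) x y - Wf m a x y) \<le> nrm A (f k \<ominus> a) * ?K" for k
    using Wf_bound[of "f k \<ominus> a" x y m] assms by (simp add: Wf_minus)
qed auto

lemma lipb_lim:
  assumes f: "\<And>k. f k \<in> carrier A" "a \<in> carrier A" "(\<lambda>k. nrm A (f k \<ominus> a)) \<longlonglongrightarrow> 0"
    and l: "\<And>k. lipb C (f k)"
  shows "lipb C a"
  unfolding lipb_def
proof (intro allI ballI)
  fix m x y assume xy: "x \<in> F m" "y \<in> F m"
  have "(\<lambda>k. cmod (Wf m (f k) x y)) \<longlonglongrightarrow> cmod (Wf m a x y)"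
    using xy by (intro tendsto_norm Wf_lim f) auto
  thus "cmod (Wf m a x y) \<le> C * tn x * tn y"
    using lipbD[OF l xy] by (intro LIMSEQ_le_const2) auto
qed

text \<open>By the trace property s (a u) v is the pairing of a with v u*, which lies in F n
  together with u and v; there a and E n a cannot be told apart.\<close>

lemma Wf_E:
  assumes a: "a \<in> carrier A" and xy: "x \<in> F n" "y \<in> F n"
  shows "Wf n (E n a) x y = Wf n a x y"
proof -
  have *: "s (E n a \<otimes> u) v = s (a \<otimes> u) v" if "u \<in> F n" "v \<in> F n" for u v
    using a that s_mult_right[of "E n a" u v] s_mult_right[of a u v] E_s[OF a, of "v \<otimes> star A u" n] by simp
  have "dsum n x \<in> F n" "dsum n y \<in> F n" using xy by auto
  thus ?thesis unfolding Wf_def using xy by (simp only: *)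
qed

text \<open>For j > n, left multiplication by b commutes with q j, so these summands of D cancel in
  the commutator. Afterwards all remaining vectors lie in stage n on one side, and the other side
  may be projected.\<close>

lemma Wf_reduce:
  assumes b: "b \<in> F n" and xy: "x \<in> carrier A" "y \<in> carrier A" and nm: "n \<le> m"
  shows "Wf m b x y = Wf n b (E n x) (E n y)"
proof -
  have bc: "b \<in> carrier A" using b by simp
  have "Wf m b x y = Wf n b x y" using nm
  proof (induction m rule: dec_induct)
    case (step m)
    have "s (b \<otimes> q (Suc m) x) y = s (b \<otimes> x) (q (Suc m) y)"
      using q_mult_left[OF b, of "Suc m" x] q_sym[of "b \<otimes> x" y "Suc m"] bc xy step(1) by simp
    hence "Wf (Suc m) b x y = Wf m b x y"
      using bc xy by (simp add: Wf_def dsum_Suc r_distr smult_mult_right s_add s_add_right s_smult s_smult_right st_smult st_add)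
    thus ?case using step by simp
  qed simp
  also have "\<dots> = Wf n b (E n x) (E n y)"
  proof -
    have 1: "s (b \<otimes> E n x) (dsum n y) = s (b \<otimes> x) (dsum n y)"
      using E_s[of "b \<otimes> x" "dsum n y" n] b bc xy by (simp add: E_mult_left)
    have 2: "s (b \<otimes> dsum n x) (E n y) = s (b \<otimes> dsum n x) y"
      using E_s_right[of y "b \<otimes> dsum n x" n] b xy by simp
    show ?thesis unfolding Wf_def using xy dsum_E[of n n x] dsum_E[of n n y] 1 2 by simp
  qed
  finally show ?thesis .
qed

text \<open>For an element of stage n the Lipschitz condition is a statement about stage n alone.
  This gives \<open>lipb_E\<close>, and it is what allows seminorms for different angles to be
  compared.\<close>

lemma lipb_F_iff:
  assumes b: "b \<in> F n" and C: "0 \<le> C"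
  shows "lipb C b \<longleftrightarrow> (\<forall>x\<in>F n. \<forall>y\<in>F n. cmod (Wf n b x y) \<le> C * tn x * tn y)"
proof
  assume r: "\<forall>x\<in>F n. \<forall>y\<in>F n. cmod (Wf n b x y) \<le> C * tn x * tn y"
  show "lipb C b" unfolding lipb_def
  proof (intro allI ballI)
    fix m x y assume xy: "x \<in> F m" "y \<in> F m"
    have c: "x \<in> carrier A" "y \<in> carrier A" using xy by auto
    show "cmod (Wf m b x y) \<le> C * tn x * tn y"
    proof (cases "n \<le> m")
      case True
      have "cmod (Wf m b x y) \<le> C * tn (E n x) * tn (E n y)"
        using r c Wf_reduce[OF b c True] by simp
      also have "\<dots> \<le> C * tn x * tn y"
        using c C tn_E by (intro mult_mono mult_left_mono) auto
      finally show ?thesis .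
    next
      case False
      hence mn: "m \<le> n" by simp
      have "Wf m b x y = Wf n b x y" using dsum_stable[OF xy(1) mn] dsum_stable[OF xy(2) mn] by (simp add: Wf_def)
      thus ?thesis using r F_mono[OF mn xy(1)] F_mono[OF mn xy(2)] by simp
    qed
  qed
qed (simp add: lipbD)

lemma lipb_E: "a \<in> carrier A \<Longrightarrow> 0 \<le> C \<Longrightarrow> lipb C a \<Longrightarrow> lipb C (E n a)"
  by (simp add: lipb_F_iff[of _ n] Wf_E lipbD)

text \<open>A crude bound for the norm of D on stage n (\<open>tn_dsum_le\<close>).\<close>

definition K :: "nat \<Rightarrow> real" where "K n = (\<Sum>j<n. \<bar>\<kappa> (Suc j)\<bar>)"

lemma tn_dsum_le:
  assumes x: "x \<in> carrier A" shows "tn (dsum n x) \<le> K n * tn x"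
proof -
  have "tn (dsum n x) \<le> (\<Sum>j<n. cmod (complex_of_real (\<kappa> (Suc j))) * tn (q (Suc j) x))"
    unfolding dsum_def using x by (intro T.N_lcomb_le) simp
  also have "\<dots> \<le> (\<Sum>j<n. \<bar>\<kappa> (Suc j)\<bar> * tn x)"
    using x by (intro sum_mono) (auto intro!: mult_left_mono tn_q)
  finally show ?thesis by (simp add: K_def sum_distrib_right)
qed

lemma lipb_ex:
  assumes b: "b \<in> F n" shows "\<exists>C\<ge>0. lipb C b"
proof (intro exI conjI)
  have bc: "b \<in> carrier A" using b by simp
  have K0: "K n \<ge> 0" by (auto simp: K_def intro: sum_nonneg)
  show C: "0 \<le> nrm A b * (2 * K n)" using K0 N_nonneg[OF bc] by simp
  show "lipb (nrm A b * (2 * K n)) b"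
    unfolding lipb_F_iff[OF b C]
  proof (intro ballI)
    fix x y assume "x \<in> F n" "y \<in> F n"
    hence c: "x \<in> carrier A" "y \<in> carrier A" by auto
    have "cmod (Wf n b x y) \<le> nrm A b * (tn x * tn (dsum n y) + tn (dsum n x) * tn y)"
      by (rule Wf_bound[OF bc c])
    also have "\<dots> \<le> nrm A b * (tn x * (K n * tn y) + (K n * tn x) * tn y)"
      using c bc by (intro mult_left_mono add_mono mult_right_mono tn_dsum_le N_nonneg) auto
    finally show "cmod (Wf n b x y) \<le> nrm A b * (2 * K n) * tn x * tn y" by (simp add: algebra_simps)
  qed
qed

text \<open>The derivation rule for commutators evaluates the form at b x and a* y, which must stay
  in a stage; hence a and b are taken from F n here. \<open>lipb_mult\<close> then passes to the
  limit along E k a and E k b, whose norms and Lipschitz bounds do not increase.\<close>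

lemma lipb_mult_F:
  assumes a: "a \<in> F n" "lipb C a" "0 \<le> C" and b: "b \<in> F n" "lipb C' b" "0 \<le> C'"
  shows "lipb (nrm A a * C' + nrm A b * C) (a \<otimes> b)"
proof -
  have ac: "a \<in> carrier A" and bc: "b \<in> carrier A" using a b by auto
  have C: "0 \<le> nrm A a * C' + nrm A b * C" using a b ac bc N_nonneg by simp
  have ab: "a \<otimes> b \<in> F n" using a b by simp
  show ?thesis unfolding lipb_F_iff[OF ab C]
  proof (intro ballI)
    fix x y assume xy: "x \<in> F n" "y \<in> F n"
    have c: "x \<in> carrier A" "y \<in> carrier A" using xy by auto
    have bx: "b \<otimes> x \<in> F n" and ay: "star A a \<otimes> y \<in> F n" using a b xy by auto
    have 1: "s (a \<otimes> dsum n (b \<otimes> x)) y = s (b \<otimes> x) (dsum n (star A a \<otimes> y))"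
      using s_mult_left[of a "dsum n (b \<otimes> x)" y] dsum_sym[of "b \<otimes> x" "star A a \<otimes> y" n] ac bc c by simp
    have 2: "s (b \<otimes> dsum n x) (star A a \<otimes> y) = s (a \<otimes> b \<otimes> dsum n x) y"
      using s_mult_left[of a "b \<otimes> dsum n x" y] ac bc c by (simp add: m_assoc)
    have e: "Wf n (a \<otimes> b) x y = Wf n a (b \<otimes> x) y + Wf n b x (star A a \<otimes> y)"
      unfolding Wf_def 1 2 using ac bc c by (simp add: m_assoc)
    have "cmod (Wf n (a \<otimes> b) x y) \<le> C * tn (b \<otimes> x) * tn y + C' * tn x * tn (star A a \<otimes> y)"
      unfolding e using lipbD[OF a(2) bx xy(2)] lipbD[OF b(2) xy(1) ay]
        norm_triangle_ineq[of "Wf n a (b \<otimes> x) y" "Wf n b x (star A a \<otimes> y)"] by linarith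
    also have "\<dots> \<le> C * (nrm A b * tn x) * tn y + C' * tn x * (nrm A a * tn y)"
      using a b ac bc c tn_mult[of "star A a" y]
      by (intro add_mono mult_left_mono mult_right_mono tn_mult) auto
    finally show "cmod (Wf n (a \<otimes> b) x y) \<le> (nrm A a * C' + nrm A b * C) * tn x * tn y"
      by (simp add: algebra_simps)
  qed
qed

lemma lipb_mult:
  assumes a: "a \<in> carrier A" "lipb C a" "0 \<le> C" and b: "b \<in> carrier A" "lipb C' b" "0 \<le> C'"
  shows "lipb (nrm A a * C' + nrm A b * C) (a \<otimes> b)"
proof (rule lipb_lim)
  fix k
  have "lipb (nrm A (E k a) * C' + nrm A (E k b) * C) (E k a \<otimes> E k b)"
    using a b by (intro lipb_mult_F[of _ k] lipb_E) auto
  thus "lipb (nrm A a * C' + nrm A b * C) (E k a \<otimes> E k b)"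
    by (rule lipb_mono) (use a b in \<open>auto intro!: add_mono mult_right_mono nrm_E\<close>)
next
  have "(\<lambda>k. nrm A a * nrm A (E k b \<ominus> b) + nrm A (E k a \<ominus> a) * nrm A b) \<longlonglongrightarrow> nrm A a * 0 + 0 * nrm A b"
    by (intro tendsto_intros E_lim a b)
  hence l: "(\<lambda>k. nrm A a * nrm A (E k b \<ominus> b) + nrm A (E k a \<ominus> a) * nrm A b) \<longlonglongrightarrow> 0" by simp
  show "(\<lambda>k. nrm A (E k a \<otimes> E k b \<ominus> a \<otimes> b)) \<longlonglongrightarrow> 0"
  proof (rule null_le[OF _ _ l])
    fix k
    have "nrm A (E k a \<otimes> E k b \<ominus> a \<otimes> b) \<le> nrm A (E k a) * nrm A (E k b \<ominus> b) + nrm A (E k a \<ominus> a) * nrm A b"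
      using a b by (intro nrm_mult_minus_mult) auto
    also have "\<dots> \<le> nrm A a * nrm A (E k b \<ominus> b) + nrm A (E k a \<ominus> a) * nrm A b"
      using a b by (intro add_mono mult_right_mono nrm_E N_nonneg) auto
    finally show "nrm A (E k a \<otimes> E k b \<ominus> a \<otimes> b) \<le> nrm A a * nrm A (E k b \<ominus> b) + nrm A (E k a \<ominus> a) * nrm A b" .
  qed (use a b in \<open>auto intro: N_nonneg\<close>)
qed (use a b in auto)

section \<open>The norm constants and the tail estimate\<close>

lemma nrm_one: "nrm A \<one> = 1"
  using nrm_one_le tn_le_nrm[of \<one>] by simp

text \<open>The admissible constants are bounded below by the value 1 at the unit, and their infimum
  is itself admissible. So the least real number in \<open>ci_const\<close> exists.\<close>

lemma const_ex: "\<exists>c. (\<forall>x\<in>F n. nrm A x \<le> c * tn x) \<and> (\<forall>c'. (\<forall>x\<in>F n. nrm A x \<le> c' * tn x) \<longrightarrow> c \<le> c')"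
proof -
  define S where "S = {c. \<forall>x\<in>F n. nrm A x \<le> c * tn x}"
  have ne: "S \<noteq> {}" using norm_equiv[of n] by (auto simp: S_def)
  have ge: "1 \<le> c" if "c \<in> S" for c
  proof -
    have "nrm A \<one> \<le> c * tn \<one>" using that F_one unfolding S_def by blast
    thus ?thesis by (simp add: nrm_one)
  qed
  have bdd: "bdd_below S" using ge by (auto simp: bdd_below_def)
  have "nrm A x \<le> Inf S * tn x" if x: "x \<in> F n" for x
  proof (cases "tn x = 0")
    case True
    thus ?thesis using F_definite[OF x] by simp
  next
    case False
    hence t: "tn x > 0" using tn_nonneg[OF F_carrier[OF x]] by linarith
    have "nrm A x / tn x \<le> Inf S"
      using ne t x by (intro cInf_greatest) (auto simp: S_def pos_divide_le_eq)
    thus ?thesis using t by (simp add: pos_divide_le_eq)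
  qed
  moreover have "Inf S \<le> c'" if "\<forall>x\<in>F n. nrm A x \<le> c' * tn x" for c'
    using that bdd by (intro cInf_lower) (auto simp: S_def)
  ultimately show ?thesis by blast
qed

lemma ci_const_props: "(\<forall>x\<in>F n. nrm A x \<le> ci_const A F \<tau> n * tn x) \<and>
    (\<forall>c'. (\<forall>x\<in>F n. nrm A x \<le> c' * tn x) \<longrightarrow> ci_const A F \<tau> n \<le> c')"
proof -
  obtain c where c: "\<forall>x\<in>F n. nrm A x \<le> c * tn x" "\<And>c'. (\<forall>x\<in>F n. nrm A x \<le> c' * tn x) \<Longrightarrow> c \<le> c'"
    using const_ex by blast
  have "ci_const A F \<tau> n = c" unfolding ci_const_def by (rule Least_equality) (use c in auto)
  thus ?thesis using c by blast
qed

lemma ci_const: "x \<in> F n \<Longrightarrow> nrm A x \<le> ci_const A F \<tau> n * tn x"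
  and ci_const_least: "(\<And>x. x \<in> F n \<Longrightarrow> nrm A x \<le> c * tn x) \<Longrightarrow> ci_const A F \<tau> n \<le> c"
  using ci_const_props by blast+

lemma ci_const_pos: "ci_const A F \<tau> n > 0"
proof -
  have "nrm A \<one> \<le> ci_const A F \<tau> n * tn \<one>" by (rule ci_const) simp
  thus ?thesis by (simp add: nrm_one)
qed

lemma \<kappa>_eq: "\<kappa> j = ci_const A F \<tau> j / \<beta> j"
  by (simp add: \<kappa>_def ci_coeff_def)

lemma \<kappa>_pos: "j \<ge> 1 \<Longrightarrow> \<kappa> j > 0"
  using ci_const_pos \<beta>_pos by (simp add: \<kappa>_eq)

text \<open>The commutator is tested on 1 and y = q j a. Since D 1 = 0 and D y = \<kappa> j y, the
  form equals \<kappa> j times the squared trace norm of y, so \<kappa> j |y| \<le> C. As \<kappa> j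
  is the norm constant of stage j divided by \<beta> j, this is precisely a bound by C \<beta> j in
  the C*-norm.\<close>

lemma nrm_q_le:
  assumes a: "a \<in> carrier A" and C: "0 \<le> C" and l: "lipb C a" and j: "j \<ge> 1"
  shows "nrm A (q j a) \<le> C * \<beta> j"
proof -
  let ?y = "q j a"
  have yc: "?y \<in> carrier A" using a by simp
  obtain i where i: "j = Suc i" using j by (cases j) auto
  have "q (Suc k) ?y = \<zero>" if "k < i" for k using that i a by (simp add: q_q)
  hence "dsum i ?y = lcomb A (\<lambda>j. complex_of_real (\<kappa> (Suc j))) (\<lambda>j. \<zero>) i"
    unfolding dsum_def by (intro lcomb_cong) auto
  also have "\<dots> = \<zero>" by (induction i) auto
  finally have d: "dsum j ?y = complex_of_real (\<kappa> j) \<odot> ?y"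
    using a unfolding i by (simp add: dsum_Suc q_idem)
  have "Wf j a \<one> ?y = complex_of_real (\<kappa> j) * s a ?y"
    unfolding Wf_def d using a by (simp add: dsum_one s_smult_right)
  also have "s a ?y = s ?y ?y" using q_sym[of a ?y j] a by (simp add: q_idem)
  finally have e: "Wf j a \<one> ?y = complex_of_real (\<kappa> j * (tn ?y)\<^sup>2)" using s_self[OF yc] by simp
  have "\<kappa> j * (tn ?y)\<^sup>2 \<le> C * tn ?y"
    using lipbD[OF l, of \<one> j ?y] a \<kappa>_pos[OF j] unfolding e by (simp del: of_real_mult of_real_power)
  hence "tn ?y * (\<kappa> j * tn ?y) \<le> tn ?y * C" by (simp add: power2_eq_square ac_simps)
  hence "\<kappa> j * tn ?y \<le> C"
    using tn_nonneg[OF yc] C by (cases "tn ?y = 0") (auto simp: mult_le_cancel_left)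
  hence "ci_const A F \<tau> j * tn ?y \<le> C * \<beta> j"
    using \<beta>_pos[OF j] by (simp add: \<kappa>_eq pos_divide_le_eq)
  moreover have "nrm A ?y \<le> ci_const A F \<tau> j * tn ?y" using a by (intro ci_const) simp
  ultimately show ?thesis by linarith
qed

definition tl :: "nat \<Rightarrow> real" where "tl n = (\<Sum>j. \<beta> (Suc (j + n)))"

lemma tl_summable: "summable (\<lambda>j. \<beta> (Suc (j + n)))"
  using summable_ignore_initial_segment[OF \<beta>_summable, of "Suc n"] by simp

lemma tl_nonneg: "0 \<le> tl n"
  unfolding tl_def by (intro suminf_nonneg tl_summable) (simp add: \<beta>_pos less_imp_le)

lemma nrm_minus_E_le:
  assumes a: "a \<in> carrier A" and C: "0 \<le> C" and l: "lipb C a"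
  shows "nrm A (a \<ominus> E n a) \<le> C * tl n"
proof -
  have le: "nrm A (E (k + n) a \<ominus> E n a) \<le> C * tl n" for k
  proof -
    have "nrm A (E (Suc i + n) a \<ominus> E (i + n) a) \<le> C * \<beta> (Suc (i + n))" for i
      using nrm_q_le[OF a C l, of "Suc i + n"] by (simp add: q_def)
    hence "nrm A (E (0 + k + n) a \<ominus> E (0 + n) a) \<le> (\<Sum>i=0..<0+k. C * \<beta> (Suc (i + n)))"
      by (intro N_minus_telescope[of "\<lambda>i. E (i + n) a"]) (use a in auto)
    also have "\<dots> = C * (\<Sum>i<k. \<beta> (Suc (i + n)))" by (simp add: sum_distrib_left lessThan_atLeast0)
    also have "\<dots> \<le> C * tl n" unfolding tl_def
      by (intro mult_left_mono sum_le_suminf tl_summable C) (auto simp: \<beta>_pos less_imp_le)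
    finally show ?thesis by simp
  qed
  have "(\<lambda>k. C * tl n + nrm A (E (k + n) a \<ominus> a)) \<longlonglongrightarrow> C * tl n + 0"
    using LIMSEQ_ignore_initial_segment[OF E_lim[OF a], of n] by (intro tendsto_intros) simp
  moreover have "nrm A (a \<ominus> E n a) \<le> C * tl n + nrm A (E (k + n) a \<ominus> a)" for k
    using N_triangle[of a "E (k + n) a" "E n a"] N_minus_commute[of a "E (k + n) a"] le[of k] a by simp
  ultimately show ?thesis using LIMSEQ_le_const by fastforce
qed

lemma tl_lim: "tl \<longlonglongrightarrow> 0"
proof -
  have "(\<lambda>n. \<Sum>j. \<beta> (j + n)) \<longlonglongrightarrow> 0" by (rule suminf_exist_split2[OF \<beta>_summable])
  from LIMSEQ_Suc[OF this] show ?thesis by (simp add: tl_def[abs_def])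
qed

subsection \<open>The seminorm with values in the extended half-line\<close>

abbreviation L :: "'a \<Rightarrow> ennreal" where "L \<equiv> ci_seminorm A F \<tau> \<beta>"

lemma L_le_iff: "\<lbrakk>a \<in> carrier A; 0 \<le> C\<rbrakk> \<Longrightarrow> L a \<le> ennreal C \<longleftrightarrow> lipb C a"
  by (rule ci_seminorm_le_iff)

lemma L_cases:
  assumes "a \<in> carrier A"
  obtains "L a = \<infinity>" | C where "0 \<le> C" "L a = ennreal C" "lipb C a"
proof (cases "L a")
  case (real r)
  thus ?thesis using that(2)[of r] L_le_iff[OF assms, of r] by simp
qed (use that in simp)

lemma L_zero_elt: "L \<zero> = 0"
proof -
  have "lipb 0 \<zero>" using lipb_smult[of \<zero> _ 0] lipb_ex[OF F_zero] by fastforce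
  thus ?thesis using L_le_iff[of \<zero> 0] by simp
qed

lemma L_F: "b \<in> F n \<Longrightarrow> L b < \<infinity>"
proof -
  assume b: "b \<in> F n"
  obtain C where "0 \<le> C" "lipb C b" using lipb_ex[OF b] by blast
  hence "L b \<le> ennreal C" using L_le_iff b by simp
  thus ?thesis by (simp add: le_less_trans)
qed

lemma L_add:
  assumes a: "a \<in> carrier A" and b: "b \<in> carrier A"
  shows "L (a \<oplus> b) \<le> L a + L b"
proof (cases rule: L_cases[OF a])
  case a': (2 C)
  show ?thesis
  proof (cases rule: L_cases[OF b])
    case b': (2 C')
    have "L (a \<oplus> b) \<le> ennreal (C + C')" using a b a' b' by (subst L_le_iff) (auto intro: lipb_add)
    thus ?thesis using a' b' by simp
  qed simp
qed simp

lemma L_smult_le: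
  assumes a: "a \<in> carrier A" shows "L (c \<odot> a) \<le> ennreal (cmod c) * L a"
proof (cases rule: L_cases[OF a])
  case 1
  thus ?thesis using a by (cases "c = 0") (auto simp: L_zero_elt ennreal_mult_top)
next
  case (2 C)
  have "L (c \<odot> a) \<le> ennreal (cmod c * C)" using a 2 by (subst L_le_iff) (auto intro: lipb_smult)
  thus ?thesis using 2 by (simp add: ennreal_mult)
qed

lemma L_smult:
  assumes a: "a \<in> carrier A" shows "L (c \<odot> a) = ennreal (cmod c) * L a"
proof (cases "c = 0")
  case False
  have "L a \<le> ennreal (cmod (inverse c)) * L (c \<odot> a)"
    using L_smult_le[of "c \<odot> a" "inverse c"] a False by (simp add: smult_smult)
  hence "ennreal (cmod c) * L a \<le> ennreal (cmod c) * (ennreal (cmod (inverse c)) * L (c \<odot> a))"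
    by (rule mult_left_mono) simp
  also have "\<dots> = ennreal (cmod c * cmod (inverse c)) * L (c \<odot> a)"
    by (simp add: ennreal_mult mult.assoc)
  also have "\<dots> = L (c \<odot> a)" using False by (simp add: norm_inverse)
  finally show ?thesis using L_smult_le[OF a] by (intro antisym)
qed (use a L_zero_elt in simp)

lemma L_star: "a \<in> carrier A \<Longrightarrow> L (star A a) = L a"
proof -
  have *: "L (star A a) \<le> L a" if a: "a \<in> carrier A" for a
  proof (cases rule: L_cases[OF a])
    case (2 C)
    thus ?thesis using a L_le_iff[of "star A a" C] lipb_star by simp
  qed simp
  assume a: "a \<in> carrier A"
  show ?thesis using *[OF a] *[of "star A a"] a by simp
qed

lemma L_mult:
  assumes a: "a \<in> carrier A" and b: "b \<in> carrier A"
  shows "L (a \<otimes> b) \<le> ennreal (nrm A a) * L b + ennreal (nrm A b) * L a"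
\<comment> \<open>In \<open>ennreal\<close> a zero norm would annihilate an infinite seminorm on the
  right-hand side, so zero factors are treated separately.\<close>
proof (cases "a = \<zero> \<or> b = \<zero>")
  case True
  thus ?thesis using a b L_zero_elt by auto
next
  case False
  hence n: "nrm A a > 0" "nrm A b > 0"
    using N_nonneg[OF a] N_nonneg[OF b] nrm_eq_0[OF a] nrm_eq_0[OF b] by linarith+
  show ?thesis
  proof (cases rule: L_cases[OF a])
    case 1 thus ?thesis using n by (simp add: ennreal_mult_top)
  next
    case a': (2 C)
    show ?thesis
    proof (cases rule: L_cases[OF b])
      case 1 thus ?thesis using n by (simp add: ennreal_mult_top)
    next
      case b': (2 C')
      have "L (a \<otimes> b) \<le> ennreal (nrm A a * C' + nrm A b * C)"
        using a b a' b' n by (subst L_le_iff) (auto intro: lipb_mult)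
      thus ?thesis using a' b' n by (simp add: ennreal_mult)
    qed
  qed
qed

text \<open>The tail estimate with C = 0 at stage 0 identifies a with its scalar part.\<close>

lemma L_eq_0_iff:
  assumes a: "a \<in> carrier A" shows "L a = 0 \<longleftrightarrow> (\<exists>c. a = c \<odot> \<one>)"
proof
  assume "L a = 0"
  hence "lipb 0 a" using L_le_iff[OF a, of 0] by simp
  hence "nrm A (a \<ominus> E 0 a) = 0" using nrm_minus_E_le[OF a, of 0 0] N_nonneg[of "a \<ominus> E 0 a"] a by simp
  hence "a = E 0 a" using nrm_eq_0[of "a \<ominus> E 0 a"] a minus_eq_zero[of a "E 0 a"] by simp
  thus "\<exists>c. a = c \<odot> \<one>" using E_0[OF a] by metis
next
  assume "\<exists>c. a = c \<odot> \<one>"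
  then obtain c where c: "a = c \<odot> \<one>" by blast
  have "lipb 0 \<one>"
    unfolding lipb_def Wf_def using dsum_sym by (auto simp: F_carrier)
  hence "L \<one> = 0" using L_le_iff[of \<one> 0] by simp
  thus "L a = 0" unfolding c by (simp add: L_smult)
qed

text \<open>Failure of \<open>lipb r\<close> is witnessed by one pair of stage vectors, and a strict
  violation there persists under small changes of a in norm.\<close>

lemma L_lsc:
  assumes f: "\<And>n. f n \<in> carrier A" "a \<in> carrier A" "(\<lambda>n. nrm A (f n \<ominus> a)) \<longlonglongrightarrow> 0"
  shows "L a \<le> liminf (\<lambda>n. L (f n))"
  unfolding le_Liminf_iff
proof (intro allI impI)
  fix y assume y: "y < L a"
  then obtain r where r: "0 \<le> r" "y = ennreal r" by (cases y) (auto simp: top.not_eq_extremum)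
  hence "\<not> lipb r a" using y L_le_iff[OF f(2) r(1)] by auto
  then obtain m x z where xz: "x \<in> F m" "z \<in> F m" "cmod (Wf m a x z) > r * tn x * tn z"
    unfolding lipb_def by (auto simp: not_le)
  have "(\<lambda>n. cmod (Wf m (f n) x z)) \<longlonglongrightarrow> cmod (Wf m a x z)"
    using xz by (intro tendsto_norm Wf_lim f) auto
  hence "\<forall>\<^sub>F n in sequentially. cmod (Wf m (f n) x z) > r * tn x * tn z"
    using xz(3) by (rule order_tendstoD)
  thus "\<forall>\<^sub>F n in sequentially. y < L (f n)"
  proof (rule eventually_mono)
    fix n assume "cmod (Wf m (f n) x z) > r * tn x * tn z"
    hence "\<not> lipb r (f n)" using lipbD[OF _ xz(1,2)] by fastforce
    thus "y < L (f n)" using L_le_iff[OF f(1) r(1), of n] r by (simp add: not_le)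
  qed
qed

end

section \<open>Compact quantum metric spaces\<close>

text \<open>\<open>tb\<close> is total boundedness of S modulo scalars: finitely many evaluations
  control the distance of two states on all of S, so weak* convergence implies metric convergence.
  \<open>sp\<close> says that S spans densely in a quantitative form: small metric distance forces
  closeness at every a, which gives the converse and separates states.\<close>

lemma (in cstar) metrizes_weak_starI:
  assumes S: "S \<subseteq> carrier A"
    and tb: "\<And>\<epsilon>. \<epsilon> > 0 \<Longrightarrow> \<exists>K d e. (\<forall>i<d. e i \<in> carrier A) \<and>
      (\<forall>a\<in>S. \<exists>c l. (\<forall>i<d. cmod (c i) \<le> K) \<and> nrm A (a \<ominus> (l \<odot> \<one> \<oplus> lcomb A c e d)) \<le> \<epsilon>)"
    and sp: "\<And>a \<epsilon>. a \<in> carrier A \<Longrightarrow> \<epsilon> > 0 \<Longrightarrow> \<exists>M\<ge>0. \<forall>\<phi>\<in>states A. \<forall>\<psi>\<in>states A. \<forall>r\<ge>0.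
      (\<forall>b\<in>S. cmod (\<phi> b - \<psi> b) \<le> r) \<longrightarrow> cmod (\<phi> a - \<psi> a) \<le> M * r + \<epsilon>"
  shows "metrizes_weak_star A (mk_dist S)"
proof -
  \<comment> \<open>The scalar part drops out because both states are 1 at the unit; the remainder
    costs \<epsilon> for each of the two states.\<close>
  have approx: "\<exists>K (d :: nat) e. K \<ge> 0 \<and> (\<forall>i<d. e i \<in> carrier A) \<and> (\<forall>\<phi>\<in>states A. \<forall>\<psi>\<in>states A. \<forall>a\<in>S.
      cmod (\<phi> a - \<psi> a) \<le> 2 * \<epsilon> + K * (\<Sum>i<d. cmod (\<phi> (e i) - \<psi> (e i))))" if e: "\<epsilon> > 0" for \<epsilon> :: real
  proof -
    obtain K d e where Kde: "\<And>i. i < d \<Longrightarrow> e i \<in> carrier A"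
      "\<And>a. a \<in> S \<Longrightarrow> \<exists>c l. (\<forall>i<d. cmod (c i) \<le> K) \<and> nrm A (a \<ominus> (l \<odot> \<one> \<oplus> lcomb A c e d)) \<le> \<epsilon>"
      using tb[OF e] by blast
    have *: "cmod (\<phi> a - \<psi> a) \<le> 2 * \<epsilon> + max K 0 * (\<Sum>i<d. cmod (\<phi> (e i) - \<psi> (e i)))"
      if st: "\<phi> \<in> states A" "\<psi> \<in> states A" and a: "a \<in> S" for \<phi> \<psi> a
    proof -
      interpret P: cstate A \<phi> by unfold_locales fact
      interpret Q: cstate A \<psi> by unfold_locales fact
      have ac: "a \<in> carrier A" using a S by blast
      obtain c l where cl: "\<And>i. i < d \<Longrightarrow> cmod (c i) \<le> K" "nrm A (a \<ominus> (l \<odot> \<one> \<oplus> lcomb A c e d)) \<le> \<epsilon>"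
        using Kde(2)[OF a] by blast
      let ?y = "lcomb A c e d"
      let ?x = "l \<odot> \<one> \<oplus> ?y"
      have y: "?y \<in> carrier A" using Kde by simp
      hence x: "?x \<in> carrier A" by simp
      have lin: "\<rho> (lcomb A c e k) = (\<Sum>i<k. c i * \<rho> (e i))" if "cstate A \<rho>" "k \<le> d" for \<rho> k
      proof -
        interpret C: cstate A \<rho> by fact
        have z: "\<rho> \<zero> = 0" using C.st_smult[of \<zero> 0] by simp
        show ?thesis using \<open>k \<le> d\<close>
          by (induction k) (use Kde z in \<open>auto simp: C.st_add C.st_smult\<close>)
      qed
      have "\<phi> ?y - \<psi> ?y = (\<Sum>i<d. c i * (\<phi> (e i) - \<psi> (e i)))"
        using lin[OF P.cstate_axioms order_refl] lin[OF Q.cstate_axioms order_refl]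
        by (simp add: sum_subtractf algebra_simps)
      note y_eq = this[symmetric]
      have eq: "\<phi> a - \<psi> a = (\<phi> (a \<ominus> ?x) - \<psi> (a \<ominus> ?x)) + (\<Sum>i<d. c i * (\<phi> (e i) - \<psi> (e i)))"
        unfolding y_eq using ac x y by (simp add: P.st_minus Q.st_minus P.st_add Q.st_add P.st_smult Q.st_smult)
      have "cmod (\<phi> a - \<psi> a)
          \<le> (cmod (\<phi> (a \<ominus> ?x)) + cmod (\<psi> (a \<ominus> ?x))) + (\<Sum>i<d. cmod (c i * (\<phi> (e i) - \<psi> (e i))))"
        unfolding eq by (intro norm_triangle_mono norm_triangle_ineq4 norm_sum)
      also have "\<dots> \<le> (\<epsilon> + \<epsilon>) + (\<Sum>i<d. max K 0 * cmod (\<phi> (e i) - \<psi> (e i)))"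
        using P.st_bound[of "a \<ominus> ?x"] Q.st_bound[of "a \<ominus> ?x"] ac x cl
        by (intro add_mono sum_mono) (auto simp: norm_mult intro!: mult_right_mono intro: order_trans le_max_iff_disj[THEN iffD2])
      finally show ?thesis by (simp add: sum_distrib_left)
    qed
    show ?thesis
    proof (intro exI[of _ "max K 0"] exI[of _ d] exI[of _ e] conjI allI ballI impI)
      show "e i \<in> carrier A" if "i < d" for i using that by (rule Kde(1))
    qed (rule max.cobounded2, rule *)
  qed
  define \<delta> where "\<delta> \<phi> \<psi> = enn2real (mk_dist S \<phi> \<psi>)" for \<phi> \<psi>
  have fin: "mk_dist S \<phi> \<psi> < \<infinity>" if st: "\<phi> \<in> states A" "\<psi> \<in> states A" for \<phi> \<psi>
  proof -
    have "(0::real) < 1" by simp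
    from approx[OF this] obtain K and d :: nat and e where
      "\<forall>\<phi>\<in>states A. \<forall>\<psi>\<in>states A. \<forall>a\<in>S. cmod (\<phi> a - \<psi> a) \<le> 2 * 1 + K * (\<Sum>i<d. cmod (\<phi> (e i) - \<psi> (e i)))"
      by blast
    hence b: "\<forall>a\<in>S. cmod (\<phi> a - \<psi> a) \<le> 2 * 1 + K * (\<Sum>i<d. cmod (\<phi> (e i) - \<psi> (e i)))"
      using st by blast
    have "mk_dist S \<phi> \<psi> \<le> ennreal (2 * 1 + K * (\<Sum>i<d. cmod (\<phi> (e i) - \<psi> (e i))))"
      unfolding mk_dist_def using b by (intro SUP_least ennreal_leI) auto
    thus ?thesis by (simp add: le_less_trans)
  qed
  have le_\<delta>: "cmod (\<phi> a - \<psi> a) \<le> \<delta> \<phi> \<psi>" if "\<phi> \<in> states A" "\<psi> \<in> states A" "a \<in> S" for \<phi> \<psi> a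
  proof -
    have "ennreal (cmod (\<phi> a - \<psi> a)) \<le> mk_dist S \<phi> \<psi>"
      unfolding mk_dist_def using that by (intro SUP_upper)
    also have "\<dots> = ennreal (\<delta> \<phi> \<psi>)" using fin[OF that(1,2)] by (simp add: \<delta>_def)
    finally show ?thesis by (simp add: \<delta>_def)
  qed
  have \<delta>_le: "\<delta> \<phi> \<psi> \<le> r" if "r \<ge> 0" "\<And>a. a \<in> S \<Longrightarrow> cmod (\<phi> a - \<psi> a) \<le> r" for \<phi> \<psi> r
    unfolding \<delta>_def mk_dist_def using that
    by (intro enn2real_leI SUP_least ennreal_leI) auto
  have \<delta>0: "0 \<le> \<delta> \<phi> \<psi>" for \<phi> \<psi> by (simp add: \<delta>_def)
  have M: "Metric_space (states A) \<delta>"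
  proof
    show "0 \<le> \<delta> \<phi> \<psi>" for \<phi> \<psi> by (rule \<delta>0)
    show "\<delta> \<phi> \<psi> = \<delta> \<psi> \<phi>" for \<phi> \<psi>
      by (simp add: \<delta>_def mk_dist_def norm_minus_commute)
    show "\<delta> \<phi> \<psi> = 0 \<longleftrightarrow> \<phi> = \<psi>" if st: "\<phi> \<in> states A" "\<psi> \<in> states A" for \<phi> \<psi>
    proof
      assume z: "\<delta> \<phi> \<psi> = 0"
      have "\<phi> a = \<psi> a" if a: "a \<in> carrier A" for a
      proof -
        have "cmod (\<phi> a - \<psi> a) \<le> 0"
        proof (rule field_le_epsilon)
          fix e :: real assume "e > 0"
          then obtain M where "(\<forall>b\<in>S. cmod (\<phi> b - \<psi> b) \<le> 0) \<longrightarrow> cmod (\<phi> a - \<psi> a) \<le> M * 0 + e"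
            using sp[OF a, of e] st by blast
          thus "cmod (\<phi> a - \<psi> a) \<le> 0 + e" using le_\<delta>[OF st] z by simp
        qed
        thus ?thesis by simp
      qed
      moreover have "\<phi> \<in> extensional (carrier A)" "\<psi> \<in> extensional (carrier A)"
        using st by (auto simp: states_def)
      ultimately show "\<phi> = \<psi>" by (rule extensionalityI[rotated 2])
    next
      assume "\<phi> = \<psi>"
      thus "\<delta> \<phi> \<psi> = 0" using \<delta>_le[of 0 \<phi> \<psi>] \<delta>0[of \<phi> \<psi>] by simp
    qed
    show "\<delta> \<phi> \<rho> \<le> \<delta> \<phi> \<psi> + \<delta> \<psi> \<rho>" if st: "\<phi> \<in> states A" "\<psi> \<in> states A" "\<rho> \<in> states A" for \<phi> \<psi> \<rho>
    proof (rule \<delta>_le)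
      fix a assume "a \<in> S"
      thus "cmod (\<phi> a - \<rho> a) \<le> \<delta> \<phi> \<psi> + \<delta> \<psi> \<rho>"
        using le_\<delta>[OF st(1,2)] le_\<delta>[OF st(2,3)] norm_triangle_ineq[of "\<phi> a - \<psi> a" "\<psi> a - \<rho> a"]
        by fastforce
    qed (use \<delta>0 in simp)
  qed
  interpret M: Metric_space "states A" \<delta> by (rule M)
  have top: "topspace (weak_star A) = states A"
    by (auto simp: weak_star_def states_def extensional_def PiE_def)
  have ev: "continuous_map (weak_star A) euclidean (\<lambda>\<phi>. \<phi> a)" if "a \<in> carrier A" for a
    unfolding weak_star_def using that
    by (intro continuous_map_from_subtopology continuous_map_product_projection)
  have c1: "continuous_map (weak_star A) M.mtopology id"
    unfolding M.continuous_map_to_metric top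
  proof (intro ballI allI impI)
    fix \<phi> and \<epsilon> :: real assume \<phi>: "\<phi> \<in> states A" and e: "\<epsilon> > 0"
    have "\<epsilon> / 8 > 0" using e by simp
    then obtain K and d :: nat and e where Kde: "K \<ge> 0" "\<And>i. i < d \<Longrightarrow> e i \<in> carrier A"
      "\<And>\<phi> \<psi> a. \<phi> \<in> states A \<Longrightarrow> \<psi> \<in> states A \<Longrightarrow> a \<in> S \<Longrightarrow>
      cmod (\<phi> a - \<psi> a) \<le> 2 * (\<epsilon> / 8) + K * (\<Sum>i<d. cmod (\<phi> (e i) - \<psi> (e i)))"
      using approx[of "\<epsilon> / 8"] by blast
    define g where "g \<psi> = (\<Sum>i<d. cmod (\<phi> (e i) - \<psi> (e i)))" for \<psi>
    have g: "continuous_map (weak_star A) euclidean g"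
      unfolding g_def
    proof (rule continuous_map_sum)
      fix i assume "i \<in> {..<d}"
      hence 1: "continuous_map (weak_star A) euclidean (\<lambda>\<psi>. \<psi> (e i))" using Kde(2) by (intro ev) simp
      have 2: "continuous_map euclidean euclidean (\<lambda>z. cmod (\<phi> (e i) - z))"
        by (auto intro!: continuous_intros)
      have "continuous_map (weak_star A) euclidean ((\<lambda>z. cmod (\<phi> (e i) - z)) \<circ> (\<lambda>\<psi>. \<psi> (e i)))"
        by (rule continuous_map_compose[OF 1 2])
      thus "continuous_map (weak_star A) euclidean (\<lambda>\<psi>. cmod (\<phi> (e i) - \<psi> (e i)))" by (simp add: o_def)
    qed simp
    define \<eta> where "\<eta> = \<epsilon> / (4 * (K + 1))"
    have \<eta>: "\<eta> > 0" "K * \<eta> \<le> \<epsilon> / 4" using e Kde(1) by (auto simp: \<eta>_def divide_simps)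
    let ?U = "{\<psi> \<in> topspace (weak_star A). g \<psi> \<in> {..<\<eta>}}"
    have "openin (weak_star A) ?U" by (rule openin_continuous_map_preimage[OF g]) simp
    moreover have "\<phi> \<in> ?U" using \<phi> \<eta> by (simp add: top g_def)
    moreover have "id \<psi> \<in> M.mball (id \<phi>) \<epsilon>" if \<psi>: "\<psi> \<in> ?U" for \<psi>
    proof -
      have "\<delta> \<phi> \<psi> \<le> \<epsilon> / 2"
      proof (rule \<delta>_le)
        fix a assume "a \<in> S"
        hence "cmod (\<phi> a - \<psi> a) \<le> 2 * (\<epsilon> / 8) + K * g \<psi>"
          using Kde(3)[of \<phi> \<psi> a] \<phi> \<psi> by (simp add: top g_def)
        also have "K * g \<psi> \<le> K * \<eta>" using \<psi> Kde(1) by (intro mult_left_mono) auto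
        finally show "cmod (\<phi> a - \<psi> a) \<le> \<epsilon> / 2" using \<eta> by simp
      qed (use e in simp)
      thus ?thesis using \<phi> \<psi> e by (simp add: top)
    qed
    ultimately show "\<exists>U. openin (weak_star A) U \<and> \<phi> \<in> U \<and> (\<forall>\<psi>\<in>U. id \<psi> \<in> M.mball (id \<phi>) \<epsilon>)" by blast
  qed
  have c2: "continuous_map M.mtopology (weak_star A) id"
    unfolding weak_star_def
  proof (rule continuous_map_into_subtopology)
    show "continuous_map M.mtopology (product_topology (\<lambda>_. euclidean) (carrier A)) id"
      unfolding continuous_map_componentwise
    proof (intro conjI ballI)
      show "id ` topspace M.mtopology \<subseteq> extensional (carrier A)"
        by (simp only: M.topspace_mtopology) (auto simp: states_def)
      fix a assume a: "a \<in> carrier A"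
      have "continuous_map M.mtopology Met_TC.mtopology (\<lambda>\<phi>. id \<phi> a)"
        unfolding Met_TC.continuous_map_to_metric M.topspace_mtopology
      proof (intro ballI allI impI)
        fix \<phi> and \<epsilon> :: real assume \<phi>: "\<phi> \<in> states A" and e: "\<epsilon> > 0"
        obtain M where Mp: "M \<ge> 0" "\<And>\<psi> r. \<psi> \<in> states A \<Longrightarrow> r \<ge> 0 \<Longrightarrow> (\<forall>b\<in>S. cmod (\<phi> b - \<psi> b) \<le> r) \<Longrightarrow>
            cmod (\<phi> a - \<psi> a) \<le> M * r + \<epsilon> / 2"
          using sp[OF a, of "\<epsilon> / 2"] \<phi> e by auto
        define r where "r = \<epsilon> / (4 * (M + 1))"
        have r: "r > 0" "M * r \<le> \<epsilon> / 4" using e Mp(1) by (auto simp: r_def divide_simps)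
        have "id \<psi> a \<in> Met_TC.mball (id \<phi> a) \<epsilon>" if "\<psi> \<in> M.mball \<phi> r" for \<psi>
        proof -
          have \<psi>: "\<psi> \<in> states A" "\<delta> \<phi> \<psi> < r" using that by auto
          have "cmod (\<phi> a - \<psi> a) \<le> M * r + \<epsilon> / 2"
            using le_\<delta>[OF \<phi> \<psi>(1)] \<psi> r by (intro Mp(2)) fastforce+
          hence "cmod (\<phi> a - \<psi> a) < \<epsilon>" using r e by linarith
          thus ?thesis by (simp add: dist_norm)
        qed
        moreover have "\<phi> \<in> M.mball \<phi> r" using \<phi> r by simp
        ultimately show "\<exists>U. openin M.mtopology U \<and> \<phi> \<in> U \<and> (\<forall>\<psi>\<in>U. id \<psi> a \<in> Met_TC.mball (id \<phi> a) \<epsilon>)"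
          by (intro exI[of _ "M.mball \<phi> r"]) auto
      qed
      thus "continuous_map M.mtopology euclidean (\<lambda>\<phi>. id \<phi> a)" by simp
    qed
  qed auto
  have "M.mtopology = weak_star A"
  proof (rule topology_eq[THEN iffD2], intro allI iffI)
    fix U assume U: "openin M.mtopology U"
    hence "U \<subseteq> states A" using openin_subset by force
    hence "{x \<in> topspace (weak_star A). id x \<in> U} = U" by (auto simp: top)
    thus "openin (weak_star A) U" using openin_continuous_map_preimage[OF c1 U] by simp
  next
    fix U assume U: "openin (weak_star A) U"
    hence "U \<subseteq> states A" using openin_subset top by force
    hence "{x \<in> topspace M.mtopology. id x \<in> U} = U" by auto
    thus "openin M.mtopology U" using openin_continuous_map_preimage[OF c2 U] by simp
  qed
  thus ?thesis using fin M unfolding metrizes_weak_star_def \<delta>_def by blast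
qed

lemma half_ennreal: "ennreal (1 / 2) * (z + z) = z"
proof -
  have "ennreal (1 / 2) + ennreal (1 / 2) = 1" by (subst ennreal_plus[symmetric]) auto
  moreover have "ennreal (1 / 2) * (z + z) = (ennreal (1 / 2) + ennreal (1 / 2)) * z"
    by (simp only: distrib_left distrib_right)
  ultimately show ?thesis by simp
qed

text \<open>The subalgebra \<open>X\<close> will be one of the stages or the whole algebra.\<close>

locale ci_sub = ci A \<tau> F \<beta> for A :: "'a cstar" (structure) and \<tau> F \<beta> +
  fixes X :: "'a set"
  assumes X_sub: "X \<subseteq> carrier A"
    and X_add: "\<lbrakk>x \<in> X; y \<in> X\<rbrakk> \<Longrightarrow> x \<oplus> y \<in> X"
    and X_smult: "x \<in> X \<Longrightarrow> c \<odot> x \<in> X"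
    and X_mult: "\<lbrakk>x \<in> X; y \<in> X\<rbrakk> \<Longrightarrow> x \<otimes> y \<in> X"
    and X_star: "x \<in> X \<Longrightarrow> star A x \<in> X"
    and X_one: "\<one> \<in> X"
    and X_closed: "\<lbrakk>\<And>n. f n \<in> X; x \<in> carrier A; (\<lambda>n. nrm A (f n \<ominus> x)) \<longlonglongrightarrow> 0\<rbrakk> \<Longrightarrow> x \<in> X"
    and X_bounded: "\<epsilon> > 0 \<Longrightarrow> \<exists>n. F n \<subseteq> X \<and> (\<forall>a\<in>X. lipb 1 a \<longrightarrow> nrm A (a \<ominus> E n a) \<le> \<epsilon>)"
    and X_dense: "\<lbrakk>a \<in> X; \<epsilon> > 0\<rbrakk> \<Longrightarrow> \<exists>n. F n \<subseteq> X \<and> (\<exists>b\<in>F n. nrm A (a \<ominus> b) < \<epsilon>)"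
begin

abbreviation "AX \<equiv> A\<lparr>carrier := X\<rparr>"

lemma X_carrier [simp]: "x \<in> X \<Longrightarrow> x \<in> carrier A"
  using X_sub by blast

lemma X_zero: "\<zero> \<in> X"
  using X_smult[OF X_one, of 0] by simp

lemma X_minus: "x \<in> X \<Longrightarrow> y \<in> X \<Longrightarrow> x \<ominus> y \<in> X"
  by (simp add: minus_eq_smult X_add X_smult)

lemma abelian_group_AX: "abelian_group AX"
proof (rule abelian_groupI)
  fix x assume x: "x \<in> carrier AX"
  have "(-1) \<odot> x \<oplus> x = \<zero>" using x l_neg[of x] by (simp add: uminus_eq_smult)
  thus "\<exists>y\<in>carrier AX. y \<oplus>\<^bsub>AX\<^esub> x = \<zero>\<^bsub>AX\<^esub>" using x by (intro bexI[of _ "(-1) \<odot> x"]) (auto simp: X_smult)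
qed (auto simp: X_add X_zero a_ac)

lemma module_AX: "Module.module class_ring AX"
proof (rule moduleI)
  show "cring (class_ring :: complex ring)"
    by (rule class_field[THEN field.axioms(1), THEN domain.axioms(1)])
qed (auto simp: abelian_group_AX X_smult smult_add_left smult_add_right smult_smult class_ring_simps)

lemma minus_AX: "x \<in> X \<Longrightarrow> y \<in> X \<Longrightarrow> x \<ominus>\<^bsub>AX\<^esub> y = x \<ominus> y"
  using cvec.minus_eq_smult[OF cvec.intro[OF module_AX], of x y] by (simp add: minus_eq_smult)

lemma ring_AX: "Ring.ring AX"
proof (rule ringI)
  show "Group.monoid AX" by (rule monoidI) (auto simp: X_mult X_one m_assoc)
qed (auto simp: abelian_group_AX l_distr r_distr)

lemma cstar_AX: "cstar_algebra AX"
  unfolding cstar_algebra_def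
proof (intro conjI allI impI)
  fix f :: "nat \<Rightarrow> 'a" assume f: "\<forall>n. f n \<in> carrier AX"
    and c: "\<forall>\<epsilon>>0. \<exists>N. \<forall>m\<ge>N. \<forall>n\<ge>N. nrm AX (f m \<ominus>\<^bsub>AX\<^esub> f n) < \<epsilon>"
  have fX: "f n \<in> X" for n using f by simp
  have "\<exists>x\<in>carrier A. (\<lambda>n. nrm A (f n \<ominus> x)) \<longlonglongrightarrow> 0"
    using fX c by (intro complete) (auto simp: minus_AX)
  then obtain x where x: "x \<in> carrier A" "(\<lambda>n. nrm A (f n \<ominus> x)) \<longlonglongrightarrow> 0" by blast
  moreover from this have "x \<in> X" using X_closed[of f x] fX by blast
  ultimately show "\<exists>x\<in>carrier AX. (\<lambda>n. nrm AX (f n \<ominus>\<^bsub>AX\<^esub> x)) \<longlonglongrightarrow> 0"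
    using fX by (intro bexI[of _ x]) (auto simp: minus_AX)
qed (auto simp: ring_AX module_AX smult_mult_left smult_mult_right X_star star_add star_mult star_smult
    N_nonneg nrm_eq_0 N_add nrm_mult N_smult nrm_cstar)

sublocale AX: cstar AX by (rule cstar.intro, rule cstar_AX)

lemma AX_state: "\<phi> \<in> states AX \<Longrightarrow> cstate AX \<phi>"
  by unfold_locales

lemma X_real_parts:
  assumes b: "b \<in> F n" and FX: "F n \<subseteq> X"
  obtains h k where "h \<in> F n" "k \<in> F n" "h \<in> sa AX" "k \<in> sa AX" "b = h \<oplus> \<i> \<odot> k"
proof (rule that)
  let ?h = "(1/2) \<odot> (b \<oplus> star A b)" and ?k = "(-\<i>/2) \<odot> (b \<oplus> (-1) \<odot> star A b)"
  have bc: "b \<in> carrier A" using b by simp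
  show h: "?h \<in> F n" and k: "?k \<in> F n" using b by simp_all
  show "?h \<in> sa AX" using bc h FX by (auto simp: sa_def star_smult star_add a_comm)
  have "star A ?k = ?k" using bc
    by (simp add: star_smult star_add smult_add_right smult_smult a_comm)
  thus "?k \<in> sa AX" using k FX by (auto simp: sa_def)
  show "b = ?h \<oplus> \<i> \<odot> ?k"
  proof -
    have "?h \<oplus> \<i> \<odot> ?k = ((1/2) \<odot> b \<oplus> (1/2) \<odot> b) \<oplus> ((1/2) \<odot> star A b \<oplus> (-1/2) \<odot> star A b)"
      using bc by (simp add: smult_add_right smult_smult a_ac)
    also have "\<dots> = b" using bc by (simp only: smult_add_left[symmetric] star_closed) simp
    finally show ?thesis by simp
  qed
qed

text \<open>S may lie anywhere between the self-adjoint Lipschitz ball and the full one, which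
  covers the metric of \<open>propinquity_class\<close> as well as that of
  \<open>leibniz_cqms\<close>.\<close>

lemma metrizes:
  assumes S: "S \<subseteq> X" and S1: "\<And>a. a \<in> S \<Longrightarrow> L a \<le> 1" and S2: "\<And>a. a \<in> sa AX \<Longrightarrow> L a \<le> 1 \<Longrightarrow> a \<in> S"
  shows "metrizes_weak_star AX (mk_dist S)"
proof (rule AX.metrizes_weak_starI)
  show "S \<subseteq> carrier AX" using S by simp
next
  fix \<epsilon> :: real assume "\<epsilon> > 0"
  then obtain n where n: "F n \<subseteq> X" "\<And>a. a \<in> X \<Longrightarrow> lipb 1 a \<Longrightarrow> nrm A (a \<ominus> E n a) \<le> \<epsilon>"
    using X_bounded by blast
  obtain d e where e: "\<And>i. i < d \<Longrightarrow> e i \<in> F n" "\<And>i. i < d \<Longrightarrow> e i \<in> carrier A"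
      "\<And>i j. i < d \<Longrightarrow> j < d \<Longrightarrow> s (e i) (e j) = of_bool (i = j)"
      and ex: "\<And>x. x \<in> F n \<Longrightarrow> lcomb A (\<lambda>i. s x (e i)) e d = x"
    using basisE[of n] by metis
  have lc: "lcomb AX c e k = lcomb A c e k" for c k by (induction k) auto
  have "\<exists>c l. (\<forall>i<d. cmod (c i) \<le> tl 0) \<and> nrm AX (a \<ominus>\<^bsub>AX\<^esub> (l \<odot>\<^bsub>AX\<^esub> \<one>\<^bsub>AX\<^esub> \<oplus>\<^bsub>AX\<^esub> lcomb AX c e d)) \<le> \<epsilon>"
    if a: "a \<in> S" for a
  proof -
    have aX: "a \<in> X" using a S by blast
    hence ac: "a \<in> carrier A" by simp
    have l1: "lipb 1 a" using S1[OF a] L_le_iff[OF ac, of 1] by simp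
    \<comment> \<open>The norm of a is not controlled by its seminorm; after removal of the scalar
      part E 0 a the tail estimate at stage 0 bounds all coefficients by
      \<open>tl 0\<close>.\<close>
    let ?b = "E n a \<ominus> E 0 a"
    have b: "?b \<in> F n" using F_mono[of 0 n "E 0 a"] ac by simp
    have eb: "?b = E n (a \<ominus> E 0 a)" using ac by (simp add: E_minus E_E')
    have nb: "nrm A ?b \<le> tl 0"
      using nrm_E[of "a \<ominus> E 0 a" n] nrm_minus_E_le[OF ac _ l1, of 0] ac unfolding eb by simp
    have te: "cmod (s ?b (e i)) \<le> tl 0" if i: "i < d" for i
    proof -
      have "tn (e i) = 1" using e(3)[OF i i] by (simp add: tau_norm_def)
      hence "cmod (s ?b (e i)) \<le> tn ?b" using Cauchy_Schwarz[OF F_carrier[OF b] e(2)[OF i]] by simp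
      also have "\<dots> \<le> nrm A ?b" using ac by (intro tn_le_nrm) simp
      finally show ?thesis using nb by simp
    qed
    have En: "E n a \<in> X" using n(1) ac by (meson E_F subsetD)
    have "\<tau> a \<odot> \<one> \<oplus> lcomb A (\<lambda>i. s ?b (e i)) e d = E n a"
      unfolding ex[OF b] E_0[OF ac, symmetric] using ac by (simp add: add_minus_cancel)
    hence "nrm AX (a \<ominus>\<^bsub>AX\<^esub> (\<tau> a \<odot>\<^bsub>AX\<^esub> \<one>\<^bsub>AX\<^esub> \<oplus>\<^bsub>AX\<^esub> lcomb AX (\<lambda>i. s ?b (e i)) e d)) \<le> \<epsilon>"
      using n(2)[OF aX l1] minus_AX[OF aX En] by (simp add: lc)
    thus ?thesis using te
      by (intro exI[of _ "\<lambda>i. s ?b (e i)"] exI[of _ "\<tau> a"] conjI allI impI)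
  qed
  thus "\<exists>K d e. (\<forall>i<d. e i \<in> carrier AX) \<and> (\<forall>a\<in>S. \<exists>c l. (\<forall>i<d. cmod (c i) \<le> K) \<and>
      nrm AX (a \<ominus>\<^bsub>AX\<^esub> (l \<odot>\<^bsub>AX\<^esub> \<one>\<^bsub>AX\<^esub> \<oplus>\<^bsub>AX\<^esub> lcomb AX c e d)) \<le> \<epsilon>)"
    using e(1) n(1) by (intro exI[of _ "tl 0"] exI[of _ d] exI[of _ e]) auto
next
  fix a and \<epsilon> :: real assume "a \<in> carrier AX" and e: "\<epsilon> > 0"
  hence aX: "a \<in> X" by simp
  obtain n b where b: "F n \<subseteq> X" "b \<in> F n" "nrm A (a \<ominus> b) < \<epsilon> / 2"
    using X_dense[OF aX, of "\<epsilon> / 2"] e by auto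
  obtain h k where hk: "h \<in> F n" "k \<in> F n" "h \<in> sa AX" "k \<in> sa AX" "b = h \<oplus> \<i> \<odot> k"
    using X_real_parts[OF b(2,1)] by blast
  have X: "b \<in> X" "h \<in> X" "k \<in> X" "\<i> \<odot> k \<in> X" using b hk X_smult by auto
  obtain C where C: "C \<ge> 0" "lipb C h" using lipb_ex[OF hk(1)] by blast
  obtain C' where C': "C' \<ge> 0" "lipb C' k" using lipb_ex[OF hk(2)] by blast
  \<comment> \<open>One common scale for the real and the imaginary part of b; the summand 1 makes
    it positive even when both bounds vanish.\<close>
  define c where "c = C + C' + 1"
  have c: "c > 0" "C \<le> c" "C' \<le> c" using C C' by (auto simp: c_def)
  have inS: "complex_of_real (1 / c) \<odot> u \<in> S" if u: "u \<in> sa AX" "lipb c u" for u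
  proof (rule S2)
    have uX: "u \<in> X" using u by (simp add: sa_def)
    show "complex_of_real (1 / c) \<odot> u \<in> sa AX" using u by (auto simp: sa_def star_smult X_smult)
    have "lipb 1 (complex_of_real (1 / c) \<odot> u)"
      using lipb_smult[OF _ u(2), of "complex_of_real (1 / c)"] uX c by (simp add: norm_divide)
    thus "L (complex_of_real (1 / c) \<odot> u) \<le> 1" using L_le_iff[of "complex_of_real (1 / c) \<odot> u" 1] uX by simp
  qed
  have "cmod (\<phi> a - \<psi> a) \<le> (2 * c) * r + \<epsilon>"
    if st: "\<phi> \<in> states AX" "\<psi> \<in> states AX" and r: "r \<ge> 0" "\<And>b. b \<in> S \<Longrightarrow> cmod (\<phi> b - \<psi> b) \<le> r" for \<phi> \<psi> r
  proof -
    interpret P: cstate AX \<phi> using st by (intro AX_state)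
    interpret Q: cstate AX \<psi> using st by (intro AX_state)
    have u: "cmod (\<phi> u - \<psi> u) \<le> c * r" if u: "u \<in> sa AX" "lipb c u" for u
    proof -
      have "u \<in> X" using u by (simp add: sa_def)
      hence eq: "\<phi> (complex_of_real (1 / c) \<odot> u) - \<psi> (complex_of_real (1 / c) \<odot> u) = complex_of_real (1 / c) * (\<phi> u - \<psi> u)"
        using P.st_smult[of u "complex_of_real (1 / c)"] Q.st_smult[of u "complex_of_real (1 / c)"]
        by (simp add: right_diff_distrib)
      have "cmod (complex_of_real (1 / c) * (\<phi> u - \<psi> u)) \<le> r"
        using r(2)[OF inS[OF u]] unfolding eq .
      thus ?thesis using c(1) by (simp add: norm_mult norm_divide pos_divide_le_eq mult.commute)
    qed
    have "\<phi> b - \<psi> b = (\<phi> h - \<psi> h) + \<i> * (\<phi> k - \<psi> k)"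
      using X P.st_add[of h "\<i> \<odot> k"] Q.st_add[of h "\<i> \<odot> k"] P.st_smult[of k \<i>] Q.st_smult[of k \<i>]
      by (simp add: hk(5) algebra_simps)
    hence "cmod (\<phi> b - \<psi> b) \<le> cmod (\<phi> h - \<psi> h) + cmod (\<phi> k - \<psi> k)"
      using norm_triangle_ineq[of "\<phi> h - \<psi> h" "\<i> * (\<phi> k - \<psi> k)"] by (simp add: norm_mult)
    also have "\<dots> \<le> c * r + c * r"
      using C C' c hk by (intro add_mono u) (auto intro: lipb_mono)
    finally have 1: "cmod (\<phi> b - \<psi> b) \<le> c * r + c * r" .
    have ab: "a \<ominus> b \<in> carrier AX" using X_minus[OF aX X(1)] by simp
    have "\<phi> a - \<psi> a = \<phi> (a \<ominus> b) - \<psi> (a \<ominus> b) + (\<phi> b - \<psi> b)"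
      using P.st_minus[of a b] Q.st_minus[of a b] aX X by (simp add: minus_AX)
    hence "cmod (\<phi> a - \<psi> a) \<le> (cmod (\<phi> (a \<ominus> b)) + cmod (\<psi> (a \<ominus> b))) + cmod (\<phi> b - \<psi> b)"
      by (simp only:) (intro norm_triangle_mono norm_triangle_ineq4 order_refl)
    thus ?thesis using P.st_bound[OF ab] Q.st_bound[OF ab] b(3) 1 by simp
  qed
  thus "\<exists>M\<ge>0. \<forall>\<phi>\<in>states AX. \<forall>\<psi>\<in>states AX. \<forall>r\<ge>0.
      (\<forall>b\<in>S. cmod (\<phi> b - \<psi> b) \<le> r) \<longrightarrow> cmod (\<phi> a - \<psi> a) \<le> M * r + \<epsilon>"
    using c by (intro exI[of _ "2 * c"]) auto
qed

lemma saX: "a \<in> sa AX \<longleftrightarrow> a \<in> X \<and> star A a = a"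
  by (auto simp: sa_def)

text \<open>Treats both conditions of the class at once: c = 1/2 with c' = 1 is the Jordan product,
  c = 1/(2 \<open>\<i>\<close>) with c' = -1 the Lie product.\<close>

lemma jordan_leibniz:
  assumes a: "a \<in> carrier A" and b: "b \<in> carrier A" and c: "cmod c = 1 / 2" "cmod c' = 1"
  shows "L (c \<odot> (a \<otimes> b \<oplus> c' \<odot> (b \<otimes> a))) \<le> ennreal (nrm A a) * L b + ennreal (nrm A b) * L a"
proof -
  let ?z = "ennreal (nrm A a) * L b + ennreal (nrm A b) * L a"
  have "L (c \<odot> (a \<otimes> b \<oplus> c' \<odot> (b \<otimes> a))) = ennreal (1 / 2) * L (a \<otimes> b \<oplus> c' \<odot> (b \<otimes> a))"
    using L_smult[of "a \<otimes> b \<oplus> c' \<odot> (b \<otimes> a)" c] a b unfolding c by simp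
  also have "\<dots> \<le> ennreal (1 / 2) * (L (a \<otimes> b) + L (c' \<odot> (b \<otimes> a)))"
    using a b by (intro mult_left_mono L_add) auto
  also have "\<dots> \<le> ennreal (1 / 2) * (?z + ?z)"
    using a b c L_mult[OF a b] L_mult[OF b a] by (intro mult_left_mono add_mono) (auto simp: L_smult add.commute)
  finally show ?thesis by (simp only: half_ennreal)
qed

lemma propinquity_class: "propinquity_class (AX, L)"
  unfolding propinquity_class_def prod.case
proof (intro conjI ballI allI impI)
  show "cstar_algebra AX" by (rule cstar_AX)
  show "metrizes_weak_star AX (mk_dist (sa_lip_ball AX L))"
    by (rule metrizes) (auto simp: sa_lip_ball_def saX)
next
  fix a b assume "a \<in> sa AX" "b \<in> sa AX"
  hence ab: "a \<in> X" "b \<in> X" by (auto simp: saX)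
  show "L (a \<oplus>\<^bsub>AX\<^esub> b) \<le> L a + L b" using ab by (simp add: L_add)
  show "L ((1/2) \<odot>\<^bsub>AX\<^esub> (a \<otimes>\<^bsub>AX\<^esub> b \<oplus>\<^bsub>AX\<^esub> b \<otimes>\<^bsub>AX\<^esub> a))
      \<le> ennreal (nrm AX a) * L b + ennreal (nrm AX b) * L a"
    using jordan_leibniz[of a b "1/2" 1] ab by simp
  have "a \<otimes> b \<ominus>\<^bsub>AX\<^esub> b \<otimes> a = a \<otimes> b \<oplus> (-1) \<odot> (b \<otimes> a)"
    using ab by (simp add: minus_AX X_mult minus_eq_smult)
  thus "L ((1/(2*\<i>)) \<odot>\<^bsub>AX\<^esub> (a \<otimes>\<^bsub>AX\<^esub> b \<ominus>\<^bsub>AX\<^esub> b \<otimes>\<^bsub>AX\<^esub> a))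
      \<le> ennreal (nrm AX a) * L b + ennreal (nrm AX b) * L a"
    using jordan_leibniz[of a b "1/(2*\<i>)" "-1"] ab by (simp add: norm_divide norm_mult)
next
  fix r a assume "a \<in> sa AX"
  thus "L (complex_of_real r \<odot>\<^bsub>AX\<^esub> a) = ennreal \<bar>r\<bar> * L a" by (simp add: saX L_smult)
next
  fix f :: "nat \<Rightarrow> 'a" and a
  assume f: "\<forall>n. f n \<in> sa AX" and a: "a \<in> sa AX" and l: "(\<lambda>n. nrm AX (f n \<ominus>\<^bsub>AX\<^esub> a)) \<longlonglongrightarrow> 0"
  have "(\<lambda>n. nrm A (f n \<ominus> a)) \<longlonglongrightarrow> 0" using l f a by (simp add: saX minus_AX)
  thus "L a \<le> liminf (\<lambda>n. L (f n))" using f a by (intro L_lsc) (auto simp: saX)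
next
  show "dense_in AX (sa AX) {a \<in> sa AX. L a < \<infinity>}"
    unfolding dense_in_def
  proof (intro conjI ballI allI impI)
    fix a and \<epsilon> :: real assume a: "a \<in> sa AX" and e: "\<epsilon> > 0"
    have aX: "a \<in> X" "star A a = a" and ac: "a \<in> carrier A" using a by (auto simp: saX)
    obtain n b where b: "F n \<subseteq> X" "b \<in> F n" "nrm A (a \<ominus> b) < \<epsilon>"
      using X_dense[OF aX(1) e] by auto
    have bc: "b \<in> carrier A" using b by simp
    \<comment> \<open>The self-adjoint part of b is at most as far from the self-adjoint a as b
      is.\<close>
    let ?h = "(1/2) \<odot> (b \<oplus> star A b)"
    have h: "?h \<in> F n" "star A ?h = ?h" using b bc by (auto simp: star_smult star_add a_comm)
    have "a = (1/2) \<odot> (a \<oplus> star A a)"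
      unfolding aX(2) using ac smult_add_left[of a "1/2" "1/2"] by (simp add: smult_add_right)
    hence "a \<ominus> ?h = (1/2) \<odot> (a \<oplus> star A a) \<ominus> ?h" by simp
    also have "\<dots> = (1/2) \<odot> ((a \<ominus> b) \<oplus> star A (a \<ominus> b))"
      using ac bc by (simp add: smult_minus[symmetric] add_minus_add star_minus)
    finally have "nrm A (a \<ominus> ?h) \<le> (1/2) * (nrm A (a \<ominus> b) + nrm A (star A (a \<ominus> b)))"
      using ac bc N_add[of "a \<ominus> b" "star A (a \<ominus> b)"] by (simp add: N_smult)
    also have "\<dots> = nrm A (a \<ominus> b)" using ac bc nrm_star[of "a \<ominus> b"] by simp
    finally have "nrm A (a \<ominus> ?h) < \<epsilon>" using b(3) by simp
    moreover have "?h \<in> X" using h b by blast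
    ultimately show "\<exists>y\<in>{a \<in> sa AX. L a < \<infinity>}. nrm AX (a \<ominus>\<^bsub>AX\<^esub> y) < \<epsilon>"
      using h L_F[OF h(1)] aX by (intro bexI[of _ ?h]) (auto simp: saX minus_AX)
  qed auto
next
  show "{a \<in> sa AX. L a = 0} = {complex_of_real r \<odot>\<^bsub>AX\<^esub> \<one>\<^bsub>AX\<^esub> |r. True}"
  proof (intro equalityI subsetI)
    fix a assume "a \<in> {a \<in> sa AX. L a = 0}"
    hence a: "a \<in> carrier A" "star A a = a" "L a = 0" by (auto simp: saX)
    then obtain c where c: "a = c \<odot> \<one>" using L_eq_0_iff by blast
    have "cnj c = c" using st_star[OF a(1)] a(2) by (simp add: c st_smult)
    hence "c = complex_of_real (Re c)" by (simp add: complex_eq_iff)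
    with c have "a = complex_of_real (Re c) \<odot> \<one>" by metis
    thus "a \<in> {complex_of_real r \<odot>\<^bsub>AX\<^esub> \<one>\<^bsub>AX\<^esub> |r. True}" by auto
  next
    fix a assume "a \<in> {complex_of_real r \<odot>\<^bsub>AX\<^esub> \<one>\<^bsub>AX\<^esub> |r. True}"
    thus "a \<in> {a \<in> sa AX. L a = 0}" using L_eq_0_iff[of a] X_smult[OF X_one] by (auto simp: saX star_smult)
  qed
qed

end

section \<open>The whole algebra and its stages as quantum metric spaces\<close>

context ci
begin

lemma ci_sub_carrier: "ci_sub A \<tau> F \<beta> (carrier A)"
proof unfold_locales
  fix \<epsilon> :: real assume e: "\<epsilon> > 0"
  have "\<forall>\<^sub>F n in sequentially. tl n < \<epsilon>" using order_tendstoD(2)[OF tl_lim e] .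
  then obtain n where n: "tl n < \<epsilon>" by (auto simp: eventually_sequentially)
  have "nrm A (a \<ominus> E n a) \<le> \<epsilon>" if "a \<in> carrier A" "lipb 1 a" for a
    using nrm_minus_E_le[OF that(1) _ that(2), of n] n by simp
  thus "\<exists>n. F n \<subseteq> carrier A \<and> (\<forall>a\<in>carrier A. lipb 1 a \<longrightarrow> nrm A (a \<ominus> E n a) \<le> \<epsilon>)"
    using F_carrier by blast
next
  fix a and \<epsilon> :: real assume "a \<in> carrier A" "\<epsilon> > 0"
  thus "\<exists>n. F n \<subseteq> carrier A \<and> (\<exists>b\<in>F n. nrm A (a \<ominus> b) < \<epsilon>)" using F_dense[of a \<epsilon>] F_carrier by blast
qed auto

text \<open>A stage is closed because E n is contractive and fixes it: a limit x of stage elements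
  is also a limit towards E n x.\<close>

lemma ci_sub_F: "ci_sub A \<tau> F \<beta> (F n)"
proof unfold_locales
  fix f x assume f: "\<And>k. f k \<in> F n" and x: "x \<in> carrier A" and l: "(\<lambda>k. nrm A (f k \<ominus> x)) \<longlonglongrightarrow> 0"
  have "(\<lambda>k. nrm A (f k \<ominus> E n x)) \<longlonglongrightarrow> 0"
  proof (rule null_le[OF _ _ l])
    fix k show "nrm A (f k \<ominus> E n x) \<le> nrm A (f k \<ominus> x)"
      using nrm_E[of "f k \<ominus> x" n] F_carrier[OF f] x by (simp add: E_minus E_id[OF f])
  qed (use F_carrier[OF f] x in \<open>auto intro: N_nonneg\<close>)
  hence "nrm A (x \<ominus> E n x) = 0"
    using F_carrier[OF f] x l by (intro lim_unique[of f]) auto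
  hence "x = E n x" using nrm_eq_0[of "x \<ominus> E n x"] x minus_eq_zero[of x "E n x"] by simp
  thus "x \<in> F n" using x by (metis E_F)
next
  fix \<epsilon> :: real assume e: "\<epsilon> > 0"
  have "nrm A (a \<ominus> E n a) \<le> \<epsilon>" if "a \<in> F n" for a using that e by (simp add: E_id)
  thus "\<exists>m. F m \<subseteq> F n \<and> (\<forall>a\<in>F n. lipb 1 a \<longrightarrow> nrm A (a \<ominus> E m a) \<le> \<epsilon>)" by blast
next
  fix a and \<epsilon> :: real assume "a \<in> F n" "\<epsilon> > 0"
  thus "\<exists>m. F m \<subseteq> F n \<and> (\<exists>b\<in>F m. nrm A (a \<ominus> b) < \<epsilon>)" by (intro exI[of _ n] conjI bexI[of _ a]) auto
qed auto

lemma propinquity_class_A: "propinquity_class (A, L)"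
  using ci_sub.propinquity_class[OF ci_sub_carrier] by simp

lemma propinquity_class_F: "propinquity_class (A\<lparr>carrier := F n\<rparr>, L)"
  using ci_sub.propinquity_class[OF ci_sub_F] .

lemma leibniz_cqms_A: "leibniz_cqms (A, L)"
  unfolding leibniz_cqms_def prod.case
proof (intro conjI ballI allI)
  show "cstar_algebra A" by (rule cstar_alg)
  have "metrizes_weak_star (A\<lparr>carrier := carrier A\<rparr>) (mk_dist (lip_ball A L))"
    by (rule ci_sub.metrizes[OF ci_sub_carrier]) (auto simp: lip_ball_def sa_def)
  thus "metrizes_weak_star A (mk_dist (lip_ball A L))" by simp
  show "star_subalgebra A {a \<in> carrier A. L a < \<infinity>}"
    unfolding star_subalgebra_def
  proof (intro conjI ballI allI)
    fix x y assume xy: "x \<in> {a \<in> carrier A. L a < \<infinity>}" "y \<in> {a \<in> carrier A. L a < \<infinity>}"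
    have "L (x \<oplus> y) < \<infinity>" using L_add[of x y] xy by (auto simp: le_less_trans)
    thus "x \<oplus> y \<in> {a \<in> carrier A. L a < \<infinity>}" using xy by simp
    have "ennreal (nrm A x) * L y + ennreal (nrm A y) * L x < \<infinity>"
      using xy by (auto simp: ennreal_mult_less_top)
    hence "L (x \<otimes> y) < \<infinity>" using L_mult[of x y] xy le_less_trans by blast
    thus "x \<otimes> y \<in> {a \<in> carrier A. L a < \<infinity>}" using xy by simp
  qed (auto simp: L_zero_elt L_smult L_star ennreal_mult_less_top)
  show "dense_in A (carrier A) {a \<in> carrier A. L a < \<infinity>}"
    unfolding dense_in_def using F_dense L_F F_carrier by blast
  show "{a \<in> carrier A. L a = 0} = {c \<odot> \<one> |c. True}"
    using L_eq_0_iff by auto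
qed (auto simp: L_add L_smult L_star L_mult)

end

section \<open>Matrix algebras\<close>

no_notation inner (infixl "\<bullet>" 70)

definition cip :: "complex vec \<Rightarrow> complex vec \<Rightarrow> complex" where
  "cip v w = v \<bullet>c w"

definition vn :: "complex vec \<Rightarrow> real" where
  "vn v = sqrt (Re (v \<bullet>c v))"

lemma cip_sum: "v \<in> carrier_vec n \<Longrightarrow> w \<in> carrier_vec n \<Longrightarrow> cip v w = (\<Sum>i<n. vec_index v i * cnj (vec_index w i))"
  by (auto simp: cip_def scalar_prod_def lessThan_atLeast0 intro!: sum.cong)

interpretation cv: sesq "module_vec TYPE(complex) n" cip vn for n
proof (rule sesq.intro)
  show "cvec (module_vec TYPE(complex) n)" by (rule cvec.intro, rule vec_module)
  show "sesq_axioms (module_vec TYPE(complex) n) cip vn"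
  proof
    fix x y z :: "complex vec" and c
    assume "x \<in> carrier (module_vec TYPE(complex) n)" "y \<in> carrier (module_vec TYPE(complex) n)"
      "z \<in> carrier (module_vec TYPE(complex) n)"
    hence c: "x \<in> carrier_vec n" "y \<in> carrier_vec n" "z \<in> carrier_vec n" by (auto simp: module_vec_simps)
    show "cip (x \<oplus>\<^bsub>module_vec TYPE(complex) n\<^esub> y) z = cip x z + cip y z"
      using c by (simp add: module_vec_simps cip_sum[of _ n] distrib_right sum.distrib)
  next
    fix x z :: "complex vec" and c
    assume "x \<in> carrier (module_vec TYPE(complex) n)" "z \<in> carrier (module_vec TYPE(complex) n)"
    hence c: "x \<in> carrier_vec n" "z \<in> carrier_vec n" by (auto simp: module_vec_simps)
    show "cip (c \<odot>\<^bsub>module_vec TYPE(complex) n\<^esub> x) z = c * cip x z"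
      using c by (simp add: module_vec_simps cip_sum[of _ n] sum_distrib_left mult.assoc)
  next
    fix x y :: "complex vec"
    assume "x \<in> carrier (module_vec TYPE(complex) n)" "y \<in> carrier (module_vec TYPE(complex) n)"
    hence c: "x \<in> carrier_vec n" "y \<in> carrier_vec n" by (auto simp: module_vec_simps)
    show "cip x y = cnj (cip y x)"
      using c by (simp add: cip_sum[of _ n] mult.commute)
    show "0 \<le> Re (cip x x)"
      using c by (simp add: cip_sum[of _ n] complex_mult_cnj sum_nonneg)
  qed (simp add: vn_def cip_def)
qed

lemma vn_sq: "v \<in> carrier_vec n \<Longrightarrow> (vn v)\<^sup>2 = (\<Sum>i<n. (cmod (vec_index v i))\<^sup>2)"
proof -
  assume v: "v \<in> carrier_vec n"
  have "cip v v = complex_of_real (\<Sum>i<n. (cmod (vec_index v i))\<^sup>2)"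
    using v by (simp add: cip_sum[of _ n] complex_norm_square[symmetric] del: of_real_power)
  thus ?thesis using cv.tn_sq[of v n] v by (simp add: module_vec_simps)
qed

lemma vn_nonneg [simp]: "v \<in> carrier_vec n \<Longrightarrow> 0 \<le> vn v"
  using cv.tn_nonneg[of v n] by (simp add: module_vec_simps)

lemma vn_component_le: "v \<in> carrier_vec n \<Longrightarrow> i < n \<Longrightarrow> cmod (vec_index v i) \<le> vn v"
  by (rule power2_le_imp_le) (auto simp: vn_sq[of _ n] intro: member_le_sum[of i "{..<n}" "\<lambda>i. (cmod (vec_index v i))\<^sup>2"])

lemma vn_le_sum: assumes v: "v \<in> carrier_vec n" shows "vn v \<le> (\<Sum>i<n. cmod (vec_index v i))"
proof (rule power2_le_imp_le)
  have "(vn v)\<^sup>2 = (\<Sum>i<n. cmod (vec_index v i) * cmod (vec_index v i))"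
    using vn_sq[OF v] by (simp add: power2_eq_square)
  also have "\<dots> \<le> (\<Sum>i<n. cmod (vec_index v i) * (\<Sum>i<n. cmod (vec_index v i)))"
    by (intro sum_mono mult_left_mono member_le_sum[of _ _ "\<lambda>i. cmod (vec_index v i)"]) auto
  finally show "(vn v)\<^sup>2 \<le> (\<Sum>i<n. cmod (vec_index v i))\<^sup>2"
    by (simp add: power2_eq_square sum_distrib_right)
qed (simp add: sum_nonneg)

lemma vn_add: "v \<in> carrier_vec n \<Longrightarrow> w \<in> carrier_vec n \<Longrightarrow> vn (v + w) \<le> vn v + vn w"
  using cv.tn_add[of v n w] by (simp add: module_vec_simps)

lemma vn_smult: "v \<in> carrier_vec n \<Longrightarrow> vn (c \<cdot>\<^sub>v v) = cmod c * vn v"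
  using cv.tn_smult[of v n c] by (simp add: module_vec_simps)

lemma cip_le: "v \<in> carrier_vec n \<Longrightarrow> w \<in> carrier_vec n \<Longrightarrow> cmod (cip v w) \<le> vn v * vn w"
  using cv.Cauchy_Schwarz[of v n w] by (simp add: module_vec_simps)

lemma cip_self: "v \<in> carrier_vec n \<Longrightarrow> cip v v = complex_of_real ((vn v)\<^sup>2)"
  using cv.s_self[of v n] by (simp add: module_vec_simps)

text \<open>An upper bound for the operator norm. It makes the real supremum in
  \<open>mat_opnorm\<close> one over a bounded set.\<close>

definition msum :: "complex mat \<Rightarrow> real" where
  "msum a = (\<Sum>i<dim_row a. \<Sum>j<dim_col a. cmod (a $$ (i, j)))"

lemma msum_nonneg: "0 \<le> msum a"
  by (simp add: msum_def sum_nonneg)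

lemma vn_mult_le_msum:
  assumes a: "a \<in> carrier_mat m n" and v: "v \<in> carrier_vec n"
  shows "vn (a *\<^sub>v v) \<le> msum a * vn v"
proof -
  have "vn (a *\<^sub>v v) \<le> (\<Sum>i<m. cmod (vec_index (a *\<^sub>v v) i))" using a v by (intro vn_le_sum) auto
  also have "\<dots> \<le> (\<Sum>i<m. (\<Sum>j<n. cmod (a $$ (i, j))) * vn v)"
  proof (rule sum_mono)
    fix i assume "i \<in> {..<m}"
    hence "vec_index (a *\<^sub>v v) i = (\<Sum>j<n. a $$ (i, j) * vec_index v j)"
      using a v by (auto simp: scalar_prod_def lessThan_atLeast0 intro!: sum.cong)
    hence "cmod (vec_index (a *\<^sub>v v) i) \<le> (\<Sum>j<n. cmod (a $$ (i, j) * vec_index v j))" by (simp add: norm_sum)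
    also have "\<dots> \<le> (\<Sum>j<n. cmod (a $$ (i, j)) * vn v)"
      using v by (intro sum_mono) (auto simp: norm_mult intro!: mult_left_mono vn_component_le)
    finally show "cmod (vec_index (a *\<^sub>v v) i) \<le> (\<Sum>j<n. cmod (a $$ (i, j))) * vn v" by (simp add: sum_distrib_right)
  qed
  also have "\<dots> = msum a * vn v" using a by (simp add: msum_def sum_distrib_right)
  finally show ?thesis .
qed

lemma mat_opnorm_alt:
  "a \<in> carrier_mat m n \<Longrightarrow> mat_opnorm a = (SUP v\<in>{v \<in> carrier_vec n. vn v \<le> 1}. vn (a *\<^sub>v v))"
  by (simp add: mat_opnorm_def vn_def)

lemma vn_mult_le:
  assumes a: "a \<in> carrier_mat m n" and v: "v \<in> carrier_vec n"
  shows "vn (a *\<^sub>v v) \<le> mat_opnorm a * vn v"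
proof (cases "vn v = 0")
  case True
  thus ?thesis using vn_mult_le_msum[OF a v] by simp
next
  case False
  hence p: "vn v > 0" using vn_nonneg[OF v] by linarith
  let ?w = "complex_of_real (1 / vn v) \<cdot>\<^sub>v v"
  have w: "?w \<in> carrier_vec n" "vn ?w \<le> 1" using v p by (auto simp: vn_smult norm_divide)
  have "bdd_above ((\<lambda>v. vn (a *\<^sub>v v)) ` {v \<in> carrier_vec n. vn v \<le> 1})"
  proof (intro bdd_aboveI2)
    fix v assume "v \<in> {v \<in> carrier_vec n. vn v \<le> 1}"
    thus "vn (a *\<^sub>v v) \<le> msum a"
      using vn_mult_le_msum[OF a, of v] mult_left_mono[of "vn v" 1 "msum a"] msum_nonneg[of a] by simp
  qed
  hence "vn (a *\<^sub>v ?w) \<le> mat_opnorm a"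
    unfolding mat_opnorm_alt[OF a] using w by (intro cSUP_upper) auto
  moreover have "a *\<^sub>v ?w = complex_of_real (1 / vn v) \<cdot>\<^sub>v (a *\<^sub>v v)"
    using a v by (simp add: mult_mat_vec)
  moreover have "a *\<^sub>v v \<in> carrier_vec m" using a v by simp
  ultimately have "vn (a *\<^sub>v v) / vn v \<le> mat_opnorm a" using p by (simp add: vn_smult norm_divide)
  thus ?thesis using p by (simp add: pos_divide_le_eq)
qed

lemma mat_opnorm_least:
  assumes a: "a \<in> carrier_mat m n" and C: "0 \<le> C" and le: "\<And>v. v \<in> carrier_vec n \<Longrightarrow> vn (a *\<^sub>v v) \<le> C * vn v"
  shows "mat_opnorm a \<le> C"
  unfolding mat_opnorm_alt[OF a]
proof (rule cSUP_least)
  have "0\<^sub>v n \<in> {v \<in> carrier_vec n. vn v \<le> 1}" by (simp add: vn_def)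
  thus "{v \<in> carrier_vec n. vn v \<le> 1} \<noteq> {}" by blast
next
  fix v assume v: "v \<in> {v \<in> carrier_vec n. vn v \<le> 1}"
  thus "vn (a *\<^sub>v v) \<le> C" using le[of v] mult_left_mono[of "vn v" 1 C] C by simp
qed

lemma mat_opnorm_nonneg:
  assumes a: "a \<in> carrier_mat m n" shows "0 \<le> mat_opnorm a"
proof (rule ccontr)
  have z: "0\<^sub>v n \<in> {v \<in> carrier_vec n. vn v \<le> 1}" by (simp add: vn_def)
  assume "\<not> 0 \<le> mat_opnorm a"
  have "bdd_above ((\<lambda>v. vn (a *\<^sub>v v)) ` {v \<in> carrier_vec n. vn v \<le> 1})"
  proof (intro bdd_aboveI2)
    fix v assume "v \<in> {v \<in> carrier_vec n. vn v \<le> 1}"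
    thus "vn (a *\<^sub>v v) \<le> msum a"
      using vn_mult_le_msum[OF a, of v] mult_left_mono[of "vn v" 1 "msum a"] msum_nonneg[of a] by simp
  qed
  hence "vn (a *\<^sub>v 0\<^sub>v n) \<le> mat_opnorm a" unfolding mat_opnorm_alt[OF a] using z by (intro cSUP_upper) auto
  moreover have "0 \<le> vn (a *\<^sub>v 0\<^sub>v n)" using a by (intro vn_nonneg[of _ m]) simp
  ultimately show False using \<open>\<not> 0 \<le> mat_opnorm a\<close> by simp
qed

lemma mat_opnorm_le_msum: "a \<in> carrier_mat m n \<Longrightarrow> mat_opnorm a \<le> msum a"
  using vn_mult_le_msum msum_nonneg by (intro mat_opnorm_least) auto

lemma mat_opnorm_add:
  assumes a: "a \<in> carrier_mat m n" and b: "b \<in> carrier_mat m n"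
  shows "mat_opnorm (a + b) \<le> mat_opnorm a + mat_opnorm b"
proof (rule mat_opnorm_least[of _ m n])
  fix v :: "complex vec" assume v: "v \<in> carrier_vec n"
  have "vn ((a + b) *\<^sub>v v) \<le> vn (a *\<^sub>v v) + vn (b *\<^sub>v v)"
    using a b v by (subst add_mult_distrib_mat_vec) (auto intro!: vn_add[of _ m])
  thus "vn ((a + b) *\<^sub>v v) \<le> (mat_opnorm a + mat_opnorm b) * vn v"
    using vn_mult_le[OF a v] vn_mult_le[OF b v] by (simp add: distrib_right)
qed (use a b mat_opnorm_nonneg in \<open>auto intro: add_nonneg_nonneg\<close>)

lemma smult_mat_vec: "a \<in> carrier_mat m n \<Longrightarrow> v \<in> carrier_vec n \<Longrightarrow> (c \<cdot>\<^sub>m a) *\<^sub>v v = c \<cdot>\<^sub>v (a *\<^sub>v (v :: complex vec))"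
  by (intro eq_vecI) auto

lemma mat_opnorm_smult:
  assumes a: "a \<in> carrier_mat m n"
  shows "mat_opnorm (c \<cdot>\<^sub>m a) = cmod c * mat_opnorm a"
proof -
  have *: "mat_opnorm (c \<cdot>\<^sub>m a) \<le> cmod c * mat_opnorm a" if a: "a \<in> carrier_mat m n" for a c
  proof (rule mat_opnorm_least[of _ m n])
    fix v :: "complex vec" assume v: "v \<in> carrier_vec n"
    have "vn ((c \<cdot>\<^sub>m a) *\<^sub>v v) = cmod c * vn (a *\<^sub>v v)"
      using a v smult_mat_vec[OF a v] by (simp add: vn_smult[of _ m])
    thus "vn ((c \<cdot>\<^sub>m a) *\<^sub>v v) \<le> cmod c * mat_opnorm a * vn v"
      using mult_left_mono[OF vn_mult_le[OF a v], of "cmod c"] by (simp add: mult.assoc)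
  qed (use a mat_opnorm_nonneg in auto)
  show ?thesis
  proof (cases "c = 0")
    case True
    thus ?thesis using *[OF a, of 0] mat_opnorm_nonneg[of "c \<cdot>\<^sub>m a" m n] a by simp
  next
    case False
    have "inverse c \<cdot>\<^sub>m (c \<cdot>\<^sub>m a) = a" using False a by (intro eq_matI) auto
    hence "mat_opnorm a \<le> cmod (inverse c) * mat_opnorm (c \<cdot>\<^sub>m a)"
      using *[of "c \<cdot>\<^sub>m a" "inverse c"] a by simp
    hence "cmod c * mat_opnorm a \<le> cmod c * (cmod (inverse c) * mat_opnorm (c \<cdot>\<^sub>m a))"
      by (intro mult_left_mono) auto
    also have "\<dots> = mat_opnorm (c \<cdot>\<^sub>m a)" using False by (simp add: norm_inverse)
    finally have "cmod c * mat_opnorm a \<le> mat_opnorm (c \<cdot>\<^sub>m a)" .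
    thus ?thesis using *[OF a, of c] by simp
  qed
qed

lemma mat_opnorm_mult:
  assumes a: "a \<in> carrier_mat k m" and b: "b \<in> carrier_mat m n"
  shows "mat_opnorm (a * b) \<le> mat_opnorm a * mat_opnorm b"
proof (rule mat_opnorm_least[of _ k n])
  fix v :: "complex vec" assume v: "v \<in> carrier_vec n"
  have "vn ((a * b) *\<^sub>v v) \<le> mat_opnorm a * vn (b *\<^sub>v v)"
    using a b v by (subst assoc_mult_mat_vec) (auto intro!: vn_mult_le)
  also have "\<dots> \<le> mat_opnorm a * (mat_opnorm b * vn v)"
    using a b v by (intro mult_left_mono vn_mult_le mat_opnorm_nonneg)
  finally show "vn ((a * b) *\<^sub>v v) \<le> mat_opnorm a * mat_opnorm b * vn v" by (simp add: mult.assoc)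
qed (use a b mat_opnorm_nonneg in auto)

lemma mat_adjoint_carrier [simp]: "a \<in> carrier_mat m n \<Longrightarrow> mat_adjoint a \<in> carrier_mat n (m :: nat)"
  by (auto simp: mat_adjoint_def mat_of_rows_def)

lemma mat_adjoint_dim [simp]: "dim_row (mat_adjoint a) = dim_col a" "dim_col (mat_adjoint a) = dim_row a"
  by (auto simp: mat_adjoint_def mat_of_rows_def)

lemma mat_adjoint_index [simp]:
  "i < dim_col a \<Longrightarrow> j < dim_row a \<Longrightarrow> mat_adjoint (a :: complex mat) $$ (i, j) = cnj (a $$ (j, i))"
  by (simp add: mat_adjoint_def mat_of_rows_def)

lemma mat_adjoint_adjoint [simp]: "mat_adjoint (mat_adjoint a) = (a :: complex mat)"
  by (rule eq_matI) auto

lemma mat_adjoint_add: "a \<in> carrier_mat m n \<Longrightarrow> b \<in> carrier_mat m n \<Longrightarrow>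
    mat_adjoint (a + b) = mat_adjoint a + mat_adjoint (b :: complex mat)"
  by (rule eq_matI) auto

lemma mat_adjoint_smult: "mat_adjoint (c \<cdot>\<^sub>m a) = cnj c \<cdot>\<^sub>m mat_adjoint (a :: complex mat)"
  by (rule eq_matI) auto

lemma mat_mult_index: "a \<in> carrier_mat k m \<Longrightarrow> b \<in> carrier_mat m n \<Longrightarrow> i < k \<Longrightarrow> j < n \<Longrightarrow>
    (a * b) $$ (i, j) = (\<Sum>l<m. a $$ (i, l) * (b $$ (l, j) :: complex))"
  by (auto simp: scalar_prod_def lessThan_atLeast0 intro!: sum.cong)

lemma mat_adjoint_mult: "a \<in> carrier_mat k m \<Longrightarrow> b \<in> carrier_mat m n \<Longrightarrow>
    mat_adjoint (a * b) = mat_adjoint b * mat_adjoint (a :: complex mat)"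
  by (rule eq_matI) (auto simp: mat_mult_index[of _ _ m] scalar_prod_def mult.commute intro!: sum.cong)

lemma cip_adjoint:
  assumes a: "a \<in> carrier_mat m n" and v: "v \<in> carrier_vec n" and w: "w \<in> carrier_vec m"
  shows "cip (a *\<^sub>v v) w = cip v (mat_adjoint a *\<^sub>v w)"
proof -
  have 1: "vec_index (a *\<^sub>v v) i = (\<Sum>j<n. a $$ (i, j) * vec_index v j)" if "i < m" for i
    using a v that by (auto simp: scalar_prod_def lessThan_atLeast0 intro!: sum.cong)
  have 2: "vec_index (mat_adjoint a *\<^sub>v w) j = (\<Sum>i<m. cnj (a $$ (i, j)) * vec_index w i)" if "j < n" for j
    using a w that by (auto simp: scalar_prod_def lessThan_atLeast0 intro!: sum.cong)
  have "cip (a *\<^sub>v v) w = (\<Sum>i<m. \<Sum>j<n. a $$ (i, j) * vec_index v j * cnj (vec_index w i))"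
    using a v w by (subst cip_sum[of _ m]) (auto simp: 1 sum_distrib_right simp del: index_mult_mat_vec)
  also have "\<dots> = (\<Sum>j<n. \<Sum>i<m. a $$ (i, j) * vec_index v j * cnj (vec_index w i))" by (rule sum.swap)
  also have "\<dots> = cip v (mat_adjoint a *\<^sub>v w)"
    using a v w by (subst cip_sum[of _ n])
      (auto simp: 2 sum_distrib_left cnj_sum mult_ac simp del: index_mult_mat_vec intro!: mult_mat_vec_carrier)
  finally show ?thesis .
qed

lemma mat_opnorm_adjoint_le:
  assumes a: "a \<in> carrier_mat m n" shows "mat_opnorm (mat_adjoint a) \<le> mat_opnorm a"
proof (rule mat_opnorm_least[of _ n m])
  fix v :: "complex vec" assume v: "v \<in> carrier_vec m"
  let ?w = "mat_adjoint a *\<^sub>v v"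
  have w: "?w \<in> carrier_vec n" using a v by (auto intro!: mult_mat_vec_carrier)
  have aw: "a *\<^sub>v ?w \<in> carrier_vec m" using a w by simp
  have "(vn ?w)\<^sup>2 = cmod (cip ?w ?w)" using w by (simp add: cip_self del: of_real_power)
  also have "\<dots> = cmod (cip (a *\<^sub>v ?w) v)" using cip_adjoint[OF a w v] by simp
  also have "\<dots> \<le> vn (a *\<^sub>v ?w) * vn v" by (rule cip_le[OF aw v])
  also have "\<dots> \<le> (mat_opnorm a * vn ?w) * vn v" using v by (intro mult_right_mono vn_mult_le[OF a w] vn_nonneg)
  finally have "vn ?w * vn ?w \<le> vn ?w * (mat_opnorm a * vn v)" by (simp add: power2_eq_square ac_simps)
  thus "vn ?w \<le> mat_opnorm a * vn v"
    using vn_nonneg[OF w] vn_nonneg[OF v] mat_opnorm_nonneg[OF a]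
    by (cases "vn ?w = 0") (auto simp: mult_le_cancel_left)
qed (use a mat_opnorm_nonneg in auto)

lemma mat_opnorm_cstar:
  assumes a: "a \<in> carrier_mat n n" shows "mat_opnorm (mat_adjoint a * a) = (mat_opnorm a)\<^sup>2"
proof (rule antisym)
  have "mat_opnorm (mat_adjoint a * a) \<le> mat_opnorm (mat_adjoint a) * mat_opnorm a"
    using a by (intro mat_opnorm_mult[of _ n n _ n]) auto
  also have "\<dots> \<le> mat_opnorm a * mat_opnorm a"
    using a by (intro mult_right_mono mat_opnorm_adjoint_le[of _ n n] mat_opnorm_nonneg)
  finally show "mat_opnorm (mat_adjoint a * a) \<le> (mat_opnorm a)\<^sup>2" by (simp add: power2_eq_square)
  let ?C = "mat_opnorm (mat_adjoint a * a)"
  have aa: "mat_adjoint a * a \<in> carrier_mat n n" using a by (intro mult_carrier_mat[of _ n n]) auto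
  have C: "0 \<le> ?C" using aa by (rule mat_opnorm_nonneg)
  have "mat_opnorm a \<le> sqrt ?C"
  proof (rule mat_opnorm_least[OF a])
    fix v :: "complex vec" assume v: "v \<in> carrier_vec n"
    have av: "a *\<^sub>v v \<in> carrier_vec n" using a v by simp
    have "(vn (a *\<^sub>v v))\<^sup>2 = cmod (cip (a *\<^sub>v v) (a *\<^sub>v v))" using av by (simp add: cip_self del: of_real_power)
    also have "\<dots> = cmod (cip v ((mat_adjoint a * a) *\<^sub>v v))"
      using cip_adjoint[OF a v av] a v by (subst assoc_mult_mat_vec[of _ n n]) auto
    also have "\<dots> \<le> vn v * vn ((mat_adjoint a * a) *\<^sub>v v)"
      using v aa by (intro cip_le[of _ n]) auto
    also have "\<dots> \<le> vn v * (?C * vn v)" using v aa by (intro mult_left_mono vn_mult_le vn_nonneg)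
    also have "\<dots> = (sqrt ?C * vn v)\<^sup>2" using C by (simp add: power_mult_distrib power2_eq_square)
    finally show "vn (a *\<^sub>v v) \<le> sqrt ?C * vn v"
      by (rule power2_le_imp_le) (use C v in auto)
  qed (use C in simp)
  hence "(mat_opnorm a)\<^sup>2 \<le> (sqrt ?C)\<^sup>2" using mat_opnorm_nonneg[OF a] by (intro power_mono)
  thus "(mat_opnorm a)\<^sup>2 \<le> ?C" using C by simp
qed

lemma cmod_entry_le:
  assumes a: "a \<in> carrier_mat m n" and ij: "i < m" "j < n"
  shows "cmod (a $$ (i, j)) \<le> mat_opnorm a"
proof -
  have u: "unit_vec n j \<in> carrier_vec n" by simp
  have "(vn (unit_vec n j))\<^sup>2 = (\<Sum>i<n. (cmod (vec_index (unit_vec n j) i))\<^sup>2)" by (rule vn_sq[OF u])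
  also have "\<dots> = (\<Sum>i<n. if i = j then 1 else 0)" using ij by (intro sum.cong) auto
  finally have u1: "vn (unit_vec n j) = 1" using ij vn_nonneg[OF u] by (simp add: power2_eq_1_iff)
  have "vec_index (a *\<^sub>v unit_vec n j) i = a $$ (i, j)" using a ij by simp
  moreover have "cmod (vec_index (a *\<^sub>v unit_vec n j) i) \<le> vn (a *\<^sub>v unit_vec n j)"
    using a ij u by (intro vn_component_le[of _ m]) auto
  ultimately show ?thesis using vn_mult_le[OF a u] u1 by simp
qed

lemma mat_opnorm_eq_0: "a \<in> carrier_mat m n \<Longrightarrow> mat_opnorm a = 0 \<longleftrightarrow> a = 0\<^sub>m m n"
proof
  assume a: "a \<in> carrier_mat m n" and z: "mat_opnorm a = 0"
  show "a = 0\<^sub>m m n"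
  proof (rule eq_matI)
    fix i j assume "i < dim_row (0\<^sub>m m n)" "j < dim_col (0\<^sub>m m n)"
    thus "a $$ (i, j) = 0\<^sub>m m n $$ (i, j)" using cmod_entry_le[OF a, of i j] z by simp
  qed (use a in auto)
next
  assume a: "a \<in> carrier_mat m n" and "a = 0\<^sub>m m n"
  thus "mat_opnorm a = 0"
    using mat_opnorm_le_msum[OF a] mat_opnorm_nonneg[OF a] by (simp add: msum_def)
qed

section \<open>Direct sums of two matrix algebras\<close>

lemma two_block_sel [simp]:
  "carrier (two_block k l) = carrier_mat k k \<times> carrier_mat l l"
  "(a, b) \<otimes>\<^bsub>two_block k l\<^esub> (a', b') = (a * a', b * b')"
  "\<one>\<^bsub>two_block k l\<^esub> = (1\<^sub>m k, 1\<^sub>m l)"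
  "\<zero>\<^bsub>two_block k l\<^esub> = (0\<^sub>m k k, 0\<^sub>m l l)"
  "(a, b) \<oplus>\<^bsub>two_block k l\<^esub> (a', b') = (a + a', b + b')"
  "c \<odot>\<^bsub>two_block k l\<^esub> (a, b) = (c \<cdot>\<^sub>m a, c \<cdot>\<^sub>m b)"
  "star (two_block k l) (a, b) = (mat_adjoint a, mat_adjoint b)"
  "nrm (two_block k l) (a, b) = max (mat_opnorm a) (mat_opnorm b)"
  by (simp_all add: two_block_def)

lemma abelian_group_two_block: "abelian_group (two_block k l)"
proof (rule abelian_groupI)
  fix x assume "x \<in> carrier (two_block k l)"
  then obtain a b where x: "x = (a, b)" "a \<in> carrier_mat k k" "b \<in> carrier_mat l l" by auto
  have "- a + a = 0\<^sub>m k k" "- b + b = 0\<^sub>m l l" using x by (auto intro!: eq_matI)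
  thus "\<exists>y\<in>carrier (two_block k l). y \<oplus>\<^bsub>two_block k l\<^esub> x = \<zero>\<^bsub>two_block k l\<^esub>"
    using x by (intro bexI[of _ "(- a, - b)"]) auto
qed (auto simp: assoc_add_mat[of _ k k] assoc_add_mat[of _ l l] intro: comm_add_mat)

lemma module_two_block: "Module.module class_ring (two_block k l)"
proof (rule moduleI)
  show "cring (class_ring :: complex ring)"
    by (rule class_field[THEN field.axioms(1), THEN domain.axioms(1)])
qed (auto simp: abelian_group_two_block class_ring_simps add_smult_distrib_left_mat[of _ k k]
  add_smult_distrib_left_mat[of _ l l] add_smult_distrib_right_mat[of _ k k] add_smult_distrib_right_mat[of _ l l]
  intro!: eq_matI simp: algebra_simps)

lemma cvec_two_block: "cvec (two_block k l)"
  by (rule cvec.intro, rule module_two_block)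

lemma two_block_minus:
  assumes "a \<in> carrier_mat k k" "b \<in> carrier_mat l l" "a' \<in> carrier_mat k k" "b' \<in> carrier_mat l l"
  shows "(a, b) \<ominus>\<^bsub>two_block k l\<^esub> (a', b') = (a - a', b - b')"
  using assms by (subst cvec.minus_eq_smult[OF cvec_two_block]) (auto intro!: eq_matI)

lemma ring_two_block: "Ring.ring (two_block k l)"
proof (rule ringI)
  show "Group.monoid (two_block k l)"
    by (rule monoidI) (auto simp: assoc_mult_mat[of _ k k _ k _ k] assoc_mult_mat[of _ l l _ l _ l])
qed (auto simp: abelian_group_two_block add_mult_distrib_mat[of _ k k _ _ k] add_mult_distrib_mat[of _ l l _ _ l]
   mult_add_distrib_mat[of _ k k _ k] mult_add_distrib_mat[of _ l l _ l])

text \<open>Entries are dominated by the operator norm (\<open>cmod_entry_le\<close>) and the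
  operator norm by the sum of the entries (\<open>mat_opnorm_le_msum\<close>), so convergence may be
  taken entrywise.\<close>

lemma Cauchy_mat_complete:
  fixes f :: "nat \<Rightarrow> complex mat"
  assumes f: "\<And>n. f n \<in> carrier_mat k k"
    and c: "\<And>\<epsilon>. \<epsilon> > 0 \<Longrightarrow> \<exists>N. \<forall>m\<ge>N. \<forall>n\<ge>N. mat_opnorm (f m - f n) < \<epsilon>"
  shows "\<exists>a\<in>carrier_mat k k. (\<lambda>n. mat_opnorm (f n - a)) \<longlonglongrightarrow> 0"
proof -
  have e: "cmod (f m $$ (i, j) - f n $$ (i, j)) \<le> mat_opnorm (f m - f n)" if "i < k" "j < k" for m n i j
    using cmod_entry_le[OF minus_carrier_mat[OF f[of n]], of i j "f m"] that f[of m] f[of n] by simp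
  have "convergent (\<lambda>n. f n $$ (i, j))" if ij: "i < k" "j < k" for i j
    unfolding Cauchy_convergent_iff[symmetric]
  proof (rule CauchyI)
    fix \<epsilon> :: real assume "\<epsilon> > 0"
    then obtain N where N: "\<And>m n. m \<ge> N \<Longrightarrow> n \<ge> N \<Longrightarrow> mat_opnorm (f m - f n) < \<epsilon>" using c by blast
    show "\<exists>M. \<forall>m\<ge>M. \<forall>n\<ge>M. norm (f m $$ (i, j) - f n $$ (i, j)) < \<epsilon>"
      using e[OF ij] N by (meson le_less_trans)
  qed
  hence l: "(\<lambda>n. f n $$ (i, j)) \<longlonglongrightarrow> lim (\<lambda>n. f n $$ (i, j))" if "i < k" "j < k" for i j
    using that by (simp add: convergent_LIMSEQ_iff)
  define a where "a = mat k k (\<lambda>(i, j). lim (\<lambda>n. f n $$ (i, j)))"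
  have a: "a \<in> carrier_mat k k" by (simp add: a_def)
  have "(\<lambda>n. \<Sum>i<k. \<Sum>j<k. cmod (f n $$ (i, j) - a $$ (i, j))) \<longlonglongrightarrow> (\<Sum>i<k. \<Sum>j<k. 0)"
  proof (intro tendsto_sum)
    fix i j assume ij: "i \<in> {..<k}" "j \<in> {..<k}"
    have "(\<lambda>n. f n $$ (i, j) - a $$ (i, j)) \<longlonglongrightarrow> 0"
      using l[of i j] ij by (auto simp: a_def intro: LIM_zero)
    thus "(\<lambda>n. cmod (f n $$ (i, j) - a $$ (i, j))) \<longlonglongrightarrow> 0" by (rule tendsto_norm_zero)
  qed
  hence 0: "(\<lambda>n. \<Sum>i<k. \<Sum>j<k. cmod (f n $$ (i, j) - a $$ (i, j))) \<longlonglongrightarrow> 0" by simp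
  have "(\<lambda>n. mat_opnorm (f n - a)) \<longlonglongrightarrow> 0"
  proof (rule null_le[OF _ _ 0])
    fix n
    have fa: "f n - a \<in> carrier_mat k k" using a by (rule minus_carrier_mat)
    show "0 \<le> mat_opnorm (f n - a)" using fa by (rule mat_opnorm_nonneg)
    have "mat_opnorm (f n - a) \<le> msum (f n - a)" using fa by (rule mat_opnorm_le_msum)
    also have "\<dots> = (\<Sum>i<k. \<Sum>j<k. cmod (f n $$ (i, j) - a $$ (i, j)))"
      using f[of n] a by (simp add: msum_def)
    finally show "mat_opnorm (f n - a) \<le> (\<Sum>i<k. \<Sum>j<k. cmod (f n $$ (i, j) - a $$ (i, j)))" .
  qed
  thus ?thesis using a by blast
qed

lemma cstar_two_block: "cstar_algebra (two_block k l)"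
  unfolding cstar_algebra_def
proof (intro conjI allI impI)
  fix f :: "nat \<Rightarrow> complex mat \<times> complex mat"
  assume f: "\<forall>n. f n \<in> carrier (two_block k l)"
    and c: "\<forall>\<epsilon>>0. \<exists>N. \<forall>m\<ge>N. \<forall>n\<ge>N. nrm (two_block k l) (f m \<ominus>\<^bsub>two_block k l\<^esub> f n) < \<epsilon>"
  have f1: "fst (f n) \<in> carrier_mat k k" and f2: "snd (f n) \<in> carrier_mat l l" for n
    using f by (auto simp: mem_Times_iff)
  have m: "nrm (two_block k l) (f n \<ominus>\<^bsub>two_block k l\<^esub> (a, b)) = max (mat_opnorm (fst (f n) - a)) (mat_opnorm (snd (f n) - b))"
    if "a \<in> carrier_mat k k" "b \<in> carrier_mat l l" for n a b
    using two_block_minus[OF f1 f2 that, of n n] by simp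
  have m': "nrm (two_block k l) (f p \<ominus>\<^bsub>two_block k l\<^esub> f n) = max (mat_opnorm (fst (f p) - fst (f n))) (mat_opnorm (snd (f p) - snd (f n)))" for n p
    using m[OF f1 f2, of p n n] by simp
  obtain a where a: "a \<in> carrier_mat k k" "(\<lambda>n. mat_opnorm (fst (f n) - a)) \<longlonglongrightarrow> 0"
  proof -
    have "\<exists>N. \<forall>m\<ge>N. \<forall>n\<ge>N. mat_opnorm (fst (f m) - fst (f n)) < \<epsilon>" if "\<epsilon> > 0" for \<epsilon> :: real
    proof -
      obtain N where "\<forall>m\<ge>N. \<forall>n\<ge>N. nrm (two_block k l) (f m \<ominus>\<^bsub>two_block k l\<^esub> f n) < \<epsilon>"
        using c \<open>\<epsilon> > 0\<close> by blast
      thus ?thesis unfolding m' by (intro exI[of _ N]) auto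
    qed
    from Cauchy_mat_complete[OF f1 this] show ?thesis using that by blast
  qed
  obtain b where b: "b \<in> carrier_mat l l" "(\<lambda>n. mat_opnorm (snd (f n) - b)) \<longlonglongrightarrow> 0"
  proof -
    have "\<exists>N. \<forall>m\<ge>N. \<forall>n\<ge>N. mat_opnorm (snd (f m) - snd (f n)) < \<epsilon>" if "\<epsilon> > 0" for \<epsilon> :: real
    proof -
      obtain N where "\<forall>m\<ge>N. \<forall>n\<ge>N. nrm (two_block k l) (f m \<ominus>\<^bsub>two_block k l\<^esub> f n) < \<epsilon>"
        using c \<open>\<epsilon> > 0\<close> by blast
      thus ?thesis unfolding m' by (intro exI[of _ N]) auto
    qed
    from Cauchy_mat_complete[OF f2 this] show ?thesis using that by blast
  qed
  have "(\<lambda>n. nrm (two_block k l) (f n \<ominus>\<^bsub>two_block k l\<^esub> (a, b))) \<longlonglongrightarrow> max 0 0"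
    unfolding m[OF a(1) b(1)] by (intro tendsto_max a b)
  thus "\<exists>x\<in>carrier (two_block k l). (\<lambda>n. nrm (two_block k l) (f n \<ominus>\<^bsub>two_block k l\<^esub> x)) \<longlonglongrightarrow> 0"
    using a b by (intro bexI[of _ "(a, b)"]) auto
next
  show "\<forall>x\<in>carrier (two_block k l). nrm (two_block k l) (star (two_block k l) x \<otimes>\<^bsub>two_block k l\<^esub> x) = (nrm (two_block k l) x)\<^sup>2"
  proof
    fix x assume "x \<in> carrier (two_block k l)"
    then obtain a b where x: "x = (a, b)" "a \<in> carrier_mat k k" "b \<in> carrier_mat l l" by auto
    have "max (u\<^sup>2) (v\<^sup>2) = (max u v)\<^sup>2" if "0 \<le> u" "0 \<le> v" for u v :: real
      using that by (auto simp: max_def power2_le_iff_abs_le abs_le_square_iff[symmetric])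
    thus "nrm (two_block k l) (star (two_block k l) x \<otimes>\<^bsub>two_block k l\<^esub> x) = (nrm (two_block k l) x)\<^sup>2"
      using x mat_opnorm_nonneg by (simp add: mat_opnorm_cstar)
  qed
  show "\<forall>x\<in>carrier (two_block k l). \<forall>y\<in>carrier (two_block k l).
      nrm (two_block k l) (x \<oplus>\<^bsub>two_block k l\<^esub> y) \<le> nrm (two_block k l) x + nrm (two_block k l) y \<and>
      nrm (two_block k l) (x \<otimes>\<^bsub>two_block k l\<^esub> y) \<le> nrm (two_block k l) x * nrm (two_block k l) y"
  proof (intro ballI conjI)
    fix x y assume "x \<in> carrier (two_block k l)" "y \<in> carrier (two_block k l)"
    then obtain a b a' b' where x: "x = (a, b)" "a \<in> carrier_mat k k" "b \<in> carrier_mat l l"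
      and y: "y = (a', b')" "a' \<in> carrier_mat k k" "b' \<in> carrier_mat l l" by auto
    show "nrm (two_block k l) (x \<oplus>\<^bsub>two_block k l\<^esub> y) \<le> nrm (two_block k l) x + nrm (two_block k l) y"
      using mat_opnorm_add[OF x(2) y(2)] mat_opnorm_add[OF x(3) y(3)] x y by (auto simp: max_def)
    have "mat_opnorm a * mat_opnorm a' \<le> max (mat_opnorm a) (mat_opnorm b) * max (mat_opnorm a') (mat_opnorm b')"
      "mat_opnorm b * mat_opnorm b' \<le> max (mat_opnorm a) (mat_opnorm b) * max (mat_opnorm a') (mat_opnorm b')"
      using x y by (auto intro!: mult_mono mat_opnorm_nonneg simp: le_max_iff_disj)
    thus "nrm (two_block k l) (x \<otimes>\<^bsub>two_block k l\<^esub> y) \<le> nrm (two_block k l) x * nrm (two_block k l) y"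
      using mat_opnorm_mult[OF x(2) y(2)] mat_opnorm_mult[OF x(3) y(3)] x y by simp
  qed
  show "\<forall>x\<in>carrier (two_block k l). 0 \<le> nrm (two_block k l) x \<and> (nrm (two_block k l) x = 0) = (x = \<zero>\<^bsub>two_block k l\<^esub>)"
  proof
    fix x assume "x \<in> carrier (two_block k l)"
    then obtain a b where x: "x = (a, b)" "a \<in> carrier_mat k k" "b \<in> carrier_mat l l" by auto
    show "0 \<le> nrm (two_block k l) x \<and> (nrm (two_block k l) x = 0) = (x = \<zero>\<^bsub>two_block k l\<^esub>)"
      using mat_opnorm_nonneg[OF x(2)] mat_opnorm_nonneg[OF x(3)]
        mat_opnorm_eq_0[OF x(2)] mat_opnorm_eq_0[OF x(3)] unfolding x(1) by (auto simp: max_def)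
  qed
  show "\<forall>x\<in>carrier (two_block k l). nrm (two_block k l) (c \<odot>\<^bsub>two_block k l\<^esub> x) = cmod c * nrm (two_block k l) x" for c
    by (auto simp: mat_opnorm_smult max_mult_distrib_left)
qed (auto simp: ring_two_block module_two_block mat_adjoint_add mat_adjoint_smult
    mat_adjoint_mult[of _ k k] mat_adjoint_mult[of _ l l] intro!: mult_smult_assoc_mat mult_smult_distrib)

section \<open>Traces and block diagonal embeddings\<close>

lemma mat_tr_add: "a \<in> carrier_mat k k \<Longrightarrow> b \<in> carrier_mat k k \<Longrightarrow> mat_tr (a + b) = mat_tr a + mat_tr b"
  by (simp add: mat_tr_def sum.distrib)

lemma mat_tr_smult: "a \<in> carrier_mat k k \<Longrightarrow> mat_tr (c \<cdot>\<^sub>m a) = c * mat_tr a"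
  by (simp add: mat_tr_def sum_distrib_left)

lemma mat_tr_mult:
  "a \<in> carrier_mat k k \<Longrightarrow> b \<in> carrier_mat k k \<Longrightarrow> mat_tr (a * b) = (\<Sum>i<k. \<Sum>j<k. a $$ (i, j) * b $$ (j, i))"
  by (simp add: mat_tr_def mat_mult_index del: index_mult_mat(1))

lemma mat_tr_comm:
  assumes "a \<in> carrier_mat k k" "b \<in> carrier_mat k k" shows "mat_tr (a * b) = mat_tr (b * a)"
  unfolding mat_tr_mult[OF assms] mat_tr_mult[OF assms(2,1)]
  by (subst sum.swap) (simp add: mult.commute)

lemma mat_tr_one: "mat_tr (1\<^sub>m k) = of_nat k"
  by (simp add: mat_tr_def)

lemma mat_tr_adjoint_mult:
  assumes "a \<in> carrier_mat k k" "b \<in> carrier_mat k k"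
  shows "mat_tr (mat_adjoint b * a) = (\<Sum>i<k. \<Sum>j<k. cnj (b $$ (i, j)) * a $$ (i, j))"
  unfolding mat_tr_mult[OF mat_adjoint_carrier[OF assms(2)] assms(1)]
  using assms by (subst sum.swap) (auto intro!: sum.cong)

text \<open>The weights u and v multiply unnormalized traces, so they are the values at the minimal
  projections of the two blocks. The restriction provides the extensionality that
  \<open>states\<close> demands.\<close>

definition block_trace :: "nat \<Rightarrow> nat \<Rightarrow> real \<Rightarrow> real \<Rightarrow> complex mat \<times> complex mat \<Rightarrow> complex" where
  "block_trace k l u v = restrict (\<lambda>x. complex_of_real u * mat_tr (fst x) + complex_of_real v * mat_tr (snd x))
     (carrier (two_block k l))"

lemma block_trace_eq:
  "a \<in> carrier_mat k k \<Longrightarrow> b \<in> carrier_mat l l \<Longrightarrow>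
    block_trace k l u v (a, b) = complex_of_real u * mat_tr a + complex_of_real v * mat_tr b"
  by (simp add: block_trace_def)

lemma block_trace_ip:
  assumes "a \<in> carrier_mat k k" "b \<in> carrier_mat l l" "c \<in> carrier_mat k k" "d \<in> carrier_mat l l"
  shows "block_trace k l u v (star (two_block k l) (c, d) \<otimes>\<^bsub>two_block k l\<^esub> (a, b)) =
    complex_of_real u * (\<Sum>i<k. \<Sum>j<k. cnj (c $$ (i, j)) * a $$ (i, j)) +
    complex_of_real v * (\<Sum>i<l. \<Sum>j<l. cnj (d $$ (i, j)) * b $$ (i, j))"
proof -
  have "mat_adjoint c * a \<in> carrier_mat k k" "mat_adjoint d * b \<in> carrier_mat l l"
    using assms by (auto intro!: mult_carrier_mat[of _ k k] mult_carrier_mat[of _ l l])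
  thus ?thesis using assms by (simp add: block_trace_eq mat_tr_adjoint_mult)
qed

lemma two_block_cases:
  assumes "x \<in> carrier (two_block k l)"
  obtains a b where "x = (a, b)" "a \<in> carrier_mat k k" "b \<in> carrier_mat l l"
  using assms by auto

lemma cstate_block_trace:
  assumes u: "u > 0" and v: "v > 0" and 1: "real k * u + real l * v = 1"
  shows "cstate (two_block k l) (block_trace k l u v)"
proof (rule cstate.intro, rule cstar.intro, rule cstar_two_block, rule cstate_axioms.intro)
  have p: "block_trace k l u v (star (two_block k l) x \<otimes>\<^bsub>two_block k l\<^esub> x) \<in> \<real>\<^sub>\<ge>\<^sub>0"
    if "x \<in> carrier (two_block k l)" for x
  proof -
    obtain a b where x: "x = (a, b)" "a \<in> carrier_mat k k" "b \<in> carrier_mat l l"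
      using \<open>x \<in> carrier (two_block k l)\<close> by (rule two_block_cases)
    have "block_trace k l u v (star (two_block k l) x \<otimes>\<^bsub>two_block k l\<^esub> x) =
       complex_of_real (u * (\<Sum>i<k. \<Sum>j<k. (cmod (a $$ (i, j)))\<^sup>2) + v * (\<Sum>i<l. \<Sum>j<l. (cmod (b $$ (i, j)))\<^sup>2))"
      unfolding x(1) block_trace_ip[OF x(2,3) x(2,3)]
      by (simp add: complex_norm_square mult.commute del: of_real_power)
    moreover have "0 \<le> u * (\<Sum>i<k. \<Sum>j<k. (cmod (a $$ (i, j)))\<^sup>2) + v * (\<Sum>i<l. \<Sum>j<l. (cmod (b $$ (i, j)))\<^sup>2)"
      using u v by (intro add_nonneg_nonneg mult_nonneg_nonneg sum_nonneg) auto
    ultimately show ?thesis by (simp only: nonneg_Reals_of_real_iff)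
  qed
  have "complex_of_real u * of_nat k + complex_of_real v * of_nat l = complex_of_real (real k * u + real l * v)"
    by simp
  hence one: "block_trace k l u v \<one>\<^bsub>two_block k l\<^esub> = 1"
    unfolding 1 by (simp add: block_trace_eq mat_tr_one)
  show "block_trace k l u v \<in> states (two_block k l)"
    unfolding states_def
  proof (intro CollectI conjI ballI allI p one)
    show "block_trace k l u v \<in> extensional (carrier (two_block k l))" by (simp add: block_trace_def)
  next
    fix x y assume "x \<in> carrier (two_block k l)" "y \<in> carrier (two_block k l)"
    thus "block_trace k l u v (x \<oplus>\<^bsub>two_block k l\<^esub> y) = block_trace k l u v x + block_trace k l u v y"
      by (auto simp: block_trace_eq mat_tr_add[of _ k] mat_tr_add[of _ l] algebra_simps)
  next
    fix x c assume "x \<in> carrier (two_block k l)"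
    thus "block_trace k l u v (c \<odot>\<^bsub>two_block k l\<^esub> x) = c * block_trace k l u v x"
      by (auto simp: block_trace_eq mat_tr_smult[of _ k] mat_tr_smult[of _ l] algebra_simps)
  qed
qed

lemma block_trace_comm:
  assumes "x \<in> carrier (two_block k l)" "y \<in> carrier (two_block k l)"
  shows "block_trace k l u v (x \<otimes>\<^bsub>two_block k l\<^esub> y) = block_trace k l u v (y \<otimes>\<^bsub>two_block k l\<^esub> x)"
  using assms by (auto simp: block_trace_eq mat_tr_comm[of _ k] mat_tr_comm[of _ l])

text \<open>A multiple of a matrix unit; row and column are packed into the single index t = i * k +
  j, so that a basis is indexed by an initial segment.\<close>

definition munit :: "nat \<Rightarrow> complex \<Rightarrow> nat \<Rightarrow> complex mat" where
  "munit k c t = mat k k (\<lambda>ij. c * of_bool (ij = (t div k, t mod k)))"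

lemma munit_carrier [simp]: "munit k c t \<in> carrier_mat k k"
  by (simp add: munit_def)

lemma munit_index: "i < k \<Longrightarrow> j < k \<Longrightarrow> munit k c t $$ (i, j) = c * of_bool (i = t div k \<and> j = t mod k)"
  by (simp add: munit_def)

lemma sum_munit:
  assumes t: "t < k * k"
  shows "(\<Sum>i<k. \<Sum>j<k. cnj (munit k c t $$ (i, j)) * f i j) = cnj c * f (t div k) (t mod k)"
proof -
  have k: "k > 0" using t by (cases k) auto
  have tk: "t div k < k" "t mod k < k" using t k by (auto simp: less_mult_imp_div_less)
  have "(\<Sum>j<k. cnj (munit k c t $$ (i, j)) * f i j) = (if i = t div k then cnj c * f i (t mod k) else 0)"
    if "i < k" for i
  proof -
    have "(\<Sum>j<k. cnj (munit k c t $$ (i, j)) * f i j) =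
        (\<Sum>j<k. if j = t mod k then (if i = t div k then cnj c * f i j else 0) else 0)"
      using that by (intro sum.cong) (auto simp: munit_index)
    thus ?thesis using tk by simp
  qed
  hence "(\<Sum>i<k. \<Sum>j<k. cnj (munit k c t $$ (i, j)) * f i j) = (\<Sum>i<k. if i = t div k then cnj c * f i (t mod k) else 0)"
    by simp
  thus ?thesis using tk by simp
qed

lemma sum_munit_expand:
  assumes ij: "i < k" "j < k"
  shows "(\<Sum>t<k * k. g t * munit k c t $$ (i, j)) = g (i * k + j) * c"
proof -
  have lt: "i * k + j < k * k"
  proof -
    have "i * k + j < i * k + k" using ij by simp
    also have "\<dots> = Suc i * k" by simp
    also have "\<dots> \<le> k * k" using ij by (intro mult_le_mono1) simp
    finally show ?thesis .
  qed
  have "(i = t div k \<and> j = t mod k) \<longleftrightarrow> t = i * k + j" for t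
    using ij div_mult_mod_eq[of t k] by auto
  hence "(\<Sum>t<k * k. g t * munit k c t $$ (i, j)) = (\<Sum>t<k * k. if t = i * k + j then g t * c else 0)"
    using ij by (intro sum.cong) (auto simp: munit_index)
  thus ?thesis using lt by simp
qed

lemma lcomb_two_block:
  assumes "\<And>t. t < d \<Longrightarrow> e t \<in> carrier (two_block k l)"
  shows "lcomb (two_block k l) c e d =
    (mat k k (\<lambda>ij. \<Sum>t<d. c t * fst (e t) $$ ij), mat l l (\<lambda>ij. \<Sum>t<d. c t * snd (e t) $$ ij))"
  using assms
proof (induction d)
  case 0
  show ?case by (auto intro!: eq_matI)
next
  case (Suc d)
  obtain a b where e: "e d = (a, b)" "a \<in> carrier_mat k k" "b \<in> carrier_mat l l"
    using Suc.prems[of d] by (metis lessI two_block_cases)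
  show ?case using Suc e by (auto intro!: eq_matI)
qed

text \<open>Matrix units are orthogonal for a weighted trace, with squared norm equal to the weight
  of their block. Dividing by the square root of the weight makes them orthonormal.\<close>

lemma block_basis:
  assumes u: "u > 0" and v: "v > 0"
  shows "\<exists>d e. (\<forall>i<d. e i \<in> carrier (two_block k l)) \<and>
    (\<forall>i<d. \<forall>j<d. block_trace k l u v (star (two_block k l) (e j) \<otimes>\<^bsub>two_block k l\<^esub> e i) = of_bool (i = j)) \<and>
    (\<forall>x\<in>carrier (two_block k l). x = lcomb (two_block k l)
      (\<lambda>i. block_trace k l u v (star (two_block k l) (e i) \<otimes>\<^bsub>two_block k l\<^esub> x)) e d)"
proof -
  define cu where "cu = complex_of_real (1 / sqrt u)"
  define cv where "cv = complex_of_real (1 / sqrt v)"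
  have cu: "complex_of_real u * (cnj cu * z) * cu = z" "complex_of_real u * (cnj cu * (cu * z)) = z" for z
  proof -
    have "u * (1 / sqrt u) * (1 / sqrt u) = 1" using u by (simp add: field_simps)
    hence "complex_of_real u * cnj cu * cu = 1" unfolding cu_def by (metis complex_cnj_complex_of_real of_real_1 of_real_mult)
    thus "complex_of_real u * (cnj cu * z) * cu = z" "complex_of_real u * (cnj cu * (cu * z)) = z"
      by (metis mult.assoc mult.commute mult.left_neutral)+
  qed
  have cv: "complex_of_real v * (cnj cv * z) * cv = z" "complex_of_real v * (cnj cv * (cv * z)) = z" for z
  proof -
    have "v * (1 / sqrt v) * (1 / sqrt v) = 1" using v by (simp add: field_simps)
    hence "complex_of_real v * cnj cv * cv = 1" unfolding cv_def by (metis complex_cnj_complex_of_real of_real_1 of_real_mult)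
    thus "complex_of_real v * (cnj cv * z) * cv = z" "complex_of_real v * (cnj cv * (cv * z)) = z"
      by (metis mult.assoc mult.commute mult.left_neutral)+
  qed
  define K where "K = k * k"
  define M where "M = l * l"
  define e where "e t = (if t < K then (munit k cu t, 0\<^sub>m l l) else (0\<^sub>m k k, munit l cv (t - K)))" for t
  have ec: "e t \<in> carrier (two_block k l)" for t by (simp add: e_def)
  have s1: "block_trace k l u v (star (two_block k l) (e t) \<otimes>\<^bsub>two_block k l\<^esub> (a, b)) =
      (if t < K then complex_of_real u * (cnj cu * a $$ (t div k, t mod k))
       else complex_of_real v * (cnj cv * b $$ ((t - K) div l, (t - K) mod l)))"
    if "t < K + M" "a \<in> carrier_mat k k" "b \<in> carrier_mat l l" for t a b
  proof (cases "t < K")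
    case True
    thus ?thesis using that block_trace_ip[of a k b l "munit k cu t" "0\<^sub>m l l" u v]
        sum_munit[of t k cu "\<lambda>i j. a $$ (i, j)"] by (simp add: e_def K_def)
  next
    case False
    hence "t - K < l * l" using that by (simp add: M_def)
    thus ?thesis using that False block_trace_ip[of a k b l "0\<^sub>m k k" "munit l cv (t - K)" u v]
        sum_munit[of "t - K" l cv "\<lambda>i j. b $$ (i, j)"] by (simp add: e_def)
  qed
  have dm: "t div n < n" "t mod n < n" if "t < n * n" for t n :: nat
    using that by (cases n; simp add: less_mult_imp_div_less)+
  have dm_eq: "t div n = t' div n \<and> t mod n = t' mod n \<longleftrightarrow> t = t'" for t t' n :: nat
    by (metis div_mult_mod_eq)
  have orth: "block_trace k l u v (star (two_block k l) (e j) \<otimes>\<^bsub>two_block k l\<^esub> e i) = of_bool (i = j)"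
    if i: "i < K + M" and j: "j < K + M" for i j
  proof -
    have s: "block_trace k l u v (star (two_block k l) (e j) \<otimes>\<^bsub>two_block k l\<^esub> e i) =
      (if j < K then complex_of_real u * (cnj cu * fst (e i) $$ (j div k, j mod k))
       else complex_of_real v * (cnj cv * snd (e i) $$ ((j - K) div l, (j - K) mod l)))"
      using s1[OF j, of "fst (e i)" "snd (e i)"] by (simp add: e_def split: if_splits)
    show ?thesis
    proof (cases "j < K")
      case True
      hence "j div k < k" "j mod k < k" using dm[of j k] by (auto simp: K_def)
      thus ?thesis unfolding s using True dm_eq[of j k i] by (auto simp: e_def munit_index cu)
    next
      case False
      hence "(j - K) div l < l" "(j - K) mod l < l" using dm[of "j - K" l] j by (auto simp: M_def)
      thus ?thesis unfolding s using False dm_eq[of "j - K" l "i - K"] by (auto simp: e_def munit_index cv)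
    qed
  qed
  have expand: "x = lcomb (two_block k l)
      (\<lambda>i. block_trace k l u v (star (two_block k l) (e i) \<otimes>\<^bsub>two_block k l\<^esub> x)) e (K + M)"
    if "x \<in> carrier (two_block k l)" for x
  proof -
    obtain a b where x: "x = (a, b)" "a \<in> carrier_mat k k" "b \<in> carrier_mat l l"
      using \<open>x \<in> carrier (two_block k l)\<close> by (rule two_block_cases)
    let ?c = "\<lambda>i. block_trace k l u v (star (two_block k l) (e i) \<otimes>\<^bsub>two_block k l\<^esub> x)"
    have split: "(\<Sum>t<K + M. h t) = (\<Sum>t<K. h t) + (\<Sum>t<M. h (K + t))" for h :: "nat \<Rightarrow> complex"
      by (induction M) (simp_all add: add.assoc)
    have 1: "(\<Sum>t<K + M. ?c t * fst (e t) $$ (i, j)) = a $$ (i, j)" if ij: "i < k" "j < k" for i j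
    proof -
      have "(\<Sum>t<K + M. ?c t * fst (e t) $$ (i, j)) = (\<Sum>t<k * k. (complex_of_real u * (cnj cu * a $$ (t div k, t mod k))) * munit k cu t $$ (i, j))"
        unfolding split using ij x by (simp add: s1 K_def[symmetric]) (simp add: e_def)
      also have "\<dots> = a $$ (i, j)"
        using ij sum_munit_expand[OF ij, of "\<lambda>t. complex_of_real u * (cnj cu * a $$ (t div k, t mod k))" cu] cu(1) by simp
      finally show ?thesis .
    qed
    have 2: "(\<Sum>t<K + M. ?c t * snd (e t) $$ (i, j)) = b $$ (i, j)" if ij: "i < l" "j < l" for i j
    proof -
      have "(\<Sum>t<K + M. ?c t * snd (e t) $$ (i, j)) = (\<Sum>t<l * l. (complex_of_real v * (cnj cv * b $$ (t div l, t mod l))) * munit l cv t $$ (i, j))"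
        unfolding split using ij x by (simp add: s1 M_def[symmetric]) (simp add: e_def)
      also have "\<dots> = b $$ (i, j)"
        using ij sum_munit_expand[OF ij, of "\<lambda>t. complex_of_real v * (cnj cv * b $$ (t div l, t mod l))" cv] cv(1) by simp
      finally show ?thesis .
    qed
    show ?thesis
      unfolding lcomb_two_block[OF ec] using x 1 2 by (auto intro!: eq_matI)
  qed
  show ?thesis using ec orth expand by blast
qed

lemma block_norm_equiv:
  assumes "u > 0" "v > 0" "real k * u + real l * v = 1"
  shows "\<exists>c. \<forall>x\<in>carrier (two_block k l). nrm (two_block k l) x \<le> c * tau_norm (two_block k l) (block_trace k l u v) x"
proof -
  interpret cstate "two_block k l" "block_trace k l u v" by (rule cstate_block_trace[OF assms])
  obtain d e where e: "\<forall>i<d. e i \<in> carrier (two_block k l)"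
    "\<forall>i<d. \<forall>j<d. block_trace k l u v (star (two_block k l) (e j) \<otimes>\<^bsub>two_block k l\<^esub> e i) = of_bool (i = j)"
    "\<forall>x\<in>carrier (two_block k l). x = lcomb (two_block k l)
      (\<lambda>i. block_trace k l u v (star (two_block k l) (e i) \<otimes>\<^bsub>two_block k l\<^esub> x)) e d"
    using block_basis[OF assms(1,2), of k l] by blast
  show ?thesis
  proof (intro exI ballI)
    fix x assume x: "x \<in> carrier (two_block k l)"
    show "nrm (two_block k l) x \<le> (\<Sum>i<d. nrm (two_block k l) (e i)) * tau_norm (two_block k l) (block_trace k l u v) x"
      using e(1,2) e(3)[rule_format, OF x, symmetric] x by (intro norm_le_basis) auto
  qed
qed

text \<open>Block diagonal sum of matrices, unrelated to the truncated operator
  \<open>ci.dsum\<close>.\<close>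

definition dsum :: "complex mat \<Rightarrow> complex mat \<Rightarrow> complex mat" where
  "dsum a b = four_block_mat a (0\<^sub>m (dim_row a) (dim_col b)) (0\<^sub>m (dim_row b) (dim_col a)) b"

definition dbm :: "nat \<Rightarrow> complex mat \<Rightarrow> complex mat \<Rightarrow> complex mat" where
  "dbm r a b = diag_block_mat (replicate r a @ [b])"

lemma dbm_0: "dbm 0 a b = b"
  by (simp only: dbm_def replicate_0 append_Nil diag_block_mat_singleton)

lemma dbm_Suc: "dbm (Suc r) a b = dsum a (dbm r a b)"
  by (simp add: dbm_def dsum_def Let_def)

lemma dsum_carrier: "a \<in> carrier_mat n n \<Longrightarrow> b \<in> carrier_mat m m \<Longrightarrow> dsum a b \<in> carrier_mat (n + m) (n + m)"
  by (simp add: dsum_def)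

lemma dsum_mult:
  assumes "a \<in> carrier_mat n n" "b \<in> carrier_mat m m" "a' \<in> carrier_mat n n" "b' \<in> carrier_mat m m"
  shows "dsum (a * a') (b * b') = dsum a b * dsum a' b'"
proof -
  have "dsum a b * dsum a' b' = four_block_mat (a * a' + 0\<^sub>m n m * 0\<^sub>m m n) (a * 0\<^sub>m n m + 0\<^sub>m n m * b')
      (0\<^sub>m m n * a' + b * 0\<^sub>m m n) (0\<^sub>m m n * 0\<^sub>m n m + b * b')"
    using assms unfolding dsum_def by (subst mult_four_block_mat[of _ n n _ m _ m _ _ n _ m]) auto
  also have "\<dots> = dsum (a * a') (b * b')"
    using assms by (auto simp: dsum_def intro!: cong_four_block_mat)
  finally show ?thesis by simp
qed

lemma dsum_add:
  assumes "a \<in> carrier_mat n n" "b \<in> carrier_mat m m" "a' \<in> carrier_mat n n" "b' \<in> carrier_mat m m"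
  shows "dsum (a + a') (b + b') = dsum a b + dsum a' b'"
  using assms by (intro eq_matI) (auto simp: dsum_def)

lemma dsum_smult:
  assumes "a \<in> carrier_mat n n" "b \<in> carrier_mat m m"
  shows "dsum (c \<cdot>\<^sub>m a) (c \<cdot>\<^sub>m b) = c \<cdot>\<^sub>m dsum a b"
  using assms by (intro eq_matI) (auto simp: dsum_def)

lemma dsum_adjoint:
  assumes "a \<in> carrier_mat n n" "b \<in> carrier_mat m m"
  shows "dsum (mat_adjoint a) (mat_adjoint b) = mat_adjoint (dsum a b)"
  using assms by (intro eq_matI) (auto simp: dsum_def)

lemma dsum_one: "dsum (1\<^sub>m n) (1\<^sub>m m) = 1\<^sub>m (n + m)"
  by (simp add: dsum_def)

lemma mat_tr_dsum:
  assumes "a \<in> carrier_mat n n" "b \<in> carrier_mat m m"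
  shows "mat_tr (dsum a b) = mat_tr a + mat_tr b"
proof -
  have split: "(\<Sum>t<n + m. h t) = (\<Sum>t<n. h t) + (\<Sum>t<m. h (n + t))" for h :: "nat \<Rightarrow> complex"
    by (induction m) (simp_all add: add.assoc)
  show ?thesis using assms by (simp add: mat_tr_def dsum_def split)
qed

lemma dbm_carrier: "a \<in> carrier_mat n n \<Longrightarrow> b \<in> carrier_mat m m \<Longrightarrow> dbm r a b \<in> carrier_mat (r * n + m) (r * n + m)"
proof (induction r)
  case (Suc r)
  thus ?case using dsum_carrier[of a n "dbm r a b" "r * n + m"] by (simp add: dbm_Suc add.assoc)
qed (simp add: dbm_0)

lemma dbm_mult:
  assumes "a \<in> carrier_mat n n" "b \<in> carrier_mat m m" "a' \<in> carrier_mat n n" "b' \<in> carrier_mat m m"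
  shows "dbm r (a * a') (b * b') = dbm r a b * dbm r a' b'"
  using assms dbm_carrier
  by (induction r) (simp_all add: dbm_0 dbm_Suc dsum_mult[OF assms(1) dbm_carrier[OF assms(1,2)] assms(3) dbm_carrier[OF assms(3,4)]])

lemma dbm_add:
  assumes "a \<in> carrier_mat n n" "b \<in> carrier_mat m m" "a' \<in> carrier_mat n n" "b' \<in> carrier_mat m m"
  shows "dbm r (a + a') (b + b') = dbm r a b + dbm r a' b'"
  by (induction r) (simp_all add: dbm_0 dbm_Suc dsum_add[OF assms(1) dbm_carrier[OF assms(1,2)] assms(3) dbm_carrier[OF assms(3,4)]])

lemma dbm_smult:
  assumes "a \<in> carrier_mat n n" "b \<in> carrier_mat m m"
  shows "dbm r (c \<cdot>\<^sub>m a) (c \<cdot>\<^sub>m b) = c \<cdot>\<^sub>m dbm r a b"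
  by (induction r) (simp_all add: dbm_0 dbm_Suc dsum_smult[OF assms(1) dbm_carrier[OF assms]])

lemma dbm_adjoint:
  assumes "a \<in> carrier_mat n n" "b \<in> carrier_mat m m"
  shows "dbm r (mat_adjoint a) (mat_adjoint b) = mat_adjoint (dbm r a b)"
  by (induction r) (simp_all add: dbm_0 dbm_Suc dsum_adjoint[OF assms(1) dbm_carrier[OF assms]])

lemma dbm_one: "dbm r (1\<^sub>m n) (1\<^sub>m m) = 1\<^sub>m (r * n + m)"
  by (induction r) (simp_all add: dbm_0 dbm_Suc dsum_one add.assoc)

lemma mat_tr_dbm:
  assumes "a \<in> carrier_mat n n" "b \<in> carrier_mat m m"
  shows "mat_tr (dbm r a b) = of_nat r * mat_tr a + mat_tr b"
  by (induction r) (simp_all add: dbm_0 dbm_Suc mat_tr_dsum[OF assms(1) dbm_carrier[OF assms]] algebra_simps)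

definition block_map :: "nat \<Rightarrow> complex mat \<times> complex mat \<Rightarrow> complex mat \<times> complex mat" where
  "block_map r = (\<lambda>(a, b). (dbm r a b, a))"

lemma block_map_closed: "x \<in> carrier (two_block k l) \<Longrightarrow> block_map r x \<in> carrier (two_block (r * k + l) k)"
  by (auto simp: block_map_def intro: dbm_carrier)

lemma block_map_add:
  "x \<in> carrier (two_block k l) \<Longrightarrow> y \<in> carrier (two_block k l) \<Longrightarrow>
    block_map r (x \<oplus>\<^bsub>two_block k l\<^esub> y) = block_map r x \<oplus>\<^bsub>two_block (r * k + l) k\<^esub> block_map r y"
  by (auto simp: block_map_def dbm_add[of _ k _ l])

lemma block_map_mult:
  "x \<in> carrier (two_block k l) \<Longrightarrow> y \<in> carrier (two_block k l) \<Longrightarrow>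
    block_map r (x \<otimes>\<^bsub>two_block k l\<^esub> y) = block_map r x \<otimes>\<^bsub>two_block (r * k + l) k\<^esub> block_map r y"
  by (auto simp: block_map_def dbm_mult[of _ k _ l])

lemma block_map_smult:
  "x \<in> carrier (two_block k l) \<Longrightarrow> block_map r (c \<odot>\<^bsub>two_block k l\<^esub> x) = c \<odot>\<^bsub>two_block (r * k + l) k\<^esub> block_map r x"
  by (auto simp: block_map_def dbm_smult[of _ k _ l])

lemma block_map_star:
  "x \<in> carrier (two_block k l) \<Longrightarrow> block_map r (star (two_block k l) x) = star (two_block (r * k + l) k) (block_map r x)"
  by (auto simp: block_map_def dbm_adjoint[of _ k _ l])

lemma block_map_one: "block_map r \<one>\<^bsub>two_block k l\<^esub> = \<one>\<^bsub>two_block (r * k + l) k\<^esub>"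
  by (simp add: block_map_def dbm_one)

text \<open>The matrix a occurs r times in the new first block and once in the new second block, b
  once in the first. So weights v, w pull back to r v + w and v.\<close>

lemma block_map_trace:
  "x \<in> carrier (two_block k l) \<Longrightarrow> block_trace (r * k + l) k v w (block_map r x) = block_trace k l (real r * v + w) v x"
proof -
  assume "x \<in> carrier (two_block k l)"
  then obtain a b where x: "x = (a, b)" "a \<in> carrier_mat k k" "b \<in> carrier_mat l l" by (rule two_block_cases)
  show ?thesis
    unfolding x(1) block_map_def prod.case block_trace_eq[OF dbm_carrier[OF x(2,3)] x(2)]
      block_trace_eq[OF x(2,3)] mat_tr_dbm[OF x(2,3)] by (simp add: algebra_simps)
qed

text \<open>The norm is not computed from the block structure. The map preserves traces for suitable
  normalized positive weights, and \<open>trace_preserving_isometric\<close> gives the rest.\<close>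

lemma block_map_nrm:
  assumes uv: "v > 0" "w > 0" "real (r * k + l) * v + real k * w = 1" and x: "x \<in> carrier (two_block k l)"
  shows "nrm (two_block (r * k + l) k) (block_map r x) = nrm (two_block k l) x"
proof -
  let ?u = "real r * v + w"
  have u: "?u > 0" "real k * ?u + real l * v = 1"
    using uv add_nonneg_pos[of "real r * v" w] by (simp, simp add: algebra_simps)
  obtain c where c: "\<And>x. x \<in> carrier (two_block k l) \<Longrightarrow> nrm (two_block k l) x \<le> c * tau_norm (two_block k l) (block_trace k l ?u v) x"
    using block_norm_equiv[OF u(1) uv(1) u(2)] by blast
  obtain d where d: "\<And>x. x \<in> carrier (two_block (r * k + l) k) \<Longrightarrow>
      nrm (two_block (r * k + l) k) x \<le> d * tau_norm (two_block (r * k + l) k) (block_trace (r * k + l) k v w) x"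
    using block_norm_equiv[OF uv] by blast
  show ?thesis
    by (rule trace_preserving_isometric[OF cstate_block_trace[OF u(1) uv(1) u(2)] cstate_block_trace[OF uv]
      _ block_map_mult block_map_star block_map_one block_map_trace c d x])
      (auto dest: block_map_closed simp del: two_block_sel)
qed

section \<open>Bridges with trivial pivot\<close>

lemma hausdorff_edist_le:
  assumes "\<And>s. s \<in> S \<Longrightarrow> \<exists>t\<in>T. d s t \<le> e" "\<And>t. t \<in> T \<Longrightarrow> \<exists>s\<in>S. d s t \<le> e"
  shows "hausdorff_edist d S T \<le> e"
proof -
  have "(INF t\<in>T. d s t) \<le> e" if "s \<in> S" for s
    using assms(1)[OF that] by (auto intro: INF_lower2)
  moreover have "(INF s\<in>S. d s t) \<le> e" if "t \<in> T" for t
    using assms(2)[OF that] by (auto intro: INF_lower2)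
  ultimately show ?thesis unfolding hausdorff_edist_def by (auto intro!: SUP_least)
qed

lemma hausdorff_mk_dist_self: "hausdorff_edist (mk_dist S) T T = 0"
proof -
  have "mk_dist S \<phi> \<phi> \<le> 0" for \<phi> unfolding mk_dist_def by (intro SUP_least) simp
  hence "hausdorff_edist (mk_dist S) T T \<le> 0" by (intro hausdorff_edist_le) blast+
  thus ?thesis by simp
qed

locale star_iso = B: cstar B for B :: "'b cstar" +
  fixes A :: "'a cstar" and J :: "'b \<Rightarrow> 'a" and X :: "'a set"
  assumes A: "cstar A"
    and J_closed: "x \<in> carrier B \<Longrightarrow> J x \<in> carrier A"
    and J_add: "\<lbrakk>x \<in> carrier B; y \<in> carrier B\<rbrakk> \<Longrightarrow> J (x \<oplus>\<^bsub>B\<^esub> y) = J x \<oplus>\<^bsub>A\<^esub> J y"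
    and J_smult: "x \<in> carrier B \<Longrightarrow> J (c \<odot>\<^bsub>B\<^esub> x) = c \<odot>\<^bsub>A\<^esub> J x"
    and J_mult: "\<lbrakk>x \<in> carrier B; y \<in> carrier B\<rbrakk> \<Longrightarrow> J (x \<otimes>\<^bsub>B\<^esub> y) = J x \<otimes>\<^bsub>A\<^esub> J y"
    and J_star: "x \<in> carrier B \<Longrightarrow> J (star B x) = star A (J x)"
    and J_one: "J \<one>\<^bsub>B\<^esub> = \<one>\<^bsub>A\<^esub>"
    and J_nrm: "x \<in> carrier B \<Longrightarrow> nrm A (J x) = nrm B x"
    and J_image: "J ` carrier B = X"
begin

sublocale A: cstar A by (rule A)

lemma J_minus: "\<lbrakk>x \<in> carrier B; y \<in> carrier B\<rbrakk> \<Longrightarrow> J (x \<ominus>\<^bsub>B\<^esub> y) = J x \<ominus>\<^bsub>A\<^esub> J y"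
  by (simp add: B.minus_eq_smult A.minus_eq_smult J_add J_smult J_closed)

lemma J_inj: "inj_on J (carrier B)"
proof (rule inj_onI)
  fix x y assume x: "x \<in> carrier B" "y \<in> carrier B" and e: "J x = J y"
  have d: "x \<ominus>\<^bsub>B\<^esub> y \<in> carrier B" using x by simp
  have "J (x \<ominus>\<^bsub>B\<^esub> y) = \<zero>\<^bsub>A\<^esub>" unfolding J_minus[OF x] e using J_closed[OF x(2)] by simp
  hence "nrm B (x \<ominus>\<^bsub>B\<^esub> y) = 0" using J_nrm[OF d] by simp
  hence "x \<ominus>\<^bsub>B\<^esub> y = \<zero>\<^bsub>B\<^esub>" using B.nrm_eq_0[OF d] by simp
  thus "x = y" using B.minus_eq_zero[OF x] by simp
qed

lemma unital_star_mono_J: "unital_star_mono B A J"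
  unfolding unital_star_mono_def using J_inj by (auto simp: J_closed J_add J_smult J_mult J_star J_one)

definition G :: "'a \<Rightarrow> 'b" where "G = inv_into (carrier B) J"

lemma G_closed: "x \<in> X \<Longrightarrow> G x \<in> carrier B"
  unfolding G_def J_image[symmetric] by (rule inv_into_into)

lemma J_G: "x \<in> X \<Longrightarrow> J (G x) = x"
  unfolding G_def J_image[symmetric] by (rule f_inv_into_f)

lemma G_J: "x \<in> carrier B \<Longrightarrow> G (J x) = x"
  unfolding G_def by (rule inv_into_f_f[OF J_inj])

lemma G_eqI: "x \<in> carrier B \<Longrightarrow> J x = y \<Longrightarrow> G y = x"
  using G_J by blast

end

section \<open>Extension of states from a stage, and the resulting bridges\<close>

lemma Re_complex_of_real_mult: "Re (complex_of_real r * z) = r * Re z"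
  by simp

text \<open>With h = x* x one has |(1 - h) y|^2 = |y|^2 - 2 |x y|^2 + |h y|^2 in the trace norm, and
  |h y| \<le> |x y| because x is a contraction. This is the estimate behind the positivity of
  extended states.\<close>

lemma (in filt) nrm_one_minus_le:
  assumes x: "x \<in> F k" and n: "nrm A x \<le> 1" shows "nrm A (\<one> \<ominus> star A x \<otimes> x) \<le> 1"
proof (rule nrm_le_F[of _ k])
  fix y assume y: "y \<in> F k"
  have c: "x \<in> carrier A" "y \<in> carrier A" using x y by auto
  let ?h = "star A x \<otimes> x"
  have hy: "(\<one> \<ominus> ?h) \<otimes> y = y \<ominus> ?h \<otimes> y" using c by (simp add: a_minus_def l_distr l_minus)
  have h1: "s (?h \<otimes> y) y = s (x \<otimes> y) (x \<otimes> y)"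
    using c by (simp add: star_mult m_assoc)
  have h2: "s y (?h \<otimes> y) = s (x \<otimes> y) (x \<otimes> y)"
    using c by (simp add: star_mult m_assoc)
  have eq: "(tn ((\<one> \<ominus> ?h) \<otimes> y))\<^sup>2 = (tn y)\<^sup>2 - 2 * (tn (x \<otimes> y))\<^sup>2 + (tn (?h \<otimes> y))\<^sup>2"
    unfolding hy using c h1 h2 by (simp add: tn_sq s_minus s_minus_right)
  have "tn (star A x \<otimes> (x \<otimes> y)) \<le> nrm A (star A x) * tn (x \<otimes> y)" using c by (intro tn_mult) auto
  also have "\<dots> \<le> 1 * tn (x \<otimes> y)" using c n by (intro mult_right_mono) auto
  finally have le: "tn (?h \<otimes> y) \<le> tn (x \<otimes> y)" using c by (simp add: m_assoc)
  have "(tn (?h \<otimes> y))\<^sup>2 \<le> (tn (x \<otimes> y))\<^sup>2" using c by (intro power_mono[OF le]) simp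
  hence sq: "(tn ((\<one> \<ominus> ?h) \<otimes> y))\<^sup>2 \<le> (tn y)\<^sup>2"
    using eq zero_le_power2[of "tn (x \<otimes> y)"] by linarith
  show "tn ((\<one> \<ominus> ?h) \<otimes> y) \<le> 1 * tn y"
    unfolding mult_1 by (rule power2_le_imp_le[OF sq tn_nonneg[OF c(2)]])
qed (use x in auto)

locale ci_bridge = ci A \<tau> F \<beta> + star_iso B A J "F n"
  for A :: "'a cstar" and \<tau> F \<beta> and B :: "'b cstar" and J n
begin

text \<open>The extension is \<psi> composed with E n and the inverse of J. Positivity of E n is not
  proved separately: the extension \<phi> is contractive and unital, so for h = y* y with y a
  contraction in a stage, Re \<phi>(1 - h) \<le> 1 and hence Re \<phi>(h) \<ge> 0. General elements
  follow by scaling and by approximation with E k x.\<close>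

lemma extend_state:
  assumes \<psi>: "\<psi> \<in> states B"
  shows "\<exists>\<phi>\<in>states A. \<psi> = compose (carrier B) \<phi> J"
proof -
  interpret Q: cstate B \<psi> using \<psi> by unfold_locales
  define \<phi> where "\<phi> = restrict (\<lambda>x. \<psi> (G (E n x))) (carrier A)"
  have \<phi>: "\<phi> x = \<psi> (G (E n x))" if "x \<in> carrier A" for x using that by (simp add: \<phi>_def)
  have GE: "G (E n x) \<in> carrier B" "J (G (E n x)) = E n x" if "x \<in> carrier A" for x
    using that by (simp_all add: G_closed J_G)
  have add: "\<phi> (x \<oplus>\<^bsub>A\<^esub> y) = \<phi> x + \<phi> y" if "x \<in> carrier A" "y \<in> carrier A" for x y
  proof -
    have "G (E n (x \<oplus>\<^bsub>A\<^esub> y)) = G (E n x) \<oplus>\<^bsub>B\<^esub> G (E n y)"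
      by (rule G_eqI) (use that GE in \<open>auto simp: J_add E_add\<close>)
    thus ?thesis using that GE by (simp add: \<phi> Q.st_add)
  qed
  have smult: "\<phi> (c \<odot>\<^bsub>A\<^esub> x) = c * \<phi> x" if "x \<in> carrier A" for x c
  proof -
    have "G (E n (c \<odot>\<^bsub>A\<^esub> x)) = c \<odot>\<^bsub>B\<^esub> G (E n x)"
      by (rule G_eqI) (use that GE in \<open>auto simp: J_smult E_smult\<close>)
    thus ?thesis using that GE by (simp add: \<phi> Q.st_smult)
  qed
  have bound: "cmod (\<phi> x) \<le> nrm A x" if x: "x \<in> carrier A" for x
  proof -
    have "cmod (\<phi> x) \<le> nrm B (G (E n x))" using x GE by (simp add: \<phi> Q.st_bound)
    also have "\<dots> = nrm A (E n x)" using J_nrm[of "G (E n x)"] GE[OF x] by simp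
    also have "\<dots> \<le> nrm A x" using x by (rule nrm_E)
    finally show ?thesis .
  qed
  have real: "Im (\<phi> h) = 0" if h: "h \<in> carrier A" "star A h = h" for h
  proof -
    have "star B (G (E n h)) = G (E n h)"
      by (rule G_eqI[symmetric]) (use h GE E_star[OF h(1), of n] in \<open>auto simp: J_star\<close>)
    hence "\<phi> h = cnj (\<phi> h)" using Q.st_star[of "G (E n h)"] GE[OF h(1)] h by (simp add: \<phi>)
    thus ?thesis by (simp add: complex_eq_iff)
  qed
  have one: "\<phi> \<one>\<^bsub>A\<^esub> = 1"
    using G_eqI[of "\<one>\<^bsub>B\<^esub>" "\<one>\<^bsub>A\<^esub>"] by (simp add: \<phi> E_id J_one)
  have minus: "\<phi> (x \<ominus>\<^bsub>A\<^esub> y) = \<phi> x - \<phi> y" if "x \<in> carrier A" "y \<in> carrier A" for x y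
    using that by (simp add: minus_eq_smult add smult)
  have posF: "0 \<le> Re (\<phi> (star A x \<otimes>\<^bsub>A\<^esub> x))" if x: "x \<in> F k" for x k
  proof (cases "nrm A x = 0")
    case True
    hence "x = \<zero>\<^bsub>A\<^esub>" using x by (simp add: nrm_eq_0)
    thus ?thesis using smult[of "\<zero>\<^bsub>A\<^esub>" 0] by simp
  next
    case False
    hence p: "nrm A x > 0" using N_nonneg[of x] x by simp
    let ?y = "complex_of_real (1 / nrm A x) \<odot>\<^bsub>A\<^esub> x"
    let ?h = "star A ?y \<otimes>\<^bsub>A\<^esub> ?y"
    have y: "?y \<in> F k" "nrm A ?y \<le> 1" using x p by (simp_all add: N_smult norm_divide)
    have yc: "?y \<in> carrier A" using y(1) F_carrier by blast
    have hc: "?h \<in> carrier A" "\<one>\<^bsub>A\<^esub> \<ominus>\<^bsub>A\<^esub> ?h \<in> carrier A" using yc by auto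
    have "Re (\<phi> (\<one>\<^bsub>A\<^esub> \<ominus>\<^bsub>A\<^esub> ?h)) \<le> 1"
      by (rule order_trans[OF complex_Re_le_cmod order_trans[OF bound[OF hc(2)] nrm_one_minus_le[OF y]]])
    hence 0: "0 \<le> Re (\<phi> ?h)" unfolding minus[OF one_closed hc(1)] one by simp
    define r where "r = (1 / nrm A x) * (1 / nrm A x)"
    have xc: "star A x \<otimes>\<^bsub>A\<^esub> x \<in> carrier A" using x by auto
    have "?h = complex_of_real r \<odot>\<^bsub>A\<^esub> (star A x \<otimes>\<^bsub>A\<^esub> x)"
      using x by (simp add: r_def star_smult smult_mult_left smult_mult_right smult_smult)
    hence "\<phi> ?h = complex_of_real r * \<phi> (star A x \<otimes>\<^bsub>A\<^esub> x)" by (simp only: smult[OF xc])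
    hence "Re (\<phi> ?h) = r * Re (\<phi> (star A x \<otimes>\<^bsub>A\<^esub> x))" by (simp only: Re_complex_of_real_mult)
    moreover have "0 < r" using p by (simp add: r_def)
    ultimately show ?thesis using 0 by (simp add: zero_le_mult_iff)
  qed
  have pos: "0 \<le> Re (\<phi> (star A x \<otimes>\<^bsub>A\<^esub> x))" if x: "x \<in> carrier A" for x
  proof -
    have l: "(\<lambda>k. nrm A x * nrm A (E k x \<ominus>\<^bsub>A\<^esub> x) + nrm A (E k x \<ominus>\<^bsub>A\<^esub> x) * nrm A x) \<longlonglongrightarrow> 0"
      using tendsto_add[OF tendsto_mult_right_zero[OF E_lim[OF x], of "nrm A x"] tendsto_mult_left_zero[OF E_lim[OF x], of "nrm A x"]] by simp
    have "(\<lambda>k. \<phi> (star A (E k x) \<otimes>\<^bsub>A\<^esub> E k x) - \<phi> (star A x \<otimes>\<^bsub>A\<^esub> x)) \<longlonglongrightarrow> 0"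
    proof (rule tendsto_norm_zero_cancel, rule null_le[OF _ _ l])
      fix k
      have "\<phi> (star A (E k x) \<otimes>\<^bsub>A\<^esub> E k x) - \<phi> (star A x \<otimes>\<^bsub>A\<^esub> x)
          = \<phi> (star A (E k x) \<otimes>\<^bsub>A\<^esub> E k x \<ominus>\<^bsub>A\<^esub> star A x \<otimes>\<^bsub>A\<^esub> x)" using x by (simp add: minus)
      hence "norm (\<phi> (star A (E k x) \<otimes>\<^bsub>A\<^esub> E k x) - \<phi> (star A x \<otimes>\<^bsub>A\<^esub> x))
          \<le> nrm A (star A (E k x) \<otimes>\<^bsub>A\<^esub> E k x \<ominus>\<^bsub>A\<^esub> star A x \<otimes>\<^bsub>A\<^esub> x)" using x bound by simp
      also have "\<dots> \<le> nrm A (star A (E k x)) * nrm A (E k x \<ominus>\<^bsub>A\<^esub> x) + nrm A (star A (E k x) \<ominus>\<^bsub>A\<^esub> star A x) * nrm A x"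
        using x by (intro nrm_mult_minus_mult) auto
      also have "\<dots> = nrm A (E k x) * nrm A (E k x \<ominus>\<^bsub>A\<^esub> x) + nrm A (E k x \<ominus>\<^bsub>A\<^esub> x) * nrm A x"
        using x nrm_star[of "E k x \<ominus>\<^bsub>A\<^esub> x"] by (simp add: star_minus)
      also have "\<dots> \<le> nrm A x * nrm A (E k x \<ominus>\<^bsub>A\<^esub> x) + nrm A (E k x \<ominus>\<^bsub>A\<^esub> x) * nrm A x"
        using x by (intro add_mono mult_right_mono nrm_E N_nonneg) auto
      finally show "norm (\<phi> (star A (E k x) \<otimes>\<^bsub>A\<^esub> E k x) - \<phi> (star A x \<otimes>\<^bsub>A\<^esub> x))
          \<le> nrm A x * nrm A (E k x \<ominus>\<^bsub>A\<^esub> x) + nrm A (E k x \<ominus>\<^bsub>A\<^esub> x) * nrm A x" .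
    qed auto
    hence "(\<lambda>k. Re (\<phi> (star A (E k x) \<otimes>\<^bsub>A\<^esub> E k x))) \<longlonglongrightarrow> Re (\<phi> (star A x \<otimes>\<^bsub>A\<^esub> x))"
      by (rule tendsto_Re[OF LIM_zero_cancel])
    thus ?thesis by (rule LIMSEQ_le_const) (use posF[OF E_F[OF x]] in auto)
  qed
  have st: "\<phi> \<in> states A"
    unfolding states_def using add smult one pos real
    by (auto simp: complex_nonneg_Reals_iff star_mult) (simp add: \<phi>_def)
  have "\<psi> = compose (carrier B) \<phi> J"
  proof (rule extensionalityI)
    show "\<psi> \<in> extensional (carrier B)" using \<psi> by (simp add: states_def)
    fix x assume x: "x \<in> carrier B"
    have "J x \<in> F n" using x J_image by blast
    thus "\<psi> x = compose (carrier B) \<phi> J x" using x by (simp add: compose_def \<phi> J_closed E_id G_J)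
  qed (simp add: compose_def)
  thus ?thesis using st by blast
qed

lemma one_level_one: "one_level A \<one>\<^bsub>A\<^esub> = states A"
proof -
  have "\<phi> \<zero>\<^bsub>A\<^esub> = 0" if "\<phi> \<in> states A" for \<phi>
  proof -
    interpret P: cstate A \<phi> using that by unfold_locales
    show ?thesis using P.st_smult[of "\<zero>\<^bsub>A\<^esub>" 0] by simp
  qed
  thus ?thesis by (auto simp: one_level_def)
qed

lemma states_J: "(\<lambda>\<phi>. compose (carrier B) \<phi> J) ` states A = states B"
proof (intro equalityI subsetI)
  fix \<psi> assume "\<psi> \<in> states B"
  thus "\<psi> \<in> (\<lambda>\<phi>. compose (carrier B) \<phi> J) ` states A" using extend_state by blast
next
  fix \<psi> assume "\<psi> \<in> (\<lambda>\<phi>. compose (carrier B) \<phi> J) ` states A"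
  then obtain \<phi> where \<phi>: "\<phi> \<in> states A" "\<psi> = compose (carrier B) \<phi> J" by blast
  interpret P: cstate A \<phi> using \<phi> by unfold_locales
  show "\<psi> \<in> states B"
    using P.st_pos J_closed unfolding \<phi>(2) states_def
    by (auto simp: compose_def J_add J_smult J_mult J_star J_one P.st_add P.st_smult complex_nonneg_Reals_iff)
qed

lemma states_id: "(\<lambda>\<phi>. compose (carrier A) \<phi> (\<lambda>x. x)) ` states A = states A"
proof -
  have "compose (carrier A) \<phi> (\<lambda>x. x) = \<phi>" if "\<phi> \<in> states A" for \<phi>
    using that by (auto simp: states_def compose_def extensional_def fun_eq_iff)
  thus ?thesis by simp
qed

lemma unital_star_mono_id: "unital_star_mono A A (\<lambda>x. x)"
  by (auto simp: unital_star_mono_def)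

definition bridge_BA :: "('b, 'a, 'a) bridge" where
  "bridge_BA = \<lparr>bridge_algebra = A, pivot = \<one>\<^bsub>A\<^esub>, left_map = J, right_map = (\<lambda>x. x)\<rparr>"

definition bridge_AB :: "('a, 'b, 'a) bridge" where
  "bridge_AB = \<lparr>bridge_algebra = A, pivot = \<one>\<^bsub>A\<^esub>, left_map = (\<lambda>x. x), right_map = J\<rparr>"

lemma is_bridge_BA: "is_bridge B A bridge_BA"
  using state cstar_alg unital_star_mono_J unital_star_mono_id
  by (auto simp: is_bridge_def bridge_BA_def one_level_one)

lemma is_bridge_AB: "is_bridge A B bridge_AB"
  using state cstar_alg unital_star_mono_J unital_star_mono_id
  by (auto simp: is_bridge_def bridge_AB_def one_level_one)

lemma bridge_length_le:
  assumes 1: "\<And>b. b \<in> sa_lip_ball B LB \<Longrightarrow> \<exists>a\<in>sa_lip_ball A LA. nrm A (J b \<ominus>\<^bsub>A\<^esub> a) \<le> \<epsilon>"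
    and 2: "\<And>a. a \<in> sa_lip_ball A LA \<Longrightarrow> \<exists>b\<in>sa_lip_ball B LB. nrm A (J b \<ominus>\<^bsub>A\<^esub> a) \<le> \<epsilon>"
  shows "bridge_length bridge_BA (B, LB) (A, LA) \<le> ennreal \<epsilon>" (is ?BA)
    and "bridge_length bridge_AB (A, LA) (B, LB) \<le> ennreal \<epsilon>" (is ?AB)
proof -
  have c: "J b \<in> carrier A" "a \<in> carrier A" if "b \<in> sa_lip_ball B LB" "a \<in> sa_lip_ball A LA" for a b
    using that J_closed by (auto simp: sa_lip_ball_def sa_def)
  have sc: "sa_lip_ball A LA \<subseteq> carrier A" by (auto simp: sa_lip_ball_def sa_def)
  have i1: "(\<lambda>b. J b \<otimes>\<^bsub>A\<^esub> \<one>\<^bsub>A\<^esub>) ` sa_lip_ball B LB = J ` sa_lip_ball B LB"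
    "(\<lambda>b. \<one>\<^bsub>A\<^esub> \<otimes>\<^bsub>A\<^esub> J b) ` sa_lip_ball B LB = J ` sa_lip_ball B LB"
    using J_closed by (auto simp: sa_lip_ball_def sa_def intro!: image_cong)
  have i2: "(\<lambda>a. a \<otimes>\<^bsub>A\<^esub> \<one>\<^bsub>A\<^esub>) ` sa_lip_ball A LA = sa_lip_ball A LA"
    "(\<lambda>a. \<one>\<^bsub>A\<^esub> \<otimes>\<^bsub>A\<^esub> a) ` sa_lip_ball A LA = sa_lip_ball A LA"
    using sc by (force simp: image_iff)+
  have "hausdorff_edist (\<lambda>x y. ennreal (nrm A (x \<ominus>\<^bsub>A\<^esub> y))) (J ` sa_lip_ball B LB) (sa_lip_ball A LA) \<le> ennreal \<epsilon>"
    by (rule hausdorff_edist_le) (use 1 2 in \<open>fastforce intro: ennreal_leI\<close>)+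
  thus ?BA
    by (simp add: bridge_length_def bridge_reach_def bridge_height_def bridge_BA_def Let_def i1 i2
        one_level_one states_J states_id hausdorff_mk_dist_self)
  have "hausdorff_edist (\<lambda>x y. ennreal (nrm A (x \<ominus>\<^bsub>A\<^esub> y))) (sa_lip_ball A LA) (J ` sa_lip_ball B LB) \<le> ennreal \<epsilon>"
  proof (rule hausdorff_edist_le)
    fix a assume a: "a \<in> sa_lip_ball A LA"
    then obtain b where "b \<in> sa_lip_ball B LB" "nrm A (J b \<ominus>\<^bsub>A\<^esub> a) \<le> \<epsilon>" using 2 by blast
    hence b: "J b \<in> J ` sa_lip_ball B LB" "nrm A (a \<ominus>\<^bsub>A\<^esub> J b) \<le> \<epsilon>"
      using c[of b a] a N_minus_commute[of a "J b"] by auto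
    show "\<exists>t\<in>J ` sa_lip_ball B LB. ennreal (nrm A (a \<ominus>\<^bsub>A\<^esub> t)) \<le> ennreal \<epsilon>"
      by (rule bexI[OF _ b(1)]) (rule ennreal_leI[OF b(2)])
  next
    fix t assume "t \<in> J ` sa_lip_ball B LB"
    then obtain b where b: "b \<in> sa_lip_ball B LB" "t = J b" by blast
    then obtain a where "a \<in> sa_lip_ball A LA" "nrm A (J b \<ominus>\<^bsub>A\<^esub> a) \<le> \<epsilon>" using 1 by blast
    thus "\<exists>a\<in>sa_lip_ball A LA. ennreal (nrm A (a \<ominus>\<^bsub>A\<^esub> t)) \<le> ennreal \<epsilon>"
      using c[of b a] b N_minus_commute[of a "J b"] by (auto intro!: ennreal_leI bexI[of _ a])
  qed
  thus ?AB
    by (simp add: bridge_length_def bridge_reach_def bridge_height_def bridge_AB_def Let_def i1 i2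
        one_level_one states_J states_id hausdorff_mk_dist_self)
qed

end

section \<open>Perturbation of the trace\<close>

lemma (in ci) lipb_one: "lipb 0 (c \<odot> \<one>)"
  using L_eq_0_iff[of "c \<odot> \<one>"] L_le_iff[of "c \<odot> \<one>" 0] by auto

lemma (in ci) Wf_one: "x \<in> F m \<Longrightarrow> y \<in> F m \<Longrightarrow> Wf m (c \<odot> \<one>) x y = 0"
  using lipbD[OF lipb_one] by fastforce

text \<open>Scaling a itself would cost \<eta> times its norm, which the seminorm does not control.
  Only a - E 0 a is scaled by 1/(1 + \<eta>); its norm is at most (1 + \<eta>) \<open>tl 0\<close>,
  so the cost is \<eta> \<open>tl 0\<close>.\<close>

lemma (in ci) shrink:
  assumes a: "a \<in> F n" "star A a = a" "lipb (1 + \<eta>) a" and \<eta>: "\<eta> \<ge> 0"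
  shows "\<exists>a'\<in>F n. star A a' = a' \<and> lipb 1 a' \<and> nrm A (a \<ominus> a') \<le> \<eta> * tl 0"
proof -
  let ?c = "complex_of_real (1 / (1 + \<eta>))"
  have ac: "a \<in> carrier A" using a by simp
  let ?a' = "E 0 a \<oplus> ?c \<odot> (a \<ominus> E 0 a)"
  have E0: "E 0 a \<in> F n" using F_mono[of 0 n "E 0 a"] ac by simp
  have l0: "lipb 0 (E 0 a)" using lipb_one E_0[OF ac] by simp
  have l0': "lipb 0 ((-1) \<odot> E 0 a)" using lipb_smult[OF _ l0, of "-1"] ac by simp
  have "lipb (1 + \<eta> + 0) (a \<oplus> (-1) \<odot> E 0 a)" using ac a l0' by (intro lipb_add) auto
  hence "lipb (1 + \<eta>) (a \<ominus> E 0 a)" using ac by (simp add: minus_eq_smult)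
  hence "lipb (cmod ?c * (1 + \<eta>)) (?c \<odot> (a \<ominus> E 0 a))" using ac by (intro lipb_smult) auto
  moreover have "cmod ?c * (1 + \<eta>) = 1" using \<eta> unfolding norm_of_real by simp
  ultimately have "lipb 1 (?c \<odot> (a \<ominus> E 0 a))" by simp
  hence "lipb (0 + 1) ?a'" using ac l0 by (intro lipb_add) auto
  moreover have "?a' \<in> F n" using E0 a by simp
  moreover have "star A ?a' = ?a'"
    using ac a(2) E_star[OF ac, of 0] by (simp add: star_add star_smult star_minus)
  moreover have "nrm A (a \<ominus> ?a') \<le> \<eta> * tl 0"
  proof -
    have "a \<ominus> ?a' = (a \<ominus> E 0 a) \<ominus> ?c \<odot> (a \<ominus> E 0 a)"
      using ac by (simp add: a_minus_def minus_add a_assoc)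
    also have "\<dots> = (1 - ?c) \<odot> (a \<ominus> E 0 a)"
      using ac by (simp add: minus_eq_smult smult_smult) (simp add: smult_add_left[of _ 1 "- _", simplified] smult_add_left)
    finally have "nrm A (a \<ominus> ?a') = cmod (1 - ?c) * nrm A (a \<ominus> E 0 a)" using ac by (simp add: N_smult)
    also have "1 - ?c = complex_of_real (1 - 1 / (1 + \<eta>))" by simp
    also have "cmod \<dots> = \<eta> / (1 + \<eta>)" using \<eta> by (simp only: norm_of_real) (simp add: field_simps)
    also have "\<eta> / (1 + \<eta>) * nrm A (a \<ominus> E 0 a) \<le> \<eta> / (1 + \<eta>) * ((1 + \<eta>) * tl 0)"
      using \<eta> nrm_minus_E_le[OF ac _ a(3), of 0] by (intro mult_left_mono) auto
    also have "\<dots> = \<eta> * tl 0" using \<eta> by simp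
    finally show ?thesis .
  qed
  ultimately show ?thesis by auto
qed

text \<open>\<open>J\<close> identifies the stages up to \<open>n\<close>, preserving everything except the trace; \<open>\<delta>\<close> measures the
  relative change of the inner product.\<close>

locale ci_pair = P: ci A \<tau> F \<beta> + Q: ci A' \<tau>' F' \<beta>'
  for A :: "'a cstar" and \<tau> F \<beta> and A' :: "'b cstar" and \<tau>' F' \<beta>' +
  fixes J :: "'b \<Rightarrow> 'a" and n :: nat and \<delta> :: real
  assumes J_add: "\<lbrakk>x \<in> F' n; y \<in> F' n\<rbrakk> \<Longrightarrow> J (x \<oplus>\<^bsub>A'\<^esub> y) = J x \<oplus>\<^bsub>A\<^esub> J y"
    and J_smult: "x \<in> F' n \<Longrightarrow> J (c \<odot>\<^bsub>A'\<^esub> x) = c \<odot>\<^bsub>A\<^esub> J x"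
    and J_mult: "\<lbrakk>x \<in> F' n; y \<in> F' n\<rbrakk> \<Longrightarrow> J (x \<otimes>\<^bsub>A'\<^esub> y) = J x \<otimes>\<^bsub>A\<^esub> J y"
    and J_star: "x \<in> F' n \<Longrightarrow> J (star A' x) = star A (J x)"
    and J_one: "J \<one>\<^bsub>A'\<^esub> = \<one>\<^bsub>A\<^esub>"
    and J_nrm: "x \<in> F' n \<Longrightarrow> nrm A (J x) = nrm A' x"
    and J_F: "j \<le> n \<Longrightarrow> J ` F' j = F j"
    and \<beta>_eq: "1 \<le> j \<Longrightarrow> j \<le> n \<Longrightarrow> \<beta> j = \<beta>' j"
    and \<delta>: "0 \<le> \<delta>" "\<delta> \<le> 1"
    and close1: "\<lbrakk>x \<in> F' n; y \<in> F' n\<rbrakk> \<Longrightarrow> cmod (P.s (J x) (J y) - Q.s x y) \<le> \<delta> * Q.tn x * Q.tn y"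
    and close2: "\<lbrakk>x \<in> F' n; y \<in> F' n\<rbrakk> \<Longrightarrow> cmod (P.s (J x) (J y) - Q.s x y) \<le> \<delta> * P.tn (J x) * P.tn (J y)"
begin

lemma JF: "j \<le> n \<Longrightarrow> x \<in> F' j \<Longrightarrow> J x \<in> F j"
  using J_F by blast

lemma Jc [simp]: "x \<in> F' n \<Longrightarrow> J x \<in> carrier A"
  using JF[of n x] by simp

lemma F'_n: "j \<le> n \<Longrightarrow> x \<in> F' j \<Longrightarrow> x \<in> F' n"
  by (rule Q.F_mono)

lemma J_minus: "\<lbrakk>x \<in> F' n; y \<in> F' n\<rbrakk> \<Longrightarrow> J (x \<ominus>\<^bsub>A'\<^esub> y) = J x \<ominus>\<^bsub>A\<^esub> J y"
  by (simp add: Q.minus_eq_smult P.minus_eq_smult J_add J_smult)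

text \<open>The inner products give the factor 1 + \<delta> for squared norms; enlarging it to its
  square avoids square roots.\<close>

lemma tn_J_le: assumes x: "x \<in> F' n" shows "P.tn (J x) \<le> (1 + \<delta>) * Q.tn x"
proof (rule power2_le_imp_le)
  have "(P.tn (J x))\<^sup>2 = cmod (P.s (J x) (J x))" using x P.s_self[of "J x"] by (simp del: of_real_power)
  also have "\<dots> \<le> cmod (Q.s x x) + \<delta> * Q.tn x * Q.tn x"
    using close1[OF x x] norm_triangle_sub[of "P.s (J x) (J x)" "Q.s x x"] by simp
  also have "\<dots> = (1 + \<delta>) * (Q.tn x)\<^sup>2" using x Q.s_self[of x] by (simp add: power2_eq_square algebra_simps del: of_real_power of_real_mult)
  also have "\<dots> \<le> (1 + \<delta>)\<^sup>2 * (Q.tn x)\<^sup>2" using \<delta> by (intro mult_right_mono) (auto simp: power2_eq_square)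
  finally show "(P.tn (J x))\<^sup>2 \<le> ((1 + \<delta>) * Q.tn x)\<^sup>2" by (simp add: power_mult_distrib)
qed (use x \<delta> in auto)

lemma tn_le_J: assumes x: "x \<in> F' n" shows "Q.tn x \<le> (1 + \<delta>) * P.tn (J x)"
proof (rule power2_le_imp_le)
  have "(Q.tn x)\<^sup>2 = cmod (Q.s x x)" using x Q.s_self[of x] by (simp del: of_real_power)
  also have "\<dots> \<le> cmod (P.s (J x) (J x)) + \<delta> * P.tn (J x) * P.tn (J x)"
    using close2[OF x x] norm_triangle_sub[of "Q.s x x" "P.s (J x) (J x)"] by (simp add: norm_minus_commute)
  also have "\<dots> = (1 + \<delta>) * (P.tn (J x))\<^sup>2" using x P.s_self[of "J x"] by (simp add: power2_eq_square algebra_simps del: of_real_power of_real_mult)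
  also have "\<dots> \<le> (1 + \<delta>)\<^sup>2 * (P.tn (J x))\<^sup>2" using \<delta> by (intro mult_right_mono) (auto simp: power2_eq_square)
  finally show "(Q.tn x)\<^sup>2 \<le> ((1 + \<delta>) * P.tn (J x))\<^sup>2" by (simp add: power_mult_distrib)
qed (use x \<delta> in auto)

lemma tn_J_le2: "x \<in> F' n \<Longrightarrow> P.tn (J x) \<le> 2 * Q.tn x"
  using tn_J_le[of x] mult_right_mono[of "1 + \<delta>" 2 "Q.tn x"] \<delta> by fastforce

lemma tn_le_J2: "x \<in> F' n \<Longrightarrow> Q.tn x \<le> 2 * P.tn (J x)"
  using tn_le_J[of x] mult_right_mono[of "1 + \<delta>" 2 "P.tn (J x)"] \<delta> by fastforce

lemma E'_n: "x \<in> F' n \<Longrightarrow> j \<le> n \<Longrightarrow> Q.E j x \<in> F' n"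
  using F'_n[of j "Q.E j x"] by simp

text \<open>The difference w lies in stage j, where it is the image of some w'. Its pairing with
  itself is an inner product whose counterpart for the other trace vanishes by orthogonality, so
  only the discrepancy \<delta> remains. The 8 collects a factor 2 for each change of trace norm and
  one for the norm of E x - x.\<close>

lemma E_close:
  assumes x: "x \<in> F' n" and j: "j \<le> n"
  shows "P.tn (J (Q.E j x) \<ominus>\<^bsub>A\<^esub> P.E j (J x)) \<le> 8 * \<delta> * P.tn (J x)"
proof (rule P.tn_le_if_s_le)
  let ?w = "J (Q.E j x) \<ominus>\<^bsub>A\<^esub> P.E j (J x)"
  have e: "Q.E j x \<in> F' n" using E'_n[OF x j] .
  have u: "Q.E j x \<ominus>\<^bsub>A'\<^esub> x \<in> F' n" using e x by simp
  have wF: "?w \<in> F j" using JF[OF j, of "Q.E j x"] x by simp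
  then obtain w' where w': "w' \<in> F' j" "?w = J w'" using J_F[OF j] by blast
  have w'n: "w' \<in> F' n" using F'_n[OF j w'(1)] .
  show wc: "?w \<in> carrier A" using wF by simp
  have "P.s ?w ?w = P.s (J (Q.E j x)) ?w - P.s (J x) ?w"
    using P.E_s[of "J x" ?w j] wF x e wc by (simp add: P.s_minus)
  also have "\<dots> = P.s (J (Q.E j x \<ominus>\<^bsub>A'\<^esub> x)) (J w')"
    using x e w'n by (simp add: J_minus P.s_minus w'(2))
  finally have 1: "P.s ?w ?w = P.s (J (Q.E j x \<ominus>\<^bsub>A'\<^esub> x)) (J w')" .
  have 2: "Q.s (Q.E j x \<ominus>\<^bsub>A'\<^esub> x) w' = 0"
    using Q.E_s[of x w' j] x e w' w'n by (simp add: Q.s_minus)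
  have "cmod (P.s ?w ?w) \<le> \<delta> * P.tn (J (Q.E j x \<ominus>\<^bsub>A'\<^esub> x)) * P.tn ?w"
    using close2[OF u w'n] unfolding 1 2 diff_0_right by (simp only: w'(2))
  also have "P.tn (J (Q.E j x \<ominus>\<^bsub>A'\<^esub> x)) \<le> 8 * P.tn (J x)"
  proof -
    have "P.tn (J (Q.E j x \<ominus>\<^bsub>A'\<^esub> x)) \<le> 2 * Q.tn (Q.E j x \<ominus>\<^bsub>A'\<^esub> x)" by (rule tn_J_le2[OF u])
    also have "Q.tn (Q.E j x \<ominus>\<^bsub>A'\<^esub> x) \<le> Q.tn x + Q.tn x"
      using Q.T.N_minus[of "Q.E j x" x] Q.tn_E[of x j] x by simp
    also have "Q.tn x \<le> 2 * P.tn (J x)" by (rule tn_le_J2[OF x])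
    finally show ?thesis by simp
  qed
  finally show "cmod (P.s ?w ?w) \<le> 8 * \<delta> * P.tn (J x) * P.tn ?w"
    using \<delta> wc by (simp add: mult_left_mono mult_right_mono mult.assoc mult.left_commute)
qed (use \<delta> x in simp)

lemma q_close:
  assumes x: "x \<in> F' n" and j: "j \<le> n"
  shows "P.tn (J (Q.q j x) \<ominus>\<^bsub>A\<^esub> P.q j (J x)) \<le> 16 * \<delta> * P.tn (J x)"
proof -
  have e: "Q.E j x \<in> F' n" "Q.E (j - 1) x \<in> F' n" using E'_n[OF x] j by auto
  have "J (Q.q j x) \<ominus>\<^bsub>A\<^esub> P.q j (J x) = (J (Q.E j x) \<ominus>\<^bsub>A\<^esub> P.E j (J x)) \<ominus>\<^bsub>A\<^esub> (J (Q.E (j - 1) x) \<ominus>\<^bsub>A\<^esub> P.E (j - 1) (J x))"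
    using e x P.minus_add_minus[of "J (Q.E j x)" "P.E j (J x)" "J (Q.E (j - 1) x)" "P.E (j - 1) (J x)"]
    by (simp add: Q.q_def P.q_def J_minus)
  hence "P.tn (J (Q.q j x) \<ominus>\<^bsub>A\<^esub> P.q j (J x)) \<le>
      P.tn (J (Q.E j x) \<ominus>\<^bsub>A\<^esub> P.E j (J x)) + P.tn (J (Q.E (j - 1) x) \<ominus>\<^bsub>A\<^esub> P.E (j - 1) (J x))"
    using e x by (simp only:) (intro P.T.N_minus; simp)
  moreover have "j - 1 \<le> n" using j by simp
  ultimately show ?thesis using E_close[OF x j] E_close[OF x, of "j - 1"] by linarith
qed

lemma const_close:
  assumes j: "j \<le> n"
  shows "ci_const A' F' \<tau>' j \<le> (1 + \<delta>) * ci_const A F \<tau> j" "ci_const A F \<tau> j \<le> (1 + \<delta>) * ci_const A' F' \<tau>' j"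
proof -
  show "ci_const A' F' \<tau>' j \<le> (1 + \<delta>) * ci_const A F \<tau> j"
  proof (rule Q.ci_const_least)
    fix x assume x: "x \<in> F' j"
    have xn: "x \<in> F' n" using F'_n[OF j x] .
    have "nrm A' x \<le> ci_const A F \<tau> j * P.tn (J x)" using P.ci_const[OF JF[OF j x]] J_nrm[OF xn] by simp
    also have "\<dots> \<le> ci_const A F \<tau> j * ((1 + \<delta>) * Q.tn x)"
      using P.ci_const_pos[of j] by (intro mult_left_mono tn_J_le[OF xn]) simp
    finally show "nrm A' x \<le> (1 + \<delta>) * ci_const A F \<tau> j * Q.tn x" by (simp add: ac_simps)
  qed
  show "ci_const A F \<tau> j \<le> (1 + \<delta>) * ci_const A' F' \<tau>' j"
  proof (rule P.ci_const_least)
    fix y assume "y \<in> F j"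
    then obtain x where x: "x \<in> F' j" "y = J x" using J_F[OF j] by blast
    have xn: "x \<in> F' n" using F'_n[OF j x(1)] .
    have "nrm A y \<le> ci_const A' F' \<tau>' j * Q.tn x" using Q.ci_const[OF x(1)] J_nrm[OF xn] x by simp
    also have "\<dots> \<le> ci_const A' F' \<tau>' j * ((1 + \<delta>) * P.tn y)"
      unfolding x(2) using Q.ci_const_pos[of j] by (intro mult_left_mono tn_le_J[OF xn]) simp
    finally show "nrm A y \<le> (1 + \<delta>) * ci_const A' F' \<tau>' j * P.tn y" by (simp add: ac_simps)
  qed
qed

text \<open>The \<beta> j are common, so the coefficients differ as the norm constants do. The
  factor 2 replaces the other coefficient by that of A, using \<delta> \<le> 1.\<close>

lemma \<kappa>_close:
  assumes j: "1 \<le> j" "j \<le> n" shows "\<bar>Q.\<kappa> j - P.\<kappa> j\<bar> \<le> 2 * \<delta> * P.\<kappa> j"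
proof -
  have 1: "Q.\<kappa> j \<le> (1 + \<delta>) * P.\<kappa> j" "P.\<kappa> j \<le> (1 + \<delta>) * Q.\<kappa> j"
    using const_close[OF j(2)] \<beta>_eq[OF j] Q.\<beta>_pos[OF j(1)]
    by (simp_all add: Q.\<kappa>_eq P.\<kappa>_eq divide_right_mono)
  have p: "0 < P.\<kappa> j" "0 < Q.\<kappa> j" using P.\<kappa>_pos Q.\<kappa>_pos j by auto
  have "(1 + \<delta>) * P.\<kappa> j \<le> 2 * P.\<kappa> j" using \<delta> p by (intro mult_right_mono) auto
  hence "\<delta> * Q.\<kappa> j \<le> \<delta> * (2 * P.\<kappa> j)" using 1(1) \<delta> by (intro mult_left_mono) auto
  moreover have "0 \<le> \<delta> * P.\<kappa> j" using \<delta> p by simp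
  ultimately show ?thesis using 1 by (simp add: abs_le_iff algebra_simps)
qed

lemma q'_n: "x \<in> F' n \<Longrightarrow> j \<le> n \<Longrightarrow> Q.q j x \<in> F' n"
  using F'_n[of j "Q.q j x"] by simp

lemma dsum'_n: "x \<in> F' n \<Longrightarrow> m \<le> n \<Longrightarrow> Q.dsum m x \<in> F' n"
  using F'_n[of m "Q.dsum m x"] by simp

text \<open>Each summand changes through its coefficient and through its projection: 2 \<delta>
  times the factor 4 from two changes of trace norm, plus 16 \<delta> from \<open>q_close\<close>,
  which makes 24 \<delta>.\<close>

lemma dsum_close:
  assumes x: "x \<in> F' n" and m: "m \<le> n"
  shows "P.tn (J (Q.dsum m x) \<ominus>\<^bsub>A\<^esub> P.dsum m (J x)) \<le> 24 * \<delta> * P.K m * P.tn (J x)"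
  using m
proof (induction m)
  case 0
  have "J \<zero>\<^bsub>A'\<^esub> = \<zero>\<^bsub>A\<^esub>" using J_smult[of "\<zero>\<^bsub>A'\<^esub>" 0] by simp
  thus ?case by (simp add: P.K_def)
next
  case (Suc m)
  have q: "Q.q (Suc m) x \<in> F' n" using q'_n[OF x Suc.prems] .
  have d: "Q.dsum m x \<in> F' n" using dsum'_n[OF x] Suc.prems by simp
  have \<kappa>0: "0 < P.\<kappa> (Suc m)" using P.\<kappa>_pos by simp
  let ?k = "complex_of_real (P.\<kappa> (Suc m))" and ?k' = "complex_of_real (Q.\<kappa> (Suc m))"
  let ?u = "J (Q.q (Suc m) x)" and ?v = "P.q (Suc m) (J x)"
  have uv: "?u \<in> carrier A" "?v \<in> carrier A" using q x by auto
  have e: "J (Q.dsum (Suc m) x) \<ominus>\<^bsub>A\<^esub> P.dsum (Suc m) (J x)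
      = (J (Q.dsum m x) \<ominus>\<^bsub>A\<^esub> P.dsum m (J x)) \<oplus>\<^bsub>A\<^esub> (?k' \<odot>\<^bsub>A\<^esub> ?u \<ominus>\<^bsub>A\<^esub> ?k \<odot>\<^bsub>A\<^esub> ?v)"
    using d q x by (simp add: Q.dsum_Suc P.dsum_Suc J_add J_smult P.add_minus_add)
  have "?k' \<odot>\<^bsub>A\<^esub> ?u \<ominus>\<^bsub>A\<^esub> ?k \<odot>\<^bsub>A\<^esub> ?v = (?k' - ?k) \<odot>\<^bsub>A\<^esub> ?u \<oplus>\<^bsub>A\<^esub> ?k \<odot>\<^bsub>A\<^esub> (?u \<ominus>\<^bsub>A\<^esub> ?v)"
  proof -
    have "(?k' - ?k) \<odot>\<^bsub>A\<^esub> ?u \<oplus>\<^bsub>A\<^esub> ?k \<odot>\<^bsub>A\<^esub> ?u = ?k' \<odot>\<^bsub>A\<^esub> ?u"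
      using uv P.smult_add_left[of ?u "?k' - ?k" ?k] by simp
    moreover have "(?k' - ?k) \<odot>\<^bsub>A\<^esub> ?u \<oplus>\<^bsub>A\<^esub> ?k \<odot>\<^bsub>A\<^esub> (?u \<ominus>\<^bsub>A\<^esub> ?v)
        = ((?k' - ?k) \<odot>\<^bsub>A\<^esub> ?u \<oplus>\<^bsub>A\<^esub> ?k \<odot>\<^bsub>A\<^esub> ?u) \<ominus>\<^bsub>A\<^esub> ?k \<odot>\<^bsub>A\<^esub> ?v"
      using uv by (simp only: P.smult_minus) (simp add: a_minus_def P.a_assoc)
    ultimately show ?thesis by simp
  qed
  hence "P.tn (?k' \<odot>\<^bsub>A\<^esub> ?u \<ominus>\<^bsub>A\<^esub> ?k \<odot>\<^bsub>A\<^esub> ?v)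
      \<le> P.tn ((?k' - ?k) \<odot>\<^bsub>A\<^esub> ?u) + P.tn (?k \<odot>\<^bsub>A\<^esub> (?u \<ominus>\<^bsub>A\<^esub> ?v))"
    using uv by (simp only:) (intro P.tn_add; simp)
  also have "\<dots> = \<bar>Q.\<kappa> (Suc m) - P.\<kappa> (Suc m)\<bar> * P.tn ?u + P.\<kappa> (Suc m) * P.tn (?u \<ominus>\<^bsub>A\<^esub> ?v)"
    using uv \<kappa>0 by (simp add: P.tn_smult del: of_real_diff flip: of_real_diff)
  also have "\<dots> \<le> (2 * \<delta> * P.\<kappa> (Suc m)) * (4 * P.tn (J x)) + P.\<kappa> (Suc m) * (16 * \<delta> * P.tn (J x))"
  proof (intro add_mono mult_mono)
    have "P.tn ?u \<le> 2 * Q.tn (Q.q (Suc m) x)" by (rule tn_J_le2[OF q])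
    also have "Q.tn (Q.q (Suc m) x) \<le> Q.tn x" using x by (intro Q.tn_q) simp
    also have "Q.tn x \<le> 2 * P.tn (J x)" by (rule tn_le_J2[OF x])
    finally show "P.tn ?u \<le> 4 * P.tn (J x)" by simp
    show "P.tn (?u \<ominus>\<^bsub>A\<^esub> ?v) \<le> 16 * \<delta> * P.tn (J x)" using q_close[OF x Suc.prems] .
    show "\<bar>Q.\<kappa> (Suc m) - P.\<kappa> (Suc m)\<bar> \<le> 2 * \<delta> * P.\<kappa> (Suc m)" using Suc.prems by (intro \<kappa>_close) auto
  qed (use \<kappa>0 \<delta> uv in auto)
  also have "\<dots> = 24 * \<delta> * P.\<kappa> (Suc m) * P.tn (J x)" by (simp add: algebra_simps)
  finally have 1: "P.tn (?k' \<odot>\<^bsub>A\<^esub> ?u \<ominus>\<^bsub>A\<^esub> ?k \<odot>\<^bsub>A\<^esub> ?v) \<le> 24 * \<delta> * P.\<kappa> (Suc m) * P.tn (J x)" .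
  have "P.tn (J (Q.dsum (Suc m) x) \<ominus>\<^bsub>A\<^esub> P.dsum (Suc m) (J x))
     \<le> P.tn (J (Q.dsum m x) \<ominus>\<^bsub>A\<^esub> P.dsum m (J x)) + P.tn (?k' \<odot>\<^bsub>A\<^esub> ?u \<ominus>\<^bsub>A\<^esub> ?k \<odot>\<^bsub>A\<^esub> ?v)"
    unfolding e using d uv x by (intro P.tn_add) auto
  also have "\<dots> \<le> 24 * \<delta> * P.K m * P.tn (J x) + 24 * \<delta> * P.\<kappa> (Suc m) * P.tn (J x)"
    using Suc 1 by simp
  also have "\<dots> = 24 * \<delta> * P.K (Suc m) * P.tn (J x)" using \<kappa>0 by (simp add: P.K_def algebra_simps)
  finally show ?case .
qed

text \<open>Both terms of the form carry an error 49 = 25 + 24: the changed inner product applied to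
  a transported D z, whose norm is at most 1 + 24 times \<open>K n\<close>, and the change 24 of the
  operator itself.\<close>

lemma Wf_close:
  assumes b: "b \<in> F' n" and x: "x \<in> F' n" and y: "y \<in> F' n"
  shows "cmod (P.Wf n (J b) (J x) (J y) - Q.Wf n b x y) \<le> 98 * \<delta> * P.K n * nrm A' b * P.tn (J x) * P.tn (J y)"
proof -
  define k where "k = P.K n"
  have k0: "0 \<le> k" by (simp add: k_def P.K_def sum_nonneg)
  have d: "Q.dsum n z \<in> F' n" if "z \<in> F' n" for z using dsum'_n[OF that] by simp
  have dd: "P.tn (J (Q.dsum n z) \<ominus>\<^bsub>A\<^esub> P.dsum n (J z)) \<le> 24 * \<delta> * k * P.tn (J z)" if "z \<in> F' n" for z
    using dsum_close[OF that, of n] by (simp add: k_def)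
  have dJ: "P.tn (J (Q.dsum n z)) \<le> 25 * k * P.tn (J z)" if z: "z \<in> F' n" for z
  proof -
    have "P.tn (J (Q.dsum n z)) \<le> P.tn (P.dsum n (J z)) + P.tn (J (Q.dsum n z) \<ominus>\<^bsub>A\<^esub> P.dsum n (J z))"
      using z d[OF z] by (intro P.T.N_le_minus) auto
    also have "\<dots> \<le> k * P.tn (J z) + 24 * \<delta> * k * P.tn (J z)"
      using P.tn_dsum_le[of "J z" n] dd[OF z] z by (simp add: k_def)
    also have "24 * \<delta> * k * P.tn (J z) \<le> 24 * 1 * k * P.tn (J z)"
      using \<delta> k0 z by (intro mult_right_mono mult_left_mono) auto
    finally show ?thesis by simp
  qed
  have nb: "0 \<le> nrm A' b" using b by (intro Q.N_nonneg) simp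
  have Jb: "nrm A (J b) = nrm A' b" by (rule J_nrm[OF b])
  have m: "P.tn (J (b \<otimes>\<^bsub>A'\<^esub> z)) \<le> nrm A' b * P.tn (J z)" if "z \<in> F' n" for z
    using P.tn_mult[of "J b" "J z"] that b by (simp add: J_mult Jb)
  let ?T = "nrm A' b * P.tn (J x) * P.tn (J y)"
  have T0: "0 \<le> ?T" using nb x y by simp
  have 1: "cmod (P.s (J b \<otimes>\<^bsub>A\<^esub> J x) (P.dsum n (J y)) - Q.s (b \<otimes>\<^bsub>A'\<^esub> x) (Q.dsum n y)) \<le> 49 * \<delta> * k * ?T"
  proof -
    let ?z = "b \<otimes>\<^bsub>A'\<^esub> x"
    have z: "?z \<in> F' n" "J ?z = J b \<otimes>\<^bsub>A\<^esub> J x" using b x by (simp_all add: J_mult)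
    have "P.s (J ?z) (P.dsum n (J y)) - Q.s ?z (Q.dsum n y)
        = (P.s (J ?z) (J (Q.dsum n y)) - Q.s ?z (Q.dsum n y)) - P.s (J ?z) (J (Q.dsum n y) \<ominus>\<^bsub>A\<^esub> P.dsum n (J y))"
      using P.s_minus_right[of "J (Q.dsum n y)" "P.dsum n (J y)" "J ?z"] z(1) d[OF y] y by simp
    hence "cmod (P.s (J ?z) (P.dsum n (J y)) - Q.s ?z (Q.dsum n y))
        \<le> cmod (P.s (J ?z) (J (Q.dsum n y)) - Q.s ?z (Q.dsum n y)) + cmod (P.s (J ?z) (J (Q.dsum n y) \<ominus>\<^bsub>A\<^esub> P.dsum n (J y)))"
      by (simp only: norm_triangle_ineq4)
    also have "\<dots> \<le> \<delta> * P.tn (J ?z) * P.tn (J (Q.dsum n y)) + P.tn (J ?z) * P.tn (J (Q.dsum n y) \<ominus>\<^bsub>A\<^esub> P.dsum n (J y))"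
      using z(1) d[OF y] y by (intro add_mono[OF close2[OF z(1) d[OF y]] P.Cauchy_Schwarz]) simp_all
    also have "\<dots> \<le> \<delta> * (nrm A' b * P.tn (J x)) * (25 * k * P.tn (J y)) + (nrm A' b * P.tn (J x)) * (24 * \<delta> * k * P.tn (J y))"
      using z(1) d[OF y] y x nb \<delta> k0 by (intro add_mono mult_mono mult_left_mono m dJ dd mult_nonneg_nonneg) auto
    also have "\<dots> = 49 * \<delta> * k * ?T" by (simp add: algebra_simps)
    finally show ?thesis unfolding z(2) .
  qed
  have 2: "cmod (P.s (J b \<otimes>\<^bsub>A\<^esub> P.dsum n (J x)) (J y) - Q.s (b \<otimes>\<^bsub>A'\<^esub> Q.dsum n x) y) \<le> 49 * \<delta> * k * ?T"
  proof -
    let ?z = "b \<otimes>\<^bsub>A'\<^esub> Q.dsum n x"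
    let ?e = "J (Q.dsum n x) \<ominus>\<^bsub>A\<^esub> P.dsum n (J x)"
    have z: "?z \<in> F' n" "J ?z = J b \<otimes>\<^bsub>A\<^esub> J (Q.dsum n x)" using b d[OF x] by (simp_all add: J_mult)
    have ec: "?e \<in> carrier A" using d[OF x] x by simp
    have "J b \<otimes>\<^bsub>A\<^esub> ?e = J ?z \<ominus>\<^bsub>A\<^esub> J b \<otimes>\<^bsub>A\<^esub> P.dsum n (J x)"
      unfolding z(2) using b x d[OF x] by (simp add: a_minus_def P.r_distr P.r_minus)
    hence "P.s (J b \<otimes>\<^bsub>A\<^esub> ?e) (J y) = P.s (J ?z) (J y) - P.s (J b \<otimes>\<^bsub>A\<^esub> P.dsum n (J x)) (J y)"
      using z(1) b x y by (simp add: P.s_minus)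
    hence eq: "P.s (J b \<otimes>\<^bsub>A\<^esub> P.dsum n (J x)) (J y) - Q.s ?z y
        = (P.s (J ?z) (J y) - Q.s ?z y) - P.s (J b \<otimes>\<^bsub>A\<^esub> ?e) (J y)" by simp
    have "cmod (P.s (J b \<otimes>\<^bsub>A\<^esub> P.dsum n (J x)) (J y) - Q.s ?z y)
        \<le> cmod (P.s (J ?z) (J y) - Q.s ?z y) + cmod (P.s (J b \<otimes>\<^bsub>A\<^esub> ?e) (J y))"
      unfolding eq by (rule norm_triangle_ineq4)
    also have "\<dots> \<le> \<delta> * P.tn (J ?z) * P.tn (J y) + P.tn (J b \<otimes>\<^bsub>A\<^esub> ?e) * P.tn (J y)"
      by (rule add_mono[OF close2[OF z(1) y] P.Cauchy_Schwarz[OF P.m_closed[OF Jc[OF b] ec] Jc[OF y]]])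
    also have "\<dots> \<le> \<delta> * (nrm A' b * (25 * k * P.tn (J x))) * P.tn (J y) + (nrm A' b * (24 * \<delta> * k * P.tn (J x))) * P.tn (J y)"
    proof (intro add_mono mult_right_mono mult_left_mono)
      show "P.tn (J ?z) \<le> nrm A' b * (25 * k * P.tn (J x))"
        using m[OF d[OF x]] mult_left_mono[OF dJ[OF x] nb] by linarith
      show "P.tn (J b \<otimes>\<^bsub>A\<^esub> ?e) \<le> nrm A' b * (24 * \<delta> * k * P.tn (J x))"
        using P.tn_mult[OF Jc[OF b] ec] mult_left_mono[OF dd[OF x] nb] unfolding Jb by linarith
      show "0 \<le> \<delta>" by (rule \<delta>(1))
    qed (rule P.tn_nonneg[OF Jc[OF y]])+
    also have "\<dots> = 49 * \<delta> * k * ?T" by (simp add: algebra_simps)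
    finally show ?thesis .
  qed
  have "P.Wf n (J b) (J x) (J y) - Q.Wf n b x y =
      (P.s (J b \<otimes>\<^bsub>A\<^esub> J x) (P.dsum n (J y)) - Q.s (b \<otimes>\<^bsub>A'\<^esub> x) (Q.dsum n y)) -
      (P.s (J b \<otimes>\<^bsub>A\<^esub> P.dsum n (J x)) (J y) - Q.s (b \<otimes>\<^bsub>A'\<^esub> Q.dsum n x) y)"
    by (simp add: P.Wf_def Q.Wf_def)
  hence "cmod (P.Wf n (J b) (J x) (J y) - Q.Wf n b x y) \<le> 49 * \<delta> * k * ?T + 49 * \<delta> * k * ?T"
    using 1 2 by (simp only:) (rule norm_triangle_le_diff; linarith)
  thus ?thesis by (simp add: k_def algebra_simps)
qed

text \<open>The 3 comes from (1 + \<delta>)^2 \<le> 1 + 3 \<delta>, that is from the change of the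
  trace norms of the test vectors; the second term is the error of \<open>Wf_close\<close> for an
  element of norm at most \<open>Q.tl 0\<close>.\<close>

definition \<eta> :: real where "\<eta> = \<delta> * (3 + 98 * P.K n * Q.tl 0)"

lemma \<eta>_nonneg: "0 \<le> \<eta>"
  unfolding \<eta>_def using \<delta> Q.tl_nonneg by (intro mult_nonneg_nonneg add_nonneg_nonneg) (auto simp: P.K_def sum_nonneg)

text \<open>\<open>Wf_close\<close> involves the norm of b, which the seminorm does not bound.
  Scalars contribute nothing to the form, so b is replaced by b - E 0 b, of norm at most C
  \<open>Q.tl 0\<close>.\<close>

lemma lipb_transfer:
  assumes b: "b \<in> F' n" and l: "Q.lipb C b" and C: "0 \<le> C"
  shows "P.lipb ((1 + \<eta>) * C) (J b)"
proof -
  have bc: "b \<in> carrier A'" using b by simp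
  have C': "0 \<le> (1 + \<eta>) * C" using C \<eta>_nonneg by simp
  show ?thesis
    unfolding P.lipb_F_iff[OF JF[OF order_refl b] C']
  proof (intro ballI)
    fix u v assume "u \<in> F n" "v \<in> F n"
    then obtain x y where xy: "x \<in> F' n" "u = J x" "y \<in> F' n" "v = J y" using J_F[of n] by blast
    let ?b = "b \<ominus>\<^bsub>A'\<^esub> Q.E 0 b"
    have E0: "Q.E 0 b \<in> F' n" using E'_n[OF b] by simp
    have E0': "Q.E 0 b = \<tau>' b \<odot>\<^bsub>A'\<^esub> \<one>\<^bsub>A'\<^esub>" by (rule Q.E_0[OF bc])
    have JE0: "J (Q.E 0 b) = \<tau>' b \<odot>\<^bsub>A\<^esub> \<one>\<^bsub>A\<^esub>" unfolding E0' by (simp add: J_smult J_one)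
    have b0: "?b \<in> F' n" using b E0 by simp
    have nb: "nrm A' ?b \<le> C * Q.tl 0" by (rule Q.nrm_minus_E_le[OF bc C l])
    have W': "Q.Wf n ?b x y = Q.Wf n b x y"
      using bc E0 xy Q.Wf_one[OF xy(1,3), of "\<tau>' b"] by (simp add: Q.Wf_minus E0')
    have W: "P.Wf n (J ?b) (J x) (J y) = P.Wf n (J b) (J x) (J y)"
      using b E0 xy P.Wf_one[OF JF[OF order_refl xy(1)] JF[OF order_refl xy(3)], of "\<tau>' b"]
      by (simp add: J_minus P.Wf_minus JE0)
    have tx: "0 \<le> P.tn (J x)" "0 \<le> P.tn (J y)" using xy by auto
    let ?T = "P.tn (J x) * P.tn (J y)"
    have T: "0 \<le> ?T" using tx by simp
    have "cmod (P.Wf n (J b) (J x) (J y)) \<le> cmod (Q.Wf n b x y) + cmod (P.Wf n (J b) (J x) (J y) - Q.Wf n b x y)"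
      by (rule norm_triangle_sub)
    also have "cmod (P.Wf n (J b) (J x) (J y) - Q.Wf n b x y) \<le> 98 * \<delta> * P.K n * nrm A' ?b * P.tn (J x) * P.tn (J y)"
      using Wf_close[OF b0 xy(1,3)] unfolding W W' .
    also have "\<dots> = (98 * \<delta> * P.K n * ?T) * nrm A' ?b" by (simp add: ac_simps)
    also have "\<dots> \<le> (98 * \<delta> * P.K n * ?T) * (C * Q.tl 0)"
      using nb \<delta> T by (intro mult_left_mono) (auto simp: P.K_def sum_nonneg)
    also have "cmod (Q.Wf n b x y) \<le> C * Q.tn x * Q.tn y" by (rule Q.lipbD[OF l xy(1,3)])
    also have "C * Q.tn x * Q.tn y \<le> C * ((1 + \<delta>) * P.tn (J x)) * ((1 + \<delta>) * P.tn (J y))"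
      using C xy \<delta> by (intro mult_mono mult_left_mono tn_le_J mult_nonneg_nonneg) auto
    also have "\<dots> = (1 + (2 * \<delta> + \<delta> * \<delta>)) * (C * ?T)" by (simp add: algebra_simps)
    also have "\<dots> \<le> (1 + 3 * \<delta>) * (C * ?T)"
      using \<delta> C T mult_left_mono[of \<delta> 1 \<delta>] by (intro mult_right_mono) auto
    finally have "cmod (P.Wf n (J b) (J x) (J y)) \<le> (1 + 3 * \<delta>) * (C * ?T) + (98 * \<delta> * P.K n * ?T) * (C * Q.tl 0)"
      by simp
    also have "\<dots> = (1 + \<eta>) * C * P.tn (J x) * P.tn (J y)" by (simp add: \<eta>_def algebra_simps)
    finally show "cmod (P.Wf n (J b) u v) \<le> (1 + \<eta>) * C * P.tn u * P.tn v" unfolding xy .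
  qed
qed

end

section \<open>Estimating the propinquity\<close>

lemma (in ci) ci_bridge_id: "ci_bridge A \<tau> F \<beta> (A\<lparr>carrier := F n\<rparr>) (\<lambda>x. x) n"
proof (intro ci_bridge.intro star_iso.intro star_iso_axioms.intro)
  show "ci A \<tau> F \<beta>" by (rule ci_axioms)
  show "cstar (A\<lparr>carrier := F n\<rparr>)" by (rule cstar.intro[OF ci_sub.cstar_AX[OF ci_sub_F]])
  show "cstar A" by (rule cstar_axioms)
qed (auto simp: F_carrier)

text \<open>The Lipschitz ball of the stage is contained in that of the algebra; conversely E n maps
  the latter into the former and moves its elements by at most \<open>tl n\<close>.\<close>

lemma (in ci) bridge_id_length:
  "bridge_length (ci_bridge.bridge_AB A (\<lambda>x. x)) (A, L) (A\<lparr>carrier := F n\<rparr>, L) \<le> ennreal (tl n)"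
proof -
  interpret b: ci_bridge A \<tau> F \<beta> "A\<lparr>carrier := F n\<rparr>" "\<lambda>x. x" n by (rule ci_bridge_id)
  show ?thesis
  proof (rule b.bridge_length_le(2))
    fix b assume "b \<in> sa_lip_ball (A\<lparr>carrier := F n\<rparr>) L"
    hence b: "b \<in> F n" "b \<in> sa_lip_ball A L" by (auto simp: sa_lip_ball_def sa_def F_carrier)
    hence "nrm A (b \<ominus>\<^bsub>A\<^esub> b) \<le> tl n" using tl_nonneg[of n] by simp
    thus "\<exists>a\<in>sa_lip_ball A L. nrm A (b \<ominus>\<^bsub>A\<^esub> a) \<le> tl n" using b(2) by (rule bexI)
  next
    fix a assume "a \<in> sa_lip_ball A L"
    hence a: "a \<in> carrier A" "star A a = a" "lipb 1 a"
      using L_le_iff[of a 1] by (auto simp: sa_lip_ball_def sa_def)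
    have e: "E n a \<in> F n" "star A (E n a) = E n a" using a E_star[OF a(1), of n] by simp_all
    have "lipb 1 (E n a)" using lipb_E a by simp
    hence "E n a \<in> sa_lip_ball (A\<lparr>carrier := F n\<rparr>) L"
      using e L_le_iff[of "E n a" 1] by (auto simp: sa_lip_ball_def sa_def F_carrier)
    moreover have "nrm A (E n a \<ominus>\<^bsub>A\<^esub> a) \<le> tl n"
      using nrm_minus_E_le[OF a(1) _ a(3), of n] N_minus_commute[of "E n a" a] a(1) by simp
    ultimately show "\<exists>b\<in>sa_lip_ball (A\<lparr>carrier := F n\<rparr>) L. nrm A (b \<ominus>\<^bsub>A\<^esub> a) \<le> tl n" by blast
  qed
qed

context ci_pair
begin

lemma J_inj: "inj_on J (F' n)"
proof (rule inj_onI)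
  fix x y assume xy: "x \<in> F' n" "y \<in> F' n" "J x = J y"
  have d: "x \<ominus>\<^bsub>A'\<^esub> y \<in> F' n" using xy by simp
  have "J (x \<ominus>\<^bsub>A'\<^esub> y) = \<zero>\<^bsub>A\<^esub>" unfolding J_minus[OF xy(1,2)] xy(3) using xy by simp
  hence "nrm A' (x \<ominus>\<^bsub>A'\<^esub> y) = 0" using J_nrm[OF d] by simp
  hence "x \<ominus>\<^bsub>A'\<^esub> y = \<zero>\<^bsub>A'\<^esub>" using Q.nrm_eq_0 d by simp
  thus "x = y" using Q.minus_eq_zero[of x y] xy by simp
qed

definition G :: "'a \<Rightarrow> 'b" where "G = inv_into (F' n) J"

lemma G_eqI: "x \<in> F' n \<Longrightarrow> J x = y \<Longrightarrow> G y = x"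
  unfolding G_def by (rule inv_into_f_eq[OF J_inj])

lemma G_F: "y \<in> F n \<Longrightarrow> G y \<in> F' n" and J_G: "y \<in> F n \<Longrightarrow> J (G y) = y"
proof -
  have e: "F n = J ` F' n" using J_F[of n] by simp
  show "G y \<in> F' n" if "y \<in> F n" using that unfolding G_def e by (rule inv_into_into)
  show "J (G y) = y" if "y \<in> F n" using that unfolding G_def e by (rule f_inv_into_f)
qed

text \<open>The hypotheses are symmetric once \<open>close1\<close> and \<open>close2\<close>
  exchange roles, so every estimate is also available for the inverse of J.\<close>

lemma inverse: "ci_pair A' \<tau>' F' \<beta>' A \<tau> F \<beta> G n \<delta>"
proof (intro ci_pair.intro ci_pair_axioms.intro)
  show "ci A' \<tau>' F' \<beta>'" "ci A \<tau> F \<beta>" by unfold_locales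
  show "G (x \<oplus>\<^bsub>A\<^esub> y) = G x \<oplus>\<^bsub>A'\<^esub> G y" if "x \<in> F n" "y \<in> F n" for x y
    using that by (intro G_eqI) (auto simp: G_F J_G J_add)
  show "G (c \<odot>\<^bsub>A\<^esub> x) = c \<odot>\<^bsub>A'\<^esub> G x" if "x \<in> F n" for x c
    using that by (intro G_eqI) (auto simp: G_F J_G J_smult)
  show "G (x \<otimes>\<^bsub>A\<^esub> y) = G x \<otimes>\<^bsub>A'\<^esub> G y" if "x \<in> F n" "y \<in> F n" for x y
    using that by (intro G_eqI) (auto simp: G_F J_G J_mult)
  show "G (star A x) = star A' (G x)" if "x \<in> F n" for x
    using that by (intro G_eqI) (auto simp: G_F J_G J_star)
  show "G \<one>\<^bsub>A\<^esub> = \<one>\<^bsub>A'\<^esub>" by (intro G_eqI) (auto simp: J_one)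
  show "nrm A' (G x) = nrm A x" if "x \<in> F n" for x
    using J_nrm[OF G_F[OF that]] J_G[OF that] by simp
  show "G ` F j = F' j" if j: "j \<le> n" for j
  proof -
    have "G (J x) = x" if "x \<in> F' j" for x by (rule G_eqI[OF F'_n[OF j that]]) simp
    thus ?thesis unfolding J_F[OF j, symmetric] image_image by simp
  qed
  show "\<beta>' j = \<beta> j" if "1 \<le> j" "j \<le> n" for j using \<beta>_eq[OF that] by simp
  show "0 \<le> \<delta>" "\<delta> \<le> 1" by (rule \<delta>)+
  show "cmod (Q.s (G x) (G y) - P.s x y) \<le> \<delta> * P.tn x * P.tn y" if "x \<in> F n" "y \<in> F n" for x y
    using close2[OF G_F G_F, OF that] that by (simp add: J_G norm_minus_commute)
  show "cmod (Q.s (G x) (G y) - P.s x y) \<le> \<delta> * Q.tn (G x) * Q.tn (G y)" if "x \<in> F n" "y \<in> F n" for x y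
    using close1[OF G_F G_F, OF that] that by (simp add: J_G norm_minus_commute)
qed

lemma approx:
  assumes b: "b \<in> F' n" "star A' b = b" and l: "Q.lipb 1 b"
  shows "\<exists>a\<in>F n. star A a = a \<and> P.lipb 1 a \<and> nrm A (J b \<ominus>\<^bsub>A\<^esub> a) \<le> \<eta> * P.tl 0"
proof (rule P.shrink)
  show "J b \<in> F n" using JF b by simp
  show "star A (J b) = J b" using J_star[OF b(1)] b(2) by simp
  show "P.lipb (1 + \<eta>) (J b)" using lipb_transfer[OF b(1) l] by simp
qed (rule \<eta>_nonneg)

text \<open>Keeps the final bound in terms of \<open>K n\<close> for A, which stays fixed while A'
  varies; 3 bounds 1 + 2 \<delta>.\<close>

lemma K_le: "Q.K n \<le> 3 * P.K n"
proof -
  have "\<bar>Q.\<kappa> (Suc j)\<bar> \<le> 3 * \<bar>P.\<kappa> (Suc j)\<bar>" if "j < n" for j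
  proof -
    have "\<bar>Q.\<kappa> (Suc j) - P.\<kappa> (Suc j)\<bar> \<le> 2 * \<delta> * P.\<kappa> (Suc j)" using that by (intro \<kappa>_close) auto
    also have "\<dots> \<le> 2 * 1 * P.\<kappa> (Suc j)" using \<delta> P.\<kappa>_pos[of "Suc j"] by (intro mult_right_mono) auto
    finally show ?thesis using P.\<kappa>_pos[of "Suc j"] by simp
  qed
  thus ?thesis unfolding P.K_def Q.K_def sum_distrib_left by (intro sum_mono) simp
qed

lemma ci_bridge_J: "ci_bridge A \<tau> F \<beta> (A'\<lparr>carrier := F' n\<rparr>) J n"
proof (intro ci_bridge.intro star_iso.intro star_iso_axioms.intro)
  show "ci A \<tau> F \<beta>" by unfold_locales
  show "cstar (A'\<lparr>carrier := F' n\<rparr>)" by (rule cstar.intro[OF ci_sub.cstar_AX[OF Q.ci_sub_F]])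
  show "cstar A" by unfold_locales
qed (use J_F[of n] in \<open>auto simp: J_add J_smult J_mult J_star J_one J_nrm\<close>)

text \<open>The first term is the cost of truncation to stage n. The other two are the costs of
  shrinking a transported element back into the Lipschitz ball, for J and for its inverse; in the
  last one \<open>K n\<close> of A' has been replaced by three times that of A.\<close>

definition \<epsilon> :: real where
  "\<epsilon> = P.tl n + \<delta> * (3 + 98 * P.K n * Q.tl 0) * P.tl 0 + \<delta> * (3 + 98 * (3 * P.K n) * P.tl 0) * Q.tl 0"

text \<open>From the stage of A' one applies J and shrinks in A. From A one truncates by E n,
  transports by the inverse of J and shrinks there, hence the additional
  \<open>P.tl n\<close>.\<close>

lemma bridge_J_length:
  "bridge_length (ci_bridge.bridge_BA A J) (A'\<lparr>carrier := F' n\<rparr>, Q.L) (A, P.L) \<le> ennreal \<epsilon>"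
proof -
  interpret b: ci_bridge A \<tau> F \<beta> "A'\<lparr>carrier := F' n\<rparr>" J n by (rule ci_bridge_J)
  interpret I: ci_pair A' \<tau>' F' \<beta>' A \<tau> F \<beta> G n \<delta> by (rule inverse)
  have K0: "0 \<le> P.K n" by (simp add: P.K_def sum_nonneg)
  have I\<eta>: "I.\<eta> * Q.tl 0 \<le> \<delta> * (3 + 98 * (3 * P.K n) * P.tl 0) * Q.tl 0"
    unfolding I.\<eta>_def using K_le \<delta> P.tl_nonneg[of 0] Q.tl_nonneg[of 0]
    by (intro mult_right_mono mult_left_mono add_left_mono) auto
  have \<eta>0: "0 \<le> \<eta> * P.tl 0" using \<eta>_nonneg P.tl_nonneg[of 0] by simp
  have \<eta>1: "0 \<le> I.\<eta> * Q.tl 0" using I.\<eta>_nonneg Q.tl_nonneg[of 0] by simp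
  have \<epsilon>: "\<eta> * P.tl 0 \<le> \<epsilon>" "I.\<eta> * Q.tl 0 + P.tl n \<le> \<epsilon>"
    using I\<eta> \<eta>0 \<eta>1 P.tl_nonneg[of n] unfolding \<epsilon>_def \<eta>_def by linarith+
  show ?thesis
  proof (rule b.bridge_length_le(1))
    fix b assume "b \<in> sa_lip_ball (A'\<lparr>carrier := F' n\<rparr>) Q.L"
    hence b: "b \<in> F' n" "star A' b = b" "Q.lipb 1 b"
      using Q.L_le_iff[of b 1] by (auto simp: sa_lip_ball_def sa_def Q.F_carrier)
    obtain a where a: "a \<in> F n" "star A a = a" "P.lipb 1 a" "nrm A (J b \<ominus>\<^bsub>A\<^esub> a) \<le> \<eta> * P.tl 0"
      using approx[OF b] by blast
    have "a \<in> sa_lip_ball A P.L" using a P.L_le_iff[of a 1] by (auto simp: sa_lip_ball_def sa_def P.F_carrier)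
    thus "\<exists>a\<in>sa_lip_ball A P.L. nrm A (J b \<ominus>\<^bsub>A\<^esub> a) \<le> \<epsilon>" using a(4) \<epsilon>(1) by (meson order_trans)
  next
    fix a assume "a \<in> sa_lip_ball A P.L"
    hence a: "a \<in> carrier A" "star A a = a" "P.lipb 1 a"
      using P.L_le_iff[of a 1] by (auto simp: sa_lip_ball_def sa_def)
    have e: "P.E n a \<in> F n" "star A (P.E n a) = P.E n a" using a P.E_star[OF a(1), of n] by simp_all
    have "P.lipb 1 (P.E n a)" using P.lipb_E a by simp
    then obtain b where b: "b \<in> F' n" "star A' b = b" "Q.lipb 1 b" "nrm A' (G (P.E n a) \<ominus>\<^bsub>A'\<^esub> b) \<le> I.\<eta> * Q.tl 0"
      using I.approx[OF e] by blast
    have "b \<in> sa_lip_ball (A'\<lparr>carrier := F' n\<rparr>) Q.L"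
      using b Q.L_le_iff[of b 1] by (auto simp: sa_lip_ball_def sa_def Q.F_carrier)
    moreover have "nrm A (J b \<ominus>\<^bsub>A\<^esub> a) \<le> \<epsilon>"
    proof -
      have Gc: "G (P.E n a) \<in> F' n" by (rule G_F[OF e(1)])
      have d: "G (P.E n a) \<ominus>\<^bsub>A'\<^esub> b \<in> F' n" using Gc b(1) by simp
      have "nrm A' (G (P.E n a) \<ominus>\<^bsub>A'\<^esub> b) = nrm A (P.E n a \<ominus>\<^bsub>A\<^esub> J b)"
        using J_nrm[OF d] J_minus[OF Gc b(1)] J_G[OF e(1)] by simp
      hence 1: "nrm A (J b \<ominus>\<^bsub>A\<^esub> P.E n a) \<le> I.\<eta> * Q.tl 0"
        using b(4) P.N_minus_commute[of "J b" "P.E n a"] b(1) a(1) by simp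
      have 2: "nrm A (P.E n a \<ominus>\<^bsub>A\<^esub> a) \<le> P.tl n"
        using P.nrm_minus_E_le[OF a(1) _ a(3), of n] P.N_minus_commute[of "P.E n a" a] a(1) by simp
      have "nrm A (J b \<ominus>\<^bsub>A\<^esub> a) \<le> nrm A (J b \<ominus>\<^bsub>A\<^esub> P.E n a) + nrm A (P.E n a \<ominus>\<^bsub>A\<^esub> a)"
        using P.N_triangle[of "J b" "P.E n a" a] b(1) a(1) by simp
      thus ?thesis using 1 2 \<epsilon>(2) by linarith
    qed
    ultimately show "\<exists>b\<in>sa_lip_ball (A'\<lparr>carrier := F' n\<rparr>) Q.L. nrm A (J b \<ominus>\<^bsub>A\<^esub> a) \<le> \<epsilon>" by blast
  qed
qed

end

theorem propinquity_le:
  fixes A :: "'u cstar" and A' :: "'u cstar"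
  assumes "ci_pair A \<tau> F \<beta> A' \<tau>' F' \<beta>' J n \<delta>"
  shows "propinquity (A', ci_seminorm A' F' \<tau>' \<beta>') (A, ci_seminorm A F \<tau> \<beta>)
    \<le> ennreal (ci.tl \<beta>' n) + ennreal (ci_pair.\<epsilon> A \<tau> F \<beta> \<beta>' n \<delta>)"
proof -
  interpret ci_pair A \<tau> F \<beta> A' \<tau>' F' \<beta>' J n \<delta> by fact
  let ?B = "A'\<lparr>carrier := F' n\<rparr>"
  let ?Xs = "[(A', Q.L), (?B, Q.L), (A, P.L)]"
  let ?gs = "[ci_bridge.bridge_AB A' (\<lambda>x. x), ci_bridge.bridge_BA A J]"
  have "is_trek (A', Q.L) (A, P.L) ?Xs ?gs"
    using P.propinquity_class_A Q.propinquity_class_A Q.propinquity_class_F[of n]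
      ci_bridge.is_bridge_AB[OF Q.ci_bridge_id[of n]] ci_bridge.is_bridge_BA[OF ci_bridge_J]
    by (auto simp: is_trek_def less_Suc_eq)
  hence "propinquity (A', Q.L) (A, P.L) \<le> trek_length ?Xs ?gs"
    unfolding propinquity_def by (intro INF_lower2[of "(?Xs, ?gs)"]) auto
  also have "\<dots> = bridge_length (ci_bridge.bridge_AB A' (\<lambda>x. x)) (A', Q.L) (?B, Q.L)
      + bridge_length (ci_bridge.bridge_BA A J) (?B, Q.L) (A, P.L)"
    by (simp add: trek_length_def)
  also have "\<dots> \<le> ennreal (Q.tl n) + ennreal \<epsilon>"
    by (rule add_mono[OF Q.bridge_id_length bridge_J_length])
  finally show ?thesis .
qed

section \<open>Effros--Shen algebras\<close>

text \<open>\<open>es_wt \<theta> n\<close> is the distance of \<open>\<theta> * cf_q \<theta> (n - 1)\<close> from \<open>cf_p \<theta> (n - 1)\<close>; it is the weight of the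
  first block in the trace on stage \<open>n\<close>, and of the second block on stage \<open>n - 1\<close>.\<close>

definition es_wt :: "real \<Rightarrow> nat \<Rightarrow> real" where
  "es_wt \<theta> n = (\<Prod>i<n. frac (cf_rem \<theta> i))"

definition es_st :: "real \<Rightarrow> nat \<Rightarrow> complex mat \<times> complex mat \<Rightarrow> complex" where
  "es_st \<theta> n = block_trace (cf_q \<theta> n) (cf_q_prev \<theta> n) (es_wt \<theta> n) (es_wt \<theta> (Suc n))"

lemma cf_q_prev_Suc [simp]: "cf_q_prev \<theta> (Suc n) = cf_q \<theta> n"
  by (simp add: cf_q_prev_def)

lemma cf_q_Suc: "cf_q \<theta> (Suc n) = cf_digit \<theta> (Suc n) * cf_q \<theta> n + cf_q_prev \<theta> n"
  by (cases n) (simp_all add: cf_q_prev_def)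

lemma es_connect_eq: "es_connect \<theta> n = block_map (cf_digit \<theta> (Suc n))"
  by (simp add: es_connect_def block_map_def dbm_def)

lemma es_stage_Suc:
  "es_stage \<theta> (Suc n) = two_block (cf_digit \<theta> (Suc n) * cf_q \<theta> n + cf_q_prev \<theta> n) (cf_q \<theta> n)"
  unfolding es_stage_def cf_q_prev_Suc unfolding cf_q_Suc ..

locale irrational_angle =
  fixes \<theta> :: real assumes \<theta>: "0 < \<theta>" "\<theta> < 1" "\<theta> \<notin> \<rat>"
begin

lemma rem_irr: "cf_rem \<theta> n \<notin> \<rat>"
proof (induction n)
  case 0
  show ?case using \<theta> by simp
next
  case (Suc n)
  show ?case
  proof
    assume "cf_rem \<theta> (Suc n) \<in> \<rat>"
    hence "inverse (1 / frac (cf_rem \<theta> n)) \<in> \<rat>" unfolding cf_rem.simps by (rule Rats_inverse)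
    hence "frac (cf_rem \<theta> n) \<in> \<rat>" by (simp only: inverse_divide div_by_1)
    thus False using Suc by simp
  qed
qed

lemma rem_not_Int: "cf_rem \<theta> n \<notin> \<int>"
  using rem_irr[of n] Ints_subset_Rats by blast

lemma frac_pos: "0 < frac (cf_rem \<theta> n)"
  using rem_not_Int by simp

lemma rem_gt_1: "1 < cf_rem \<theta> (Suc n)"
  using frac_pos[of n] frac_lt_1[of "cf_rem \<theta> n"] by simp

lemma rem_eq: "cf_rem \<theta> n = real (cf_digit \<theta> n) + frac (cf_rem \<theta> n)"
proof -
  have "0 \<le> cf_rem \<theta> n" using \<theta> rem_gt_1[of "n - 1"] by (cases n) auto
  thus ?thesis by (simp add: cf_digit_def frac_def)
qed

lemma digit_0: "cf_digit \<theta> 0 = 0"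
  using \<theta> by (simp add: cf_digit_def floor_eq_iff)

lemma digit_pos: "1 \<le> cf_digit \<theta> (Suc n)"
  using rem_gt_1[of n] by (simp add: cf_digit_def le_nat_iff le_floor_iff del: cf_rem.simps)

lemma wt_pos: "0 < es_wt \<theta> n"
  unfolding es_wt_def by (intro prod_pos ballI frac_pos)

lemma wt_Suc: "es_wt \<theta> (Suc n) = es_wt \<theta> n * frac (cf_rem \<theta> n)"
  by (simp add: es_wt_def)

text \<open>Since \<open>cf_rem \<theta> (Suc n)\<close> is the reciprocal of the preceding
  fractional part, multiplying weight n + 1 by it returns weight n; splitting it into digit and
  fraction gives the recursion. By \<open>block_map_trace\<close> this is the compatibility of the
  traces with the connecting maps.\<close>

lemma wt_rec: "es_wt \<theta> n = real (cf_digit \<theta> (Suc n)) * es_wt \<theta> (Suc n) + es_wt \<theta> (Suc (Suc n))"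
proof -
  have "real (cf_digit \<theta> (Suc n)) * es_wt \<theta> (Suc n) + es_wt \<theta> (Suc (Suc n))
      = es_wt \<theta> (Suc n) * cf_rem \<theta> (Suc n)"
    unfolding wt_Suc[of "Suc n"] using arg_cong[OF rem_eq[of "Suc n"], of "(*) (es_wt \<theta> (Suc n))"]
    by (simp only: distrib_left mult.commute)
  also have "\<dots> = es_wt \<theta> n" using frac_pos[of n] by (simp add: wt_Suc)
  finally show ?thesis by simp
qed

text \<open>The recursion of the denominators is the transpose of the one for the weights, so this
  pairing does not depend on n. It is the normalization of the trace.\<close>

lemma wt_total: "real (cf_q \<theta> n) * es_wt \<theta> n + real (cf_q_prev \<theta> n) * es_wt \<theta> (Suc n) = 1"
proof (induction n)
  case 0
  show ?case by (simp add: es_wt_def cf_q_prev_def)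
next
  case (Suc n)
  have "real (cf_q \<theta> (Suc n)) * es_wt \<theta> (Suc n) + real (cf_q_prev \<theta> (Suc n)) * es_wt \<theta> (Suc (Suc n))
      = real (cf_q \<theta> n) * (real (cf_digit \<theta> (Suc n)) * es_wt \<theta> (Suc n) + es_wt \<theta> (Suc (Suc n)))
        + real (cf_q_prev \<theta> n) * es_wt \<theta> (Suc n)"
    unfolding cf_q_Suc[of \<theta> n] by (simp add: algebra_simps)
  thus ?case using Suc wt_rec[of n] by simp
qed

text \<open>Both sides satisfy the recursion of \<open>wt_rec\<close> read upwards and agree at the
  first two indices. This connects the product formula for the weights with the prescribed
  \<open>es_t\<close>.\<close>

lemma wt_p: "(-1) ^ n * (\<theta> * real (cf_q \<theta> n) - real (cf_p \<theta> n)) = es_wt \<theta> (Suc n)"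
proof (induction n rule: induct_nat_012)
  case 0
  have "frac \<theta> = \<theta>" using \<theta> by (simp add: frac_eq)
  thus ?case by (simp add: es_wt_def digit_0)
next
  case 1
  have "frac \<theta> = \<theta>" using \<theta> by (simp add: frac_eq)
  hence "es_wt \<theta> (Suc 0) = \<theta>" "es_wt \<theta> 0 = 1" by (simp_all add: es_wt_def)
  thus ?case using wt_rec[of 0] by (simp add: algebra_simps)
next
  case (ge2 n)
  have "(-1) ^ Suc (Suc n) * (\<theta> * real (cf_q \<theta> (Suc (Suc n))) - real (cf_p \<theta> (Suc (Suc n))))
      = (-1) ^ n * (\<theta> * real (cf_q \<theta> n) - real (cf_p \<theta> n))
        - real (cf_digit \<theta> (Suc (Suc n))) * ((-1) ^ Suc n * (\<theta> * real (cf_q \<theta> (Suc n)) - real (cf_p \<theta> (Suc n))))"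
    by (simp add: algebra_simps)
  also have "\<dots> = es_wt \<theta> (Suc n) - real (cf_digit \<theta> (Suc (Suc n))) * es_wt \<theta> (Suc (Suc n))"
    unfolding ge2 ..
  finally show ?case using wt_rec[of "Suc n"] by simp
qed

lemma q_pos: "1 \<le> cf_q \<theta> n" and q_ge: "n \<le> cf_q \<theta> n"
proof (induction n rule: induct_nat_012)
  case 1
  { case 1 show ?case using digit_pos[of 0] by simp }
  { case 2 show ?case using digit_pos[of 0] by simp }
next
  case (ge2 n)
  have "1 * cf_q \<theta> (Suc n) \<le> cf_digit \<theta> (Suc (Suc n)) * cf_q \<theta> (Suc n)"
    using digit_pos by (intro mult_right_mono) auto
  hence *: "cf_q \<theta> (Suc n) + cf_q \<theta> n \<le> cf_q \<theta> (Suc (Suc n))" by simp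
  { case 1 show ?case using * ge2 by linarith }
  { case 2 show ?case using * ge2 by linarith }
qed simp_all

lemma es_t_div:
  assumes "n \<ge> 1"
  shows "es_t \<theta> n / real (cf_q \<theta> n) = es_wt \<theta> n"
    and "(1 - es_t \<theta> n) / real (cf_q \<theta> (n - 1)) = es_wt \<theta> (Suc n)"
proof -
  obtain m where m: "n = Suc m" using assms by (cases n) auto
  have t: "es_t \<theta> n = real (cf_q \<theta> n) * es_wt \<theta> n"
    unfolding m wt_p[symmetric] by (simp add: es_t_def m)
  show "es_t \<theta> n / real (cf_q \<theta> n) = es_wt \<theta> n" using t q_pos[of n] by simp
  have "1 - es_t \<theta> n = real (cf_q \<theta> m) * es_wt \<theta> (Suc n)" using wt_total[of n] t by (simp add: m)
  thus "(1 - es_t \<theta> n) / real (cf_q \<theta> (n - 1)) = es_wt \<theta> (Suc n)" using q_pos[of m] by (simp add: m)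
qed

lemma beta_pos: "0 < es_beta \<theta> n"
  using q_pos[of n] by (simp add: es_beta_def add_pos_nonneg)

lemma beta_le: "es_beta \<theta> (Suc n) \<le> 1 / (real (Suc n))\<^sup>2"
proof -
  have "(real (Suc n))\<^sup>2 \<le> (real (cf_q \<theta> (Suc n)))\<^sup>2" using q_ge[of "Suc n"] by (intro power_mono) auto
  also have "\<dots> \<le> (real (cf_q \<theta> (Suc n)))\<^sup>2 + (real (cf_q_prev \<theta> (Suc n)))\<^sup>2" by simp
  finally have "(real (Suc n))\<^sup>2 \<le> (real (cf_q \<theta> (Suc n)))\<^sup>2 + (real (cf_q_prev \<theta> (Suc n)))\<^sup>2" .
  moreover have "0 < cf_q \<theta> (Suc n)" using q_pos[of "Suc n"] by linarith
  ultimately show ?thesis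
    unfolding es_beta_def by (intro divide_left_mono) (auto intro!: mult_pos_pos add_pos_nonneg simp del: of_nat_Suc)
qed

lemma summable_squares: "summable (\<lambda>n. 1 / (real (Suc n))\<^sup>2)"
proof -
  have "summable (\<lambda>n. inverse (real n ^ 2))" by (rule inverse_power_summable) simp
  thus ?thesis unfolding summable_Suc_iff[of "\<lambda>n. 1 / (real n)\<^sup>2"] by (simp add: inverse_eq_divide)
qed

lemma beta_summable: "summable (es_beta \<theta>)"
proof -
  have "summable (\<lambda>n. es_beta \<theta> (Suc n))"
    by (rule summable_comparison_test'[OF summable_squares, of 0]) (use beta_le beta_pos[THEN less_imp_le] in simp)
  thus ?thesis by (subst (asm) summable_Suc_iff)
qed

lemma stage_nrm: "x \<in> carrier (es_stage \<theta> n) \<Longrightarrow> nrm (es_stage \<theta> (Suc n)) (es_connect \<theta> n x) = nrm (es_stage \<theta> n) x"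
  unfolding es_connect_eq es_stage_Suc unfolding es_stage_def
proof (rule block_map_nrm[of "es_wt \<theta> (Suc n)" "es_wt \<theta> (Suc (Suc n))"])
  show "real (cf_digit \<theta> (Suc n) * cf_q \<theta> n + cf_q_prev \<theta> n) * es_wt \<theta> (Suc n) + real (cf_q \<theta> n) * es_wt \<theta> (Suc (Suc n)) = 1"
    using wt_total[of "Suc n"] unfolding cf_q_prev_Suc cf_q_Suc[of \<theta> n] .
qed (simp_all add: wt_pos)

lemma st_cstate: "cstate (es_stage \<theta> n) (es_st \<theta> n)"
  unfolding es_st_def es_stage_def by (rule cstate_block_trace[OF wt_pos wt_pos wt_total])

lemma st_connect: "x \<in> carrier (es_stage \<theta> n) \<Longrightarrow> es_st \<theta> (Suc n) (es_connect \<theta> n x) = es_st \<theta> n x"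
  unfolding es_st_def es_connect_eq cf_q_prev_Suc es_stage_def cf_q_Suc[of \<theta> n]
  by (subst block_map_trace) (simp_all only: wt_rec[of n, symmetric])

sublocale S: cstar_sys_state "es_stage \<theta>" "es_connect \<theta>" "es_st \<theta>"
proof (rule cstar_sys_state.intro)
  show "cstar_sys (es_stage \<theta>) (es_connect \<theta>)"
  proof
    show "cstar_algebra (es_stage \<theta> n)" for n unfolding es_stage_def by (rule cstar_two_block)
  next
    fix n x assume "x \<in> carrier (es_stage \<theta> n)"
    thus "es_connect \<theta> n x \<in> carrier (es_stage \<theta> (Suc n))"
      unfolding es_connect_eq es_stage_Suc unfolding es_stage_def by (rule block_map_closed)
  next
    fix n x y assume "x \<in> carrier (es_stage \<theta> n)" "y \<in> carrier (es_stage \<theta> n)"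
    thus "es_connect \<theta> n (x \<oplus>\<^bsub>es_stage \<theta> n\<^esub> y) = es_connect \<theta> n x \<oplus>\<^bsub>es_stage \<theta> (Suc n)\<^esub> es_connect \<theta> n y"
      unfolding es_connect_eq es_stage_Suc unfolding es_stage_def by (rule block_map_add)
  next
    fix n x c assume "x \<in> carrier (es_stage \<theta> n)"
    thus "es_connect \<theta> n (c \<odot>\<^bsub>es_stage \<theta> n\<^esub> x) = c \<odot>\<^bsub>es_stage \<theta> (Suc n)\<^esub> es_connect \<theta> n x"
      unfolding es_connect_eq es_stage_Suc unfolding es_stage_def by (rule block_map_smult)
  next
    fix n x y assume "x \<in> carrier (es_stage \<theta> n)" "y \<in> carrier (es_stage \<theta> n)"
    thus "es_connect \<theta> n (x \<otimes>\<^bsub>es_stage \<theta> n\<^esub> y) = es_connect \<theta> n x \<otimes>\<^bsub>es_stage \<theta> (Suc n)\<^esub> es_connect \<theta> n y"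
      unfolding es_connect_eq es_stage_Suc unfolding es_stage_def by (rule block_map_mult)
  next
    fix n x assume "x \<in> carrier (es_stage \<theta> n)"
    thus "es_connect \<theta> n (star (es_stage \<theta> n) x) = star (es_stage \<theta> (Suc n)) (es_connect \<theta> n x)"
      unfolding es_connect_eq es_stage_Suc unfolding es_stage_def by (rule block_map_star)
  next
    fix n
    show "es_connect \<theta> n \<one>\<^bsub>es_stage \<theta> n\<^esub> = \<one>\<^bsub>es_stage \<theta> (Suc n)\<^esub>"
      unfolding es_connect_eq es_stage_Suc unfolding es_stage_def by (rule block_map_one)
  next
    fix n x assume "x \<in> carrier (es_stage \<theta> n)"
    thus "nrm (es_stage \<theta> (Suc n)) (es_connect \<theta> n x) = nrm (es_stage \<theta> n) x" by (rule stage_nrm)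
  qed
  show "cstar_sys_state_axioms (es_stage \<theta>) (es_connect \<theta>) (es_st \<theta>)"
  proof
    show "cstar_algebra (es_stage \<theta> n)" for n unfolding es_stage_def by (rule cstar_two_block)
    show "es_st \<theta> n \<in> states (es_stage \<theta> n)" for n using cstate.state[OF st_cstate] .
    show "es_st \<theta> (Suc n) (es_connect \<theta> n x) = es_st \<theta> n x" if "x \<in> carrier (es_stage \<theta> n)" for n x
      by (rule st_connect[OF that])
    show "es_st \<theta> n (x \<otimes>\<^bsub>es_stage \<theta> n\<^esub> y) = es_st \<theta> n (y \<otimes>\<^bsub>es_stage \<theta> n\<^esub> x)"
      if "x \<in> carrier (es_stage \<theta> n)" "y \<in> carrier (es_stage \<theta> n)" for n x y
      using that unfolding es_st_def es_stage_def by (rule block_trace_comm)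
  qed
qed

section \<open>The image filtration, the trace and the seminorm of the Effros-Shen algebra\<close>

lemma W_eq: "inductive_limit (es_stage \<theta>) (es_connect \<theta>) = effros_shen \<theta>"
  by (simp add: effros_shen_def)

lemma incl_eq: "S.incl = es_map \<theta>"
  by (simp add: es_map_def S.limit_map_eq)

lemmas map_closed [simp] = S.incl_closed[unfolded incl_eq W_eq]
lemmas map_add = S.incl_add[unfolded incl_eq W_eq]
lemmas map_smult = S.incl_smult[unfolded incl_eq W_eq]
lemmas map_mult = S.incl_mult[unfolded incl_eq W_eq]
lemmas map_star = S.incl_star[unfolded incl_eq W_eq]
lemmas map_one = S.incl_one[unfolded incl_eq W_eq]
lemmas map_nrm = S.incl_N[unfolded incl_eq W_eq]
lemmas map_connect = S.incl_connect[unfolded incl_eq]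
lemmas map_inj = S.incl_inj[unfolded incl_eq]
lemmas map_dense = S.incl_dense[unfolded incl_eq W_eq]
lemmas lim_state_map = S.lim_state_incl[unfolded incl_eq]

lemma map_zero: "es_map \<theta> n \<zero>\<^bsub>es_stage \<theta> n\<^esub> = \<zero>\<^bsub>effros_shen \<theta>\<^esub>"
  using map_smult[of "\<zero>\<^bsub>es_stage \<theta> n\<^esub>" n 0] S.W.smult_zero_left[unfolded W_eq] by simp

lemma map_lcomb:
  assumes "\<And>i. i < d \<Longrightarrow> e i \<in> carrier (es_stage \<theta> n)"
  shows "lcomb (effros_shen \<theta>) c (\<lambda>i. es_map \<theta> n (e i)) d = es_map \<theta> n (lcomb (es_stage \<theta> n) c e d)"
  using assms
proof (induction d)
  case 0
  show ?case by (simp add: map_zero)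
next
  case (Suc d)
  have "lcomb (es_stage \<theta> n) c e d \<in> carrier (es_stage \<theta> n)" using Suc.prems by (intro S.B.lcomb_closed) simp
  thus ?case using Suc by (simp add: map_add map_smult)
qed

lemma stage_0:
  assumes "x \<in> carrier (es_stage \<theta> 0)" shows "\<exists>c. x = c \<odot>\<^bsub>es_stage \<theta> 0\<^esub> \<one>\<^bsub>es_stage \<theta> 0\<^esub>"
proof -
  obtain a b where x: "x = (a, b)" "a \<in> carrier_mat 1 1" "b \<in> carrier_mat 0 0"
    using assms by (auto simp: es_stage_def cf_q_prev_def)
  have "a = a $$ (0, 0) \<cdot>\<^sub>m 1\<^sub>m 1" "b = a $$ (0, 0) \<cdot>\<^sub>m 1\<^sub>m 0"
    using x by (auto intro!: eq_matI)
  thus ?thesis unfolding x(1) by (intro exI[of _ "a $$ (0, 0)"]) (simp add: es_stage_def cf_q_prev_def)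
qed

lemma filtration_filt: "filt (effros_shen \<theta>) S.lim_state (es_filtration \<theta>)"
proof (intro filt.intro filt_axioms.intro)
  show "cstate (effros_shen \<theta>) S.lim_state" using S.L.cstate_axioms unfolding W_eq .
  show "S.lim_state (x \<otimes>\<^bsub>effros_shen \<theta>\<^esub> y) = S.lim_state (y \<otimes>\<^bsub>effros_shen \<theta>\<^esub> x)"
    if "x \<in> carrier (effros_shen \<theta>)" "y \<in> carrier (effros_shen \<theta>)" for x y
    using S.lim_state_trace[unfolded W_eq, OF that] .
  show "x \<in> carrier (effros_shen \<theta>)" if "x \<in> es_filtration \<theta> n" for x n
    using that by (auto simp: es_filtration_def)
  show "x \<oplus>\<^bsub>effros_shen \<theta>\<^esub> y \<in> es_filtration \<theta> n" if "x \<in> es_filtration \<theta> n" "y \<in> es_filtration \<theta> n" for x y n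
    using that by (auto simp: es_filtration_def map_add[symmetric])
  show "c \<odot>\<^bsub>effros_shen \<theta>\<^esub> x \<in> es_filtration \<theta> n" if "x \<in> es_filtration \<theta> n" for x c n
    using that by (auto simp: es_filtration_def map_smult[symmetric])
  show "x \<otimes>\<^bsub>effros_shen \<theta>\<^esub> y \<in> es_filtration \<theta> n" if "x \<in> es_filtration \<theta> n" "y \<in> es_filtration \<theta> n" for x y n
    using that by (auto simp: es_filtration_def map_mult[symmetric])
  show "star (effros_shen \<theta>) x \<in> es_filtration \<theta> n" if "x \<in> es_filtration \<theta> n" for x n
    using that by (auto simp: es_filtration_def map_star[symmetric])
  show "\<one>\<^bsub>effros_shen \<theta>\<^esub> \<in> es_filtration \<theta> n" for n
    unfolding es_filtration_def map_one[of n, symmetric] by (intro imageI) simp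
  show "x \<in> es_filtration \<theta> (Suc n)" if x: "x \<in> es_filtration \<theta> n" for x n
  proof -
    obtain b where b: "b \<in> carrier (es_stage \<theta> n)" "x = es_map \<theta> n b" using x by (auto simp: es_filtration_def)
    have "x = es_map \<theta> (Suc n) (es_connect \<theta> n b)" using map_connect[OF b(1), of 1] b(2) by simp
    thus ?thesis unfolding es_filtration_def using S.con1_closed[OF b(1)] by blast
  qed
  show "\<exists>c. x = c \<odot>\<^bsub>effros_shen \<theta>\<^esub> \<one>\<^bsub>effros_shen \<theta>\<^esub>" if x: "x \<in> es_filtration \<theta> 0" for x
  proof -
    obtain b where b: "b \<in> carrier (es_stage \<theta> 0)" "x = es_map \<theta> 0 b" using x by (auto simp: es_filtration_def)
    obtain c where "b = c \<odot>\<^bsub>es_stage \<theta> 0\<^esub> \<one>\<^bsub>es_stage \<theta> 0\<^esub>" using stage_0[OF b(1)] by blast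
    thus ?thesis using b(2) map_smult[of "\<one>\<^bsub>es_stage \<theta> 0\<^esub>" 0 c] map_one[of 0] by auto
  qed
  show "\<exists>n. \<exists>y\<in>es_filtration \<theta> n. nrm (effros_shen \<theta>) (x \<ominus>\<^bsub>effros_shen \<theta>\<^esub> y) < \<epsilon>"
    if "x \<in> carrier (effros_shen \<theta>)" "\<epsilon> > 0" for x \<epsilon>
    using map_dense[OF that, of 0] by (auto simp: es_filtration_def)
  show "\<exists>d e. (\<forall>i<d. e i \<in> es_filtration \<theta> n) \<and>
      (\<forall>i<d. \<forall>j<d. S.lim_state (star (effros_shen \<theta>) (e j) \<otimes>\<^bsub>effros_shen \<theta>\<^esub> e i) = of_bool (i = j)) \<and>
      (\<forall>x\<in>es_filtration \<theta> n. x = lcomb (effros_shen \<theta>) (\<lambda>i. S.lim_state (star (effros_shen \<theta>) (e i) \<otimes>\<^bsub>effros_shen \<theta>\<^esub> x)) e d)" for n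
  proof -
    have "\<exists>d e. (\<forall>i<d. e i \<in> carrier (es_stage \<theta> n)) \<and>
      (\<forall>i<d. \<forall>j<d. es_st \<theta> n (star (es_stage \<theta> n) (e j) \<otimes>\<^bsub>es_stage \<theta> n\<^esub> e i) = of_bool (i = j)) \<and>
      (\<forall>x\<in>carrier (es_stage \<theta> n). x = lcomb (es_stage \<theta> n)
        (\<lambda>i. es_st \<theta> n (star (es_stage \<theta> n) (e i) \<otimes>\<^bsub>es_stage \<theta> n\<^esub> x)) e d)"
      unfolding es_stage_def es_st_def by (rule block_basis[OF wt_pos wt_pos])
    then obtain d :: nat and e where e: "\<And>i. i < d \<Longrightarrow> e i \<in> carrier (es_stage \<theta> n)"
      "\<And>i j. i < d \<Longrightarrow> j < d \<Longrightarrow> es_st \<theta> n (star (es_stage \<theta> n) (e j) \<otimes>\<^bsub>es_stage \<theta> n\<^esub> e i) = of_bool (i = j)"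
      "\<And>x. x \<in> carrier (es_stage \<theta> n) \<Longrightarrow> x = lcomb (es_stage \<theta> n)
        (\<lambda>i. es_st \<theta> n (star (es_stage \<theta> n) (e i) \<otimes>\<^bsub>es_stage \<theta> n\<^esub> x)) e d" by blast
    let ?e = "\<lambda>i. es_map \<theta> n (e i)"
    have s: "S.lim_state (star (effros_shen \<theta>) (?e i) \<otimes>\<^bsub>effros_shen \<theta>\<^esub> es_map \<theta> n x)
        = es_st \<theta> n (star (es_stage \<theta> n) (e i) \<otimes>\<^bsub>es_stage \<theta> n\<^esub> x)"
      if i: "i < d" and x: "x \<in> carrier (es_stage \<theta> n)" for i x
    proof -
      have se: "star (es_stage \<theta> n) (e i) \<in> carrier (es_stage \<theta> n)" using e(1)[OF i] by simp
      show ?thesis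
        unfolding map_star[OF e(1)[OF i], symmetric] map_mult[OF se x, symmetric]
        by (rule lim_state_map) (use se x in simp)
    qed
    have 3: "es_map \<theta> n x = lcomb (effros_shen \<theta>) (\<lambda>i. S.lim_state (star (effros_shen \<theta>) (?e i) \<otimes>\<^bsub>effros_shen \<theta>\<^esub> es_map \<theta> n x)) ?e d"
      if x: "x \<in> carrier (es_stage \<theta> n)" for x
    proof -
      have "lcomb (effros_shen \<theta>) (\<lambda>i. S.lim_state (star (effros_shen \<theta>) (?e i) \<otimes>\<^bsub>effros_shen \<theta>\<^esub> es_map \<theta> n x)) ?e d
          = lcomb (effros_shen \<theta>) (\<lambda>i. es_st \<theta> n (star (es_stage \<theta> n) (e i) \<otimes>\<^bsub>es_stage \<theta> n\<^esub> x)) ?e d"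
        by (rule S.W.lcomb_cong[unfolded W_eq]) (simp_all add: s[OF _ x])
      also have "\<dots> = es_map \<theta> n x" using map_lcomb[OF e(1), of d] e(3)[OF x] by simp
      finally show ?thesis by simp
    qed
    show ?thesis
    proof (rule exI[of _ d], rule exI[of _ ?e], intro conjI allI impI ballI)
      show "?e i \<in> es_filtration \<theta> n" if "i < d" for i using e(1)[OF that] by (auto simp: es_filtration_def)
      show "S.lim_state (star (effros_shen \<theta>) (?e j) \<otimes>\<^bsub>effros_shen \<theta>\<^esub> ?e i) = of_bool (i = j)" if "i < d" "j < d" for i j
        using s[OF that(2) e(1)[OF that(1)]] e(2)[OF that] by simp
      show "x = lcomb (effros_shen \<theta>) (\<lambda>i. S.lim_state (star (effros_shen \<theta>) (?e i) \<otimes>\<^bsub>effros_shen \<theta>\<^esub> x)) ?e d"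
        if "x \<in> es_filtration \<theta> n" for x
        using that 3 unfolding es_filtration_def by blast
    qed
  qed
qed

text \<open>The description in \<open>es_trace\<close> fits the limit of the stage traces, which is
  faithful by \<open>filt.faithful_tracial\<close>. Uniqueness holds because the stages from 1 on
  are dense and states are continuous.\<close>

lemma es_trace_eq: "es_trace \<theta> = S.lim_state"
  unfolding es_trace_def
proof (rule the_equality)
  have st: "es_st \<theta> n (a, b) = complex_of_real (es_t \<theta> n / real (cf_q \<theta> n)) * mat_tr a +
          complex_of_real ((1 - es_t \<theta> n) / real (cf_q \<theta> (n - 1))) * mat_tr b"
    if "n \<ge> 1" "(a, b) \<in> carrier (es_stage \<theta> n)" for n a b
    using that unfolding es_t_div[OF that(1)] by (simp add: es_st_def es_stage_def block_trace_eq)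
  show "faithful_tracial_state (effros_shen \<theta>) S.lim_state \<and>
     (\<forall>n\<ge>1. \<forall>(a, b)\<in>carrier (es_stage \<theta> n).
        S.lim_state (es_map \<theta> n (a, b)) =
          complex_of_real (es_t \<theta> n / real (cf_q \<theta> n)) * mat_tr a +
          complex_of_real ((1 - es_t \<theta> n) / real (cf_q \<theta> (n - 1))) * mat_tr b)"
    using filt.faithful_tracial[OF filtration_filt] st lim_state_map by auto
  fix \<tau> assume \<tau>: "faithful_tracial_state (effros_shen \<theta>) \<tau> \<and>
     (\<forall>n\<ge>1. \<forall>(a, b)\<in>carrier (es_stage \<theta> n).
        \<tau> (es_map \<theta> n (a, b)) =
          complex_of_real (es_t \<theta> n / real (cf_q \<theta> n)) * mat_tr a +
          complex_of_real ((1 - es_t \<theta> n) / real (cf_q \<theta> (n - 1))) * mat_tr b)"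
  show "\<tau> = S.lim_state"
  proof (rule S.lim_state_unique[unfolded incl_eq W_eq])
    show "cstate (effros_shen \<theta>) \<tau>"
      using \<tau> filtration_filt by (auto simp: faithful_tracial_state_def filt_def cstate_def cstate_axioms_def)
    show "\<tau> (es_map \<theta> n b) = es_st \<theta> n b" if n: "1 \<le> n" and b: "b \<in> carrier (es_stage \<theta> n)" for n b
    proof (cases b)
      case (Pair x y)
      thus ?thesis using \<tau> st[OF n, of x y] n b by auto
    qed
  qed
qed

sublocale C: ci "effros_shen \<theta>" "es_trace \<theta>" "es_filtration \<theta>" "es_beta \<theta>"
proof (intro ci.intro ci_axioms.intro)
  show "filt (effros_shen \<theta>) (es_trace \<theta>) (es_filtration \<theta>)" unfolding es_trace_eq by (rule filtration_filt)
qed (simp_all add: beta_pos beta_summable)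

lemma es_qms_eq: "es_qms \<theta> = (effros_shen \<theta>, C.L)"
  by (simp add: es_qms_def es_seminorm_def)

lemma tl_le: "C.tl n \<le> (\<Sum>j. 1 / (real (Suc (j + n)))\<^sup>2)"
  unfolding C.tl_def
proof (rule suminf_le)
  show "es_beta \<theta> (Suc (j + n)) \<le> 1 / (real (Suc (j + n)))\<^sup>2" for j by (rule beta_le)
  show "summable (\<lambda>j. 1 / (real (Suc (j + n)))\<^sup>2)"
    using summable_ignore_initial_segment[OF summable_squares, of n] by simp
qed (rule C.tl_summable)

lemma s_map:
  assumes x: "x \<in> carrier (es_stage \<theta> n)" and y: "y \<in> carrier (es_stage \<theta> n)"
  shows "es_trace \<theta> (star (effros_shen \<theta>) (es_map \<theta> n y) \<otimes>\<^bsub>effros_shen \<theta>\<^esub> es_map \<theta> n x)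
    = es_st \<theta> n (star (es_stage \<theta> n) y \<otimes>\<^bsub>es_stage \<theta> n\<^esub> x)"
proof -
  have sy: "star (es_stage \<theta> n) y \<in> carrier (es_stage \<theta> n)" using y by simp
  show ?thesis
    unfolding map_star[OF y, symmetric] map_mult[OF sy x, symmetric] es_trace_eq
    by (rule lim_state_map) (use sy x in simp)
qed

lemma tau_norm_map: "x \<in> carrier (es_stage \<theta> n) \<Longrightarrow>
    tau_norm (effros_shen \<theta>) (es_trace \<theta>) (es_map \<theta> n x) = tau_norm (es_stage \<theta> n) (es_st \<theta> n) x"
  by (simp add: tau_norm_def s_map)

end

section \<open>Continuity\<close>

text \<open>The inner product is a sum of two block terms. Cauchy-Schwarz for elements supported in
  one block bounds each weighted term by the product of the trace norms; changing its weight from u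
  to u' alters it by the relative amount |u - u'|/u.\<close>

lemma block_trace_close:
  assumes u: "u > 0" and v: "v > 0" and 1: "real k * u + real l * v = 1"
    and x: "x \<in> carrier (two_block k l)" and y: "y \<in> carrier (two_block k l)"
  defines "z \<equiv> star (two_block k l) y \<otimes>\<^bsub>two_block k l\<^esub> x"
  shows "cmod (block_trace k l u v z - block_trace k l u' v' z) \<le> (\<bar>u - u'\<bar> / u + \<bar>v - v'\<bar> / v) *
    tau_norm (two_block k l) (block_trace k l u v) x * tau_norm (two_block k l) (block_trace k l u v) y"
proof -
  interpret T: cstate "two_block k l" "block_trace k l u v" by (rule cstate_block_trace[OF u v 1])
  let ?t = "tau_norm (two_block k l) (block_trace k l u v)"
  define S :: "nat \<Rightarrow> complex mat \<Rightarrow> complex mat \<Rightarrow> complex"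
    where "S k c a = (\<Sum>i<k. \<Sum>j<k. cnj (c $$ (i, j)) * a $$ (i, j))" for k c a
  obtain a b where xab: "x = (a, b)" "a \<in> carrier_mat k k" "b \<in> carrier_mat l l" using two_block_cases[OF x] .
  obtain c d where ycd: "y = (c, d)" "c \<in> carrier_mat k k" "d \<in> carrier_mat l l" using two_block_cases[OF y] .
  note bt = block_trace_ip[folded S_def]
  have S0: "S k (0\<^sub>m k k) a = 0" "S k a (0\<^sub>m k k) = 0" for k a by (simp_all add: S_def)
  have Spos: "0 \<le> Re (S k a a)" for k a by (auto simp: S_def intro!: sum_nonneg add_nonneg_nonneg)
  have le: "?t (a, 0\<^sub>m l l) \<le> ?t (a, b)" "?t (0\<^sub>m k k, b) \<le> ?t (a, b)"
    if "a \<in> carrier_mat k k" "b \<in> carrier_mat l l" for a b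
    using that u v Spos unfolding tau_norm_def by (auto intro!: real_sqrt_le_mono simp: bt S0 simp del: two_block_sel)
  have z: "block_trace k l u'' v'' z = complex_of_real u'' * S k c a + complex_of_real v'' * S l d b" for u'' v''
    unfolding z_def xab(1) ycd(1) by (rule bt) (use xab ycd in auto)
  have "cmod (complex_of_real u * S k c a) \<le> ?t (a, 0\<^sub>m l l) * ?t (c, 0\<^sub>m l l)"
    using T.Cauchy_Schwarz[of "(a, 0\<^sub>m l l)" "(c, 0\<^sub>m l l)"] bt[of a k "0\<^sub>m l l" l c "0\<^sub>m l l" u v] xab ycd
    by (simp add: S0 del: two_block_sel(2-))
  also have "\<dots> \<le> ?t x * ?t y"
    using le xab ycd T.tn_nonneg by (intro mult_mono) auto
  finally have 2: "u * cmod (S k c a) \<le> ?t x * ?t y" using u by (simp add: norm_mult)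
  have "cmod (complex_of_real v * S l d b) \<le> ?t (0\<^sub>m k k, b) * ?t (0\<^sub>m k k, d)"
    using T.Cauchy_Schwarz[of "(0\<^sub>m k k, b)" "(0\<^sub>m k k, d)"] bt[of "0\<^sub>m k k" k b l "0\<^sub>m k k" d u v] xab ycd
    by (simp add: S0 del: two_block_sel(2-))
  also have "\<dots> \<le> ?t x * ?t y"
    using le xab ycd T.tn_nonneg by (intro mult_mono) auto
  finally have 3: "v * cmod (S l d b) \<le> ?t x * ?t y" using v by (simp add: norm_mult)
  have eq: "block_trace k l u v z - block_trace k l u' v' z
      = complex_of_real (u - u') * S k c a + complex_of_real (v - v') * S l d b"
    unfolding z by (simp add: algebra_simps)
  have "cmod (block_trace k l u v z - block_trace k l u' v' z) \<le> \<bar>u - u'\<bar> * cmod (S k c a) + \<bar>v - v'\<bar> * cmod (S l d b)"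
    unfolding eq by (rule order_trans[OF norm_triangle_ineq]) (simp add: norm_mult del: of_real_diff)
  also have "\<dots> = \<bar>u - u'\<bar> / u * (u * cmod (S k c a)) + \<bar>v - v'\<bar> / v * (v * cmod (S l d b))"
    using u v by simp
  also have "\<dots> \<le> \<bar>u - u'\<bar> / u * (?t x * ?t y) + \<bar>v - v'\<bar> / v * (?t x * ?t y)"
    using u v 2 3 by (intro add_mono mult_left_mono) auto
  finally show ?thesis by (simp add: algebra_simps)
qed

lemma cf_q_cong: "(\<And>i. i \<le> j \<Longrightarrow> cf_digit \<theta> i = cf_digit \<theta>' i) \<Longrightarrow> cf_q \<theta> j = cf_q \<theta>' j"
  by (induction j rule: induct_nat_012) simp_all

lemma cf_q_prev_cong: "(\<And>i. i \<le> j \<Longrightarrow> cf_digit \<theta> i = cf_digit \<theta>' i) \<Longrightarrow> cf_q_prev \<theta> j = cf_q_prev \<theta>' j"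
  using cf_q_cong[of "j - 1" \<theta> \<theta>'] by (cases j) (simp_all add: cf_q_prev_def)

lemma es_stage_cong: "(\<And>i. i \<le> j \<Longrightarrow> cf_digit \<theta> i = cf_digit \<theta>' i) \<Longrightarrow> es_stage \<theta> j = es_stage \<theta>' j"
  using cf_q_cong[of j \<theta> \<theta>'] cf_q_prev_cong[of j \<theta> \<theta>'] by (simp add: es_stage_def)

lemma es_connect_cong:
  "(\<And>i. i \<le> j + k \<Longrightarrow> cf_digit \<theta> i = cf_digit \<theta>' i) \<Longrightarrow> connect (es_connect \<theta>) j k = connect (es_connect \<theta>') j k"
  by (induction k) (simp_all add: es_connect_eq)

text \<open>Relative change of the two weights, measured by those of the first angle and therefore
  not symmetric. Closeness in both trace norms is obtained from the sum over the two orders.\<close>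

definition es_dist :: "real \<Rightarrow> real \<Rightarrow> nat \<Rightarrow> real" where
  "es_dist \<theta> \<theta>' n = \<bar>es_wt \<theta> n - es_wt \<theta>' n\<bar> / es_wt \<theta> n + \<bar>es_wt \<theta> (Suc n) - es_wt \<theta>' (Suc n)\<bar> / es_wt \<theta> (Suc n)"

text \<open>Back to the pair of matrices through the first n stages of \<theta>', then forward in
  the algebra of \<theta>; this is meaningful when both angles have the same n-th stage.\<close>

definition es_iso :: "real \<Rightarrow> real \<Rightarrow> nat \<Rightarrow> es_elem \<Rightarrow> es_elem" where
  "es_iso \<theta> \<theta>' n X = es_map \<theta> n (inv_into (carrier (es_stage \<theta>' n)) (es_map \<theta>' n) X)"

text \<open>Equal digits up to n give literally the same matrix algebras, connecting maps and
  \<beta> up to stage n. Only the two weights of the trace on stage n differ.\<close>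

lemma es_pair:
  assumes "irrational_angle \<theta>" "irrational_angle \<theta>'" and digits: "\<And>i. i \<le> n \<Longrightarrow> cf_digit \<theta> i = cf_digit \<theta>' i"
  defines "\<delta> \<equiv> es_dist \<theta> \<theta>' n + es_dist \<theta>' \<theta> n"
  assumes le: "\<delta> \<le> 1"
  shows "ci_pair (effros_shen \<theta>) (es_trace \<theta>) (es_filtration \<theta>) (es_beta \<theta>)
    (effros_shen \<theta>') (es_trace \<theta>') (es_filtration \<theta>') (es_beta \<theta>') (es_iso \<theta> \<theta>' n) n \<delta>"
proof -
  interpret P: irrational_angle \<theta> by fact
  interpret Q: irrational_angle \<theta>' by fact
  have st: "es_stage \<theta>' j = es_stage \<theta> j" if "j \<le> n" for j
    using es_stage_cong[of j \<theta> \<theta>'] digits that by simp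
  have iso: "es_iso \<theta> \<theta>' n (es_map \<theta>' n b) = es_map \<theta> n b" if "b \<in> carrier (es_stage \<theta> n)" for b
  proof -
    have "inj_on (es_map \<theta>' n) (carrier (es_stage \<theta>' n))" by (rule inj_onI) (rule Q.map_inj)
    thus ?thesis using that by (simp add: es_iso_def st)
  qed
  have F: "es_filtration \<theta> n = es_map \<theta> n ` carrier (es_stage \<theta> n)" "es_filtration \<theta>' n = es_map \<theta>' n ` carrier (es_stage \<theta> n)"
    by (simp_all add: es_filtration_def st)
  have d0: "0 \<le> es_dist \<theta> \<theta>' n" "0 \<le> es_dist \<theta>' \<theta> n"
    using P.wt_pos[THEN less_imp_le] Q.wt_pos[THEN less_imp_le] by (auto simp: es_dist_def)
  define k l where "k = cf_q \<theta> n" and "l = cf_q_prev \<theta> n"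
  have kl: "cf_q \<theta>' n = k" "cf_q_prev \<theta>' n = l"
    using cf_q_cong[of n \<theta> \<theta>'] cf_q_prev_cong[of n \<theta> \<theta>'] digits by (simp_all add: k_def l_def)
  have stn: "es_stage \<theta> n = two_block k l" "es_stage \<theta>' n = two_block k l"
    "es_st \<theta> n = block_trace k l (es_wt \<theta> n) (es_wt \<theta> (Suc n))"
    "es_st \<theta>' n = block_trace k l (es_wt \<theta>' n) (es_wt \<theta>' (Suc n))"
    by (simp_all add: es_stage_def es_st_def kl) (simp_all add: k_def l_def)
  have tot: "real k * es_wt \<theta> n + real l * es_wt \<theta> (Suc n) = 1"
    "real k * es_wt \<theta>' n + real l * es_wt \<theta>' (Suc n) = 1"
    using P.wt_total[of n] Q.wt_total[of n] unfolding kl by (simp_all add: k_def l_def)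
  have close: "cmod (es_st \<theta> n (star (es_stage \<theta> n) b \<otimes>\<^bsub>es_stage \<theta> n\<^esub> a) - es_st \<theta>' n (star (es_stage \<theta> n) b \<otimes>\<^bsub>es_stage \<theta> n\<^esub> a))
      \<le> \<delta> * tau_norm (es_stage \<theta> n) (es_st \<theta> n) a * tau_norm (es_stage \<theta> n) (es_st \<theta> n) b"
    "cmod (es_st \<theta> n (star (es_stage \<theta> n) b \<otimes>\<^bsub>es_stage \<theta> n\<^esub> a) - es_st \<theta>' n (star (es_stage \<theta> n) b \<otimes>\<^bsub>es_stage \<theta> n\<^esub> a))
      \<le> \<delta> * tau_norm (es_stage \<theta> n) (es_st \<theta>' n) a * tau_norm (es_stage \<theta> n) (es_st \<theta>' n) b"
    if ab: "a \<in> carrier (es_stage \<theta> n)" "b \<in> carrier (es_stage \<theta> n)" for a b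
  proof -
    have t: "0 \<le> tau_norm (es_stage \<theta> n) (es_st \<theta> n) x" "0 \<le> tau_norm (es_stage \<theta> n) (es_st \<theta>' n) x"
      if "x \<in> carrier (es_stage \<theta> n)" for x
      using P.S.T.tn_nonneg[of x n] Q.S.T.tn_nonneg[of x n] that by (simp_all add: st)
    let ?z = "star (es_stage \<theta> n) b \<otimes>\<^bsub>es_stage \<theta> n\<^esub> a"
    have "cmod (es_st \<theta> n ?z - es_st \<theta>' n ?z) \<le> es_dist \<theta> \<theta>' n * tau_norm (es_stage \<theta> n) (es_st \<theta> n) a * tau_norm (es_stage \<theta> n) (es_st \<theta> n) b"
      using block_trace_close[OF P.wt_pos P.wt_pos tot(1), of a b] ab unfolding stn es_dist_def by blast
    also have "\<dots> \<le> \<delta> * tau_norm (es_stage \<theta> n) (es_st \<theta> n) a * tau_norm (es_stage \<theta> n) (es_st \<theta> n) b"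
      using t[OF ab(1)] t[OF ab(2)] d0 by (intro mult_right_mono) (auto simp: \<delta>_def)
    finally show "cmod (es_st \<theta> n ?z - es_st \<theta>' n ?z)
      \<le> \<delta> * tau_norm (es_stage \<theta> n) (es_st \<theta> n) a * tau_norm (es_stage \<theta> n) (es_st \<theta> n) b" .
    have "cmod (es_st \<theta>' n ?z - es_st \<theta> n ?z) \<le> es_dist \<theta>' \<theta> n * tau_norm (es_stage \<theta> n) (es_st \<theta>' n) a * tau_norm (es_stage \<theta> n) (es_st \<theta>' n) b"
      using block_trace_close[OF Q.wt_pos Q.wt_pos tot(2), of a b] ab unfolding stn es_dist_def by blast
    also have "\<dots> \<le> \<delta> * tau_norm (es_stage \<theta> n) (es_st \<theta>' n) a * tau_norm (es_stage \<theta> n) (es_st \<theta>' n) b"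
      using t[OF ab(1)] t[OF ab(2)] d0 by (intro mult_right_mono) (auto simp: \<delta>_def)
    finally show "cmod (es_st \<theta> n ?z - es_st \<theta>' n ?z)
      \<le> \<delta> * tau_norm (es_stage \<theta> n) (es_st \<theta>' n) a * tau_norm (es_stage \<theta> n) (es_st \<theta>' n) b"
      by (simp add: norm_minus_commute)
  qed
  have s': "es_trace \<theta>' (star (effros_shen \<theta>') (es_map \<theta>' n y) \<otimes>\<^bsub>effros_shen \<theta>'\<^esub> es_map \<theta>' n x)
      = es_st \<theta>' n (star (es_stage \<theta> n) y \<otimes>\<^bsub>es_stage \<theta> n\<^esub> x)"
    "tau_norm (effros_shen \<theta>') (es_trace \<theta>') (es_map \<theta>' n x) = tau_norm (es_stage \<theta> n) (es_st \<theta>' n) x"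
    if "x \<in> carrier (es_stage \<theta> n)" "y \<in> carrier (es_stage \<theta> n)" for x y
    using Q.s_map[of x n y] Q.tau_norm_map[of x n] that by (simp_all add: st)
  have Qmap: "es_map \<theta>' n (a \<oplus>\<^bsub>es_stage \<theta> n\<^esub> b) = es_map \<theta>' n a \<oplus>\<^bsub>effros_shen \<theta>'\<^esub> es_map \<theta>' n b"
    "es_map \<theta>' n (c \<odot>\<^bsub>es_stage \<theta> n\<^esub> a) = c \<odot>\<^bsub>effros_shen \<theta>'\<^esub> es_map \<theta>' n a"
    "es_map \<theta>' n (a \<otimes>\<^bsub>es_stage \<theta> n\<^esub> b) = es_map \<theta>' n a \<otimes>\<^bsub>effros_shen \<theta>'\<^esub> es_map \<theta>' n b"
    "es_map \<theta>' n (star (es_stage \<theta> n) a) = star (effros_shen \<theta>') (es_map \<theta>' n a)"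
    "nrm (effros_shen \<theta>') (es_map \<theta>' n a) = nrm (es_stage \<theta> n) a"
    if "a \<in> carrier (es_stage \<theta> n)" "b \<in> carrier (es_stage \<theta> n)" for a b c
    using Q.map_add[of a n b] Q.map_smult[of a n c] Q.map_mult[of a n b] Q.map_star[of a n] Q.map_nrm[of a n] that
    by (simp_all add: st)
  have Qone: "es_map \<theta>' n \<one>\<^bsub>es_stage \<theta> n\<^esub> = \<one>\<^bsub>effros_shen \<theta>'\<^esub>" using Q.map_one[of n] by (simp add: st)
  show ?thesis
  proof (intro ci_pair.intro ci_pair_axioms.intro)
    fix x y assume "x \<in> es_filtration \<theta>' n" "y \<in> es_filtration \<theta>' n"
    then obtain a b where ab: "a \<in> carrier (es_stage \<theta> n)" "x = es_map \<theta>' n a" "b \<in> carrier (es_stage \<theta> n)" "y = es_map \<theta>' n b"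
      unfolding F by blast
    have c: "a \<oplus>\<^bsub>es_stage \<theta> n\<^esub> b \<in> carrier (es_stage \<theta> n)" "a \<otimes>\<^bsub>es_stage \<theta> n\<^esub> b \<in> carrier (es_stage \<theta> n)"
      using ab by simp_all
    show "es_iso \<theta> \<theta>' n (x \<oplus>\<^bsub>effros_shen \<theta>'\<^esub> y) = es_iso \<theta> \<theta>' n x \<oplus>\<^bsub>effros_shen \<theta>\<^esub> es_iso \<theta> \<theta>' n y"
      unfolding ab(2,4) Qmap(1)[OF ab(1,3), symmetric] iso[OF c(1)] iso[OF ab(1)] iso[OF ab(3)] by (rule P.map_add[OF ab(1,3)])
    show "es_iso \<theta> \<theta>' n (x \<otimes>\<^bsub>effros_shen \<theta>'\<^esub> y) = es_iso \<theta> \<theta>' n x \<otimes>\<^bsub>effros_shen \<theta>\<^esub> es_iso \<theta> \<theta>' n y"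
      unfolding ab(2,4) Qmap(3)[OF ab(1,3), symmetric] iso[OF c(2)] iso[OF ab(1)] iso[OF ab(3)] by (rule P.map_mult[OF ab(1,3)])
    show "cmod (es_trace \<theta> (star (effros_shen \<theta>) (es_iso \<theta> \<theta>' n y) \<otimes>\<^bsub>effros_shen \<theta>\<^esub> es_iso \<theta> \<theta>' n x) -
        es_trace \<theta>' (star (effros_shen \<theta>') y \<otimes>\<^bsub>effros_shen \<theta>'\<^esub> x))
      \<le> \<delta> * tau_norm (effros_shen \<theta>') (es_trace \<theta>') x * tau_norm (effros_shen \<theta>') (es_trace \<theta>') y"
      unfolding ab(2,4) iso[OF ab(1)] iso[OF ab(3)] P.s_map[OF ab(1,3)] s'(1)[OF ab(1,3)] s'(2)[OF ab(1,1)] s'(2)[OF ab(3,3)]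
      by (rule close(2)[OF ab(1,3)])
    show "cmod (es_trace \<theta> (star (effros_shen \<theta>) (es_iso \<theta> \<theta>' n y) \<otimes>\<^bsub>effros_shen \<theta>\<^esub> es_iso \<theta> \<theta>' n x) -
        es_trace \<theta>' (star (effros_shen \<theta>') y \<otimes>\<^bsub>effros_shen \<theta>'\<^esub> x))
      \<le> \<delta> * tau_norm (effros_shen \<theta>) (es_trace \<theta>) (es_iso \<theta> \<theta>' n x) * tau_norm (effros_shen \<theta>) (es_trace \<theta>) (es_iso \<theta> \<theta>' n y)"
      unfolding ab(2,4) iso[OF ab(1)] iso[OF ab(3)] P.s_map[OF ab(1,3)] s'(1)[OF ab(1,3)] P.tau_norm_map[OF ab(1)] P.tau_norm_map[OF ab(3)]
      by (rule close(1)[OF ab(1,3)])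
  next
    fix x assume "x \<in> es_filtration \<theta>' n"
    then obtain a where a: "a \<in> carrier (es_stage \<theta> n)" "x = es_map \<theta>' n a" unfolding F by blast
    have c: "c \<odot>\<^bsub>es_stage \<theta> n\<^esub> a \<in> carrier (es_stage \<theta> n)" "star (es_stage \<theta> n) a \<in> carrier (es_stage \<theta> n)" for c
      using a by simp_all
    show "es_iso \<theta> \<theta>' n (c \<odot>\<^bsub>effros_shen \<theta>'\<^esub> x) = c \<odot>\<^bsub>effros_shen \<theta>\<^esub> es_iso \<theta> \<theta>' n x" for c
      unfolding a(2) Qmap(2)[OF a(1,1), symmetric] iso[OF c(1)] iso[OF a(1)] by (rule P.map_smult[OF a(1)])
    show "es_iso \<theta> \<theta>' n (star (effros_shen \<theta>') x) = star (effros_shen \<theta>) (es_iso \<theta> \<theta>' n x)"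
      unfolding a(2) Qmap(4)[OF a(1,1), symmetric] iso[OF c(2)] iso[OF a(1)] by (rule P.map_star[OF a(1)])
    show "nrm (effros_shen \<theta>) (es_iso \<theta> \<theta>' n x) = nrm (effros_shen \<theta>') x"
      unfolding a(2) Qmap(5)[OF a(1,1)] iso[OF a(1)] by (rule P.map_nrm[OF a(1)])
  next
    show "es_iso \<theta> \<theta>' n \<one>\<^bsub>effros_shen \<theta>'\<^esub> = \<one>\<^bsub>effros_shen \<theta>\<^esub>"
      unfolding Qone[symmetric] P.map_one[of n, symmetric] by (rule iso) simp
  next
    fix j assume j: "j \<le> n"
    \<comment> \<open>A lower stage is pushed up to stage n before \<open>es_iso\<close> is
      evaluated; the composite connecting maps of both angles agree on the way.\<close>
    have "es_iso \<theta> \<theta>' n (es_map \<theta>' j b) = es_map \<theta> j b" if b: "b \<in> carrier (es_stage \<theta> j)" for b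
    proof -
      have b': "b \<in> carrier (es_stage \<theta>' j)" using b st[OF j] by simp
      have "connect (es_connect \<theta>') j (n - j) b = connect (es_connect \<theta>) j (n - j) b"
        using es_connect_cong[of j "n - j" \<theta> \<theta>'] digits j by simp
      hence e: "es_map \<theta>' n (connect (es_connect \<theta>) j (n - j) b) = es_map \<theta>' j b"
        using Q.map_connect[OF b', of "n - j"] j by simp
      have "connect (es_connect \<theta>) j (n - j) b \<in> carrier (es_stage \<theta> n)"
        using P.S.con_closed[OF b, of "n - j"] j by simp
      from iso[OF this] show ?thesis
        unfolding e using P.map_connect[OF b, of "n - j"] j by simp
    qed
    thus "es_iso \<theta> \<theta>' n ` es_filtration \<theta>' j = es_filtration \<theta> j"
      unfolding es_filtration_def image_image st[OF j] by (intro image_cong) auto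
  next
    fix j assume "1 \<le> j" "j \<le> n"
    thus "es_beta \<theta> j = es_beta \<theta>' j"
      using cf_q_cong[of j \<theta> \<theta>'] cf_q_prev_cong[of j \<theta> \<theta>'] digits by (simp add: es_beta_def)
  next
    show "0 \<le> \<delta>" "\<delta> \<le> 1" using d0 le by (simp_all add: \<delta>_def)
  qed unfold_locales
qed

lemma irrational_angleI: "\<theta> \<in> {0<..<1} - \<rat> \<Longrightarrow> irrational_angle \<theta>"
  by (auto simp: irrational_angle_def)

section \<open>Convergence along a sequence of angles\<close>

context
  fixes \<theta> :: real and \<theta>s :: "nat \<Rightarrow> real"
  assumes \<theta>: "\<theta> \<in> {0<..<1} - \<rat>" and \<theta>s: "\<And>m. \<theta>s m \<in> {0<..<1} - \<rat>" and lim: "\<theta>s \<longlonglongrightarrow> \<theta>"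
begin

interpretation irrational_angle \<theta> by (rule irrational_angleI[OF \<theta>])

text \<open>The fractional part is continuous off the integers, and all remainders of an irrational
  number are irrational. For the same reason the digits eventually agree.\<close>

lemma rem_lim: "(\<lambda>m. cf_rem (\<theta>s m) i) \<longlonglongrightarrow> cf_rem \<theta> i"
proof (induction i)
  case 0
  show ?case using lim by simp
next
  case (Suc i)
  have "(\<lambda>m. frac (cf_rem (\<theta>s m) i)) \<longlonglongrightarrow> frac (cf_rem \<theta> i)"
    by (rule isCont_tendsto_compose[OF continuous_frac[OF rem_not_Int] Suc])
  thus ?case using frac_pos[of i] by (auto intro!: tendsto_intros)
qed

lemma wt_lim: "(\<lambda>m. es_wt (\<theta>s m) i) \<longlonglongrightarrow> es_wt \<theta> i"
  unfolding es_wt_def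
  by (intro tendsto_prod isCont_tendsto_compose[OF continuous_frac[OF rem_not_Int] rem_lim])

lemma digit_eventually: "\<forall>\<^sub>F m in sequentially. \<forall>i\<in>{..n}. cf_digit \<theta> i = cf_digit (\<theta>s m) i"
proof (subst eventually_ball_finite_distrib)
  show "\<forall>i\<in>{..n}. \<forall>\<^sub>F m in sequentially. cf_digit \<theta> i = cf_digit (\<theta>s m) i"
  proof
    fix i
    have "\<forall>\<^sub>F m in sequentially. \<lfloor>cf_rem (\<theta>s m) i\<rfloor> = \<lfloor>cf_rem \<theta> i\<rfloor>"
      by (rule eventually_floor_eq[OF rem_lim rem_not_Int])
    thus "\<forall>\<^sub>F m in sequentially. cf_digit \<theta> i = cf_digit (\<theta>s m) i"
      by eventually_elim (simp add: cf_digit_def)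
  qed
qed simp

lemma dist_lim: "(\<lambda>m. es_dist \<theta> (\<theta>s m) n + es_dist (\<theta>s m) \<theta> n) \<longlonglongrightarrow> 0"
proof -
  have "(\<lambda>m. es_dist \<theta> (\<theta>s m) n + es_dist (\<theta>s m) \<theta> n) \<longlonglongrightarrow>
     (\<bar>es_wt \<theta> n - es_wt \<theta> n\<bar> / es_wt \<theta> n + \<bar>es_wt \<theta> (Suc n) - es_wt \<theta> (Suc n)\<bar> / es_wt \<theta> (Suc n)) +
     (\<bar>es_wt \<theta> n - es_wt \<theta> n\<bar> / es_wt \<theta> n + \<bar>es_wt \<theta> (Suc n) - es_wt \<theta> (Suc n)\<bar> / es_wt \<theta> (Suc n))"
    unfolding es_dist_def
    by (intro tendsto_add tendsto_divide tendsto_rabs tendsto_diff tendsto_const wt_lim)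
      (use wt_pos[of n] wt_pos[of "Suc n"] in linarith)+
  thus ?thesis by simp
qed

text \<open>First n is chosen with tails below e/4 for every angle; then \<delta> is made small
  against the constant D, which depends on n and on the limit angle only. The two truncations and
  the comparison cost e/4 + e/4 + e/2.\<close>

lemma propinquity_eventually:
  assumes e: "e > 0"
  shows "\<forall>\<^sub>F m in sequentially. propinquity (es_qms (\<theta>s m)) (es_qms \<theta>) \<le> ennreal e"
proof -
  define T where "T n = (\<Sum>j. 1 / (real (Suc (j + n)))\<^sup>2)" for n
  have "(\<lambda>n. \<Sum>j. 1 / (real (Suc (j + n)))\<^sup>2) \<longlonglongrightarrow> 0"
    by (rule suminf_exist_split2[OF summable_squares])
  hence "\<forall>\<^sub>F n in sequentially. T n < e / 4"
    unfolding T_def using e by (intro order_tendstoD(2)) auto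
  then obtain n where n: "T n < e / 4" by (auto simp: eventually_sequentially)
  \<comment> \<open>The coefficient of \<delta> in the bound of \<open>bridge_J_length\<close>, with
    every tail replaced by the uniform bound T 0, so that it does not depend on m.\<close>
  define D where "D = (3 + 98 * C.K n * T 0) * T 0 + (3 + 98 * (3 * C.K n) * T 0) * T 0"
  let ?\<delta> = "\<lambda>m. es_dist \<theta> (\<theta>s m) n + es_dist (\<theta>s m) \<theta> n"
  have "(\<lambda>m. ?\<delta> m * D) \<longlonglongrightarrow> 0" using tendsto_mult[OF dist_lim tendsto_const, of n D] by simp
  hence "\<forall>\<^sub>F m in sequentially. ?\<delta> m * D < e / 2" using e by (intro order_tendstoD(2)) auto
  moreover have "\<forall>\<^sub>F m in sequentially. ?\<delta> m < 1" by (rule order_tendstoD(2)[OF dist_lim]) simp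
  moreover note digit_eventually[of n]
  ultimately show ?thesis
  proof eventually_elim
    case (elim m)
    interpret Q: irrational_angle "\<theta>s m" by (rule irrational_angleI[OF \<theta>s])
    define \<delta> where "\<delta> = ?\<delta> m"
    interpret ci_pair "effros_shen \<theta>" "es_trace \<theta>" "es_filtration \<theta>" "es_beta \<theta>"
      "effros_shen (\<theta>s m)" "es_trace (\<theta>s m)" "es_filtration (\<theta>s m)" "es_beta (\<theta>s m)" "es_iso \<theta> (\<theta>s m) n" n \<delta>
      unfolding \<delta>_def using elim by (intro es_pair) (auto intro: irrational_angle_axioms Q.irrational_angle_axioms)
    have tl: "C.tl j \<le> T j" "Q.C.tl j \<le> T j" for j using tl_le[of j] Q.tl_le[of j] by (simp_all add: T_def)
    have t0: "0 \<le> C.tl j" "0 \<le> Q.C.tl j" for j by (rule C.tl_nonneg Q.C.tl_nonneg)+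
    have K0: "0 \<le> C.K n" by (simp add: C.K_def sum_nonneg)
    have "\<delta> * (3 + 98 * C.K n * Q.C.tl 0) * C.tl 0 \<le> \<delta> * (3 + 98 * C.K n * T 0) * T 0"
      using \<delta>(1) K0 tl[of 0] t0[of 0]
      by (intro mult_mono mult_left_mono add_left_mono mult_nonneg_nonneg add_nonneg_nonneg) auto
    moreover have "\<delta> * (3 + 98 * (3 * C.K n) * C.tl 0) * Q.C.tl 0 \<le> \<delta> * (3 + 98 * (3 * C.K n) * T 0) * T 0"
      using \<delta>(1) K0 tl[of 0] t0[of 0]
      by (intro mult_mono mult_left_mono add_left_mono mult_nonneg_nonneg add_nonneg_nonneg) auto
    ultimately have "\<epsilon> \<le> T n + \<delta> * D"
      using tl(1)[of n] unfolding \<epsilon>_def D_def by (simp add: algebra_simps)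
    hence "Q.C.tl n + \<epsilon> \<le> e" using tl(2)[of n] n elim(1) e unfolding \<delta>_def by linarith
    moreover have "0 \<le> \<epsilon>"
      unfolding \<epsilon>_def using \<delta>(1) K0 t0[of 0] t0[of n] by (intro add_nonneg_nonneg mult_nonneg_nonneg) auto
    ultimately have "ennreal (Q.C.tl n) + ennreal \<epsilon> \<le> ennreal e"
      using t0(2)[of n] by (simp flip: ennreal_plus add: ennreal_leI)
    moreover have "propinquity (es_qms (\<theta>s m)) (es_qms \<theta>) \<le> ennreal (Q.C.tl n) + ennreal \<epsilon>"
      unfolding es_qms_eq Q.es_qms_eq by (rule propinquity_le[OF ci_pair_axioms])
    ultimately show ?case by (rule order_trans[rotated])
  qed
qed

lemma propinquity_lim: "(\<lambda>m. propinquity (es_qms (\<theta>s m)) (es_qms \<theta>)) \<longlonglongrightarrow> 0"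
proof (rule order_tendstoI)
  fix a :: ennreal assume "0 < a"
  then obtain b where b: "0 < b" "b < a" using dense by blast
  have "b = ennreal (enn2real b)" "0 < enn2real b"
    using b by (auto simp: enn2real_positive_iff less_top[symmetric] dest: less_le_trans[OF _ top_greatest])
  thus "\<forall>\<^sub>F m in sequentially. propinquity (es_qms (\<theta>s m)) (es_qms \<theta>) < a"
    using propinquity_eventually[of "enn2real b"] b(2) by (auto elim: eventually_mono)
qed simp

end

theorem theorem3p1:
  "(\<forall>\<theta> \<in> {0<..<1} - \<rat>. leibniz_cqms (es_qms \<theta>)) \<and>
   (\<forall>(\<theta>s :: nat \<Rightarrow> real) (\<theta> :: real).
      (\<forall>n. \<theta>s n \<in> {0<..<1} - \<rat>) \<longrightarrow> \<theta> \<in> {0<..<1} - \<rat> \<longrightarrow> \<theta>s \<longlonglongrightarrow> \<theta> \<longrightarrow>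
      (\<lambda>n. propinquity (es_qms (\<theta>s n)) (es_qms \<theta>)) \<longlonglongrightarrow> 0)"
proof (intro conjI ballI allI impI)
  fix \<theta> :: real assume "\<theta> \<in> {0<..<1} - \<rat>"
  then interpret irrational_angle \<theta> by (rule irrational_angleI)
  show "leibniz_cqms (es_qms \<theta>)" unfolding es_qms_eq by (rule C.leibniz_cqms_A)
next
  fix \<theta>s :: "nat \<Rightarrow> real" and \<theta> :: real
  assume "\<forall>n. \<theta>s n \<in> {0<..<1} - \<rat>" "\<theta> \<in> {0<..<1} - \<rat>" "\<theta>s \<longlonglongrightarrow> \<theta>"
  thus "(\<lambda>n. propinquity (es_qms (\<theta>s n)) (es_qms \<theta>)) \<longlonglongrightarrow> 0" by (intro propinquity_lim) auto
qed

end
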